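(* Let $W$ be an infinite-dimensional vector space over a field $k$ and let $\mathcal C=\operatorname{Sym}(W)$ be the symmetric coalgebra of $W$. Then: (a) the complex $$0\longleftarrow\mathcal C\longleftarrow\mathcal C\otimes_kW^*\longleftarrow\mathcal C\otimes_k\Lambda^2(W)^*\longleftarrow\cdots\longleftarrow\mathcal C\otimes_k\Lambda^n(W)^*\longleftarrow\cdots,$$ obtained by applying the functor $\Phi_{\mathcal C}=\mathcal C\odot_{\mathcal C}-$ to the truncated Koszul free contramodule resolution of $k$ (described in the context), is a bounded above, noncontractible, acyclic complex of injective comodules over $\mathcal C$; (b) the complex $$0\longrightarrow\operatorname{Hom}_k(\mathcal C,k)\longrightarrow\operatorname{Hom}_k(\mathcal C,W)\longrightarrow\operatorname{Hom}_k(\mathcal C,\Lambda^2(W))\longrightarrow\cdots\longrightarrow\operatorname{Hom}_k(\mathcal C,\Lambda^n(W))\longrightarrow\cdots,$$ obtained by applying the functor $\Psi_{\mathcal C}=\operatorname{Hom}_{\mathcal C}(\mathcal C,-)$ to the truncated Koszul cofree comodule coresolution of $k$ (described in the context), is a bounded below, noncontractible, acyclic complex of projective contramodules over $\mathcal C$.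
   Context: Complexes are cohomologically graded; bounded above (below) means that the terms vanish in all sufficiently large (sufficiently negative) cohomological degrees. In (a) the term $\mathcal C\otimes_k\Lambda^n(W)^*$ is in cohomological degree $-n$. A complex in an additive category is contractible if its identity endomorphism is homotopic to zero; in (a) contractibility is meant in the category of left $\mathcal C$-comodules, in (b) in the category of left $\mathcal C$-contramodules. Coalgebras are coassociative and counital over the field $k$. Symmetric coalgebra: the tensor coalgebra $\bigoplus_{n\ge0}W^{\otimes n}$ has comultiplication $w_1\otimes\cdots\otimes w_n\mapsto\sum_{i=0}^n(w_1\otimes\cdots\otimes w_i)\otimes(w_{i+1}\otimes\cdots\otimes w_n)$ and counit the projection onto $W^{\otimes0}=k$. The symmetric coalgebra $\operatorname{Sym}(W)=\bigoplus_{n\ge0}\operatorname{Sym}_n(W)$ is the graded subcoalgebra whose component $\operatorname{Sym}_n(W)\subset W^{\otimes n}$ is the subspace of symmetric tensors; so $\operatorname{Sym}_0(W)=k$, $\operatorname{Sym}_1(W)=W$. It is cocommutative. Put $\mathcal C=\operatorname{Sym}(W)$. Contramodules: a left $\mathcal C$-contramodule is a $k$-vector space $\mathfrak P$ with a $k$-linear contraaction map $\pi\colon\operatorname{Hom}_k(\mathcal C,\mathfrak P)\to\mathfrak P$ satisfying contraassociativity (the two maps $\operatorname{Hom}_k(\mathcal C\otimes_k\mathcal C,\mathfrak P)\simeq\operatorname{Hom}_k(\mathcal C,\operatorname{Hom}_k(\mathcal C,\mathfrak P))\rightrightarrows\operatorname{Hom}_k(\mathcal C,\mathfrak P)$, induced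 by the comultiplication and by $\pi$, have equal compositions with $\pi$) and contraunitality (the composition of the map $\mathfrak P\to\operatorname{Hom}_k(\mathcal C,\mathfrak P)$ induced by the counit with $\pi$ is the identity). Morphisms are $k$-linear maps compatible with the contraactions; left $\mathcal C$-contramodules form an abelian category. The free contramodule spanned by a vector space $V$ is $\operatorname{Hom}_k(\mathcal C,V)$ with contraaction induced by the comultiplication. The cofree left comodule cospanned by $V$ is $\mathcal C\otimes_kV$ with coaction induced by the comultiplication. $\operatorname{Hom}_{\mathcal C}$ denotes the space of morphisms in the category of left $\mathcal C$-comodules. The functor $\Psi_{\mathcal C}$ from left $\mathcal C$-comodules to left $\mathcal C$-contramodules is $\Psi_{\mathcal C}(\mathcal M)=\operatorname{Hom}_{\mathcal C}(\mathcal C,\mathcal M)$, with the contramodule structure induced by the right coaction of $\mathcal C$ on itself; one has $\Psi_{\mathcal C}(\mathcal C\otimes_kV)=\operatorname{Hom}_k(\mathcal C,V)$ naturally. The contratensor product $\mathcal N\odot_{\mathcal C}\mathfrak P$ of a right $\mathcal C$-comodule $\mathcal N$ and a left $\mathcal C$-contramodule $\mathfrak P$ is the coequalizer of two maps $\mathcal N\otimes_k\operatorname{Hom}_k(\mathcal C,\mathfrak P)\rightrightarrows\mathcal N\otimes_k\mathfrak P$, one induced by the contraaction, the other one the composition of the map induced by the coaction $\mathcal N\to\mathcal N\otimes_k\mathcal C$ with the map induced by the evaluation $\mathcal C\otimes_k\operatorname{Hom}_k(\mathcal C,\mathfrak P)\to\mathfrak P$. The functor $\Phi_{\mathcal C}$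 from left $\mathcal C$-contramodules to left $\mathcal C$-comodules is $\Phi_{\mathcal C}(\mathfrak P)=\mathcal C\odot_{\mathcal C}\mathfrak P$, with the left comodule structure induced by the left coaction of $\mathcal C$ on itself; one has $\Phi_{\mathcal C}(\operatorname{Hom}_k(\mathcal C,V))=\mathcal C\otimes_kV$ naturally. The Koszul (co)resolutions: the Koszul cofree comodule coresolution of the trivial one-dimensional $\mathcal C$-comodule $k$ (the coaction being given by $k=\operatorname{Sym}_0(W)\subset\mathcal C$) is $$0\to k\to\mathcal C\to\mathcal C\otimes_kW\to\mathcal C\otimes_k\Lambda^2(W)\to\cdots\to\mathcal C\otimes_k\Lambda^n(W)\to\cdots,$$ where $\Lambda^n$ denotes exterior powers, $k\to\mathcal C$ is the inclusion of $\operatorname{Sym}_0(W)$, and the differential $\mathcal C\otimes_k\Lambda^n(W)\to\mathcal C\otimes_k\Lambda^{n+1}(W)$ is the composition of the map $\mathcal C\otimes_k\Lambda^n(W)\to\mathcal C\otimes_kW\otimes_k\Lambda^n(W)$ induced by the component $\mathcal C\to\mathcal C\otimes_kW$ of the comultiplication and the map induced by the multiplication $W\otimes_k\Lambda^n(W)\to\Lambda^{n+1}(W)$. Applying $\operatorname{Hom}_k(-,k)$ and writing $V^*=\operatorname{Hom}_k(V,k)$, one obtains the Koszul free contramodule resolution of the trivial one-dimensional contramodule $k$: $$0\leftarrow k\leftarrow\operatorname{Hom}_k(\mathcal C,k)\leftarrow\operatorname{Hom}_k(\mathcal C,W^* )\leftarrow\operatorname{Hom}_k(\mathcal C,\Lambda^2(W)^*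 )\leftarrow\cdots.$$ Truncated means with the term $k$ removed. *)

theory Defs
  imports Complex_Main "HOL-Library.Function_Algebras" "HOL-Combinatorics.Permutations"
begin

section \<open>Vector spaces with carriers\<close>

text \<open>
  A vector space is a subspace \<open>carr V\<close> of an ambient type which is itself a vector space
  (in the sense of \<^locale>\<open>vector_space\<close>) under \<open>smul V\<close>; addition is that of the ambient
  type.  Function types carry the pointwise vector space structure.
\<close>

record ('k, 'v) vspace =
  carr :: "'v set"
  smul :: "'k \<Rightarrow> 'v \<Rightarrow> 'v"

definition vec_space :: "('k::field, 'v::ab_group_add, 'z) vspace_scheme \<Rightarrow> bool" where
  "vec_space V \<longleftrightarrow> vector_space (smul V) \<and> module.subspace (smul V) (carr V)"

definition whole :: "('k::field \<Rightarrow> 'v::ab_group_add \<Rightarrow> 'v) \<Rightarrow> ('k, 'v) vspace" where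
  "whole s = \<lparr>carr = UNIV, smul = s\<rparr>"

abbreviation ground :: "('k::field, 'k) vspace" where
  "ground \<equiv> whole (*)"

abbreviation (input) ptmul :: "('k \<Rightarrow> 'v \<Rightarrow> 'v) \<Rightarrow> 'k \<Rightarrow> ('a \<Rightarrow> 'v) \<Rightarrow> ('a \<Rightarrow> 'v)" where
  "ptmul s \<equiv> (\<lambda>c f x. s c (f x))"

definition res :: "('k, 'v, 'z) vspace_scheme \<Rightarrow> ('v \<Rightarrow> 'u::zero) \<Rightarrow> 'v \<Rightarrow> 'u" where
  "res V f = (\<lambda>x. if x \<in> carr V then f x else 0)"

text \<open>
  A linear map between carriers is represented by its extension by zero, so that equality of
  linear maps is equality of functions and \<open>hom V U\<close> is a subspace of a function type.
\<close>

definition hom :: "('k::field, 'v::ab_group_add, 'y) vspace_scheme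
    \<Rightarrow> ('k, 'u::ab_group_add, 'z) vspace_scheme \<Rightarrow> ('v \<Rightarrow> 'u) set" where
  "hom V U = {f. (\<forall>x\<in>carr V. f x \<in> carr U)
    \<and> (\<forall>x\<in>carr V. \<forall>y\<in>carr V. f (x + y) = f x + f y)
    \<and> (\<forall>c. \<forall>x\<in>carr V. f (smul V c x) = smul U c (f x))
    \<and> (\<forall>x. x \<notin> carr V \<longrightarrow> f x = 0)}"

definition Hom :: "('k::field, 'v::ab_group_add, 'y) vspace_scheme
    \<Rightarrow> ('k, 'u::ab_group_add, 'z) vspace_scheme \<Rightarrow> ('k, 'v \<Rightarrow> 'u) vspace" where
  "Hom V U = \<lparr>carr = hom V U, smul = ptmul (smul U)\<rparr>"

abbreviation dual :: "('k::field, 'v::ab_group_add, 'y) vspace_scheme \<Rightarrow> ('k, 'v \<Rightarrow> 'k) vspace" where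
  "dual V \<equiv> Hom V ground"

text \<open>
  The quotient \<open>V / R\<close>: since over a field the linear functionals vanishing on a subspace \<open>R\<close>
  separate the cosets of \<open>R\<close>, the coset of \<open>v\<close> can be represented by the function evaluating
  these functionals at \<open>v\<close>.
\<close>

definition coset :: "('k::field, 'v::ab_group_add, 'z) vspace_scheme \<Rightarrow> 'v set \<Rightarrow> 'v \<Rightarrow> ('v \<Rightarrow> 'k) \<Rightarrow> 'k" where
  "coset V R v = (\<lambda>l. if Vector_Spaces.linear (smul V) (*) l \<and> (\<forall>r\<in>R. l r = 0) then l v else 0)"

definition quotient_space :: "('k::field, 'v::ab_group_add, 'z) vspace_scheme \<Rightarrow> 'v set
    \<Rightarrow> ('k, ('v \<Rightarrow> 'k) \<Rightarrow> 'k) vspace" where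
  "quotient_space V R = \<lparr>carr = coset V R ` carr V, smul = ptmul (*)\<rparr>"


section \<open>Tensor products\<close>

text \<open>
  In the same way the tensor product, i.e. the vector space generated by symbols \<open>v \<otimes> u\<close> subject
  to bilinearity, is realized as the span of the evaluations of bilinear forms at pairs \<open>(v, u)\<close>.
  The forms are taken on the ambient types, so that the tensor product of subspaces
  is literally a subspace of the tensor product.  The universal property is proved in
  \<open>tensor_universal\<close> below.
\<close>

type_synonym ('k, 'v, 'u) tensor = "('v \<Rightarrow> 'u \<Rightarrow> 'k) \<Rightarrow> 'k"

definition bilinear_form :: "('k::field \<Rightarrow> 'v::ab_group_add \<Rightarrow> 'v) \<Rightarrow> ('k \<Rightarrow> 'u::ab_group_add \<Rightarrow> 'u)
    \<Rightarrow> ('v \<Rightarrow> 'u \<Rightarrow> 'k) \<Rightarrow> bool" where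
  "bilinear_form s t b \<longleftrightarrow> (\<forall>u. Vector_Spaces.linear s (*) (\<lambda>v. b v u))
    \<and> (\<forall>v. Vector_Spaces.linear t (*) (b v))"

definition tens :: "('k::field, 'v::ab_group_add, 'y) vspace_scheme
    \<Rightarrow> ('k, 'u::ab_group_add, 'z) vspace_scheme \<Rightarrow> 'v \<Rightarrow> 'u \<Rightarrow> ('k, 'v, 'u) tensor" where
  "tens V U v u = (\<lambda>b. if bilinear_form (smul V) (smul U) b then b v u else 0)"

definition tensor :: "('k::field, 'v::ab_group_add, 'y) vspace_scheme
    \<Rightarrow> ('k, 'u::ab_group_add, 'z) vspace_scheme \<Rightarrow> ('k, ('k, 'v, 'u) tensor) vspace" where
  "tensor V U = \<lparr>carr = module.span (ptmul (*)) {tens V U v u |v u. v \<in> carr V \<and> u \<in> carr U},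
                 smul = ptmul (*)\<rparr>"

definition tensor_lift :: "('k::field, 'v::ab_group_add, 'y) vspace_scheme
    \<Rightarrow> ('k, 'u::ab_group_add, 'z) vspace_scheme \<Rightarrow> ('k, 'x::ab_group_add, 't) vspace_scheme
    \<Rightarrow> ('v \<Rightarrow> 'u \<Rightarrow> 'x) \<Rightarrow> ('k, 'v, 'u) tensor \<Rightarrow> 'x" where
  "tensor_lift V U X f = (THE g. g \<in> hom (tensor V U) X
     \<and> (\<forall>v\<in>carr V. \<forall>u\<in>carr U. g (tens V U v u) = f v u))"

definition tensor_map :: "('k::field, 'v::ab_group_add, 'y) vspace_scheme
    \<Rightarrow> ('k, 'u::ab_group_add, 'z) vspace_scheme \<Rightarrow> ('k, 'v'::ab_group_add, 'y') vspace_scheme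
    \<Rightarrow> ('k, 'u'::ab_group_add, 'z') vspace_scheme \<Rightarrow> ('v \<Rightarrow> 'v') \<Rightarrow> ('u \<Rightarrow> 'u')
    \<Rightarrow> ('k, 'v, 'u) tensor \<Rightarrow> ('k, 'v', 'u') tensor" where
  "tensor_map V U V' U' f g = tensor_lift V U (tensor V' U') (\<lambda>v u. tens V' U' (f v) (g u))"

definition assoc :: "('k::field, 'v::ab_group_add, 'y) vspace_scheme
    \<Rightarrow> ('k, 'u::ab_group_add, 'z) vspace_scheme \<Rightarrow> ('k, 'x::ab_group_add, 't) vspace_scheme
    \<Rightarrow> ('k, ('k, 'v, 'u) tensor, 'x) tensor \<Rightarrow> ('k, 'v, ('k, 'u, 'x) tensor) tensor" where
  "assoc V U X = tensor_lift (tensor V U) X (tensor V (tensor U X))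
     (\<lambda>t x. tensor_lift V U (tensor V (tensor U X)) (\<lambda>v u. tens V (tensor U X) v (tens U X u x)) t)"


section \<open>Coalgebras, comodules, contramodules\<close>

record ('k, 'c) coalg = "('k, 'c) vspace" +
  comult :: "'c \<Rightarrow> ('k, 'c, 'c) tensor"
  counit :: "'c \<Rightarrow> 'k"

definition coalgebra :: "('k::field, 'c::ab_group_add) coalg \<Rightarrow> bool" where
  "coalgebra C \<longleftrightarrow> vec_space C \<and> comult C \<in> hom C (tensor C C) \<and> counit C \<in> hom C ground
   \<and> (\<forall>c\<in>carr C. assoc C C C (tensor_map C C (tensor C C) C (comult C) (\<lambda>x. x) (comult C c))
                = tensor_map C C C (tensor C C) (\<lambda>x. x) (comult C) (comult C c))
   \<and> (\<forall>c\<in>carr C. tensor_lift C C C (\<lambda>d e. smul C (counit C d) e) (comult C c) = c)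
   \<and> (\<forall>c\<in>carr C. tensor_lift C C C (\<lambda>d e. smul C (counit C e) d) (comult C c) = c)"

record ('k, 'c, 'm) comod = "('k, 'm) vspace" +
  coact :: "'m \<Rightarrow> ('k, 'c, 'm) tensor"

record ('k, 'c, 'n) rcomod = "('k, 'n) vspace" +
  rcoact :: "'n \<Rightarrow> ('k, 'n, 'c) tensor"

record ('k, 'c, 'p) contramod = "('k, 'p) vspace" +
  contract :: "('c \<Rightarrow> 'p) \<Rightarrow> 'p"

text \<open>Comodules (\<open>comod\<close>) and contramodules are left ones; right comodules are \<open>rcomod\<close>.\<close>

definition comodule :: "('k::field, 'c::ab_group_add) coalg \<Rightarrow> ('k, 'c, 'm::ab_group_add) comod \<Rightarrow> bool" where
  "comodule C M \<longleftrightarrow> coalgebra C \<and> vec_space M \<and> coact M \<in> hom M (tensor C M)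
   \<and> (\<forall>m\<in>carr M. assoc C C M (tensor_map C M (tensor C C) M (comult C) (\<lambda>x. x) (coact M m))
                = tensor_map C M C (tensor C M) (\<lambda>x. x) (coact M) (coact M m))
   \<and> (\<forall>m\<in>carr M. tensor_lift C M M (\<lambda>c x. smul M (counit C c) x) (coact M m) = m)"

definition comodule_hom :: "('k::field, 'c::ab_group_add) coalg \<Rightarrow> ('k, 'c, 'm::ab_group_add) comod
    \<Rightarrow> ('k, 'c, 'n::ab_group_add) comod \<Rightarrow> ('m \<Rightarrow> 'n) set" where
  "comodule_hom C M N = {f \<in> hom M N.
     \<forall>m\<in>carr M. coact N (f m) = tensor_map C M C N (\<lambda>x. x) f (coact M m)}"

text \<open>
  For left contramodules the identification
  \<open>Hom(C, Hom(C, P)) = Hom(C \<otimes> C, P)\<close> is that of \<open>Hom(V, Hom(U, P))\<close> with \<open>Hom(U \<otimes> V, P)\<close>, so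
  \<open>F\<close> in \<open>Hom(C \<otimes> C, P)\<close> corresponds to the map sending \<open>c\<close> to the map \<open>d \<mapsto> F (d \<otimes> c)\<close>.
\<close>

definition contramodule :: "('k::field, 'c::ab_group_add) coalg
    \<Rightarrow> ('k, 'c, 'p::ab_group_add) contramod \<Rightarrow> bool" where
  "contramodule C P \<longleftrightarrow> coalgebra C \<and> vec_space P \<and> contract P \<in> hom (Hom C P) P
   \<and> (\<forall>F \<in> hom (tensor C C) P.
        contract P (res C (\<lambda>c. contract P (res C (\<lambda>d. F (tens C C d c)))))
      = contract P (res C (\<lambda>c. F (comult C c))))
   \<and> (\<forall>p\<in>carr P. contract P (res C (\<lambda>c. smul P (counit C c) p)) = p)"

definition contramodule_hom :: "('k::field, 'c::ab_group_add) coalg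
    \<Rightarrow> ('k, 'c, 'p::ab_group_add) contramod \<Rightarrow> ('k, 'c, 'q::ab_group_add) contramod \<Rightarrow> ('p \<Rightarrow> 'q) set" where
  "contramodule_hom C P Q = {f \<in> hom P Q.
     \<forall>g \<in> hom C P. f (contract P g) = contract Q (res C (\<lambda>c. f (g c)))}"

definition cofree :: "('k::field, 'c::ab_group_add) coalg \<Rightarrow> ('k, 'v::ab_group_add, 'z) vspace_scheme
    \<Rightarrow> ('k, 'c, ('k, 'c, 'v) tensor) comod" where
  "cofree C V = \<lparr>carr = carr (tensor C V), smul = smul (tensor C V),
     coact = (\<lambda>t. assoc C C V (tensor_map C V (tensor C C) V (comult C) (\<lambda>x. x) t))\<rparr>"

text \<open>In Sweedler notation \<open>contract (free C V) F\<close> is \<open>c \<mapsto> F(c\<^sub>2)(c\<^sub>1)\<close>.\<close>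

definition free :: "('k::field, 'c::ab_group_add) coalg \<Rightarrow> ('k, 'v::ab_group_add, 'z) vspace_scheme
    \<Rightarrow> ('k, 'c, 'c \<Rightarrow> 'v) contramod" where
  "free C V = \<lparr>carr = hom C V, smul = ptmul (smul V),
     contract = res (Hom C (Hom C V)) (\<lambda>F. res C (\<lambda>c. tensor_lift C C V (\<lambda>d e. F e d) (comult C c)))\<rparr>"

text \<open>
  Injectivity and projectivity are tested on objects of given types.  In a theorem
  these types are free type variables, hence universally quantified.
  Monomorphisms of comodules are the injective, epimorphisms of contramodules the
  surjective morphisms.
\<close>

definition injective_comodule :: "'x::ab_group_add itself \<Rightarrow> 'y::ab_group_add itself
    \<Rightarrow> ('k::field, 'c::ab_group_add) coalg \<Rightarrow> ('k, 'c, 'm::ab_group_add) comod \<Rightarrow> bool" where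
  "injective_comodule _ _ C J \<longleftrightarrow> comodule C J
   \<and> (\<forall>(A :: ('k, 'c, 'x) comod) (B :: ('k, 'c, 'y) comod) i f.
        comodule C A \<and> comodule C B \<and> i \<in> comodule_hom C A B \<and> inj_on i (carr A)
        \<and> f \<in> comodule_hom C A J
        \<longrightarrow> (\<exists>g \<in> comodule_hom C B J. \<forall>a\<in>carr A. g (i a) = f a))"

definition projective_contramodule :: "'x::ab_group_add itself \<Rightarrow> 'y::ab_group_add itself
    \<Rightarrow> ('k::field, 'c::ab_group_add) coalg \<Rightarrow> ('k, 'c, 'p::ab_group_add) contramod \<Rightarrow> bool" where
  "projective_contramodule _ _ C P \<longleftrightarrow> contramodule C P
   \<and> (\<forall>(A :: ('k, 'c, 'x) contramod) (B :: ('k, 'c, 'y) contramod) q f.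
        contramodule C A \<and> contramodule C B \<and> q \<in> contramodule_hom C A B \<and> q ` carr A = carr B
        \<and> f \<in> contramodule_hom C P B
        \<longrightarrow> (\<exists>g \<in> contramodule_hom C P A. \<forall>p\<in>carr P. q (g p) = f p))"


section \<open>The functors Psi and Phi\<close>

definition left_regular :: "('k, 'c) coalg \<Rightarrow> ('k, 'c, 'c) comod" where
  "left_regular C = \<lparr>carr = carr C, smul = smul C, coact = comult C\<rparr>"

definition right_regular :: "('k, 'c) coalg \<Rightarrow> ('k, 'c, 'c) rcomod" where
  "right_regular C = \<lparr>carr = carr C, smul = smul C, rcoact = comult C\<rparr>"

definition Psi :: "('k::field, 'c::ab_group_add) coalg \<Rightarrow> ('k, 'c, 'm::ab_group_add) comod
    \<Rightarrow> ('k, 'c, 'c \<Rightarrow> 'm) contramod" where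
  "Psi C M = (let H = \<lparr>carr = comodule_hom C (left_regular C) M, smul = ptmul (smul M)\<rparr> in
     \<lparr>carr = carr H, smul = smul H,
      contract = res (Hom C H) (\<lambda>F. res C (\<lambda>c. tensor_lift C C M (\<lambda>d e. F e d) (comult C c)))\<rparr>)"

definition Psi_map :: "('k::field, 'c::ab_group_add) coalg \<Rightarrow> ('k, 'c, 'm::ab_group_add) comod
    \<Rightarrow> ('m \<Rightarrow> 'n::ab_group_add) \<Rightarrow> ('c \<Rightarrow> 'm) \<Rightarrow> ('c \<Rightarrow> 'n)" where
  "Psi_map C M f = res (Psi C M) (\<lambda>g. res C (\<lambda>c. f (g c)))"

definition contratensor_rel :: "('k::field, 'c::ab_group_add) coalg \<Rightarrow> ('k, 'c, 'n::ab_group_add) rcomod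
    \<Rightarrow> ('k, 'c, 'p::ab_group_add) contramod \<Rightarrow> ('k, 'n, 'p) tensor set" where
  "contratensor_rel C N P = module.span (smul (tensor N P))
     {tens N P n (contract P f)
        - tensor_lift N C (tensor N P) (\<lambda>m c. tens N P m (f c)) (rcoact N n)
      |n f. n \<in> carr N \<and> f \<in> hom C P}"

definition contratensor :: "('k::field, 'c::ab_group_add) coalg \<Rightarrow> ('k, 'c, 'n::ab_group_add) rcomod
    \<Rightarrow> ('k, 'c, 'p::ab_group_add) contramod \<Rightarrow> ('k, (('k, 'n, 'p) tensor \<Rightarrow> 'k) \<Rightarrow> 'k) vspace" where
  "contratensor C N P = quotient_space (tensor N P) (contratensor_rel C N P)"

definition ctens :: "('k::field, 'c::ab_group_add) coalg \<Rightarrow> ('k, 'c, 'n::ab_group_add) rcomod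
    \<Rightarrow> ('k, 'c, 'p::ab_group_add) contramod \<Rightarrow> 'n \<Rightarrow> 'p \<Rightarrow> (('k, 'n, 'p) tensor \<Rightarrow> 'k) \<Rightarrow> 'k" where
  "ctens C N P n p = coset (tensor N P) (contratensor_rel C N P) (tens N P n p)"

definition Phi :: "('k::field, 'c::ab_group_add) coalg \<Rightarrow> ('k, 'c, 'p::ab_group_add) contramod
    \<Rightarrow> ('k, 'c, (('k, 'c, 'p) tensor \<Rightarrow> 'k) \<Rightarrow> 'k) comod" where
  "Phi C P = (let R = right_regular C; Q = contratensor C R P in
     \<lparr>carr = carr Q, smul = smul Q,
      coact = (THE h. h \<in> hom Q (tensor C Q) \<and> (\<forall>c\<in>carr C. \<forall>p\<in>carr P. h (ctens C R P c p)
        = tensor_lift C C (tensor C Q) (\<lambda>d e. tens C Q d (ctens C R P e p)) (comult C c)))\<rparr>)"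

definition Phi_map :: "('k::field, 'c::ab_group_add) coalg \<Rightarrow> ('k, 'c, 'p::ab_group_add) contramod
    \<Rightarrow> ('k, 'c, 'q::ab_group_add) contramod \<Rightarrow> ('p \<Rightarrow> 'q)
    \<Rightarrow> ((('k, 'c, 'p) tensor \<Rightarrow> 'k) \<Rightarrow> 'k) \<Rightarrow> ((('k, 'c, 'q) tensor \<Rightarrow> 'k) \<Rightarrow> 'k)" where
  "Phi_map C P Q f = (THE h. h \<in> hom (Phi C P) (Phi C Q) \<and> (\<forall>c\<in>carr C. \<forall>p\<in>carr P.
     h (ctens C (right_regular C) P c p) = ctens C (right_regular C) Q c (f p)))"

text \<open>The natural maps \<open>C \<otimes> V \<rightarrow> Phi (Hom(C, V))\<close> and \<open>Hom(C, V) \<rightarrow> Psi (C \<otimes> V)\<close>.\<close>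

definition Phi_free :: "('k::field, 'c::ab_group_add) coalg \<Rightarrow> ('k, 'v::ab_group_add, 'z) vspace_scheme
    \<Rightarrow> ('k, 'c, 'v) tensor \<Rightarrow> (('k, 'c, 'c \<Rightarrow> 'v) tensor \<Rightarrow> 'k) \<Rightarrow> 'k" where
  "Phi_free C V = tensor_lift C V (Phi C (free C V))
     (\<lambda>c v. ctens C (right_regular C) (free C V) c (res C (\<lambda>d. smul V (counit C d) v)))"

definition Psi_cofree :: "('k::field, 'c::ab_group_add) coalg \<Rightarrow> ('k, 'v::ab_group_add, 'z) vspace_scheme
    \<Rightarrow> ('c \<Rightarrow> 'v) \<Rightarrow> 'c \<Rightarrow> ('k, 'c, 'v) tensor" where
  "Psi_cofree C V = res (free C V) (\<lambda>f. res C (\<lambda>c. tensor_map C C C V (\<lambda>x. x) f (comult C c)))"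


section \<open>Complexes\<close>

text \<open>
  A cohomologically graded complex is given by its terms \<open>X i\<close> and differentials
  \<open>d i\<close> from \<open>X i\<close> to \<open>X (i + 1)\<close>.  The parameter \<open>H\<close> is the family of morphism sets of the ambient
  category (\<open>comodule_hom C\<close> or \<open>contramodule_hom C\<close>).
\<close>

definition cochain_complex :: "(('k, 'v::ab_group_add, 'z) vspace_scheme \<Rightarrow> ('k, 'v, 'z) vspace_scheme
    \<Rightarrow> ('v \<Rightarrow> 'v) set) \<Rightarrow> (int \<Rightarrow> ('k, 'v, 'z) vspace_scheme) \<Rightarrow> (int \<Rightarrow> 'v \<Rightarrow> 'v) \<Rightarrow> bool" where
  "cochain_complex H X d \<longleftrightarrow> (\<forall>i. d i \<in> H (X i) (X (i + 1)) \<and> (\<forall>x\<in>carr (X i). d (i + 1) (d i x) = 0))"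

definition bounded_above :: "(int \<Rightarrow> ('k, 'v::zero, 'z) vspace_scheme) \<Rightarrow> bool" where
  "bounded_above X \<longleftrightarrow> (\<exists>N. \<forall>i>N. carr (X i) = {0})"

definition bounded_below :: "(int \<Rightarrow> ('k, 'v::zero, 'z) vspace_scheme) \<Rightarrow> bool" where
  "bounded_below X \<longleftrightarrow> (\<exists>N. \<forall>i<N. carr (X i) = {0})"

definition acyclic_complex :: "(int \<Rightarrow> ('k, 'v::zero, 'z) vspace_scheme) \<Rightarrow> (int \<Rightarrow> 'v \<Rightarrow> 'v) \<Rightarrow> bool" where
  "acyclic_complex X d \<longleftrightarrow> (\<forall>i. {x \<in> carr (X i). d i x = 0} = d (i - 1) ` carr (X (i - 1)))"

definition contractible :: "(('k, 'v::ab_group_add, 'z) vspace_scheme \<Rightarrow> ('k, 'v, 'z) vspace_scheme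
    \<Rightarrow> ('v \<Rightarrow> 'v) set) \<Rightarrow> (int \<Rightarrow> ('k, 'v, 'z) vspace_scheme) \<Rightarrow> (int \<Rightarrow> 'v \<Rightarrow> 'v) \<Rightarrow> bool" where
  "contractible H X d \<longleftrightarrow> (\<exists>h. (\<forall>i. h i \<in> H (X i) (X (i - 1)))
     \<and> (\<forall>i. \<forall>x\<in>carr (X i). d (i - 1) (h i x) + h (i + 1) (d i x) = x))"


section \<open>The symmetric coalgebra and exterior powers\<close>

text \<open>
  The tensor space \<open>W\<^sup>\<otimes>\<^sup>n\<close> is realized like the tensor product, by evaluating multilinear forms at
  words of length \<open>n\<close>; a multilinear form is a function on all words that is linear in each
  letter, so that its restrictions to words of distinct lengths are unrelated and the span of
  all words is the direct sum of the \<open>W\<^sup>\<otimes>\<^sup>n\<close>.  Replacing multilinear by alternating forms gives the exterior powers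
  (the quotient of the tensor algebra by the ideal generated by the \<open>w \<otimes> w\<close>).  See
  \<open>coset_eq_iff\<close>, \<open>tensor_power_universal\<close> and \<open>Ext_power_universal\<close> below.
\<close>

type_synonym ('k, 'w) words = "('w list \<Rightarrow> 'k) \<Rightarrow> 'k"

definition multilinear_form :: "('k::field \<Rightarrow> 'w::ab_group_add \<Rightarrow> 'w) \<Rightarrow> ('w list \<Rightarrow> 'k) \<Rightarrow> bool" where
  "multilinear_form s b \<longleftrightarrow> (\<forall>xs ys. Vector_Spaces.linear s (*) (\<lambda>w. b (xs @ w # ys)))"

definition alternating_form :: "('k::field \<Rightarrow> 'w::ab_group_add \<Rightarrow> 'w) \<Rightarrow> ('w list \<Rightarrow> 'k) \<Rightarrow> bool" where
  "alternating_form s b \<longleftrightarrow> multilinear_form s b \<and> (\<forall>xs w ys. b (xs @ w # w # ys) = 0)"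

definition word :: "('k::field \<Rightarrow> 'w::ab_group_add \<Rightarrow> 'w) \<Rightarrow> 'w list \<Rightarrow> ('k, 'w) words" where
  "word s ws = (\<lambda>b. if multilinear_form s b then b ws else 0)"

definition tensor_power :: "('k::field \<Rightarrow> 'w::ab_group_add \<Rightarrow> 'w) \<Rightarrow> nat \<Rightarrow> ('k, ('k, 'w) words) vspace" where
  "tensor_power s n = \<lparr>carr = module.span (ptmul (*)) (word s ` {ws. length ws = n}), smul = ptmul (*)\<rparr>"

definition tensor_coalgebra :: "('k::field \<Rightarrow> 'w::ab_group_add \<Rightarrow> 'w) \<Rightarrow> ('k, ('k, 'w) words) coalg" where
  "tensor_coalgebra s = (let T = \<lparr>carr = module.span (ptmul (*)) (range (word s)), smul = ptmul (*)\<rparr> in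
     \<lparr>carr = carr T, smul = smul T,
      comult = (THE f. f \<in> hom T (tensor T T) \<and>
        (\<forall>ws. f (word s ws) = (\<Sum>i\<le>length ws. tens T T (word s (take i ws)) (word s (drop i ws))))),
      counit = (THE f. f \<in> hom T ground \<and> (\<forall>ws. f (word s ws) = (if ws = [] then 1 else 0)))\<rparr>)"

definition permute_tensor :: "('k::field \<Rightarrow> 'w::ab_group_add \<Rightarrow> 'w) \<Rightarrow> nat \<Rightarrow> (nat \<Rightarrow> nat)
    \<Rightarrow> ('k, 'w) words \<Rightarrow> ('k, 'w) words" where
  "permute_tensor s n p = (THE f. f \<in> hom (tensor_power s n) (tensor_power s n)
     \<and> (\<forall>ws. length ws = n \<longrightarrow> f (word s ws) = word s (permute_list p ws)))"

definition symmetric_tensors :: "('k::field \<Rightarrow> 'w::ab_group_add \<Rightarrow> 'w) \<Rightarrow> nat \<Rightarrow> ('k, 'w) words set" where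
  "symmetric_tensors s n =
     {t \<in> carr (tensor_power s n). \<forall>p. p permutes {..<n} \<longrightarrow> permute_tensor s n p t = t}"

definition Sym :: "('k::field \<Rightarrow> 'w::ab_group_add \<Rightarrow> 'w) \<Rightarrow> ('k, ('k, 'w) words) coalg" where
  "Sym s = (let S = \<lparr>carr = module.span (ptmul (*)) (\<Union>n. symmetric_tensors s n), smul = ptmul (*)\<rparr> in
     \<lparr>carr = carr S, smul = smul S,
      comult = res S (comult (tensor_coalgebra s)), counit = res S (counit (tensor_coalgebra s))\<rparr>)"

definition wedge_word :: "('k::field \<Rightarrow> 'w::ab_group_add \<Rightarrow> 'w) \<Rightarrow> 'w list \<Rightarrow> ('k, 'w) words" where
  "wedge_word s ws = (\<lambda>b. if alternating_form s b then b ws else 0)"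

text \<open>The degree is an integer; exterior powers of negative degree are zero (as \<open>span {} = {0}\<close>).\<close>

definition Ext_power :: "('k::field \<Rightarrow> 'w::ab_group_add \<Rightarrow> 'w) \<Rightarrow> int \<Rightarrow> ('k, ('k, 'w) words) vspace" where
  "Ext_power s i = \<lparr>carr = module.span (ptmul (*)) (wedge_word s ` {ws. int (length ws) = i}),
                    smul = ptmul (*)\<rparr>"

definition wedge :: "('k::field \<Rightarrow> 'w::ab_group_add \<Rightarrow> 'w) \<Rightarrow> int \<Rightarrow> 'w \<Rightarrow> ('k, 'w) words \<Rightarrow> ('k, 'w) words" where
  "wedge s i w = (THE f. f \<in> hom (Ext_power s i) (Ext_power s (i + 1))
     \<and> (\<forall>ws. int (length ws) = i \<longrightarrow> f (wedge_word s ws) = wedge_word s (w # ws)))"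


section \<open>Truncated Koszul complexes\<close>

text \<open>The projection of \<open>Sym(W)\<close> onto \<open>Sym\<^sub>1(W) = W\<close>, induced by that of the tensor coalgebra.\<close>

definition Sym_proj1 :: "('k::field \<Rightarrow> 'w::ab_group_add \<Rightarrow> 'w) \<Rightarrow> ('k, 'w) words \<Rightarrow> 'w" where
  "Sym_proj1 s = res (Sym s) (THE f. f \<in> hom (tensor_coalgebra s) (whole s)
     \<and> (\<forall>ws. f (word s ws) = (case ws of [w] \<Rightarrow> w | _ \<Rightarrow> 0)))"

definition koszul_comod :: "('k::field \<Rightarrow> 'w::ab_group_add \<Rightarrow> 'w) \<Rightarrow> int
    \<Rightarrow> ('k, ('k, 'w) words, ('k, ('k, 'w) words, ('k, 'w) words) tensor) comod" where
  "koszul_comod s i = cofree (Sym s) (Ext_power s i)"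

definition koszul_comod_d :: "('k::field \<Rightarrow> 'w::ab_group_add \<Rightarrow> 'w) \<Rightarrow> int
    \<Rightarrow> ('k, ('k, 'w) words, ('k, 'w) words) tensor \<Rightarrow> ('k, ('k, 'w) words, ('k, 'w) words) tensor" where
  "koszul_comod_d s i = (let C = Sym s; W = whole s; L = Ext_power s i; L' = Ext_power s (i + 1) in
     (\<lambda>t. tensor_map C (tensor W L) C L' (\<lambda>x. x) (tensor_lift W L L' (wedge s i))
       (assoc C W L
         (tensor_map C L (tensor C W) L
           (\<lambda>c. tensor_map C C C W (\<lambda>x. x) (Sym_proj1 s) (comult C c)) (\<lambda>x. x) t))))"

text \<open>
  Applying \<open>Hom(-, k)\<close> and \<open>Hom(C \<otimes> L, k) = Hom(C, L\<^sup>*)\<close>: the term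
  \<open>Hom(C, \<Lambda>\<^sup>n(W)\<^sup>*)\<close> is in degree \<open>-n\<close>.
\<close>

definition koszul_contra :: "('k::field \<Rightarrow> 'w::ab_group_add \<Rightarrow> 'w) \<Rightarrow> int
    \<Rightarrow> ('k, ('k, 'w) words, ('k, 'w) words \<Rightarrow> ('k, 'w) words \<Rightarrow> 'k) contramod" where
  "koszul_contra s i = free (Sym s) (dual (Ext_power s (- i)))"

definition koszul_contra_d :: "('k::field \<Rightarrow> 'w::ab_group_add \<Rightarrow> 'w) \<Rightarrow> int
    \<Rightarrow> (('k, 'w) words \<Rightarrow> ('k, 'w) words \<Rightarrow> 'k) \<Rightarrow> (('k, 'w) words \<Rightarrow> ('k, 'w) words \<Rightarrow> 'k)" where
  "koszul_contra_d s i = (let C = Sym s; L = Ext_power s (- i); L' = Ext_power s (- i - 1) in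
     res (koszul_contra s i) (\<lambda>f. res C (\<lambda>c. res L' (\<lambda>x.
       tensor_lift C L ground f (koszul_comod_d s (- i - 1) (tens C L' c x))))))"


section \<open>Universal properties\<close>

lemma vector_space_mult: "vector_space ((*) :: 'k::field \<Rightarrow> 'k \<Rightarrow> 'k)"
  by unfold_locales (auto simp: algebra_simps)

lemma vector_space_ptmul:
  assumes "vector_space s"
  shows "vector_space (ptmul s)"
proof -
  interpret vector_space s by fact
  show ?thesis
    by unfold_locales (auto simp: fun_eq_iff scale_right_distrib scale_left_distrib)
qed

lemma vector_space_functions: "vector_space (\<lambda>c f x. (c::'k::field) * f x)"
  by (rule vector_space_ptmul[OF vector_space_mult])

lemma functional_separates:
  fixes s :: "'k::field \<Rightarrow> 'v::ab_group_add \<Rightarrow> 'v"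
  assumes "vector_space s" "module.subspace s R" "v \<notin> R"
  shows "\<exists>l. Vector_Spaces.linear s (*) l \<and> (\<forall>r\<in>R. l r = 0) \<and> l v = 1"
proof -
  interpret p: vector_space_pair s "(*) :: 'k \<Rightarrow> 'k \<Rightarrow> 'k"
    using assms(1) vector_space_mult by (simp add: vector_space_pair_def)
  obtain B where B: "B \<subseteq> R" "p.vs1.independent B" "R \<subseteq> p.vs1.span B"
    using p.vs1.maximal_independent_subset[of R] by blast
  have "p.vs1.span B \<subseteq> R" using B(1) assms(2) by (rule p.vs1.span_minimal)
  then have nv: "v \<notin> p.vs1.span B" using assms(3) by blast
  then have ind: "p.vs1.independent (insert v B)"
    using B(2) by (rule p.vs1.independent_insertI)
  obtain l where l: "Vector_Spaces.linear s (*) l"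
      "\<forall>x\<in>insert v B. l x = (if x = v then 1 else 0)"
    using p.linear_independent_extend[OF ind, of "\<lambda>x. if x = v then 1 else 0"] by blast
  have "v \<notin> B" using nv p.vs1.span_base by blast
  then have z: "\<And>x. x \<in> B \<Longrightarrow> l x = 0" using l(2) by auto
  have "l r = 0" if "r \<in> R" for r
    using p.linear_eq_0_on_span[OF l(1) z] B(3) that by blast
  then show ?thesis using l by auto
qed

lemma coset_eq_iff:
  fixes V :: "('k::field, 'v::ab_group_add, 'z) vspace_scheme"
  assumes "vec_space V" "module.subspace (smul V) R"
  shows "coset V R v = coset V R v' \<longleftrightarrow> v - v' \<in> R"
proof -
  interpret vector_space "smul V" using assms(1) by (simp add: vec_space_def)
  have lin: "l (x - y) = l x - l y" if "Vector_Spaces.linear (smul V) (*) l" for l :: "'v \<Rightarrow> 'k" and x y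
  proof -
    have "l (x - y + y) = l (x - y) + l y" using that unfolding Vector_Spaces.linear_iff by blast
    then show ?thesis by simp
  qed
  show ?thesis
  proof
    assume eq: "coset V R v = coset V R v'"
    show "v - v' \<in> R"
    proof (rule ccontr)
      assume "v - v' \<notin> R"
      then obtain l where l: "Vector_Spaces.linear (smul V) (*) l" "\<forall>r\<in>R. l r = 0" "l (v - v') = 1"
        using functional_separates[OF vector_space_axioms assms(2)] by blast
      have "l v = l v'" using fun_cong[OF eq, of l] l by (simp add: coset_def)
      then show False using l(3) lin[OF l(1)] by simp
    qed
  next
    assume "v - v' \<in> R"
    then show "coset V R v = coset V R v'"
      using lin unfolding coset_def fun_eq_iff by (metis right_minus_eq)
  qed
qed

lemma evaluation_span_universal:
  fixes gen :: "'i \<Rightarrow> 'f \<Rightarrow> 'k::field" and X :: "('k, 'x::ab_group_add, 'z) vspace_scheme"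
  assumes X: "vec_space X"
    and fX: "\<And>i. i \<in> I \<Longrightarrow> f i \<in> carr X"
    and ev: "\<And>l. Vector_Spaces.linear (smul X) (*) l \<Longrightarrow> \<exists>\<phi>. \<forall>i\<in>I. gen i \<phi> = l (f i)"
  shows "\<exists>!g. g \<in> hom \<lparr>carr = module.span (ptmul (*)) (gen ` I), smul = ptmul (*)\<rparr> X
               \<and> (\<forall>i\<in>I. g (gen i) = f i)"
proof -
  let ?s = "\<lambda>c (f::'f \<Rightarrow> 'k) x. c * f x"
  have vX: "vector_space (smul X)" "module.subspace (smul X) (carr X)"
    using X by (auto simp: vec_space_def)
  interpret p: vector_space_pair ?s "smul X"
    using vX vector_space_functions by (simp add: vector_space_pair_def)
  interpret q: vector_space_pair ?s "(*) :: 'k \<Rightarrow> 'k \<Rightarrow> 'k"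
    using vector_space_functions vector_space_mult by (simp add: vector_space_pair_def)
  obtain B where B: "B \<subseteq> gen ` I" "p.vs1.independent B" "gen ` I \<subseteq> p.vs1.span B"
    using p.vs1.maximal_independent_subset[of "gen ` I"] by blast
  define idx where "idx b = (SOME i. i \<in> I \<and> gen i = b)" for b
  have idx: "idx b \<in> I \<and> gen (idx b) = b" if "b \<in> B" for b
  proof -
    have "\<exists>i. i \<in> I \<and> gen i = b" using that B(1) by auto
    then show ?thesis unfolding idx_def by (rule someI_ex)
  qed
  obtain g where g: "Vector_Spaces.linear ?s (smul X) g" "\<forall>b\<in>B. g b = f (idx b)"
    using p.linear_independent_extend[OF B(2), of "\<lambda>b. f (idx b)"] by blast
  have gadd: "g (a + b) = g a + g b" and gscale: "g (?s c a) = smul X c (g a)" for a b c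
    using g(1) by (auto simp: Vector_Spaces.linear_iff)
  have gen: "g (gen i) = f i" if i: "i \<in> I" for i
  proof (rule ccontr)
    assume "g (gen i) \<noteq> f i"
    then have ne: "g (gen i) - f i \<notin> {0}" by simp
    have s0: "p.vs2.subspace {0}" by simp
    obtain l where l: "Vector_Spaces.linear (smul X) (*) l" "l (g (gen i) - f i) = 1"
      using functional_separates[OF vX(1) s0 ne] by blast
    obtain \<phi> where \<phi>: "\<forall>i\<in>I. gen i \<phi> = l (f i)" using ev[OF l(1)] by blast
    have ladd: "l (x + y) = l x + l y" and lscale: "l (smul X c x) = c * l x" for x y c
      using l(1) by (auto simp: Vector_Spaces.linear_iff)
    have "Vector_Spaces.linear ?s (*) (\<lambda>t. l (g t))"
      using vector_space_functions vector_space_mult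
      by (simp add: Vector_Spaces.linear_iff gadd gscale[simplified] ladd lscale)
    moreover have "Vector_Spaces.linear ?s (*) (\<lambda>t::'f \<Rightarrow> 'k. t \<phi>)"
      using vector_space_functions vector_space_mult by (simp add: Vector_Spaces.linear_iff)
    moreover have "l (g b) = b \<phi>" if "b \<in> B" for b
      using g(2) idx[OF that] \<phi> that by metis
    moreover have "gen i \<in> p.vs1.span B" using B(3) i by blast
    ultimately have "l (g (gen i)) = gen i \<phi>"
      using q.linear_eq_on[of "\<lambda>t. l (g t)" "\<lambda>t. t \<phi>" "gen i" B] by blast
    then have "l (g (gen i)) = l (f i)" using \<phi> i by simp
    moreover have "l (g (gen i)) = l (g (gen i) - f i) + l (f i)"
      using ladd[of "g (gen i) - f i" "f i"] by simp
    ultimately show False using l(2) by simp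
  qed
  let ?S = "p.vs1.span (gen ` I)"
  let ?T = "\<lparr>carr = ?S, smul = ?s\<rparr>"
  have img: "g t \<in> carr X" if "t \<in> ?S" for t
    using that
  proof (induction rule: p.vs1.span_induct_alt)
    case base
    have "g 0 = 0" using gadd[of 0 0] by (metis add_cancel_right_right)
    then show ?case using p.vs2.subspace_0[OF vX(2)] by metis
  next
    case (step c x y)
    then obtain i where i: "i \<in> I" "x = gen i" by auto
    have "g x \<in> carr X" using gen[OF i(1)] fX[OF i(1)] i(2) by simp
    then show ?case
      unfolding gadd gscale using step vX(2) p.vs2.subspace_add p.vs2.subspace_scale by blast
  qed
  define h where "h = res ?T g"
  have h: "h \<in> hom ?T X \<and> (\<forall>i\<in>I. h (gen i) = f i)"
    using img gen gadd gscale p.vs1.span_add p.vs1.span_scale p.vs1.span_base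
    by (auto simp: h_def res_def hom_def)
  show ?thesis
  proof (rule ex1I[of _ h])
    show "h \<in> hom ?T X \<and> (\<forall>i\<in>I. h (gen i) = f i)" by (rule h)
  next
    fix h' assume h': "h' \<in> hom ?T X \<and> (\<forall>i\<in>I. h' (gen i) = f i)"
    have eq: "t \<in> ?S \<and> h' t = h t" if "t \<in> ?S" for t
      using that
    proof (induction rule: p.vs1.span_induct_alt)
      case base
      have add: "k (x + y) = k x + k y" if "k \<in> hom ?T X" "x \<in> ?S" "y \<in> ?S" for k x y
        using that by (simp add: hom_def)
      have "k 0 = 0" if "k \<in> hom ?T X" for k
        using add[OF that p.vs1.span_zero p.vs1.span_zero] by (metis add.right_neutral add_cancel_right_right)
      then show ?case using h h' p.vs1.span_zero by metis
    next
      case (step c x y)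
      then have x: "x \<in> ?S" "?s c x \<in> ?S" using p.vs1.span_base p.vs1.span_scale by blast+
      have "h' x = h x" using step(1) h h' by auto
      then have "h' (?s c x) = h (?s c x)" using h h' x by (simp add: hom_def)
      moreover have "h' (?s c x + y) = h' (?s c x) + h' y" "h (?s c x + y) = h (?s c x) + h y"
        using h h' x step by (auto simp: hom_def)
      ultimately show ?case using step x p.vs1.span_add by metis
    qed
    show "h' = h"
    proof
      fix t show "h' t = h t"
      proof (cases "t \<in> ?S")
        case True then show ?thesis using eq by blast
      next
        case False then show ?thesis using h h' by (simp add: hom_def)
      qed
    qed
  qed
qed

lemma subspace_projection:
  fixes V :: "('k::field, 'v::ab_group_add, 'z) vspace_scheme"
  assumes "vec_space V"
  shows "\<exists>p. Vector_Spaces.linear (smul V) (smul V) p \<and> (\<forall>x. p x \<in> carr V) \<and> (\<forall>x\<in>carr V. p x = x)"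
proof -
  have V: "vector_space (smul V)" "module.subspace (smul V) (carr V)"
    using assms by (auto simp: vec_space_def)
  interpret p: vector_space_pair "smul V" "smul V"
    using V by (simp add: vector_space_pair_def)
  obtain B where B: "B \<subseteq> carr V" "p.vs1.independent B" "carr V \<subseteq> p.vs1.span B"
    using p.vs1.maximal_independent_subset[of "carr V"] by blast
  have sp: "p.vs1.span B = carr V"
    using B p.vs1.span_minimal[OF B(1) V(2)] by blast
  obtain g where g: "\<forall>x\<in>B. g x = id x" "Vector_Spaces.linear (smul V) (smul V) g"
      "range g = p.vs1.span (id ` B)"
    using p.linear_independent_extend_subspace[OF B(2), of id] by blast
  have "g x = x" if "x \<in> carr V" for x
    using p.linear_eq_on[OF g(2) p.vs1.linear_id[unfolded id_def], of x B] g(1) that sp by auto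
  moreover have "g x \<in> carr V" for x using g(3) sp by auto
  ultimately show ?thesis using g(2) by blast
qed

theorem tensor_universal:
  fixes V :: "('k::field, 'v::ab_group_add, 'y) vspace_scheme"
    and U :: "('k, 'u::ab_group_add, 'z) vspace_scheme"
    and X :: "('k, 'x::ab_group_add, 't) vspace_scheme"
  assumes V: "vec_space V" and U: "vec_space U" and X: "vec_space X"
    and left: "\<And>u. u \<in> carr U \<Longrightarrow> res V (\<lambda>v. f v u) \<in> hom V X"
    and right: "\<And>v. v \<in> carr V \<Longrightarrow> res U (f v) \<in> hom U X"
  shows "\<exists>!g. g \<in> hom (tensor V U) X \<and> (\<forall>v\<in>carr V. \<forall>u\<in>carr U. g (tens V U v u) = f v u)"
proof -
  obtain p where p: "Vector_Spaces.linear (smul V) (smul V) p" "\<And>x. p x \<in> carr V" "\<And>x. x \<in> carr V \<Longrightarrow> p x = x"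
    using subspace_projection[OF V] by blast
  obtain q where q: "Vector_Spaces.linear (smul U) (smul U) q" "\<And>x. q x \<in> carr U" "\<And>x. x \<in> carr U \<Longrightarrow> q x = x"
    using subspace_projection[OF U] by blast
  interpret V: vector_space "smul V" using V by (simp add: vec_space_def)
  interpret U: vector_space "smul U" using U by (simp add: vec_space_def)
  have Vsub: "V.subspace (carr V)" and Usub: "U.subspace (carr U)"
    using U V by (auto simp: vec_space_def)
  have ev: "\<exists>b. \<forall>i \<in> carr V \<times> carr U. (case i of (v, u) \<Rightarrow> tens V U v u) b = l (case i of (v, u) \<Rightarrow> f v u)"
    if l: "Vector_Spaces.linear (smul X) (*) l" for l
  proof -
    have f1: "f (v + v') u = f v u + f v' u" "f (smul V c v) u = smul X c (f v u)"
      if "u \<in> carr U" "v \<in> carr V" "v' \<in> carr V" for v v' u c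
      using left[OF that(1)] that V.subspace_add[OF Vsub] V.subspace_scale[OF Vsub]
      by (auto simp: hom_def res_def)
    have f2: "f v (u + u') = f v u + f v u'" "f v (smul U c u) = smul X c (f v u)"
      if "v \<in> carr V" "u \<in> carr U" "u' \<in> carr U" for v u u' c
      using right[OF that(1)] that U.subspace_add[OF Usub] U.subspace_scale[OF Usub]
      by (auto simp: hom_def res_def)
    have "bilinear_form (smul V) (smul U) (\<lambda>v u. l (f (p v) (q u)))"
      using l p(1) q(1) p(2) q(2) f1(1) f2(1) f1(2)[OF q(2) p(2) p(2)] f2(2)[OF p(2) q(2) q(2)]
      by (auto simp: bilinear_form_def Vector_Spaces.linear_iff)
    then have "\<forall>i \<in> carr V \<times> carr U. (case i of (v, u) \<Rightarrow> tens V U v u) (\<lambda>v u. l (f (p v) (q u)))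
        = l (case i of (v, u) \<Rightarrow> f v u)"
      using p q by (auto simp: tens_def)
    then show ?thesis by blast
  qed
  have fX: "(case i of (v, u) \<Rightarrow> f v u) \<in> carr X" if "i \<in> carr V \<times> carr U" for i
  proof -
    obtain v u where i: "i = (v, u)" "v \<in> carr V" "u \<in> carr U" using \<open>i \<in> _\<close> by auto
    have "res V (\<lambda>v. f v u) v \<in> carr X" using left[OF i(3)] i(2) unfolding hom_def by blast
    then show ?thesis using i by (simp add: res_def)
  qed
  have im: "(\<lambda>i. case i of (v, u) \<Rightarrow> tens V U v u) ` (carr V \<times> carr U)
      = {tens V U v u |v u. v \<in> carr V \<and> u \<in> carr U}"
    by (auto simp: image_iff)
  show ?thesis
    using evaluation_span_universal[OF X, of "carr V \<times> carr U" "\<lambda>(v, u). f v u" "\<lambda>(v, u). tens V U v u",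
        OF fX ev] unfolding im tensor_def[symmetric] by simp
qed

theorem tensor_power_universal:
  fixes s :: "'k::field \<Rightarrow> 'w::ab_group_add \<Rightarrow> 'w" and X :: "('k, 'x::ab_group_add, 'z) vspace_scheme"
  assumes "vector_space s" "vec_space X"
    and fX: "\<And>ws. length ws = n \<Longrightarrow> f ws \<in> carr X"
    and lin: "\<And>xs ys. length xs + length ys + 1 = n \<Longrightarrow> Vector_Spaces.linear s (smul X) (\<lambda>w. f (xs @ w # ys))"
  shows "\<exists>!g. g \<in> hom (tensor_power s n) X \<and> (\<forall>ws. length ws = n \<longrightarrow> g (word s ws) = f ws)"
proof -
  have "\<exists>b. \<forall>ws\<in>{ws. length ws = n}. word s ws b = l (f ws)"
    if l: "Vector_Spaces.linear (smul X) (*) l" for l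
  proof -
    have "multilinear_form s (\<lambda>ws. if length ws = n then l (f ws) else 0)"
      unfolding multilinear_form_def
    proof (intro allI)
      fix xs ys
      show "Vector_Spaces.linear s (*)
          (\<lambda>w. if length (xs @ w # ys) = n then l (f (xs @ w # ys)) else 0)"
      proof (cases "length xs + length ys + 1 = n")
        case True
        then show ?thesis using lin[OF True] l by (simp add: Vector_Spaces.linear_iff)
      next
        case False
        then show ?thesis using assms(1) vector_space_mult by (simp add: Vector_Spaces.linear_iff)
      qed
    qed
    then show ?thesis
      by (intro exI[of _ "\<lambda>ws. if length ws = n then l (f ws) else 0"]) (simp add: word_def)
  qed
  then show ?thesis
    using evaluation_span_universal[OF assms(2), of "{ws. length ws = n}" f "word s"] fX
    by (simp add: tensor_power_def)
qed

theorem Ext_power_universal: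
  fixes s :: "'k::field \<Rightarrow> 'w::ab_group_add \<Rightarrow> 'w" and X :: "('k, 'x::ab_group_add, 'z) vspace_scheme"
  assumes "vector_space s" "vec_space X"
    and fX: "\<And>ws. length ws = n \<Longrightarrow> f ws \<in> carr X"
    and lin: "\<And>xs ys. length xs + length ys + 1 = n \<Longrightarrow> Vector_Spaces.linear s (smul X) (\<lambda>w. f (xs @ w # ys))"
    and alt: "\<And>xs w ys. length xs + length ys + 2 = n \<Longrightarrow> f (xs @ w # w # ys) = 0"
  shows "\<exists>!g. g \<in> hom (Ext_power s (int n)) X \<and> (\<forall>ws. length ws = n \<longrightarrow> g (wedge_word s ws) = f ws)"
proof -
  have "\<exists>b. \<forall>ws\<in>{ws. length ws = n}. wedge_word s ws b = l (f ws)"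
    if l: "Vector_Spaces.linear (smul X) (*) l" for l
  proof -
    have l0: "l 0 = 0" using l unfolding Vector_Spaces.linear_iff by (metis add_cancel_right_right)
    have "multilinear_form s (\<lambda>ws. if length ws = n then l (f ws) else 0)"
      unfolding multilinear_form_def
    proof (intro allI)
      fix xs ys
      show "Vector_Spaces.linear s (*)
          (\<lambda>w. if length (xs @ w # ys) = n then l (f (xs @ w # ys)) else 0)"
      proof (cases "length xs + length ys + 1 = n")
        case True
        then show ?thesis using lin[OF True] l by (simp add: Vector_Spaces.linear_iff)
      next
        case False
        then show ?thesis using assms(1) vector_space_mult by (simp add: Vector_Spaces.linear_iff)
      qed
    qed
    then have "alternating_form s (\<lambda>ws. if length ws = n then l (f ws) else 0)"
      using alt l0 by (simp add: alternating_form_def)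
    then show ?thesis
      by (intro exI[of _ "\<lambda>ws. if length ws = n then l (f ws) else 0"]) (simp add: wedge_word_def)
  qed
  then show ?thesis
    using evaluation_span_universal[OF assms(2), of "{ws. length ws = n}" f "wedge_word s"] fX
    by (simp add: Ext_power_def)
qed

end

theory Submission
  imports Defs
begin

text \<open>
  Splitting off the first letter, \<open>c \<mapsto> c\<^sub>1 \<otimes> c\<^sub>2\<close> with \<open>c\<^sub>1\<close> projected to \<open>W\<close>, gives the differentials of
  \<open>Hom(C, \<Lambda>\<^sup>n(W))\<close> and \<open>C \<otimes> \<Lambda>\<^sup>n(W)\<^sup>*\<close>. For \<open>b \<in> W\<close> and \<open>g \<in> W\<^sup>*\<close> with \<open>g(b) = 1\<close> there is a linear map
  \<open>eta\<close> from \<open>C\<close> to itself with \<open>p\<^sub>1(eta(c)\<^sub>1) \<otimes> eta(c)\<^sub>2 = b \<otimes> c + \<pi>(p\<^sub>1(c\<^sub>1)) \<otimes> eta(c\<^sub>2)\<close>, where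
  \<open>\<pi>(w) = w - g(w) b\<close>; it replaces multiplication by \<open>b\<close>, without divided powers or assumptions on the
  characteristic. Combined with the contraction by \<open>g\<close> on \<open>\<Lambda>(W)\<close> it is a homotopy between the identity
  and a map that factors through \<open>x \<mapsto> b \<and> \<iota>\<^sub>g(x)\<close>. Since \<open>W\<close> is infinite-dimensional there are \<open>n + 1\<close> vectors
  with dual coordinates, and the composition of these maps for \<open>n + 1\<close> different \<open>b\<close> vanishes on
  \<open>\<Lambda>\<^sup>n(W)\<close>, as its values are multiples of a product of \<open>n + 1\<close> letters; so every cycle is a boundary.

  A contraction would provide a one-sided inverse, in the ambient category, of the differential at the end
  of the complex. Such a morphism is controlled by its value at the grouplike
  element \<open>1 \<in> Sym\<^sub>0(W)\<close>, where the differential vanishes.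
\<close>

section \<open>Linear maps on carriers\<close>

text \<open>Both complexes have differentials that split a letter off C and pass it to the exterior
  factor, so a homotopy has to insert a letter into C. The map \<open>eta\<close> has coefficient
  one there, and contraction with \<open>g\<close> is a left inverse of it. One letter never
  suffices: for W of finite dimension m both complexes have cohomology in exterior degree m, and
  accordingly each homotopy leaves a remainder that involves the letters used so far. For maps with
  values in exterior powers this is a condition on the values, for functionals it becomes the
  vanishing on such products, so the letters are used in opposite orders on the two sides. The
  functors enter only through \<open>Phi_free\<close> and \<open>Psi_cofree\<close>: these are shown
  to be bijective and compatible with the structure, and the differentials are then computed on
  \<open>C \<otimes> V\<close> and \<open>Hom(C, V)\<close>.\<close>

definition lin :: "('k::field, 'v::ab_group_add, 'y) vspace_scheme
    \<Rightarrow> ('k, 'u::ab_group_add, 'z) vspace_scheme \<Rightarrow> ('v \<Rightarrow> 'u) \<Rightarrow> bool" where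
  "lin V U f \<longleftrightarrow> (\<forall>x\<in>carr V. f x \<in> carr U)
    \<and> (\<forall>x\<in>carr V. \<forall>y\<in>carr V. f (x + y) = f x + f y)
    \<and> (\<forall>c. \<forall>x\<in>carr V. f (smul V c x) = smul U c (f x))"

definition bil :: "('k::field, 'v::ab_group_add, 'y) vspace_scheme
    \<Rightarrow> ('k, 'u::ab_group_add, 'z) vspace_scheme \<Rightarrow> ('k, 'x::ab_group_add, 't) vspace_scheme
    \<Rightarrow> ('v \<Rightarrow> 'u \<Rightarrow> 'x) \<Rightarrow> bool" where
  "bil V U X f \<longleftrightarrow> (\<forall>u\<in>carr U. lin V X (\<lambda>v. f v u)) \<and> (\<forall>v\<in>carr V. lin U X (\<lambda>u. f v u))"

text \<open>\<open>lin\<close> prescribes nothing off the carrier, so lambda terms compose without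
  case distinctions; this equivalence and \<open>res_hom\<close> lead back to extensions by zero,
  for which equality of maps is equality of functions.\<close>

lemma hom_iff_lin: "f \<in> hom V U \<longleftrightarrow> lin V U f \<and> (\<forall>x. x \<notin> carr V \<longrightarrow> f x = 0)"
  by (auto simp: hom_def lin_def)

lemma hom_lin: "f \<in> hom V U \<Longrightarrow> lin V U f"
  by (simp add: hom_iff_lin)

lemma hom_outside: "f \<in> hom V U \<Longrightarrow> x \<notin> carr V \<Longrightarrow> f x = 0"
  by (simp add: hom_iff_lin)

lemma linI:
  assumes "\<And>x. x \<in> carr V \<Longrightarrow> f x \<in> carr U"
    and "\<And>x y. x \<in> carr V \<Longrightarrow> y \<in> carr V \<Longrightarrow> f (x + y) = f x + f y"
    and "\<And>c x. x \<in> carr V \<Longrightarrow> f (smul V c x) = smul U c (f x)"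
  shows "lin V U f"
  using assms by (simp add: lin_def)

lemma lin_mem: "lin V U f \<Longrightarrow> x \<in> carr V \<Longrightarrow> f x \<in> carr U"
  by (simp add: lin_def)

lemma lin_add: "lin V U f \<Longrightarrow> x \<in> carr V \<Longrightarrow> y \<in> carr V \<Longrightarrow> f (x + y) = f x + f y"
  by (simp add: lin_def)

lemma lin_scale: "lin V U f \<Longrightarrow> x \<in> carr V \<Longrightarrow> f (smul V c x) = smul U c (f x)"
  by (simp add: lin_def)

lemma bilI:
  assumes "\<And>u. u \<in> carr U \<Longrightarrow> lin V X (\<lambda>v. f v u)" and "\<And>v. v \<in> carr V \<Longrightarrow> lin U X (\<lambda>u. f v u)"
  shows "bil V U X f"
  using assms by (simp add: bil_def)

lemma bil_left: "bil V U X f \<Longrightarrow> u \<in> carr U \<Longrightarrow> lin V X (\<lambda>v. f v u)"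
  by (simp add: bil_def)

lemma bil_right: "bil V U X f \<Longrightarrow> v \<in> carr V \<Longrightarrow> lin U X (\<lambda>u. f v u)"
  by (simp add: bil_def)

lemma bil_mem: "bil V U X f \<Longrightarrow> v \<in> carr V \<Longrightarrow> u \<in> carr U \<Longrightarrow> f v u \<in> carr X"
  by (simp add: bil_def lin_def)

context
  fixes V :: "('k::field, 'v::ab_group_add, 'z) vspace_scheme"
  assumes V: "vec_space V"
begin

interpretation V: vector_space "smul V"
  using V by (simp add: vec_space_def)

lemma vs_sub: "module.subspace (smul V) (carr V)"
  using V by (simp add: vec_space_def)

lemma vs_zero [simp, intro]: "0 \<in> carr V"
  using vs_sub V.subspace_0 by blast

lemma vs_add: "x \<in> carr V \<Longrightarrow> y \<in> carr V \<Longrightarrow> x + y \<in> carr V"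
  using vs_sub V.subspace_add by blast

lemma vs_diff: "x \<in> carr V \<Longrightarrow> y \<in> carr V \<Longrightarrow> x - y \<in> carr V"
  using vs_sub V.subspace_diff by blast

lemma vs_neg: "x \<in> carr V \<Longrightarrow> - x \<in> carr V"
  using vs_sub V.subspace_neg by blast

lemma vs_scale: "x \<in> carr V \<Longrightarrow> smul V c x \<in> carr V"
  using vs_sub V.subspace_scale by blast

lemma vs_sum: "(\<And>i. i \<in> I \<Longrightarrow> f i \<in> carr V) \<Longrightarrow> sum f I \<in> carr V"
  using vs_sub V.subspace_sum by blast

lemma vs_scale_add: "smul V c (x + y) = smul V c x + smul V c y"
  by (rule V.scale_right_distrib)

lemma vs_add_scale: "smul V (c + d) x = smul V c x + smul V d x"
  by (rule V.scale_left_distrib)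

lemma vs_scale_scale: "smul V c (smul V d x) = smul V (c * d) x"
  by (rule V.scale_scale)

lemma vs_one: "smul V 1 x = x"
  by (rule V.scale_one)

lemma vs_scale_0: "smul V 0 x = 0"
  by (rule V.scale_zero_left)

lemma vs_scale_zero: "smul V c 0 = 0"
  by (rule V.scale_zero_right)

lemma vs_scale_diff: "smul V c (x - y) = smul V c x - smul V c y"
  by (rule V.scale_right_diff_distrib)

lemma lin_zero: "lin V U f \<Longrightarrow> f 0 = 0"
  using lin_add[of V U f 0 0] by simp

lemma lin_neg: "lin V U f \<Longrightarrow> x \<in> carr V \<Longrightarrow> f (- x) = - f x"
  using lin_add[of V U f x "- x"] lin_zero[of U f] vs_neg[of x] by (simp add: eq_neg_iff_add_eq_0 add.commute)

lemma lin_diff: "lin V U f \<Longrightarrow> x \<in> carr V \<Longrightarrow> y \<in> carr V \<Longrightarrow> f (x - y) = f x - f y"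
  using lin_add[of V U f x "- y"] lin_neg[of U f y] vs_neg[of y] by simp

lemma lin_sum:
  assumes "lin V U f" "\<And>i. i \<in> I \<Longrightarrow> g i \<in> carr V"
  shows "f (sum g I) = (\<Sum>i\<in>I. f (g i))"
  using assms(2) by (induction I rule: infinite_finite_induct)
    (simp_all add: lin_zero[OF assms(1)] lin_add[OF assms(1)] vs_sum)

end

lemma lin_congI: "(\<And>x. x \<in> carr V \<Longrightarrow> f x = g x) \<Longrightarrow> vec_space V \<Longrightarrow> lin V U g \<Longrightarrow> lin V U f"
  by (simp add: lin_def vs_add vs_scale)

lemma res_apply: "x \<in> carr V \<Longrightarrow> res V f x = f x"
  by (simp add: res_def)

lemma res_hom: "vec_space V \<Longrightarrow> lin V U f \<Longrightarrow> res V f \<in> hom V U"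
  unfolding hom_iff_lin by (auto simp: res_apply intro!: lin_congI[of V "res V f" f]) (simp add: res_def)

lemma res_cong: "(\<And>x. x \<in> carr V \<Longrightarrow> f x = g x) \<Longrightarrow> res V f = res V g"
  by (auto simp: res_def)

lemma hom_res_id: "f \<in> hom V U \<Longrightarrow> res V f = f"
  by (auto simp: hom_iff_lin res_def)

lemma hom_eqI: "f \<in> hom V U \<Longrightarrow> g \<in> hom V U' \<Longrightarrow> (\<And>x. x \<in> carr V \<Longrightarrow> f x = g x) \<Longrightarrow> f = g"
  by (rule ext) (metis hom_outside)

lemma lin_id: "lin V V (\<lambda>x. x)"
  by (simp add: lin_def)

lemma lin_comp: "lin V U f \<Longrightarrow> lin U X g \<Longrightarrow> lin V X (\<lambda>x. g (f x))"
  by (simp add: lin_def)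

lemma lin_const_0: "vec_space U \<Longrightarrow> lin V U (\<lambda>x. 0)"
  by (simp add: lin_def vs_scale_zero)

lemma lin_plus:
  "vec_space U \<Longrightarrow> lin V U f \<Longrightarrow> lin V U g \<Longrightarrow> lin V U (\<lambda>x. f x + g x)"
  by (simp add: lin_def vs_add vs_scale_add)

lemma lin_minus:
  "vec_space U \<Longrightarrow> lin V U f \<Longrightarrow> lin V U g \<Longrightarrow> lin V U (\<lambda>x. f x - g x)"
  by (simp add: lin_def vs_diff vs_scale_diff)

lemma lin_setsum:
  "vec_space U \<Longrightarrow> (\<And>i. i \<in> I \<Longrightarrow> lin V U (f i)) \<Longrightarrow> lin V U (\<lambda>x. \<Sum>i\<in>I. f i x)"
  by (induction I rule: infinite_finite_induct) (simp_all add: lin_const_0 lin_plus)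

lemma carr_whole [simp]: "carr (whole s) = UNIV" and smul_whole [simp]: "smul (whole s) = s"
  by (simp_all add: whole_def)

lemma vec_space_whole: "vector_space s \<Longrightarrow> vec_space (whole s)"
  by (simp add: vec_space_def vector_space_def module.subspace_UNIV module_def)

lemma vec_space_ground [simp]: "vec_space ground"
  by (simp add: vec_space_whole vector_space_mult)

lemma lin_smul_left: "vec_space U \<Longrightarrow> u \<in> carr U \<Longrightarrow> lin V ground g \<Longrightarrow> lin V U (\<lambda>x. smul U (g x) u)"
  by (simp add: lin_def vs_add_scale vs_scale_scale vs_scale)

lemma lin_smul_right: "vec_space U \<Longrightarrow> lin V U g \<Longrightarrow> lin V U (\<lambda>x. smul U c (g x))"
  by (simp add: lin_def vs_scale_add vs_scale_scale vs_scale mult.commute)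

lemma carr_Hom [simp]: "carr (Hom V U) = hom V U" and smul_Hom: "smul (Hom V U) = ptmul (smul U)"
  by (simp_all add: Hom_def)

lemma hom_ptmul_subspace:
  assumes "vec_space U"
  shows "module.subspace (ptmul (smul U)) (hom V U)"
proof -
  have U: "vector_space (smul U)" using assms by (simp add: vec_space_def)
  interpret vector_space "ptmul (smul U)" using vector_space_ptmul[OF U] by simp
  show ?thesis
    using assms by (auto simp: subspace_def hom_iff_lin vs_scale_zero plus_fun_def zero_fun_def
        intro: lin_const_0 lin_plus lin_smul_right)
qed

lemma vec_space_Hom: "vec_space U \<Longrightarrow> vec_space (Hom V U)"
  using hom_ptmul_subspace[of U V] vector_space_ptmul[of "smul U"]
  by (auto simp: vec_space_def Hom_def)

text \<open>Elements of \<open>hom V U\<close> vanish off \<open>carr V\<close>, so linearity in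
  \<open>y\<close> can be tested pointwise on \<open>carr V\<close>. Membership in
  \<open>hom V U\<close> is a separate premise because linearity in \<open>y\<close> says nothing
  about linearity in \<open>x\<close>.\<close>

lemma lin_into_Hom:
  assumes "vec_space U" "vec_space V"
    and "\<And>y. y \<in> carr Y \<Longrightarrow> f y \<in> hom V U" "\<And>x. x \<in> carr V \<Longrightarrow> lin Y U (\<lambda>y. f y x)"
    and "vec_space Y"
  shows "lin Y (Hom V U) f"
proof (rule linI)
  show "f y \<in> carr (Hom V U)" if "y \<in> carr Y" for y
    using assms(3)[OF that] by simp
next
  fix x y assume xy: "x \<in> carr Y" "y \<in> carr Y"
  show "f (x + y) = f x + f y"
  proof
    fix v show "f (x + y) v = (f x + f y) v"
      using assms(4)[of v] xy assms(3)[THEN hom_outside, of _ v] vs_add[OF assms(5)]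
      by (cases "v \<in> carr V") (auto simp: lin_def)
  qed
next
  fix c y assume y: "y \<in> carr Y"
  show "f (smul Y c y) = smul (Hom V U) c (f y)"
  proof
    fix v show "f (smul Y c y) v = smul (Hom V U) c (f y) v"
      using assms(4)[of v] y assms(3)[THEN hom_outside, of _ v] vs_scale[OF assms(5)]
      by (cases "v \<in> carr V") (auto simp: lin_def smul_Hom vs_scale_zero[OF assms(1)])
  qed
qed

lemma lin_eval: "x \<in> carr V \<Longrightarrow> lin Y (Hom V U) g \<Longrightarrow> lin Y U (\<lambda>y. g y x)"
  by (auto simp: lin_def smul_Hom hom_def)

lemma vec_space_span_functions:
  "vec_space \<lparr>carr = module.span (ptmul (*)) S, smul = ptmul ((*) :: 'k::field \<Rightarrow> 'k \<Rightarrow> 'k)\<rparr>"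
proof -
  interpret vector_space "ptmul ((*) :: 'k::field \<Rightarrow> 'k \<Rightarrow> 'k)" using vector_space_functions by simp
  show ?thesis by (simp add: vec_space_def vector_space_functions)
qed

section \<open>Tensor products\<close>

lemma smul_tensor: "smul (tensor V U) = ptmul (*)"
  by (simp add: tensor_def)

lemma vec_space_tensor [simp]: "vec_space (tensor V U)"
  unfolding tensor_def by (rule vec_space_span_functions)

lemma bil_tens:
  fixes V :: "('k::field, 'v::ab_group_add, 'y) vspace_scheme"
    and U :: "('k, 'u::ab_group_add, 'z) vspace_scheme"
  assumes "vec_space V" "vec_space U"
  shows "bil V U (tensor V U) (tens V U)"
proof -
  interpret vector_space "ptmul ((*) :: 'k::field \<Rightarrow> 'k \<Rightarrow> 'k)" using vector_space_functions by simp
  have mem: "tens V U v u \<in> carr (tensor V U)" if "v \<in> carr V" "u \<in> carr U" for v u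
    using that unfolding tensor_def by (auto intro: span_base)
  show ?thesis
    using assms mem by (auto simp: bil_def lin_def smul_tensor tens_def fun_eq_iff
      bilinear_form_def Vector_Spaces.linear_iff)
qed

lemma tens_mem: "vec_space V \<Longrightarrow> vec_space U \<Longrightarrow> v \<in> carr V \<Longrightarrow> u \<in> carr U \<Longrightarrow> tens V U v u \<in> carr (tensor V U)"
  by (rule bil_mem[OF bil_tens])

lemma lin_tens1:
  "vec_space V \<Longrightarrow> vec_space U \<Longrightarrow> u \<in> carr U \<Longrightarrow> lin Y V g \<Longrightarrow> lin Y (tensor V U) (\<lambda>y. tens V U (g y) u)"
  by (rule lin_comp[of _ V g _ "\<lambda>v. tens V U v u"], assumption, rule bil_left[OF bil_tens])

lemma lin_tens2:
  "vec_space V \<Longrightarrow> vec_space U \<Longrightarrow> v \<in> carr V \<Longrightarrow> lin Y U g \<Longrightarrow> lin Y (tensor V U) (\<lambda>y. tens V U v (g y))"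
  by (rule lin_comp[of _ U g _ "\<lambda>u. tens V U v u"], assumption, rule bil_right[OF bil_tens])

text \<open>A scalar in front of a generator is absorbed into its left factor, so a finite sum of
  pure tensors needs no coefficients.\<close>

lemma tensor_rep:
  fixes V :: "('k::field, 'v::ab_group_add, 'y) vspace_scheme"
    and U :: "('k, 'u::ab_group_add, 'z) vspace_scheme"
  assumes V: "vec_space V" and U: "vec_space U" and t: "t \<in> carr (tensor V U)"
  shows "\<exists>(n::nat) v u. (\<forall>i<n. v i \<in> carr V \<and> u i \<in> carr U) \<and> t = (\<Sum>i<n. tens V U (v i) (u i))"
proof -
  interpret vector_space "ptmul ((*) :: 'k::field \<Rightarrow> 'k \<Rightarrow> 'k)" using vector_space_functions by simp
  have "t \<in> span {tens V U v u |v u. v \<in> carr V \<and> u \<in> carr U}"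
    using t by (simp add: tensor_def)
  then show ?thesis
  proof (induction rule: span_induct_alt)
    case base
    show ?case by (intro exI[of _ 0]) simp
  next
    case (step c x y)
    then obtain n :: nat and v u where y: "\<forall>i<n. v i \<in> carr V \<and> u i \<in> carr U" "y = (\<Sum>i<n. tens V U (v i) (u i))"
      by blast
    obtain a b where x: "x = tens V U a b" "a \<in> carr V" "b \<in> carr U" using step(1) by blast
    have "(\<lambda>f. c * x f) = tens V U (smul V c a) b"
      using lin_scale[OF bil_left[OF bil_tens[OF V U] x(3)] x(2), of c] x(1) by (simp add: smul_tensor)
    then show ?case
      using x y vs_scale[OF V x(2)]
      by (intro exI[of _ "Suc n"] exI[of _ "v(n := smul V c a)"] exI[of _ "u(n := b)"])
         (auto simp: less_Suc_eq add.commute intro!: sum.cong)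
  qed
qed

text \<open>Since pure tensors span without coefficients, only additivity is compared; hence the two
  codomains \<open>X\<close> and \<open>Y\<close> may carry different structures on the same
  type.\<close>

lemma tensor_ext:
  assumes V: "vec_space V" and U: "vec_space U"
    and g: "lin (tensor V U) X g" and h: "lin (tensor V U) Y h"
    and eq: "\<And>v u. v \<in> carr V \<Longrightarrow> u \<in> carr U \<Longrightarrow> g (tens V U v u) = h (tens V U v u)"
    and t: "t \<in> carr (tensor V U)"
  shows "g t = h t"
proof -
  obtain n :: nat and v u where *: "\<forall>i<n. v i \<in> carr V \<and> u i \<in> carr U" "t = (\<Sum>i<n. tens V U (v i) (u i))"
    using tensor_rep[OF V U t] by blast
  have m: "tens V U (v i) (u i) \<in> carr (tensor V U)" if "i \<in> {..<n}" for i
    using * that tens_mem[OF V U] by simp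
  show ?thesis
    unfolding *(2) lin_sum[OF vec_space_tensor g m, of "{..<n}" "\<lambda>i. i", simplified]
      lin_sum[OF vec_space_tensor h m, of "{..<n}" "\<lambda>i. i", simplified]
    using eq * by simp
qed

lemma tensor_lift_spec:
  assumes "vec_space V" "vec_space U" "vec_space X" "bil V U X f"
  shows "tensor_lift V U X f \<in> hom (tensor V U) X
    \<and> (\<forall>v\<in>carr V. \<forall>u\<in>carr U. tensor_lift V U X f (tens V U v u) = f v u)"
proof -
  have "\<exists>!g. g \<in> hom (tensor V U) X \<and> (\<forall>v\<in>carr V. \<forall>u\<in>carr U. g (tens V U v u) = f v u)"
    by (rule tensor_universal) (use assms in \<open>auto intro!: res_hom simp: bil_def\<close>)
  from theI'[OF this] show ?thesis by (simp add: tensor_lift_def)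
qed

lemma tensor_lift_hom:
  "vec_space V \<Longrightarrow> vec_space U \<Longrightarrow> vec_space X \<Longrightarrow> bil V U X f \<Longrightarrow> tensor_lift V U X f \<in> hom (tensor V U) X"
  using tensor_lift_spec by blast

lemma tensor_lift_tens:
  "vec_space V \<Longrightarrow> vec_space U \<Longrightarrow> vec_space X \<Longrightarrow> bil V U X f \<Longrightarrow> v \<in> carr V \<Longrightarrow> u \<in> carr U
   \<Longrightarrow> tensor_lift V U X f (tens V U v u) = f v u"
  using tensor_lift_spec by blast

lemma tensor_lift_cong:
  "(\<And>v u. v \<in> carr V \<Longrightarrow> u \<in> carr U \<Longrightarrow> f v u = g v u) \<Longrightarrow> tensor_lift V U X f = tensor_lift V U X g"
  unfolding tensor_lift_def by (rule arg_cong[of _ _ The]) (auto simp: fun_eq_iff)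

lemma lin_tensor_lift:
  "vec_space V \<Longrightarrow> vec_space U \<Longrightarrow> vec_space X \<Longrightarrow> bil V U X f \<Longrightarrow> lin Y (tensor V U) g
   \<Longrightarrow> lin Y X (\<lambda>y. tensor_lift V U X f (g y))"
  by (rule lin_comp[OF _ hom_lin[OF tensor_lift_hom]])

lemma tensor_lift_comp:
  assumes "vec_space V" "vec_space U" "vec_space X" "vec_space Y" "bil V U X f" "lin X Y g"
    "t \<in> carr (tensor V U)"
  shows "g (tensor_lift V U X f t) = tensor_lift V U Y (\<lambda>v u. g (f v u)) t"
proof -
  have b: "bil V U Y (\<lambda>v u. g (f v u))"
    using assms(5,6) by (auto simp: bil_def intro: lin_comp[OF _ assms(6)])
  show ?thesis
    by (rule tensor_ext[OF assms(1,2) lin_comp[OF hom_lin[OF tensor_lift_hom] assms(6)]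
          hom_lin[OF tensor_lift_hom] _ assms(7)])
       (use assms b in \<open>auto simp: tensor_lift_tens\<close>)
qed

text \<open>One representation of the fixed tensor \<open>t\<close> as a finite sum serves all
  \<open>y\<close> at once, which turns the lift into a finite sum of the linear maps in
  \<open>p\<close>.\<close>

lemma lin_tensor_lift_param:
  assumes V: "vec_space V" and U: "vec_space U" and X: "vec_space X" and Y: "vec_space Y"
    and t: "t \<in> carr (tensor V U)"
    and f: "\<And>y. y \<in> carr Y \<Longrightarrow> bil V U X (f y)"
    and p: "\<And>v u. v \<in> carr V \<Longrightarrow> u \<in> carr U \<Longrightarrow> lin Y X (\<lambda>y. f y v u)"
  shows "lin Y X (\<lambda>y. tensor_lift V U X (f y) t)"
proof -
  obtain n :: nat and v u where *: "\<forall>i<n. v i \<in> carr V \<and> u i \<in> carr U" "t = (\<Sum>i<n. tens V U (v i) (u i))"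
    using tensor_rep[OF V U t] by blast
  have eq: "tensor_lift V U X (f y) t = (\<Sum>i<n. f y (v i) (u i))" if y: "y \<in> carr Y" for y
  proof -
    have "tensor_lift V U X (f y) t = (\<Sum>i<n. tensor_lift V U X (f y) (tens V U (v i) (u i)))"
      unfolding *(2)
      by (rule lin_sum[OF vec_space_tensor hom_lin[OF tensor_lift_hom[OF V U X f[OF y]]]])
         (use * tens_mem[OF V U] in simp)
    then show ?thesis using * tensor_lift_tens[OF V U X f[OF y]] by simp
  qed
  show ?thesis
    by (rule lin_congI[OF eq]) (use * p X Y in \<open>auto intro!: lin_setsum\<close>)
qed

lemma tensor_lift_id:
  "vec_space V \<Longrightarrow> vec_space U \<Longrightarrow> t \<in> carr (tensor V U) \<Longrightarrow> tensor_lift V U (tensor V U) (tens V U) t = t"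
  by (rule tensor_ext[OF _ _ hom_lin[OF tensor_lift_hom] lin_id])
     (simp_all add: tensor_lift_tens bil_tens)

lemma bil_tens_comp:
  "vec_space V' \<Longrightarrow> vec_space U' \<Longrightarrow> lin V V' f \<Longrightarrow> lin U U' g
   \<Longrightarrow> bil V U (tensor V' U') (\<lambda>v u. tens V' U' (f v) (g u))"
  by (intro bilI lin_tens1 lin_tens2) (simp_all add: lin_def)

lemma tensor_map_hom:
  assumes "vec_space V" "vec_space U" "vec_space V'" "vec_space U'" "lin V V' f" "lin U U' g"
  shows "tensor_map V U V' U' f g \<in> hom (tensor V U) (tensor V' U')"
  unfolding tensor_map_def by (rule tensor_lift_hom) (simp_all add: assms bil_tens_comp)

lemma lin_tensor_map:
  assumes "vec_space V" "vec_space U" "vec_space V'" "vec_space U'" "lin V V' f" "lin U U' g"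
    "lin Y (tensor V U) h"
  shows "lin Y (tensor V' U') (\<lambda>y. tensor_map V U V' U' f g (h y))"
  by (rule lin_comp[OF assms(7) hom_lin[OF tensor_map_hom[OF assms(1-6)]]])

lemma tensor_map_tens:
  assumes "vec_space V" "vec_space U" "vec_space V'" "vec_space U'" "lin V V' f" "lin U U' g"
    "v \<in> carr V" "u \<in> carr U"
  shows "tensor_map V U V' U' f g (tens V U v u) = tens V' U' (f v) (g u)"
  unfolding tensor_map_def by (rule tensor_lift_tens) (simp_all add: assms bil_tens_comp)

lemma tensor_map_cong:
  "(\<And>v. v \<in> carr V \<Longrightarrow> f v = f' v) \<Longrightarrow> (\<And>u. u \<in> carr U \<Longrightarrow> g u = g' u)
   \<Longrightarrow> tensor_map V U V' U' f g = tensor_map V U V' U' f' g'"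
  unfolding tensor_map_def by (rule tensor_lift_cong) simp

lemma tensor_map_comp:
  assumes "vec_space V" "vec_space U" "vec_space V'" "vec_space U'" "vec_space V''" "vec_space U''"
    "lin V V' f" "lin U U' g" "lin V' V'' f'" "lin U' U'' g'" "t \<in> carr (tensor V U)"
  shows "tensor_map V' U' V'' U'' f' g' (tensor_map V U V' U' f g t)
       = tensor_map V U V'' U'' (\<lambda>v. f' (f v)) (\<lambda>u. g' (g u)) t"
proof -
  note c = lin_comp[OF assms(7,9)] lin_comp[OF assms(8,10)]
  have l1: "lin (tensor V U) (tensor V'' U'') (\<lambda>t. tensor_map V' U' V'' U'' f' g' (tensor_map V U V' U' f g t))"
    by (intro lin_tensor_map lin_id assms)
  have l2: "lin (tensor V U) (tensor V'' U'') (\<lambda>t. tensor_map V U V'' U'' (\<lambda>v. f' (f v)) (\<lambda>u. g' (g u)) t)"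
    by (intro lin_tensor_map lin_id assms c)
  show ?thesis
    by (rule tensor_ext[OF assms(1,2) l1 l2 _ assms(11)])
       (simp add: tensor_map_tens assms c lin_mem[OF assms(7)] lin_mem[OF assms(8)])
qed

lemma tensor_map_id:
  "vec_space V \<Longrightarrow> vec_space U \<Longrightarrow> t \<in> carr (tensor V U) \<Longrightarrow> tensor_map V U V U (\<lambda>x. x) (\<lambda>x. x) t = t"
  by (simp add: tensor_map_def tensor_lift_id)

lemma bil_assoc:
  assumes "vec_space V" "vec_space U" "vec_space X"
  shows "bil (tensor V U) X (tensor V (tensor U X))
     (\<lambda>t x. tensor_lift V U (tensor V (tensor U X)) (\<lambda>v u. tens V (tensor U X) v (tens U X u x)) t)"
  by (intro bilI lin_tensor_lift lin_tensor_lift_param lin_id lin_tens1 lin_tens2 tens_mem)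
     (simp_all add: assms)

lemma lin_assoc:
  assumes "vec_space V" "vec_space U" "vec_space X" "lin Y (tensor (tensor V U) X) h"
  shows "lin Y (tensor V (tensor U X)) (\<lambda>y. assoc V U X (h y))"
  unfolding assoc_def by (rule lin_tensor_lift) (simp_all add: assms bil_assoc)

lemma assoc_tens_left:
  assumes "vec_space V" "vec_space U" "vec_space X" "t \<in> carr (tensor V U)" "x \<in> carr X"
  shows "assoc V U X (tens (tensor V U) X t x)
     = tensor_lift V U (tensor V (tensor U X)) (\<lambda>v u. tens V (tensor U X) v (tens U X u x)) t"
  unfolding assoc_def by (rule tensor_lift_tens) (simp_all add: assms bil_assoc)

lemma assoc_tens:
  assumes "vec_space V" "vec_space U" "vec_space X" "v \<in> carr V" "u \<in> carr U" "x \<in> carr X"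
  shows "assoc V U X (tens (tensor V U) X (tens V U v u) x) = tens V (tensor U X) v (tens U X u x)"
proof -
  have "bil V U (tensor V (tensor U X)) (\<lambda>v u. tens V (tensor U X) v (tens U X u x))"
    by (intro bilI lin_tens1 lin_tens2 lin_id tens_mem) (simp_all add: assms)
  then show ?thesis using assms by (simp add: assoc_tens_left tens_mem tensor_lift_tens)
qed

section \<open>Coalgebras and comodules\<close>

text \<open>Comodules and contramodules are records extending vector spaces, so
  \<open>cofree C V\<close> and \<open>tensor C V\<close>, or \<open>free C V\<close> and
  \<open>Hom C V\<close>, are different terms with the same \<open>carr\<close> and
  \<open>smul\<close>. These rules identify what is built from those two fields.\<close>

lemma sp_cong:
  assumes "carr U = carr U'" "smul U = smul U'"
  shows "tensor V U = tensor V U'" "tensor U V = tensor U' V" "tens V U = tens V U'" "tens U V = tens U' V"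
    "lin U X = lin U' X" "lin X U = lin X U'" "hom U X = hom U' X" "hom X U = hom X U'"
    "Hom U X = Hom U' X" "Hom X U = Hom X U'" "vec_space U = vec_space U'" "res U f = res U' f"
  unfolding tensor_def tens_def lin_def hom_def Hom_def vec_space_def res_def assms by simp_all

lemma tensor_lift_sp_cong:
  assumes "carr U = carr U'" "smul U = smul U'"
  shows "tensor_lift V U X f = tensor_lift V U' X f" "tensor_lift U V X g = tensor_lift U' V X g"
    "tensor_lift V X U f' = tensor_lift V X U' f'"
  by (simp_all add: tensor_lift_def sp_cong[OF assms] assms(1))

lemma tensor_map_sp_cong:
  assumes "carr U = carr U'" "smul U = smul U'"
  shows "tensor_map V U X Y f g = tensor_map V U' X Y f g"
    "tensor_map V X Y U f' g' = tensor_map V X Y U' f' g'"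
  by (simp_all add: tensor_map_def sp_cong[OF assms] tensor_lift_sp_cong[OF assms])

lemma carr_cofree [simp]: "carr (cofree C V) = carr (tensor C V)"
  and smul_cofree [simp]: "smul (cofree C V) = smul (tensor C V)"
  by (simp_all add: cofree_def)

lemmas cofree_sp [simp] = sp_cong[OF carr_cofree smul_cofree]
  tensor_map_sp_cong[OF carr_cofree smul_cofree]

lemma carr_left_regular [simp]: "carr (left_regular C) = carr C"
  and smul_left_regular [simp]: "smul (left_regular C) = smul C"
  and coact_left_regular [simp]: "coact (left_regular C) = comult C"
  by (simp_all add: left_regular_def)

lemmas left_regular_sp [simp] = sp_cong[OF carr_left_regular smul_left_regular]
  tensor_map_sp_cong[OF carr_left_regular smul_left_regular]

section \<open>Extending and splitting linear maps\<close>

text \<open>A linear projection onto the image of \<open>i\<close>, followed by the inverse of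
  \<open>i\<close> and by \<open>f\<close>, gives the extension.\<close>

lemma linear_extension:
  assumes A: "vec_space A" and B: "vec_space B" and V: "vec_space V"
    and i: "lin A B i" "inj_on i (carr A)" and f: "lin A V f"
  shows "\<exists>g. g \<in> hom B V \<and> (\<forall>a\<in>carr A. g (i a) = f a)"
proof -
  let ?I = "\<lparr>carr = i ` carr A, smul = smul B\<rparr>"
  interpret B: vector_space "smul B" using B by (simp add: vec_space_def)
  have "B.subspace (i ` carr A)"
    unfolding B.subspace_def
  proof (intro conjI allI ballI)
    show "0 \<in> i ` carr A" using lin_zero[OF A i(1)] vs_zero[OF A] by (metis imageI)
    fix x assume "x \<in> i ` carr A"
    then obtain a where a: "a \<in> carr A" "x = i a" by blast
    show "smul B c x \<in> i ` carr A" for c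
      using lin_scale[OF i(1) a(1), of c] vs_scale[OF A a(1), of c] a(2) by (metis imageI)
    fix y assume "y \<in> i ` carr A"
    then obtain b where b: "b \<in> carr A" "y = i b" by blast
    show "x + y \<in> i ` carr A"
      using lin_add[OF i(1) a(1) b(1)] vs_add[OF A a(1) b(1)] a(2) b(2) by (metis imageI)
  qed
  then have "vec_space ?I" using B by (simp add: vec_space_def)
  then obtain p where p: "Vector_Spaces.linear (smul B) (smul B) p" "\<And>x. p x \<in> i ` carr A"
      "\<And>x. x \<in> i ` carr A \<Longrightarrow> p x = x"
    using subspace_projection[of ?I] by auto
  let ?j = "inv_into (carr A) i"
  have j: "?j x \<in> carr A" "i (?j x) = x" if "x \<in> i ` carr A" for x
    using that by (auto intro: inv_into_into f_inv_into_f)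
  have ji: "?j (i a) = a" if "a \<in> carr A" for a using that i(2) by simp
  have "lin B V (\<lambda>x. f (?j (p x)))"
  proof (rule linI)
    show "f (?j (p x)) \<in> carr V" for x using f j(1) p(2) by (simp add: lin_def)
    show "f (?j (p (x + y))) = f (?j (p x)) + f (?j (p y))" for x y
    proof -
      have "p (x + y) = i (?j (p x) + ?j (p y))"
        using p(1) lin_add[OF i(1) j(1)[OF p(2)[of x]] j(1)[OF p(2)[of y]]] j(2)[OF p(2)]
        by (simp add: Vector_Spaces.linear_iff)
      then show ?thesis
        using ji vs_add[OF A] j(1)[OF p(2)] lin_add[OF f] by simp
    qed
    show "f (?j (p (smul B c x))) = smul V c (f (?j (p x)))" for c x
    proof -
      have "p (smul B c x) = i (smul A c (?j (p x)))"
        using p(1) lin_scale[OF i(1) j(1)[OF p(2)[of x]]] j(2)[OF p(2)]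
        by (simp add: Vector_Spaces.linear_iff)
      then show ?thesis
        using ji vs_scale[OF A] j(1)[OF p(2)] lin_scale[OF f] by simp
    qed
  qed
  then have "res B (\<lambda>x. f (?j (p x))) \<in> hom B V" by (rule res_hom[OF B])
  moreover have "res B (\<lambda>x. f (?j (p x))) (i a) = f a" if "a \<in> carr A" for a
    using that p(3) ji lin_mem[OF i(1)] by (simp add: res_apply)
  ultimately show ?thesis by blast
qed

text \<open>Preimages are chosen on a maximal independent subset \<open>S\<close> of
  \<open>carr B\<close>. The extension is defined on the whole ambient type, and its range lies in
  the span of the chosen preimages, hence in \<open>carr A\<close>.\<close>

lemma linear_section:
  fixes A :: "('k::field, 'a::ab_group_add, 'y) vspace_scheme" and B :: "('k, 'b::ab_group_add, 'z) vspace_scheme"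
  assumes A: "vec_space A" and B: "vec_space B" and q: "lin A B q" "q ` carr A = carr B"
  shows "\<exists>r. lin B A r \<and> (\<forall>b\<in>carr B. q (r b) = b)"
proof -
  have vA: "vector_space (smul A)" and vB: "vector_space (smul B)" using A B by (simp_all add: vec_space_def)
  interpret p: vector_space_pair "smul B" "smul A" using vA vB by (simp add: vector_space_pair_def)
  interpret pb: vector_space_pair "smul B" "smul B" using vB by (simp add: vector_space_pair_def)
  obtain S where S: "S \<subseteq> carr B" "p.vs1.independent S" "carr B \<subseteq> p.vs1.span S"
    using p.vs1.maximal_independent_subset[of "carr B"] by blast
  let ?c = "inv_into (carr A) q"
  have c: "?c b \<in> carr A" "q (?c b) = b" if "b \<in> S" for b
    using that S(1) q(2) inv_into_into[of b q "carr A"] f_inv_into_f[of b q "carr A"] by auto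
  obtain g where g: "\<forall>x\<in>S. g x = ?c x" "Vector_Spaces.linear (smul B) (smul A) g"
      "range g = p.vs2.span (?c ` S)"
    using p.linear_independent_extend_subspace[OF S(2), of ?c] by blast
  have "p.vs2.span (?c ` S) \<subseteq> carr A"
    using c(1) vs_sub[OF A] by (intro p.vs2.span_minimal) auto
  then have gA: "g x \<in> carr A" for x using g(3) by auto
  have "Vector_Spaces.linear (smul B) (smul B) (\<lambda>x. q (g x))"
    using g(2) gA lin_add[OF q(1)] lin_scale[OF q(1)] vB by (simp add: Vector_Spaces.linear_iff)
  moreover have "q (g b) = b" if "b \<in> S" for b using that c g(1) by simp
  ultimately have "q (g b) = b" if "b \<in> carr B" for b
    using pb.linear_eq_on[OF _ p.vs1.linear_id[unfolded id_def], of "\<lambda>x. q (g x)" b S] that S(3) by blast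
  moreover have "lin B A g" using g(2) gA by (simp add: lin_def Vector_Spaces.linear_iff)
  ultimately show ?thesis by blast
qed

lemma lin_inverse:
  assumes V: "vec_space V" and f: "lin V U f" "bij_betw f (carr V) (carr U)"
  shows "lin U V (inv_into (carr V) f)"
proof -
  let ?g = "inv_into (carr V) f"
  have g: "?g x \<in> carr V" "f (?g x) = x" if "x \<in> carr U" for x
    using that f(2) by (auto simp: bij_betw_def intro: inv_into_into f_inv_into_f)
  have gf: "?g (f x) = x" if "x \<in> carr V" for x using that f(2) by (simp add: bij_betw_def)
  show ?thesis
  proof (rule linI)
    show "?g (x + y) = ?g x + ?g y" if "x \<in> carr U" "y \<in> carr U" for x y
      using gf[of "?g x + ?g y"] lin_add[OF f(1)] vs_add[OF V] g that by simp
    show "?g (smul U c x) = smul V c (?g x)" if "x \<in> carr U" for c x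
      using gf[of "smul V c (?g x)"] lin_scale[OF f(1)] vs_scale[OF V] g that by simp
  qed (rule g)
qed

section \<open>Comodule morphisms and transport of structure\<close>

lemma comodule_homD:
  assumes "f \<in> comodule_hom C M N"
  shows "f \<in> hom M N" "lin M N f" "m \<in> carr M \<Longrightarrow> coact N (f m) = tensor_map C M C N (\<lambda>x. x) f (coact M m)"
  using assms by (auto simp: comodule_hom_def hom_lin)

lemma comodule_vs: "comodule C M \<Longrightarrow> vec_space M"
  and comodule_coalgebra: "comodule C M \<Longrightarrow> coalgebra C"
  and comodule_coact: "comodule C M \<Longrightarrow> coact M \<in> hom M (tensor C M)"
  by (simp_all add: comodule_def)

lemma comodule_coact_mem: "comodule C M \<Longrightarrow> m \<in> carr M \<Longrightarrow> coact M m \<in> carr (tensor C M)"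
  by (meson comodule_coact hom_lin lin_mem)

lemma coalgebra_vs: "coalgebra C \<Longrightarrow> vec_space C"
  by (simp add: coalgebra_def)

lemma comodule_hom_comp:
  assumes M: "comodule C M" and N: "comodule C N" and K: "comodule C K"
    and f: "f \<in> comodule_hom C M N" and g: "g \<in> comodule_hom C N K"
  shows "res M (\<lambda>x. g (f x)) \<in> comodule_hom C M K"
proof -
  note vs = comodule_vs[OF M] comodule_vs[OF N] comodule_vs[OF K] coalgebra_vs[OF comodule_coalgebra[OF M]]
  note l = comodule_homD(2)[OF f] comodule_homD(2)[OF g]
  have h: "res M (\<lambda>x. g (f x)) \<in> hom M K" by (rule res_hom[OF vs(1) lin_comp[OF l]])
  have "coact K (g (f m)) = tensor_map C M C K (\<lambda>x. x) (res M (\<lambda>x. g (f x))) (coact M m)" if m: "m \<in> carr M" for m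
  proof -
    have "coact K (g (f m)) = tensor_map C N C K (\<lambda>x. x) g (tensor_map C M C N (\<lambda>x. x) f (coact M m))"
      using comodule_homD(3)[OF g] comodule_homD(3)[OF f m] lin_mem[OF l(1) m] by simp
    also have "\<dots> = tensor_map C M C K (\<lambda>x. x) (\<lambda>x. g (f x)) (coact M m)"
      by (rule tensor_map_comp) (simp_all add: vs l lin_id comodule_coact_mem[OF M m])
    also have "\<dots> = tensor_map C M C K (\<lambda>x. x) (res M (\<lambda>x. g (f x))) (coact M m)"
      by (subst tensor_map_cong[where f' = "\<lambda>x. x" and g' = "res M (\<lambda>x. g (f x))"]) (simp_all add: res_apply)
    finally show ?thesis .
  qed
  then show ?thesis using h by (simp add: comodule_hom_def res_apply)
qed

lemma comodule_hom_inverse: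
  assumes M: "comodule C M" and N: "comodule C N"
    and f: "f \<in> comodule_hom C M N" "bij_betw f (carr M) (carr N)"
  shows "res N (inv_into (carr M) f) \<in> comodule_hom C N M"
proof -
  let ?g = "inv_into (carr M) f"
  note vs = comodule_vs[OF M] comodule_vs[OF N] coalgebra_vs[OF comodule_coalgebra[OF M]]
  note l = comodule_homD(2)[OF f(1)] lin_inverse[OF vs(1) comodule_homD(2)[OF f(1)] f(2)]
  have g: "?g x \<in> carr M" "f (?g x) = x" if "x \<in> carr N" for x
    using that f(2) by (auto simp: bij_betw_def intro: inv_into_into f_inv_into_f)
  have gf: "?g (f x) = x" if "x \<in> carr M" for x using that f(2) by (simp add: bij_betw_def)
  have "coact M (?g n) = tensor_map C N C M (\<lambda>x. x) (res N ?g) (coact N n)" if n: "n \<in> carr N" for n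
  proof -
    have "tensor_map C N C M (\<lambda>x. x) (res N ?g) (coact N n) = tensor_map C N C M (\<lambda>x. x) ?g (coact N (f (?g n)))"
      unfolding g(2)[OF n] by (rule fun_cong[OF tensor_map_cong]) (simp_all add: res_apply)
    also have "\<dots> = tensor_map C N C M (\<lambda>x. x) ?g (tensor_map C M C N (\<lambda>x. x) f (coact M (?g n)))"
      using comodule_homD(3)[OF f(1) g(1)[OF n]] by simp
    also have "\<dots> = tensor_map C M C M (\<lambda>x. x) (\<lambda>x. ?g (f x)) (coact M (?g n))"
      by (rule tensor_map_comp) (simp_all add: vs l lin_id comodule_coact_mem[OF M g(1)[OF n]])
    also have "\<dots> = tensor_map C M C M (\<lambda>x. x) (\<lambda>x. x) (coact M (?g n))"
      by (rule fun_cong[OF tensor_map_cong]) (simp_all add: gf)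
    also have "\<dots> = coact M (?g n)"
      by (rule tensor_map_id) (simp_all add: vs comodule_coact_mem[OF M g(1)[OF n]])
    finally show ?thesis by simp
  qed
  then show ?thesis using res_hom[OF vs(2) l(2)] by (simp add: comodule_hom_def res_apply)
qed

lemma assoc_natural:
  assumes "vec_space V" "vec_space U" "vec_space X" "vec_space Y" "lin X Y f" "t \<in> carr (tensor (tensor V U) X)"
  shows "assoc V U Y (tensor_map (tensor V U) X (tensor V U) Y (\<lambda>x. x) f t)
       = tensor_map V (tensor U X) V (tensor U Y) (\<lambda>x. x) (tensor_map U X U Y (\<lambda>x. x) f) (assoc V U X t)"
proof -
  have l: "lin (tensor (tensor V U) X) (tensor V (tensor U Y))
      (\<lambda>t. assoc V U Y (tensor_map (tensor V U) X (tensor V U) Y (\<lambda>x. x) f t))"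
    by (intro lin_assoc lin_tensor_map lin_id) (simp_all add: assms)
  have r: "lin (tensor (tensor V U) X) (tensor V (tensor U Y))
      (\<lambda>t. tensor_map V (tensor U X) V (tensor U Y) (\<lambda>x. x) (tensor_map U X U Y (\<lambda>x. x) f) (assoc V U X t))"
    by (intro lin_assoc lin_tensor_map lin_id) (simp_all add: assms)
  show ?thesis
  proof (rule tensor_ext[OF vec_space_tensor assms(3) l r _ assms(6)])
    fix s x assume s: "s \<in> carr (tensor V U)" and x: "x \<in> carr X"
    note fx = lin_mem[OF assms(5) x]
    have l': "lin (tensor V U) (tensor V (tensor U Y)) (\<lambda>s. assoc V U Y (tens (tensor V U) Y s (f x)))"
      by (intro lin_assoc lin_tens1 lin_id) (simp_all add: assms fx)
    have r': "lin (tensor V U) (tensor V (tensor U Y))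
      (\<lambda>s. tensor_map V (tensor U X) V (tensor U Y) (\<lambda>x. x) (tensor_map U X U Y (\<lambda>x. x) f) (assoc V U X (tens (tensor V U) X s x)))"
      by (intro lin_assoc lin_tensor_map lin_tens1 lin_id) (simp_all add: assms x)
    have "assoc V U Y (tens (tensor V U) Y s (f x))
      = tensor_map V (tensor U X) V (tensor U Y) (\<lambda>x. x) (tensor_map U X U Y (\<lambda>x. x) f) (assoc V U X (tens (tensor V U) X s x))"
    proof (rule tensor_ext[OF assms(1,2) l' r' _ s])
      fix v u assume vu: "v \<in> carr V" "u \<in> carr U"
      have m: "lin (tensor U X) (tensor U Y) (tensor_map U X U Y (\<lambda>x. x) f)"
        by (intro lin_tensor_map[where h = "\<lambda>x. x"] lin_id) (simp_all add: assms)
      show "assoc V U Y (tens (tensor V U) Y (tens V U v u) (f x))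
        = tensor_map V (tensor U X) V (tensor U Y) (\<lambda>x. x) (tensor_map U X U Y (\<lambda>x. x) f)
           (assoc V U X (tens (tensor V U) X (tens V U v u) x))"
        using vu x fx assms m by (simp add: assoc_tens tensor_map_tens lin_id tens_mem)
    qed
    then show "assoc V U Y (tensor_map (tensor V U) X (tensor V U) Y (\<lambda>x. x) f (tens (tensor V U) X s x))
      = tensor_map V (tensor U X) V (tensor U Y) (\<lambda>x. x) (tensor_map U X U Y (\<lambda>x. x) f) (assoc V U X (tens (tensor V U) X s x))"
      using s x assms by (simp add: tensor_map_tens lin_id)
  qed
qed

text \<open>The coaction of \<open>Phi\<close> is a definite description on cosets, where the axioms
  are awkward to check. A bijection that carries the coaction of \<open>M\<close> to that of
  \<open>N\<close> makes every axiom for \<open>N\<close> the image of the axiom for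
  \<open>M\<close>.\<close>

lemma comodule_transfer:
  assumes M: "comodule C M" and N: "vec_space N" and cN: "coact N \<in> hom N (tensor C N)"
    and f: "lin M N f" "bij_betw f (carr M) (carr N)"
    and co: "\<And>m. m \<in> carr M \<Longrightarrow> coact N (f m) = tensor_map C M C N (\<lambda>x. x) f (coact M m)"
  shows "comodule C N"
proof -
  note vs [simp] = comodule_vs[OF M] N coalgebra_vs[OF comodule_coalgebra[OF M]]
  note coM [simp] = comodule_coact_mem[OF M]
  have cl: "lin C (tensor C C) (comult C)" "lin C ground (counit C)"
    using comodule_coalgebra[OF M] by (auto simp: coalgebra_def hom_lin)
  have cM: "lin M (tensor C M) (coact M)" using comodule_coact[OF M] by (rule hom_lin)
  have surj: "\<exists>m\<in>carr M. n = f m" if "n \<in> carr N" for n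
    using that f(2) by (auto simp: bij_betw_def)
  have fl: "lin (tensor C M) (tensor C N) (tensor_map C M C N (\<lambda>x. x) f)"
    by (intro lin_tensor_map[where h = "\<lambda>x. x"] lin_id) (simp_all add: f(1))
  have A: "assoc C C N (tensor_map C N (tensor C C) N (comult C) (\<lambda>x. x) (coact N n))
        = tensor_map C N C (tensor C N) (\<lambda>x. x) (coact N) (coact N n)" if n: "n \<in> carr N" for n
  proof -
    obtain m where m: "m \<in> carr M" "n = f m" using surj[OF n] by blast
    have "lin (tensor C M) (tensor (tensor C C) M) (tensor_map C M (tensor C C) M (comult C) (\<lambda>x. x))"
      by (rule hom_lin, rule tensor_map_hom) (simp_all add: cl lin_id)
    then have mem: "tensor_map C M (tensor C C) M (comult C) (\<lambda>x. x) (coact M m) \<in> carr (tensor (tensor C C) M)"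
      by (rule lin_mem) (rule coM[OF m(1)])
    have coass: "assoc C C M (tensor_map C M (tensor C C) M (comult C) (\<lambda>x. x) (coact M m))
        = tensor_map C M C (tensor C M) (\<lambda>x. x) (coact M) (coact M m)"
      using M m(1) unfolding comodule_def by blast
    \<comment> \<open>\<open>comult C\<close> on the left factor commutes with \<open>f\<close> on
      the right one. Letting \<open>f\<close> act last makes \<open>assoc_natural\<close>
      applicable.\<close>
    have "tensor_map C N (tensor C C) N (comult C) (\<lambda>x. x) (tensor_map C M C N (\<lambda>x. x) f (coact M m))
      = tensor_map C M (tensor C C) N (comult C) f (coact M m)"
      by (rule tensor_map_comp) (simp_all add: m f(1) lin_id cl)
    also have "\<dots> = tensor_map (tensor C C) M (tensor C C) N (\<lambda>x. x) f
        (tensor_map C M (tensor C C) M (comult C) (\<lambda>x. x) (coact M m))"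
      by (rule tensor_map_comp[symmetric]) (simp_all add: m f(1) lin_id cl)
    finally have "assoc C C N (tensor_map C N (tensor C C) N (comult C) (\<lambda>x. x) (tensor_map C M C N (\<lambda>x. x) f (coact M m)))
      = assoc C C N (tensor_map (tensor C C) M (tensor C C) N (\<lambda>x. x) f
        (tensor_map C M (tensor C C) M (comult C) (\<lambda>x. x) (coact M m)))" by (rule arg_cong)
    also have "\<dots> = tensor_map C (tensor C M) C (tensor C N) (\<lambda>x. x) (tensor_map C M C N (\<lambda>x. x) f)
       (assoc C C M (tensor_map C M (tensor C C) M (comult C) (\<lambda>x. x) (coact M m)))"
      by (rule assoc_natural) (simp_all add: f(1) mem m)
    also have "\<dots> = tensor_map C (tensor C M) C (tensor C N) (\<lambda>x. x) (tensor_map C M C N (\<lambda>x. x) f)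
       (tensor_map C M C (tensor C M) (\<lambda>x. x) (coact M) (coact M m))"
      unfolding coass ..
    also have "\<dots> = tensor_map C M C (tensor C N) (\<lambda>x. x) (\<lambda>x. tensor_map C M C N (\<lambda>x. x) f (coact M x)) (coact M m)"
      by (rule tensor_map_comp) (simp_all add: m lin_id cM fl)
    also have "\<dots> = tensor_map C M C (tensor C N) (\<lambda>x. x) (\<lambda>x. coact N (f x)) (coact M m)"
      by (rule fun_cong[OF tensor_map_cong]) (simp_all add: co)
    also have "\<dots> = tensor_map C N C (tensor C N) (\<lambda>x. x) (coact N) (tensor_map C M C N (\<lambda>x. x) f (coact M m))"
      by (rule tensor_map_comp[symmetric]) (simp_all add: m lin_id f(1) hom_lin[OF cN])
    finally show ?thesis using co m by simp
  qed
  have bc: "bil C M M (\<lambda>c x. smul M (counit C c) x)" "bil C N N (\<lambda>c x. smul N (counit C c) x)"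
    by (intro bilI lin_smul_left lin_smul_right lin_id; simp add: cl)+
  have B: "tensor_lift C N N (\<lambda>c x. smul N (counit C c) x) (coact N n) = n" if n: "n \<in> carr N" for n
  proof -
    obtain m where m: "m \<in> carr M" "n = f m" using surj[OF n] by blast
    have l: "lin (tensor C M) N (\<lambda>t. tensor_lift C N N (\<lambda>c x. smul N (counit C c) x) (tensor_map C M C N (\<lambda>x. x) f t))"
      by (rule lin_tensor_lift) (simp_all add: bc fl)
    have r: "lin (tensor C M) N (\<lambda>t. f (tensor_lift C M M (\<lambda>c x. smul M (counit C c) x) t))"
      by (rule lin_comp[OF lin_tensor_lift f(1)]) (simp_all add: bc lin_id)
    have "tensor_lift C N N (\<lambda>c x. smul N (counit C c) x) (tensor_map C M C N (\<lambda>x. x) f (coact M m))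
      = f (tensor_lift C M M (\<lambda>c x. smul M (counit C c) x) (coact M m))"
    proof (rule tensor_ext[OF _ _ l r])
      fix c x assume "c \<in> carr C" "x \<in> carr M"
      then show "tensor_lift C N N (\<lambda>c x. smul N (counit C c) x) (tensor_map C M C N (\<lambda>x. x) f (tens C M c x))
          = f (tensor_lift C M M (\<lambda>c x. smul M (counit C c) x) (tens C M c x))"
        by (simp add: tensor_map_tens lin_id f(1) tensor_lift_tens bc lin_mem[OF f(1)] lin_scale[OF f(1)])
    qed (simp_all add: m)
    then show ?thesis using M m co by (simp add: comodule_def)
  qed
  show ?thesis
    unfolding comodule_def using comodule_coalgebra[OF M] N cN A B by blast
qed

lemma injective_comodule_transfer:
  assumes J: "injective_comodule TYPE('x::ab_group_add) TYPE('y::ab_group_add) C J" and K: "comodule C K"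
    and e: "e \<in> comodule_hom C J K" "bij_betw e (carr J) (carr K)"
  shows "injective_comodule TYPE('x) TYPE('y) C K"
  unfolding injective_comodule_def
proof (intro conjI K allI impI)
  fix A :: "('a, 'b, 'x) comod" and B :: "('a, 'b, 'y) comod" and i f
  assume H: "comodule C A \<and> comodule C B \<and> i \<in> comodule_hom C A B \<and> inj_on i (carr A) \<and> f \<in> comodule_hom C A K"
  have Jc: "comodule C J" using J by (simp add: injective_comodule_def)
  let ?e' = "res K (inv_into (carr J) e)"
  have e': "?e' \<in> comodule_hom C K J" by (rule comodule_hom_inverse[OF Jc K e])
  have ee: "e (?e' x) = x" if "x \<in> carr K" for x
    using that e(2) by (auto simp: bij_betw_def res_apply intro: f_inv_into_f)
  have "res A (\<lambda>x. ?e' (f x)) \<in> comodule_hom C A J"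
    using comodule_hom_comp[OF _ K Jc _ e'] H by blast
  then obtain g where g: "g \<in> comodule_hom C B J" "\<forall>a\<in>carr A. g (i a) = res A (\<lambda>x. ?e' (f x)) a"
    using J H unfolding injective_comodule_def by blast
  have "res B (\<lambda>x. e (g x)) \<in> comodule_hom C B K"
    using comodule_hom_comp[OF _ Jc K g(1) e(1)] H by blast
  moreover have "res B (\<lambda>x. e (g x)) (i a) = f a" if "a \<in> carr A" for a
  proof -
    have "i a \<in> carr B" "f a \<in> carr K"
      using H that comodule_homD(2)[of i C A B] comodule_homD(2)[of f C A K] by (simp_all add: lin_def)
    then show ?thesis using g(2) that ee by (simp add: res_apply)
  qed
  ultimately show "\<exists>g\<in>comodule_hom C B K. \<forall>a\<in>carr A. g (i a) = f a" by blast
qed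

section \<open>Cofree comodules\<close>

locale coalg =
  fixes C :: "('k::field, 'c::ab_group_add) coalg"
  assumes coalgebra: "coalgebra C"
begin

text \<open>In Sweedler notation \<open>sw X f c\<close> is \<open>f(c\<^sub>1, c\<^sub>2)\<close>.\<close>

definition sw :: "('k, 'x::ab_group_add, 't) vspace_scheme \<Rightarrow> ('c \<Rightarrow> 'c \<Rightarrow> 'x) \<Rightarrow> 'c \<Rightarrow> 'x" where
  "sw X f c = tensor_lift C C X f (comult C c)"

lemma C_vs [simp]: "vec_space C"
  using coalgebra by (simp add: coalgebra_def)

lemma lin_comult: "lin C (tensor C C) (comult C)"
  using coalgebra by (simp add: coalgebra_def hom_lin)

lemma lin_counit: "lin C ground (counit C)"
  using coalgebra by (simp add: coalgebra_def hom_lin)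

lemma comult_mem: "c \<in> carr C \<Longrightarrow> comult C c \<in> carr (tensor C C)"
  by (rule lin_mem[OF lin_comult])

lemma lin_sw:
  assumes "vec_space X" "bil C C X f" "lin Y C g"
  shows "lin Y X (\<lambda>y. sw X f (g y))"
  unfolding sw_def by (rule lin_tensor_lift[OF C_vs C_vs assms(1,2) lin_comp[OF assms(3) lin_comult]])

lemma sw_mem: "vec_space X \<Longrightarrow> bil C C X f \<Longrightarrow> c \<in> carr C \<Longrightarrow> sw X f c \<in> carr X"
  by (rule lin_mem[OF lin_sw[OF _ _ lin_id]])

lemma lin_sw_param:
  assumes "vec_space X" "vec_space Y" "c \<in> carr C" "\<And>y. y \<in> carr Y \<Longrightarrow> bil C C X (f y)"
    "\<And>a b. a \<in> carr C \<Longrightarrow> b \<in> carr C \<Longrightarrow> lin Y X (\<lambda>y. f y a b)"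
  shows "lin Y X (\<lambda>y. sw X (f y) c)"
  unfolding sw_def by (rule lin_tensor_lift_param) (simp_all add: assms comult_mem)

lemma sw_cong: "(\<And>a b. a \<in> carr C \<Longrightarrow> b \<in> carr C \<Longrightarrow> f a b = g a b) \<Longrightarrow> sw X f c = sw X g c"
  unfolding sw_def by (rule fun_cong[OF tensor_lift_cong])

lemma sw_comp:
  assumes "vec_space X" "vec_space Y" "bil C C X f" "lin X Y g" "c \<in> carr C"
  shows "g (sw X f c) = sw Y (\<lambda>a b. g (f a b)) c"
  unfolding sw_def by (rule tensor_lift_comp) (simp_all add: assms comult_mem)

text \<open>\<open>comult C c\<close> is itself \<open>sw\<close> of the universal bilinear map
  \<open>tens C C\<close>; so a linear map applied to it can be computed on pure tensors, in
  Sweedler form.\<close>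

lemma comult_lin_apply:
  assumes "vec_space X" "lin (tensor C C) X g" "c \<in> carr C"
  shows "g (comult C c) = sw X (\<lambda>a b. g (tens C C a b)) c"
  using sw_comp[OF vec_space_tensor assms(1) bil_tens[OF C_vs C_vs] assms(2,3)]
  by (simp add: sw_def tensor_lift_id comult_mem assms(3))

lemma tensor_map_comult:
  "tensor_map C C C V (\<lambda>x. x) f (comult C c) = sw (tensor C V) (\<lambda>a b. tens C V a (f b)) c"
  by (simp add: sw_def tensor_map_def)

lemma assoc_comult:
  assumes "vec_space V" "v \<in> carr V" "c \<in> carr C"
  shows "assoc C C V (tens (tensor C C) V (comult C c) v)
    = sw (tensor C (tensor C V)) (\<lambda>a b. tens C (tensor C V) a (tens C V b v)) c"
  using assms by (simp add: assoc_tens_left comult_mem sw_def)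

text \<open>Coassociativity is an equation in \<open>C \<otimes> (C \<otimes> C)\<close>; applying
  to it the linear map \<open>G\<close> that corresponds to the trilinear \<open>f\<close> gives the
  form in which it is used from here on.\<close>

lemma sw_coassoc:
  fixes f :: "'c \<Rightarrow> 'c \<Rightarrow> 'c \<Rightarrow> 'x::ab_group_add"
  assumes X: "vec_space X"
    and f1: "\<And>b c. b \<in> carr C \<Longrightarrow> c \<in> carr C \<Longrightarrow> lin C X (\<lambda>a. f a b c)"
    and f2: "\<And>a c. a \<in> carr C \<Longrightarrow> c \<in> carr C \<Longrightarrow> lin C X (\<lambda>b. f a b c)"
    and f3: "\<And>a b. a \<in> carr C \<Longrightarrow> b \<in> carr C \<Longrightarrow> lin C X (\<lambda>c. f a b c)"
    and x: "x \<in> carr C"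
  shows "sw X (\<lambda>a c. sw X (\<lambda>a1 a2. f a1 a2 c) a) x = sw X (\<lambda>a b. sw X (f a) b) x"
proof -
  define G where "G = tensor_lift C (tensor C C) X (\<lambda>a t. tensor_lift C C X (f a) t)"
  have bf: "bil C C X (f a)" if "a \<in> carr C" for a by (intro bilI f2 f3 that)
  have bG: "bil C (tensor C C) X (\<lambda>a t. tensor_lift C C X (f a) t)"
    by (intro bilI lin_tensor_lift_param lin_tensor_lift lin_id) (simp_all add: X f1 f2 f3)
  have G: "lin (tensor C (tensor C C)) X G"
    unfolding G_def by (rule hom_lin, rule tensor_lift_hom) (simp_all add: X bG)
  have Gt: "G (tens C (tensor C C) a t) = tensor_lift C C X (f a) t" if "a \<in> carr C" "t \<in> carr (tensor C C)" for a t
    unfolding G_def by (rule tensor_lift_tens) (simp_all add: X bG that)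
  have l1: "lin (tensor C C) X (\<lambda>t. G (assoc C C C (tensor_map C C (tensor C C) C (comult C) (\<lambda>x. x) t)))"
    by (intro lin_comp[OF _ G] lin_assoc lin_tensor_map lin_comult lin_id) simp_all
  have l2: "lin (tensor C C) X (\<lambda>t. G (tensor_map C C C (tensor C C) (\<lambda>x. x) (comult C) t))"
    by (intro lin_comp[OF _ G] lin_tensor_map lin_comult lin_id) simp_all
  have "G (assoc C C C (tensor_map C C (tensor C C) C (comult C) (\<lambda>x. x) (comult C x)))
     = sw X (\<lambda>a c. sw X (\<lambda>a1 a2. f a1 a2 c) a) x"
    unfolding comult_lin_apply[OF X l1 x]
  proof (rule sw_cong)
    fix a c assume ac: "a \<in> carr C" "c \<in> carr C"
    have "G (assoc C C C (tensor_map C C (tensor C C) C (comult C) (\<lambda>x. x) (tens C C a c)))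
      = G (sw (tensor C (tensor C C)) (\<lambda>a1 a2. tens C (tensor C C) a1 (tens C C a2 c)) a)"
      using ac by (simp add: tensor_map_tens lin_comult lin_id assoc_comult)
    also have "\<dots> = sw X (\<lambda>a1 a2. G (tens C (tensor C C) a1 (tens C C a2 c))) a"
      by (rule sw_comp[OF vec_space_tensor X _ G ac(1)])
         (intro bilI lin_tens1 lin_tens2 tens_mem lin_id; simp add: ac)
    also have "\<dots> = sw X (\<lambda>a1 a2. f a1 a2 c) a"
      by (rule sw_cong) (simp add: Gt tens_mem ac tensor_lift_tens X bf)
    finally show "G (assoc C C C (tensor_map C C (tensor C C) C (comult C) (\<lambda>x. x) (tens C C a c)))
      = sw X (\<lambda>a1 a2. f a1 a2 c) a" .
  qed
  moreover have "G (tensor_map C C C (tensor C C) (\<lambda>x. x) (comult C) (comult C x)) = sw X (\<lambda>a b. sw X (f a) b) x"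
    unfolding comult_lin_apply[OF X l2 x]
    by (rule sw_cong) (simp add: tensor_map_tens lin_comult lin_id Gt comult_mem sw_def)
  moreover have "assoc C C C (tensor_map C C (tensor C C) C (comult C) (\<lambda>x. x) (comult C x))
      = tensor_map C C C (tensor C C) (\<lambda>x. x) (comult C) (comult C x)"
    using coalgebra x unfolding coalgebra_def by blast
  ultimately show ?thesis by simp
qed

lemma sw_counit_left:
  assumes X: "vec_space X" and g: "lin C X g" and c: "c \<in> carr C"
  shows "sw X (\<lambda>a b. smul X (counit C a) (g b)) c = g c"
proof -
  have "sw C (\<lambda>d e. smul C (counit C d) e) c = c"
    using coalgebra c unfolding coalgebra_def sw_def by blast
  moreover have "g (sw C (\<lambda>d e. smul C (counit C d) e) c) = sw X (\<lambda>d e. g (smul C (counit C d) e)) c"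
    by (rule sw_comp[OF C_vs X _ g c]) (intro bilI lin_smul_left lin_smul_right lin_counit lin_id; simp)
  moreover have "\<dots> = sw X (\<lambda>a b. smul X (counit C a) (g b)) c"
    by (rule sw_cong) (simp add: lin_scale[OF g])
  ultimately show ?thesis by simp
qed

lemma sw_counit_right:
  assumes X: "vec_space X" and g: "lin C X g" and c: "c \<in> carr C"
  shows "sw X (\<lambda>a b. smul X (counit C b) (g a)) c = g c"
proof -
  have "sw C (\<lambda>d e. smul C (counit C e) d) c = c"
    using coalgebra c unfolding coalgebra_def sw_def by blast
  moreover have "g (sw C (\<lambda>d e. smul C (counit C e) d) c) = sw X (\<lambda>d e. g (smul C (counit C e) d)) c"
    by (rule sw_comp[OF C_vs X _ g c]) (intro bilI lin_smul_left lin_smul_right lin_counit lin_id; simp)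
  moreover have "\<dots> = sw X (\<lambda>a b. smul X (counit C b) (g a)) c"
    by (rule sw_cong) (simp add: lin_scale[OF g])
  ultimately show ?thesis by simp
qed

lemma coact_cofree_tens:
  assumes "vec_space V" "c \<in> carr C" "v \<in> carr V"
  shows "coact (cofree C V) (tens C V c v)
    = sw (tensor C (tensor C V)) (\<lambda>a b. tens C (tensor C V) a (tens C V b v)) c"
  unfolding cofree_def using assms by (simp add: tensor_map_tens lin_comult lin_id assoc_comult)

text \<open>The coaction of \<open>cofree\<close> is not wrapped in \<open>res\<close>. It vanishes
  off the carrier because \<open>tensor_map\<close> does and \<open>assoc\<close> sends 0 to 0, and
  this makes it an element of \<open>hom\<close>.\<close>

lemma coact_cofree_hom:
  assumes "vec_space V"
  shows "coact (cofree C V) \<in> hom (tensor C V) (tensor C (tensor C V))"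
proof -
  have h: "tensor_map C V (tensor C C) V (comult C) (\<lambda>x. x) \<in> hom (tensor C V) (tensor (tensor C C) V)"
    by (rule tensor_map_hom) (simp_all add: assms lin_comult lin_id)
  have "lin (tensor C V) (tensor C (tensor C V)) (\<lambda>t. assoc C C V (tensor_map C V (tensor C C) V (comult C) (\<lambda>x. x) t))"
    by (intro lin_assoc lin_tensor_map lin_comult lin_id) (simp_all add: assms)
  moreover have "assoc C C V 0 = 0"
    by (rule lin_zero[OF vec_space_tensor lin_assoc[OF _ _ _ lin_id]]) (simp_all add: assms)
  ultimately show ?thesis
    using hom_outside[OF h] by (simp add: hom_iff_lin cofree_def)
qed

lemma lin_coact_cofree:
  assumes "vec_space V" "lin Y (tensor C V) g"
  shows "lin Y (tensor C (tensor C V)) (\<lambda>y. coact (cofree C V) (g y))"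
  by (rule lin_comp[OF assms(2) hom_lin[OF coact_cofree_hom[OF assms(1)]]])

lemma bil_counit_smul: "vec_space X \<Longrightarrow> bil C X X (\<lambda>c x. smul X (counit C c) x)"
  by (intro bilI lin_smul_left lin_smul_right lin_counit lin_id; simp)

text \<open>On a pure tensor both sides of the coassociativity law are
  \<open>c_1 \<otimes> c_2 \<otimes> c_3 \<otimes> v\<close>, with \<open>v\<close> as a passive
  parameter; the remaining law is the left counit identity of \<open>C\<close>.\<close>

lemma comodule_cofree:
  assumes V [simp]: "vec_space V"
  shows "comodule C (cofree C V)"
proof -
  let ?M = "tensor C V"
  let ?T = "tensor C (tensor C ?M)"
  have "assoc C C ?M (tensor_map C ?M (tensor C C) ?M (comult C) (\<lambda>x. x) (coact (cofree C V) t))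
      = tensor_map C ?M C (tensor C ?M) (\<lambda>x. x) (coact (cofree C V)) (coact (cofree C V) t)"
    if t: "t \<in> carr ?M" for t
  proof -
    have l: "lin ?M ?T (\<lambda>t. assoc C C ?M (tensor_map C ?M (tensor C C) ?M (comult C) (\<lambda>x. x) (coact (cofree C V) t)))"
      by (intro lin_assoc lin_tensor_map lin_coact_cofree lin_comult lin_id) simp_all
    have r: "lin ?M ?T (\<lambda>t. tensor_map C ?M C (tensor C ?M) (\<lambda>x. x) (coact (cofree C V)) (coact (cofree C V) t))"
      by (intro lin_tensor_map lin_coact_cofree lin_id) simp_all
    have l': "lin (tensor C ?M) ?T (\<lambda>t. assoc C C ?M (tensor_map C ?M (tensor C C) ?M (comult C) (\<lambda>x. x) t))"
      by (intro lin_assoc lin_tensor_map lin_comult lin_id) simp_all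
    have r': "lin (tensor C ?M) ?T (\<lambda>t. tensor_map C ?M C (tensor C ?M) (\<lambda>x. x) (coact (cofree C V)) t)"
      by (intro lin_tensor_map lin_coact_cofree lin_id) simp_all
    show ?thesis
    proof (rule tensor_ext[OF C_vs V l r _ t])
      fix c v assume c: "c \<in> carr C" and v: "v \<in> carr V"
      have b: "bil C C (tensor C ?M) (\<lambda>a b. tens C ?M a (tens C V b v))"
        by (intro bilI lin_tens1 lin_tens2 tens_mem lin_id; simp add: v)
      have "assoc C C ?M (tensor_map C ?M (tensor C C) ?M (comult C) (\<lambda>x. x) (coact (cofree C V) (tens C V c v)))
        = sw ?T (\<lambda>a b. assoc C C ?M (tensor_map C ?M (tensor C C) ?M (comult C) (\<lambda>x. x) (tens C ?M a (tens C V b v)))) c"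
        unfolding coact_cofree_tens[OF V c v] by (rule sw_comp[OF _ _ b l' c]) simp_all
      also have "\<dots> = sw ?T (\<lambda>a b. sw ?T (\<lambda>a1 a2. tens C (tensor C ?M) a1 (tens C ?M a2 (tens C V b v))) a) c"
        by (rule sw_cong) (simp add: tensor_map_tens lin_comult lin_id assoc_comult tens_mem v)
      also have "\<dots> = sw ?T (\<lambda>a b. sw ?T (\<lambda>b1 b2. tens C (tensor C ?M) a (tens C ?M b1 (tens C V b2 v))) b) c"
        by (rule sw_coassoc[where f = "\<lambda>a b c. tens C (tensor C ?M) a (tens C ?M b (tens C V c v))"])
           (simp, (intro lin_tens1 lin_tens2 tens_mem lin_id; simp add: v)+, rule c)
      also have "\<dots> = sw ?T (\<lambda>a b. tensor_map C ?M C (tensor C ?M) (\<lambda>x. x) (coact (cofree C V)) (tens C ?M a (tens C V b v))) c"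
      proof (rule sw_cong)
        fix a b assume ab: "a \<in> carr C" "b \<in> carr C"
        have g: "lin (tensor C ?M) ?T (\<lambda>t. tens C (tensor C ?M) a t)"
          by (intro lin_tens2 lin_id) (simp_all add: ab)
        have b': "bil C C (tensor C ?M) (\<lambda>b1 b2. tens C ?M b1 (tens C V b2 v))"
          by (intro bilI lin_tens1 lin_tens2 tens_mem lin_id; simp add: v)
        have "tensor_map C ?M C (tensor C ?M) (\<lambda>x. x) (coact (cofree C V)) (tens C ?M a (tens C V b v))
          = tens C (tensor C ?M) a (sw (tensor C ?M) (\<lambda>b1 b2. tens C ?M b1 (tens C V b2 v)) b)"
          using ab v by (simp add: tensor_map_tens lin_id lin_coact_cofree tens_mem coact_cofree_tens)
        also have "\<dots> = sw ?T (\<lambda>b1 b2. tens C (tensor C ?M) a (tens C ?M b1 (tens C V b2 v))) b"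
          by (rule sw_comp[OF _ _ b' g ab(2)]) simp_all
        finally show "sw ?T (\<lambda>b1 b2. tens C (tensor C ?M) a (tens C ?M b1 (tens C V b2 v))) b
          = tensor_map C ?M C (tensor C ?M) (\<lambda>x. x) (coact (cofree C V)) (tens C ?M a (tens C V b v))" by simp
      qed
      also have "\<dots> = tensor_map C ?M C (tensor C ?M) (\<lambda>x. x) (coact (cofree C V)) (coact (cofree C V) (tens C V c v))"
        unfolding coact_cofree_tens[OF V c v] by (rule sw_comp[OF _ _ b r' c, symmetric]) simp_all
      finally show "assoc C C ?M (tensor_map C ?M (tensor C C) ?M (comult C) (\<lambda>x. x) (coact (cofree C V) (tens C V c v)))
        = tensor_map C ?M C (tensor C ?M) (\<lambda>x. x) (coact (cofree C V)) (coact (cofree C V) (tens C V c v))" .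
    qed
  qed
  moreover have "tensor_lift C ?M ?M (\<lambda>c x. smul ?M (counit C c) x) (coact (cofree C V) t) = t"
    if t: "t \<in> carr ?M" for t
  proof -
    let ?g = "tensor_lift C ?M ?M (\<lambda>c x. smul ?M (counit C c) x)"
    have g: "lin (tensor C ?M) ?M ?g"
      by (rule hom_lin, rule tensor_lift_hom) (simp_all add: bil_counit_smul)
    show ?thesis
    proof (rule tensor_ext[OF C_vs V lin_comp[OF lin_coact_cofree[OF V lin_id] g] lin_id _ t])
      fix c v assume c: "c \<in> carr C" and v: "v \<in> carr V"
      have b: "bil C C (tensor C ?M) (\<lambda>a b. tens C ?M a (tens C V b v))"
        by (intro bilI lin_tens1 lin_tens2 tens_mem lin_id; simp add: v)
      have "?g (coact (cofree C V) (tens C V c v)) = sw ?M (\<lambda>a b. ?g (tens C ?M a (tens C V b v))) c"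
        unfolding coact_cofree_tens[OF V c v] by (rule sw_comp[OF _ _ b g c]) simp_all
      also have "\<dots> = sw ?M (\<lambda>a b. smul ?M (counit C a) (tens C V b v)) c"
        by (rule sw_cong) (simp add: tensor_lift_tens bil_counit_smul tens_mem v)
      also have "\<dots> = tens C V c v"
        by (rule sw_counit_left[where g = "\<lambda>b. tens C V b v"]) (simp_all add: lin_tens1 lin_id v c)
      finally show "?g (coact (cofree C V) (tens C V c v)) = tens C V c v" .
    qed
  qed
  ultimately show ?thesis
    unfolding comodule_def using coact_cofree_hom[OF V] coalgebra
    by (simp add: tensor_lift_sp_cong[OF carr_cofree smul_cofree] assoc_def)
qed

text \<open>The projection \<open>C \<otimes> V \<rightarrow> V\<close> through which comodule morphisms into \<open>C \<otimes> V\<close> are determined.\<close>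

definition cproj :: "('k, 'v::ab_group_add, 't) vspace_scheme \<Rightarrow> ('k, 'c, 'v) tensor \<Rightarrow> 'v" where
  "cproj V = tensor_lift C V V (\<lambda>c v. smul V (counit C c) v)"

lemma lin_cproj: "vec_space V \<Longrightarrow> lin (tensor C V) V (cproj V)"
  unfolding cproj_def by (rule hom_lin, rule tensor_lift_hom) (simp_all add: bil_counit_smul)

lemma cproj_tens: "vec_space V \<Longrightarrow> c \<in> carr C \<Longrightarrow> v \<in> carr V \<Longrightarrow> cproj V (tens C V c v) = smul V (counit C c) v"
  unfolding cproj_def by (simp add: tensor_lift_tens bil_counit_smul)

text \<open>The right counit identity of \<open>C\<close>. It recovers a tensor from its coaction,
  hence a comodule morphism into \<open>C \<otimes> V\<close> from its composition with
  \<open>cproj\<close>.\<close>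

lemma coact_cofree_cproj:
  assumes V: "vec_space V" and t: "t \<in> carr (tensor C V)"
  shows "tensor_map C (tensor C V) C V (\<lambda>x. x) (cproj V) (coact (cofree C V) t) = t"
proof -
  let ?g = "tensor_map C (tensor C V) C V (\<lambda>x. x) (cproj V)"
  have g: "lin (tensor C (tensor C V)) (tensor C V) ?g"
    by (rule hom_lin, rule tensor_map_hom) (simp_all add: V lin_id lin_cproj)
  show ?thesis
  proof (rule tensor_ext[OF C_vs V lin_comp[OF lin_coact_cofree[OF V lin_id] g] lin_id _ t])
    fix c v assume c: "c \<in> carr C" and v: "v \<in> carr V"
    have b: "bil C C (tensor C (tensor C V)) (\<lambda>a b. tens C (tensor C V) a (tens C V b v))"
      by (intro bilI lin_tens1 lin_tens2 tens_mem lin_id; simp add: V v)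
    have "?g (coact (cofree C V) (tens C V c v)) = sw (tensor C V) (\<lambda>a b. ?g (tens C (tensor C V) a (tens C V b v))) c"
      unfolding coact_cofree_tens[OF V c v] by (rule sw_comp[OF _ _ b g c]) simp_all
    also have "\<dots> = sw (tensor C V) (\<lambda>a b. smul (tensor C V) (counit C b) (tens C V a v)) c"
      by (rule sw_cong)
        (simp add: tensor_map_tens lin_id V lin_cproj tens_mem v cproj_tens
          lin_scale[OF lin_tens2[OF C_vs V _ lin_id]])
    also have "\<dots> = tens C V c v"
      by (rule sw_counit_right[where g = "\<lambda>b. tens C V b v"]) (simp_all add: lin_tens1 lin_id V v c)
    finally show "?g (coact (cofree C V) (tens C V c v)) = tens C V c v" .
  qed
qed

text \<open>The cofree coaction touches the factor \<open>C\<close> only. The right-hand side is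
  written with \<open>assoc\<close> so that the coassociativity of a comodule \<open>B\<close>
  applies to it when \<open>t\<close> is \<open>coact B b\<close>.\<close>

lemma coact_cofree_tensor_map:
  assumes V: "vec_space V" and B: "vec_space B" and g: "lin B V g" and t: "t \<in> carr (tensor C B)"
  shows "coact (cofree C V) (tensor_map C B C V (\<lambda>x. x) g t)
    = tensor_map C (tensor C B) C (tensor C V) (\<lambda>x. x) (tensor_map C B C V (\<lambda>x. x) g)
       (assoc C C B (tensor_map C B (tensor C C) B (comult C) (\<lambda>x. x) t))"
proof -
  have "lin (tensor C B) (tensor (tensor C C) B) (tensor_map C B (tensor C C) B (comult C) (\<lambda>x. x))"
    by (rule hom_lin, rule tensor_map_hom) (simp_all add: B lin_comult lin_id)
  then have m: "tensor_map C B (tensor C C) B (comult C) (\<lambda>x. x) t \<in> carr (tensor (tensor C C) B)"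
    using t by (rule lin_mem)
  have "tensor_map C V (tensor C C) V (comult C) (\<lambda>x. x) (tensor_map C B C V (\<lambda>x. x) g t)
      = tensor_map C B (tensor C C) V (comult C) g t"
    by (rule tensor_map_comp) (simp_all add: V B g t lin_id lin_comult)
  also have "\<dots> = tensor_map (tensor C C) B (tensor C C) V (\<lambda>x. x) g (tensor_map C B (tensor C C) B (comult C) (\<lambda>x. x) t)"
    by (rule tensor_map_comp[symmetric]) (simp_all add: V B g t lin_id lin_comult)
  finally show ?thesis
    unfolding cofree_def using assoc_natural[OF C_vs C_vs B V g m] by simp
qed

text \<open>Cofree comodules are right adjoint to the forgetful functor: \<open>f\<close>
  corresponds to the linear map \<open>cproj V\<close> after \<open>f\<close>, this map extends
  along \<open>i\<close> to \<open>g0\<close>, and the morphism with corestriction \<open>g0\<close>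
  extends \<open>f\<close>.\<close>

lemma cofree_injective:
  assumes V: "vec_space V"
  shows "injective_comodule TYPE('x::ab_group_add) TYPE('y::ab_group_add) C (cofree C V)"
  unfolding injective_comodule_def
proof (intro conjI comodule_cofree[OF V] allI impI)
  fix A :: "('k, 'c, 'x) comod" and B :: "('k, 'c, 'y) comod" and i f
  assume H: "comodule C A \<and> comodule C B \<and> i \<in> comodule_hom C A B \<and> inj_on i (carr A)
        \<and> f \<in> comodule_hom C A (cofree C V)"
  then have A: "comodule C A" and B: "comodule C B" and i: "i \<in> comodule_hom C A B" "inj_on i (carr A)"
    and f: "f \<in> comodule_hom C A (cofree C V)" by auto
  note vA = comodule_vs[OF A] and vB = comodule_vs[OF B]
  have lf: "lin A (tensor C V) f" using comodule_homD(2)[OF f] by simp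
  have li: "lin A B i" using comodule_homD(2)[OF i(1)] .
  have lB: "lin B (tensor C B) (coact B)" using comodule_coact[OF B] by (rule hom_lin)
  obtain g0 where "g0 \<in> hom B V" and g0: "\<And>a. a \<in> carr A \<Longrightarrow> g0 (i a) = cproj V (f a)"
    using linear_extension[OF vA vB V li i(2) lin_comp[OF lf lin_cproj[OF V]]] by blast
  then have lg0: "lin B V g0" by (simp add: hom_lin)
  let ?g = "\<lambda>b. tensor_map C B C V (\<lambda>x. x) g0 (coact B b)"
  have lg: "lin B (tensor C V) ?g"
    by (rule lin_tensor_map) (simp_all add: vB V lin_id lg0 lB)
  have "coact (cofree C V) (?g b) = tensor_map C B C (tensor C V) (\<lambda>x. x) (res B ?g) (coact B b)" if b: "b \<in> carr B" for b
  proof -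
    have "coact (cofree C V) (?g b) = tensor_map C (tensor C B) C (tensor C V) (\<lambda>x. x) (tensor_map C B C V (\<lambda>x. x) g0)
       (tensor_map C B C (tensor C B) (\<lambda>x. x) (coact B) (coact B b))"
      using coact_cofree_tensor_map[OF V vB lg0 comodule_coact_mem[OF B b]] B b unfolding comodule_def by metis
    also have "\<dots> = tensor_map C B C (tensor C V) (\<lambda>x. x) ?g (coact B b)"
      by (rule tensor_map_comp)
        (simp_all add: vB V lin_id lB comodule_coact_mem[OF B b] hom_lin[OF tensor_map_hom[OF C_vs vB C_vs V lin_id lg0]])
    also have "\<dots> = tensor_map C B C (tensor C V) (\<lambda>x. x) (res B ?g) (coact B b)"
      by (rule fun_cong[OF tensor_map_cong]) (simp_all add: res_apply)
    finally show ?thesis .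
  qed
  then have "res B ?g \<in> comodule_hom C B (cofree C V)"
    using res_hom[OF vB lg] by (simp add: comodule_hom_def res_apply)
  moreover have "res B ?g (i a) = f a" if a: "a \<in> carr A" for a
  proof -
    have "?g (i a) = tensor_map C B C V (\<lambda>x. x) g0 (tensor_map C A C B (\<lambda>x. x) i (coact A a))"
      using comodule_homD(3)[OF i(1) a] by simp
    also have "\<dots> = tensor_map C A C V (\<lambda>x. x) (\<lambda>a. g0 (i a)) (coact A a)"
      by (rule tensor_map_comp) (simp_all add: vA vB V lin_id li lg0 comodule_coact_mem[OF A a])
    also have "\<dots> = tensor_map C A C V (\<lambda>x. x) (\<lambda>a. cproj V (f a)) (coact A a)"
      by (rule fun_cong[OF tensor_map_cong]) (simp_all add: g0)
    also have "\<dots> = tensor_map C (tensor C V) C V (\<lambda>x. x) (cproj V) (tensor_map C A C (tensor C V) (\<lambda>x. x) f (coact A a))"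
      by (rule tensor_map_comp[symmetric]) (simp_all add: vA V lin_id lf lin_cproj comodule_coact_mem[OF A a])
    also have "\<dots> = tensor_map C (tensor C V) C V (\<lambda>x. x) (cproj V) (coact (cofree C V) (f a))"
      using comodule_homD(3)[OF f a] by simp
    also have "\<dots> = f a" by (rule coact_cofree_cproj[OF V lin_mem[OF lf a]])
    finally show ?thesis using lin_mem[OF li a] by (simp add: res_apply)
  qed
  ultimately show "\<exists>g\<in>comodule_hom C B (cofree C V). \<forall>a\<in>carr A. g (i a) = f a" by blast
qed

end

section \<open>Free contramodules\<close>

lemma carr_free [simp]: "carr (free C V) = carr (Hom C V)"
  and smul_free [simp]: "smul (free C V) = smul (Hom C V)"
  by (simp_all add: free_def Hom_def)

lemmas free_sp [simp] = sp_cong[OF carr_free smul_free]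

lemma lin_res_Hom:
  assumes "vec_space V" "vec_space U" "vec_space Y"
    and "\<And>y. y \<in> carr Y \<Longrightarrow> lin V U (h y)" "\<And>v. v \<in> carr V \<Longrightarrow> lin Y U (\<lambda>y. h y v)"
  shows "lin Y (Hom V U) (\<lambda>y. res V (h y))"
  by (rule lin_into_Hom) (simp_all add: assms res_hom res_apply)

lemma lin_ev: "x \<in> carr V \<Longrightarrow> lin (Hom V U) U (\<lambda>f. f x)"
  by (rule lin_eval[OF _ lin_id])

lemma lin_ev2: "x \<in> carr V \<Longrightarrow> y \<in> carr V' \<Longrightarrow> lin (Hom V (Hom V' U)) U (\<lambda>f. f x y)"
  by (rule lin_eval[OF _ lin_ev])

section \<open>Contramodule morphisms and transport of structure\<close>

lemma contramodule_vs: "contramodule C P \<Longrightarrow> vec_space P"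
  and contramodule_coalgebra: "contramodule C P \<Longrightarrow> coalgebra C"
  and contramodule_contract: "contramodule C P \<Longrightarrow> contract P \<in> hom (Hom C P) P"
  by (simp_all add: contramodule_def)

lemma contramodule_homD:
  assumes "f \<in> contramodule_hom C P Q"
  shows "f \<in> hom P Q" "lin P Q f" "F \<in> hom C P \<Longrightarrow> f (contract P F) = contract Q (res C (\<lambda>c. f (F c)))"
  using assms by (auto simp: contramodule_hom_def hom_lin)

lemma lin_contract:
  assumes "contramodule C P" "lin Y (Hom C P) g"
  shows "lin Y P (\<lambda>y. contract P (g y))"
  by (rule lin_comp[OF assms(2) hom_lin[OF contramodule_contract[OF assms(1)]]])

lemma contract_mem: "contramodule C P \<Longrightarrow> F \<in> hom C P \<Longrightarrow> contract P F \<in> carr P"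
  using lin_mem[OF lin_contract[OF _ lin_id], of C P F] by simp

lemma contramodule_hom_comp:
  assumes P: "contramodule C P" and Q: "contramodule C Q" and R: "contramodule C R"
    and f: "f \<in> contramodule_hom C P Q" and g: "g \<in> contramodule_hom C Q R"
  shows "res P (\<lambda>x. g (f x)) \<in> contramodule_hom C P R"
proof -
  note vs = contramodule_vs[OF P] contramodule_vs[OF Q] coalgebra_vs[OF contramodule_coalgebra[OF P]]
  note l = contramodule_homD(2)[OF f] contramodule_homD(2)[OF g]
  have "g (f (contract P F)) = contract R (res C (\<lambda>c. res P (\<lambda>x. g (f x)) (F c)))" if F: "F \<in> hom C P" for F
  proof -
    have FP: "F c \<in> carr P" if "c \<in> carr C" for c using hom_lin[OF F] that by (rule lin_mem)
    have "res C (\<lambda>c. f (F c)) \<in> hom C Q"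
      by (rule res_hom[OF vs(3) lin_comp[OF hom_lin[OF F] l(1)]])
    then have "g (f (contract P F)) = contract R (res C (\<lambda>c. g (res C (\<lambda>c. f (F c)) c)))"
      using contramodule_homD(3)[OF f F] contramodule_homD(3)[OF g] by simp
    also have "res C (\<lambda>c. g (res C (\<lambda>c. f (F c)) c)) = res C (\<lambda>c. res P (\<lambda>x. g (f x)) (F c))"
      by (rule res_cong) (simp add: res_apply FP)
    finally show ?thesis .
  qed
  then show ?thesis
    using res_hom[OF vs(1) lin_comp[OF l]] by (simp add: contramodule_hom_def res_apply contract_mem[OF P])
qed

lemma contramodule_hom_inverse:
  assumes P: "contramodule C P" and Q: "contramodule C Q"
    and f: "f \<in> contramodule_hom C P Q" "bij_betw f (carr P) (carr Q)"
  shows "res Q (inv_into (carr P) f) \<in> contramodule_hom C Q P"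
proof -
  let ?g = "inv_into (carr P) f"
  note vs = contramodule_vs[OF P] contramodule_vs[OF Q] coalgebra_vs[OF contramodule_coalgebra[OF P]]
  note l = contramodule_homD(2)[OF f(1)] lin_inverse[OF vs(1) contramodule_homD(2)[OF f(1)] f(2)]
  have g: "?g x \<in> carr P" "f (?g x) = x" if "x \<in> carr Q" for x
    using that f(2) by (auto simp: bij_betw_def intro: inv_into_into f_inv_into_f)
  have gf: "?g (f x) = x" if "x \<in> carr P" for x using that f(2) by (simp add: bij_betw_def)
  have "?g (contract Q F) = contract P (res C (\<lambda>c. res Q ?g (F c)))" if F: "F \<in> hom C Q" for F
  proof -
    have FQ: "F c \<in> carr Q" if "c \<in> carr C" for c using hom_lin[OF F] that by (rule lin_mem)
    have F': "res C (\<lambda>c. ?g (F c)) \<in> hom C P"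
      by (rule res_hom[OF vs(3) lin_comp[OF hom_lin[OF F] l(2)]])
    have "res C (\<lambda>c. f (res C (\<lambda>c. ?g (F c)) c)) = res C F"
      by (rule res_cong) (simp add: res_apply g FQ)
    then have "f (contract P (res C (\<lambda>c. ?g (F c)))) = contract Q F"
      using contramodule_homD(3)[OF f(1) F'] hom_res_id[OF F] by simp
    then have "?g (contract Q F) = contract P (res C (\<lambda>c. ?g (F c)))"
      using gf[OF contract_mem[OF P F']] by simp
    also have "res C (\<lambda>c. ?g (F c)) = res C (\<lambda>c. res Q ?g (F c))"
      by (rule res_cong) (simp add: res_apply FQ)
    finally show ?thesis .
  qed
  then show ?thesis
    using res_hom[OF vs(2) l(2)] by (simp add: contramodule_hom_def res_apply contract_mem[OF Q])
qed

lemma projective_contramodule_transfer: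
  assumes P: "projective_contramodule TYPE('x::ab_group_add) TYPE('y::ab_group_add) C P" and Q: "contramodule C Q"
    and e: "e \<in> contramodule_hom C P Q" "bij_betw e (carr P) (carr Q)"
  shows "projective_contramodule TYPE('x) TYPE('y) C Q"
  unfolding projective_contramodule_def
proof (intro conjI Q allI impI)
  fix A :: "('a, 'b, 'x) contramod" and B :: "('a, 'b, 'y) contramod" and q f
  assume H: "contramodule C A \<and> contramodule C B \<and> q \<in> contramodule_hom C A B \<and> q ` carr A = carr B
    \<and> f \<in> contramodule_hom C Q B"
  have Pc: "contramodule C P" using P by (simp add: projective_contramodule_def)
  let ?e' = "res Q (inv_into (carr P) e)"
  have e': "?e' \<in> contramodule_hom C Q P" by (rule contramodule_hom_inverse[OF Pc Q e])
  have ee: "?e' x \<in> carr P" "e (?e' x) = x" if "x \<in> carr Q" for x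
    using that e(2) by (auto simp: bij_betw_def res_apply intro: f_inv_into_f inv_into_into)
  have "res P (\<lambda>x. f (e x)) \<in> contramodule_hom C P B"
    using contramodule_hom_comp[OF Pc Q _ e(1)] H by blast
  then obtain g where g: "g \<in> contramodule_hom C P A" "\<forall>p\<in>carr P. q (g p) = res P (\<lambda>x. f (e x)) p"
    using P H unfolding projective_contramodule_def by blast
  have "res Q (\<lambda>x. g (?e' x)) \<in> contramodule_hom C Q A"
    using contramodule_hom_comp[OF Q Pc _ e' g(1)] H by blast
  moreover have "q (res Q (\<lambda>x. g (?e' x)) p) = f p" if "p \<in> carr Q" for p
    using g(2) ee[OF that] that by (simp add: res_apply[of p Q] res_apply[of _ P])
  ultimately show "\<exists>g\<in>contramodule_hom C Q A. \<forall>p\<in>carr Q. q (g p) = f p" by blast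
qed

text \<open>Membership facts for contraassociativity: \<open>contract P\<close> is linear on
  \<open>hom C P\<close>, so the inner and the outer argument must both be shown to lie
  there.\<close>

lemma inner_contract_hom:
  assumes P: "contramodule C P" and F: "lin (tensor C C) P F"
  shows "\<And>c. c \<in> carr C \<Longrightarrow> res C (\<lambda>d. F (tens C C d c)) \<in> hom C P"
    and "res C (\<lambda>c. contract P (res C (\<lambda>d. F (tens C C d c)))) \<in> hom C P"
proof -
  note vs = contramodule_vs[OF P] coalgebra_vs[OF contramodule_coalgebra[OF P]]
  show *: "res C (\<lambda>d. F (tens C C d c)) \<in> hom C P" if "c \<in> carr C" for c
    by (intro res_hom lin_comp[OF _ F] lin_tens1 lin_id vs that)
  show "res C (\<lambda>c. contract P (res C (\<lambda>d. F (tens C C d c)))) \<in> hom C P"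
    by (intro res_hom lin_contract[OF P] lin_res_Hom lin_comp[OF _ F] lin_tens1 lin_tens2 lin_id vs)
qed

text \<open>The counterpart of \<open>comodule_transfer\<close>. The premise \<open>out\<close> is
  separate since \<open>co\<close> determines the contraaction of \<open>Q\<close> on
  \<open>hom C Q\<close> only, while membership in \<open>hom\<close> also asks for zero
  elsewhere.\<close>

lemma contramodule_transfer:
  assumes P: "contramodule C P" and Q: "vec_space Q"
    and f: "lin P Q f" "bij_betw f (carr P) (carr Q)"
    and out: "\<And>F. F \<notin> hom C Q \<Longrightarrow> contract Q F = 0"
    and co: "\<And>F. F \<in> hom C P \<Longrightarrow> f (contract P F) = contract Q (res C (\<lambda>c. f (F c)))"
  shows "contramodule C Q"
proof -
  let ?g = "inv_into (carr P) f"
  note vs = contramodule_vs[OF P] coalgebra_vs[OF contramodule_coalgebra[OF P]]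
  note lg = lin_inverse[OF vs(1) f]
  have g: "?g x \<in> carr P" "f (?g x) = x" if "x \<in> carr Q" for x
    using that f(2) by (auto simp: bij_betw_def intro: inv_into_into f_inv_into_f)
  have contractQ: "contract Q F = f (contract P (res C (\<lambda>c. ?g (F c))))" if F: "F \<in> hom C Q" for F
  proof -
    have "res C (\<lambda>c. ?g (F c)) \<in> hom C P" by (rule res_hom[OF vs(2) lin_comp[OF hom_lin[OF F] lg]])
    moreover have "res C (\<lambda>c. f (res C (\<lambda>c. ?g (F c)) c)) = res C F"
      by (rule res_cong) (simp add: res_apply g lin_mem[OF hom_lin[OF F]])
    ultimately show ?thesis using co hom_res_id[OF F] by simp
  qed
  have vH: "vec_space (Hom C Q)" by (rule vec_space_Hom[OF Q])
  have "lin (Hom C Q) Q (contract Q)"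
  proof (rule lin_congI[OF contractQ vH])
    show "lin (Hom C Q) Q (\<lambda>F. f (contract P (res C (\<lambda>c. ?g (F c)))))"
      by (rule lin_comp[OF _ f(1)], rule lin_contract[OF P], rule lin_res_Hom)
         (auto simp: vs vH hom_lin intro!: lin_comp[OF _ lg] lin_ev)
  qed simp
  then have "contract Q \<in> hom (Hom C Q) Q" using out by (simp add: hom_iff_lin[of "contract Q"])
  moreover have "contract Q (res C (\<lambda>c. contract Q (res C (\<lambda>d. G (tens C C d c)))))
      = contract Q (res C (\<lambda>c. G (comult C c)))" if G: "G \<in> hom (tensor C C) Q" for G
  proof -
    \<comment> \<open>The test map \<open>G\<close> is pulled back along \<open>f\<close>, so that
      contraassociativity of \<open>P\<close> can be applied.\<close>
    define F where "F = res (tensor C C) (\<lambda>t. ?g (G t))"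
    have F: "F \<in> hom (tensor C C) P"
      unfolding F_def by (rule res_hom[OF vec_space_tensor lin_comp[OF hom_lin[OF G] lg]])
    have fF: "f (F t) = G t" if "t \<in> carr (tensor C C)" for t
      using that g lin_mem[OF hom_lin[OF G]] by (simp add: F_def res_apply)
    note inner = inner_contract_hom[OF P hom_lin[OF F]]
    have lc: "lin C (tensor C C) (comult C)"
      using contramodule_coalgebra[OF P] by (simp add: coalgebra_def hom_lin)
    have FD: "res C (\<lambda>c. F (comult C c)) \<in> hom C P"
      by (rule res_hom[OF vs(2) lin_comp[OF lc hom_lin[OF F]]])
    have "res C (\<lambda>c. contract Q (res C (\<lambda>d. G (tens C C d c))))
      = res C (\<lambda>c. f (res C (\<lambda>c. contract P (res C (\<lambda>d. F (tens C C d c)))) c))"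
    proof (rule res_cong)
      fix c assume c: "c \<in> carr C"
      have "res C (\<lambda>d. G (tens C C d c)) = res C (\<lambda>d. f (res C (\<lambda>d. F (tens C C d c)) d))"
        by (rule res_cong) (simp add: res_apply fF tens_mem vs c)
      then show "contract Q (res C (\<lambda>d. G (tens C C d c)))
          = f (res C (\<lambda>c. contract P (res C (\<lambda>d. F (tens C C d c)))) c)"
        using co[OF inner(1)[OF c]] c by (simp add: res_apply)
    qed
    then have "contract Q (res C (\<lambda>c. contract Q (res C (\<lambda>d. G (tens C C d c)))))
      = f (contract P (res C (\<lambda>c. contract P (res C (\<lambda>d. F (tens C C d c))))))"
      using co[OF inner(2)] by simp
    also have "\<dots> = f (contract P (res C (\<lambda>c. F (comult C c))))"
      using P F unfolding contramodule_def by metis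
    also have "\<dots> = contract Q (res C (\<lambda>c. G (comult C c)))"
    proof -
      have "res C (\<lambda>c. f (res C (\<lambda>c. F (comult C c)) c)) = res C (\<lambda>c. G (comult C c))"
        by (rule res_cong) (simp add: res_apply fF lin_mem[OF lc])
      then show ?thesis using co[OF FD] by simp
    qed
    finally show ?thesis .
  qed
  moreover have "contract Q (res C (\<lambda>c. smul Q (counit C c) x)) = x" if x: "x \<in> carr Q" for x
  proof -
    have lc: "lin C ground (counit C)"
      using contramodule_coalgebra[OF P] by (simp add: coalgebra_def hom_lin)
    have H: "res C (\<lambda>c. smul P (counit C c) (?g x)) \<in> hom C P"
      by (intro res_hom lin_smul_left vs lc g x)
    have "res C (\<lambda>c. f (res C (\<lambda>c. smul P (counit C c) (?g x)) c)) = res C (\<lambda>c. smul Q (counit C c) x)"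
      by (rule res_cong) (simp add: res_apply lin_scale[OF f(1)] g x)
    then have "contract Q (res C (\<lambda>c. smul Q (counit C c) x)) = f (contract P (res C (\<lambda>c. smul P (counit C c) (?g x))))"
      using co[OF H] by simp
    also have "\<dots> = x" using P g[OF x] by (simp add: contramodule_def)
    finally show ?thesis .
  qed
  ultimately show ?thesis
    unfolding contramodule_def using contramodule_coalgebra[OF P] Q by blast
qed

context coalg
begin

section \<open>The free contramodule and its projectivity\<close>

lemma bil_hom_Hom:
  assumes "F \<in> hom C (Hom C V)"
  shows "bil C C V (\<lambda>d e. F e d)"
proof (rule bilI)
  note l = hom_lin[OF assms]
  show "lin C V (\<lambda>d. F e d)" if "e \<in> carr C" for e using lin_mem[OF l that] by (simp add: hom_lin)
  show "lin C V (\<lambda>e. F e d)" if "d \<in> carr C" for d by (rule lin_eval[OF that l])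
qed

lemma contract_free:
  "F \<in> hom C (Hom C V) \<Longrightarrow> contract (free C V) F = res C (sw V (\<lambda>d e. F e d))"
  by (simp add: free_def res_apply sw_def[abs_def])

lemma contract_free_hom:
  assumes V: "vec_space V"
  shows "contract (free C V) \<in> hom (Hom C (Hom C V)) (Hom C V)"
proof -
  have vH: "vec_space (Hom C (Hom C V))" by (intro vec_space_Hom V)
  have "lin (Hom C (Hom C V)) (Hom C V) (\<lambda>F. res C (sw V (\<lambda>d e. F e d)))"
  proof (rule lin_res_Hom[OF C_vs V vH])
    show "lin C V (sw V (\<lambda>d e. F e d))" if "F \<in> carr (Hom C (Hom C V))" for F
      using lin_sw[OF V bil_hom_Hom lin_id] that by simp
    show "lin (Hom C (Hom C V)) V (\<lambda>F. sw V (\<lambda>d e. F e d) c)" if "c \<in> carr C" for c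
      by (rule lin_sw_param[OF V vH that]) (auto intro: bil_hom_Hom intro!: lin_ev2)
  qed
  from res_hom[OF vH this] show ?thesis by (simp add: free_def sw_def[abs_def])
qed

text \<open>Evaluated at \<open>x\<close>, both sides of contraassociativity are
  \<open>F(x_2 \<otimes> x_3)(x_1)\<close>, so this is coassociativity; contraunitality is the right
  counit identity.\<close>

lemma contramodule_free:
  assumes V: "vec_space V"
  shows "contramodule C (free C V)"
proof -
  have vH: "vec_space (Hom C V)" by (rule vec_space_Hom[OF V])
  have lc: "lin Y (Hom C V) (\<lambda>y. contract (free C V) (g y))" if "lin Y (Hom C (Hom C V)) g" for Y :: "('k, 'y::ab_group_add, 't) vspace_scheme" and g
    by (rule lin_comp[OF that hom_lin[OF contract_free_hom[OF V]]])
  have "contract (free C V) (res C (\<lambda>c. contract (free C V) (res C (\<lambda>d. F (tens C C d c)))))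
      = contract (free C V) (res C (\<lambda>c. F (comult C c)))" if F: "F \<in> hom (tensor C C) (Hom C V)" for F
  proof -
    note lF = hom_lin[OF F]
    have h1: "res C (\<lambda>d. F (tens C C d c)) \<in> hom C (Hom C V)" if "c \<in> carr C" for c
      by (intro res_hom C_vs lin_comp[OF _ lF] lin_tens1 lin_id that)
    have h2: "res C (\<lambda>c. contract (free C V) (res C (\<lambda>d. F (tens C C d c)))) \<in> hom C (Hom C V)"
      by (intro res_hom C_vs vH lc lin_res_Hom lin_comp[OF _ lF] lin_tens1 lin_tens2 lin_id)
    have h3: "res C (\<lambda>c. F (comult C c)) \<in> hom C (Hom C V)"
      by (rule res_hom[OF C_vs lin_comp[OF lin_comult lF]])
    have Fm: "lin C V (F t)" if "t \<in> carr (tensor C C)" for t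
      using lin_mem[OF lF that] by (simp add: hom_lin)
    show ?thesis
      unfolding contract_free[OF h2] contract_free[OF h3]
    proof (rule res_cong)
      fix x assume x: "x \<in> carr C"
      have "sw V (\<lambda>d e. res C (\<lambda>c. contract (free C V) (res C (\<lambda>d. F (tens C C d c)))) e d) x
        = sw V (\<lambda>d e. sw V (\<lambda>d1 d2. F (tens C C d2 e) d1) d) x"
      proof (rule sw_cong)
        fix d e assume d: "d \<in> carr C" and e: "e \<in> carr C"
        have "res C (\<lambda>c. contract (free C V) (res C (\<lambda>d. F (tens C C d c)))) e d
          = sw V (\<lambda>d1 d2. res C (\<lambda>d. F (tens C C d e)) d2 d1) d"
          using d e by (simp add: res_apply contract_free[OF h1])
        also have "\<dots> = sw V (\<lambda>d1 d2. F (tens C C d2 e) d1) d"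
          by (rule sw_cong) (simp add: res_apply)
        finally show "res C (\<lambda>c. contract (free C V) (res C (\<lambda>d. F (tens C C d c)))) e d
          = sw V (\<lambda>d1 d2. F (tens C C d2 e) d1) d" .
      qed
      also have "\<dots> = sw V (\<lambda>d e. sw V (\<lambda>e1 e2. F (tens C C e1 e2) d) e) x"
      proof (rule sw_coassoc[where f = "\<lambda>a b c. F (tens C C b c) a"])
        show "lin C V (\<lambda>b. F (tens C C b c) a)" "lin C V (\<lambda>b. F (tens C C c b) a)" if "a \<in> carr C" "c \<in> carr C" for a c
          by (rule lin_eval[OF that(1)], intro lin_comp[OF _ lF] lin_tens1 lin_tens2 lin_id C_vs that)+
      qed (simp_all add: V Fm tens_mem x)
      also have "\<dots> = sw V (\<lambda>d e. res C (\<lambda>c. F (comult C c)) e d) x"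
      proof (rule sw_cong)
        fix d e assume d: "d \<in> carr C" and e: "e \<in> carr C"
        have "F (comult C e) d = sw V (\<lambda>e1 e2. F (tens C C e1 e2) d) e"
          by (rule comult_lin_apply[where g = "\<lambda>t. F t d", OF V lin_eval[OF d lF] e])
        then show "sw V (\<lambda>e1 e2. F (tens C C e1 e2) d) e = res C (\<lambda>c. F (comult C c)) e d"
          by (simp add: res_apply e)
      qed
      finally show "sw V (\<lambda>d e. res C (\<lambda>c. contract (free C V) (res C (\<lambda>d. F (tens C C d c)))) e d) x
        = sw V (\<lambda>d e. res C (\<lambda>c. F (comult C c)) e d) x" .
    qed
  qed
  moreover have "contract (free C V) (res C (\<lambda>c. smul (free C V) (counit C c) p)) = p" if p: "p \<in> hom C V" for p
  proof -
    have h: "res C (\<lambda>c. smul (Hom C V) (counit C c) p) \<in> hom C (Hom C V)"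
      by (intro res_hom lin_smul_left vH C_vs lin_counit) (simp add: p)
    have "res C (sw V (\<lambda>d e. res C (\<lambda>c. smul (Hom C V) (counit C c) p) e d)) = res C p"
    proof (rule res_cong)
      fix x assume x: "x \<in> carr C"
      have "sw V (\<lambda>d e. res C (\<lambda>c. smul (Hom C V) (counit C c) p) e d) x = sw V (\<lambda>d e. smul V (counit C e) (p d)) x"
        by (rule sw_cong) (simp add: res_apply smul_Hom)
      then show "sw V (\<lambda>d e. res C (\<lambda>c. smul (Hom C V) (counit C c) p) e d) x = p x"
        using sw_counit_right[OF V hom_lin[OF p] x] by simp
    qed
    then show ?thesis using contract_free[OF h] hom_res_id[OF p] by simp
  qed
  ultimately show ?thesis
    unfolding contramodule_def using coalgebra vH contract_free_hom[OF V] by simp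
qed

lemma counit_smul_hom: "vec_space V \<Longrightarrow> v \<in> carr V \<Longrightarrow> res C (\<lambda>d. smul V (counit C d) v) \<in> hom C V"
  by (intro res_hom lin_smul_left C_vs lin_counit)

lemma lin_counit_smul: "vec_space V \<Longrightarrow> lin V (Hom C V) (\<lambda>v. res C (\<lambda>d. smul V (counit C d) v))"
  by (intro lin_res_Hom lin_smul_left lin_smul_right C_vs lin_counit lin_id)

text \<open>By the left counit identity every \<open>p\<close> is the contraaction of the family
  \<open>c \<mapsto> eps(-) p(c)\<close>, where \<open>eps\<close> is the counit. So a free
  contramodule is generated by the elements \<open>eps(-) v\<close>, which determine every morphism
  out of it.\<close>

lemma contract_free_counit_smul:
  assumes V: "vec_space V" and p: "p \<in> hom C V"
  shows "contract (free C V) (res C (\<lambda>c. res C (\<lambda>d. smul V (counit C d) (p c)))) = p"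
proof -
  have h: "res C (\<lambda>c. res C (\<lambda>d. smul V (counit C d) (p c))) \<in> hom C (Hom C V)"
    by (rule res_hom[OF C_vs lin_comp[OF hom_lin[OF p] lin_counit_smul[OF V]]])
  have "res C (sw V (\<lambda>d e. res C (\<lambda>c. res C (\<lambda>d. smul V (counit C d) (p c))) e d)) = res C p"
  proof (rule res_cong)
    fix x assume x: "x \<in> carr C"
    have "sw V (\<lambda>d e. res C (\<lambda>c. res C (\<lambda>d. smul V (counit C d) (p c))) e d) x = sw V (\<lambda>d e. smul V (counit C d) (p e)) x"
      by (rule sw_cong) (simp add: res_apply)
    then show "sw V (\<lambda>d e. res C (\<lambda>c. res C (\<lambda>d. smul V (counit C d) (p c))) e d) x = p x"
      using sw_counit_left[OF V hom_lin[OF p] x] by simp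
  qed
  then show ?thesis using contract_free[OF h] hom_res_id[OF p] by simp
qed

text \<open>The images of the generators \<open>eps(-) v\<close> are lifted through \<open>q\<close>
  by a linear section, and the linear map \<open>g0\<close> obtained in this way extends to a
  contramodule morphism on all of \<open>free C V\<close>.\<close>

lemma free_projective:
  assumes V: "vec_space V"
  shows "projective_contramodule TYPE('x::ab_group_add) TYPE('y::ab_group_add) C (free C V)"
  unfolding projective_contramodule_def
proof (intro conjI contramodule_free[OF V] allI impI)
  fix A :: "('k, 'c, 'x) contramod" and B :: "('k, 'c, 'y) contramod" and q f
  assume H: "contramodule C A \<and> contramodule C B \<and> q \<in> contramodule_hom C A B \<and> q ` carr A = carr B
    \<and> f \<in> contramodule_hom C (free C V) B"
  then have A: "contramodule C A" and B: "contramodule C B" and q: "q \<in> contramodule_hom C A B" "q ` carr A = carr B"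
    and f: "f \<in> contramodule_hom C (free C V) B" by auto
  note vA = contramodule_vs[OF A] and vB = contramodule_vs[OF B]
  have vH: "vec_space (Hom C V)" by (rule vec_space_Hom[OF V])
  have lf: "lin (Hom C V) B f" using contramodule_homD(2)[OF f] by simp
  have lq: "lin A B q" by (rule contramodule_homD(2)[OF q(1)])
  obtain r where r: "lin B A r" "\<And>b. b \<in> carr B \<Longrightarrow> q (r b) = b"
    using linear_section[OF vA vB lq q(2)] by blast
  define g0 where "g0 v = r (f (res C (\<lambda>d. smul V (counit C d) v)))" for v
  have lf0: "lin V B (\<lambda>v. f (res C (\<lambda>d. smul V (counit C d) v)))"
    by (rule lin_comp[OF lin_counit_smul[OF V] lf])
  have g0: "lin V A g0" unfolding g0_def by (rule lin_comp[OF lf0 r(1)])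
  have qg0: "q (g0 v) = f (res C (\<lambda>d. smul V (counit C d) v))" if "v \<in> carr V" for v
    unfolding g0_def by (rule r(2)[OF lin_mem[OF lf0 that]])
  let ?g = "\<lambda>p. contract A (res C (\<lambda>c. g0 (p c)))"
  have lg: "lin (Hom C V) A ?g"
    by (rule lin_contract[OF A], rule lin_res_Hom)
       (auto simp: vA vH hom_lin intro!: lin_comp[OF _ g0] lin_ev)
  have g0h: "res C (\<lambda>c. g0 (p c)) \<in> hom C A" if "p \<in> hom C V" for p
    by (rule res_hom[OF C_vs lin_comp[OF hom_lin[OF that] g0]])
  have "?g (contract (free C V) F) = contract A (res C (\<lambda>c. res (Hom C V) ?g (F c)))" if F: "F \<in> hom C (Hom C V)" for F
  proof -
    let ?b = "\<lambda>d c. g0 (F c d)"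
    have b: "bil C C A ?b" using bil_hom_Hom[OF F] by (auto simp: bil_def intro: lin_comp[OF _ g0])
    \<comment> \<open>Contraassociativity of \<open>A\<close> at the map with
      \<open>G (d \<otimes> c) = g0 (F c d)\<close> is exactly the compatibility of
      \<open>?g\<close> with the contraactions.\<close>
    define G where "G = tensor_lift C C A ?b"
    have G: "G \<in> hom (tensor C C) A" unfolding G_def by (rule tensor_lift_hom[OF C_vs C_vs vA b])
    have Gt: "G (tens C C d c) = g0 (F c d)" if "d \<in> carr C" "c \<in> carr C" for d c
      unfolding G_def using tensor_lift_tens[OF C_vs C_vs vA b that] .
    have "res C (\<lambda>c. g0 (contract (free C V) F c)) = res C (\<lambda>c. G (comult C c))"
    proof (rule res_cong)
      fix c assume c: "c \<in> carr C"
      have "g0 (sw V (\<lambda>d e. F e d) c) = sw A ?b c"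
        by (rule sw_comp[OF V vA bil_hom_Hom[OF F] g0 c])
      then show "g0 (contract (free C V) F c) = G (comult C c)"
        by (simp add: contract_free[OF F] res_apply c G_def sw_def)
    qed
    then have "?g (contract (free C V) F) = contract A (res C (\<lambda>c. G (comult C c)))" by simp
    also have "\<dots> = contract A (res C (\<lambda>c. contract A (res C (\<lambda>d. G (tens C C d c)))))"
      using A G unfolding contramodule_def by metis
    also have "res C (\<lambda>c. contract A (res C (\<lambda>d. G (tens C C d c)))) = res C (\<lambda>c. res (Hom C V) ?g (F c))"
    proof (rule res_cong)
      fix c assume c: "c \<in> carr C"
      have "res C (\<lambda>d. G (tens C C d c)) = res C (\<lambda>d. g0 (F c d))"
        by (rule res_cong) (simp add: Gt c)
      then show "contract A (res C (\<lambda>d. G (tens C C d c))) = res (Hom C V) ?g (F c)"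
        using lin_mem[OF hom_lin[OF F] c] by (simp add: res_apply)
    qed
    finally show ?thesis .
  qed
  moreover have "contract (free C V) F \<in> hom C V" if "F \<in> hom C (Hom C V)" for F
    using contract_mem[OF contramodule_free[OF V]] that by simp
  ultimately have "res (Hom C V) ?g \<in> contramodule_hom C (free C V) A"
    using res_hom[OF vH lg] by (simp add: contramodule_hom_def res_apply)
  moreover have "q (res (Hom C V) ?g p) = f p" if p: "p \<in> hom C V" for p
  proof -
    let ?F = "res C (\<lambda>c. res C (\<lambda>d. smul V (counit C d) (p c)))"
    have h: "?F \<in> hom C (Hom C V)"
      by (rule res_hom[OF C_vs lin_comp[OF hom_lin[OF p] lin_counit_smul[OF V]]])
    have "q (?g p) = contract B (res C (\<lambda>c. q (res C (\<lambda>c. g0 (p c)) c)))"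
      by (rule contramodule_homD(3)[OF q(1) g0h[OF p]])
    also have "res C (\<lambda>c. q (res C (\<lambda>c. g0 (p c)) c)) = res C (\<lambda>c. f (?F c))"
      by (rule res_cong) (simp add: res_apply qg0 lin_mem[OF hom_lin[OF p]])
    also have "contract B \<dots> = f (contract (free C V) ?F)"
      using contramodule_homD(3)[OF f, of ?F] h by simp
    also have "\<dots> = f p" by (simp add: contract_free_counit_smul[OF V p])
    finally show ?thesis using p by (simp add: res_apply)
  qed
  ultimately show "\<exists>g\<in>contramodule_hom C (free C V) A. \<forall>p\<in>carr (free C V). q (g p) = f p" by auto
qed

section \<open>The functor Psi on cofree comodules\<close>

lemma carr_Psi: "carr (Psi C M) = comodule_hom C (left_regular C) M"
  and smul_Psi: "smul (Psi C M) = ptmul (smul M)"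
  by (simp_all add: Psi_def Let_def)

lemma Psi_cofree_apply:
  "p \<in> hom C V \<Longrightarrow> Psi_cofree C V p = res C (sw (tensor C V) (\<lambda>a b. tens C V a (p b)))"
  using res_apply[of p "Hom C V"] by (simp add: Psi_cofree_def tensor_map_comult)

lemma bil_tens_hom:
  "vec_space V \<Longrightarrow> lin C V p \<Longrightarrow> bil C C (tensor C V) (\<lambda>a b. tens C V a (p b))"
  by (rule bil_tens_comp[OF C_vs _ lin_id])

lemma Psi_cofree_comodule_hom:
  assumes V: "vec_space V" and p: "p \<in> hom C V"
  shows "Psi_cofree C V p \<in> comodule_hom C (left_regular C) (cofree C V)"
proof -
  let ?M = "tensor C V"
  let ?p = "sw ?M (\<lambda>a b. tens C V a (p b))"
  note b = bil_tens_hom[OF V hom_lin[OF p]]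
  have pV: "p c \<in> carr V" if "c \<in> carr C" for c using hom_lin[OF p] that by (rule lin_mem)
  have l: "lin C ?M ?p" by (rule lin_sw[OF _ b lin_id]) simp
  have "coact (cofree C V) (?p c) = tensor_map C C C ?M (\<lambda>x. x) (res C ?p) (comult C c)" if c: "c \<in> carr C" for c
  proof -
    have "coact (cofree C V) (?p c) = sw (tensor C ?M) (\<lambda>a b. coact (cofree C V) (tens C V a (p b))) c"
      by (rule sw_comp[OF _ _ b lin_coact_cofree[OF V lin_id] c]) simp_all
    also have "\<dots> = sw (tensor C ?M) (\<lambda>a b. sw (tensor C ?M) (\<lambda>a1 a2. tens C ?M a1 (tens C V a2 (p b))) a) c"
      by (rule sw_cong) (simp add: coact_cofree_tens V pV)
    also have "\<dots> = sw (tensor C ?M) (\<lambda>a b. sw (tensor C ?M) (\<lambda>b1 b2. tens C ?M a (tens C V b1 (p b2))) b) c"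
      by (rule sw_coassoc[where f = "\<lambda>a b c. tens C ?M a (tens C V b (p c))"])
         (simp, (intro lin_tens1 lin_tens2 tens_mem lin_id hom_lin[OF p]; simp add: V pV)+, rule c)
    also have "\<dots> = sw (tensor C ?M) (\<lambda>a b. tens C ?M a (res C ?p b)) c"
    proof (rule sw_cong)
      fix a b' assume a: "a \<in> carr C" and b': "b' \<in> carr C"
      have "tens C ?M a (?p b') = sw (tensor C ?M) (\<lambda>b1 b2. tens C ?M a (tens C V b1 (p b2))) b'"
        by (rule sw_comp[OF _ _ b lin_tens2[OF _ _ a lin_id] b']) simp_all
      then show "sw (tensor C ?M) (\<lambda>b1 b2. tens C ?M a (tens C V b1 (p b2))) b' = tens C ?M a (res C ?p b')"
        by (simp add: res_apply b')
    qed
    finally show ?thesis by (simp add: tensor_map_comult)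
  qed
  then show ?thesis
    using res_hom[OF C_vs l] by (simp add: comodule_hom_def Psi_cofree_apply[OF p] res_apply)
qed

lemma cproj_Psi_cofree:
  assumes V: "vec_space V" and p: "p \<in> hom C V" and c: "c \<in> carr C"
  shows "cproj V (Psi_cofree C V p c) = p c"
proof -
  have "cproj V (sw (tensor C V) (\<lambda>a b. tens C V a (p b)) c) = sw V (\<lambda>a b. cproj V (tens C V a (p b))) c"
    by (rule sw_comp[OF _ V bil_tens_hom[OF V hom_lin[OF p]] lin_cproj[OF V] c]) simp
  also have "\<dots> = sw V (\<lambda>a b. smul V (counit C a) (p b)) c"
    by (rule sw_cong) (simp add: cproj_tens V lin_mem[OF hom_lin[OF p]])
  also have "\<dots> = p c" by (rule sw_counit_left[OF V hom_lin[OF p] c])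
  finally show ?thesis by (simp add: Psi_cofree_apply[OF p] res_apply c)
qed

lemma Psi_cofree_cproj:
  assumes V: "vec_space V" and g: "g \<in> comodule_hom C (left_regular C) (cofree C V)"
  shows "res C (\<lambda>c. cproj V (g c)) \<in> hom C V" "Psi_cofree C V (res C (\<lambda>c. cproj V (g c))) = g"
proof -
  have gh: "g \<in> hom C (tensor C V)" using comodule_homD(1)[OF g] by simp
  note lg = hom_lin[OF gh]
  let ?p = "res C (\<lambda>c. cproj V (g c))"
  show p: "?p \<in> hom C V" by (rule res_hom[OF C_vs lin_comp[OF lg lin_cproj[OF V]]])
  have "Psi_cofree C V ?p = res C g"
    unfolding Psi_cofree_apply[OF p]
  proof (rule res_cong)
    fix c assume c: "c \<in> carr C"
    have "sw (tensor C V) (\<lambda>a b. tens C V a (?p b)) c = tensor_map C C C V (\<lambda>x. x) (\<lambda>c. cproj V (g c)) (comult C c)"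
      by (simp add: tensor_map_comult, rule sw_cong) (simp add: res_apply)
    also have "\<dots> = tensor_map C (tensor C V) C V (\<lambda>x. x) (cproj V) (tensor_map C C C (tensor C V) (\<lambda>x. x) g (comult C c))"
      by (rule tensor_map_comp[symmetric]) (simp_all add: V lin_id lg lin_cproj comult_mem c)
    also have "\<dots> = tensor_map C (tensor C V) C V (\<lambda>x. x) (cproj V) (coact (cofree C V) (g c))"
      using comodule_homD(3)[OF g, of c] c by simp
    also have "\<dots> = g c" by (rule coact_cofree_cproj[OF V lin_mem[OF lg c]])
    finally show "sw (tensor C V) (\<lambda>a b. tens C V a (?p b)) c = g c" .
  qed
  then show "Psi_cofree C V ?p = g" using hom_res_id[OF gh] by simp
qed

text \<open>The adjunction for cofree comodules once more: composition with \<open>cproj\<close>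
  recovers \<open>p\<close> from \<open>c \<mapsto> c_1 \<otimes> p(c_2)\<close>.\<close>

lemma Psi_cofree_bij:
  assumes V: "vec_space V"
  shows "bij_betw (Psi_cofree C V) (hom C V) (comodule_hom C (left_regular C) (cofree C V))"
proof (rule bij_betw_byWitness[where f' = "\<lambda>g. res C (\<lambda>c. cproj V (g c))"])
  show "\<forall>p\<in>hom C V. res C (\<lambda>c. cproj V (Psi_cofree C V p c)) = p"
  proof
    fix p assume p: "p \<in> hom C V"
    have "res C (\<lambda>c. cproj V (Psi_cofree C V p c)) = res C p"
      by (rule res_cong) (rule cproj_Psi_cofree[OF V p])
    then show "res C (\<lambda>c. cproj V (Psi_cofree C V p c)) = p" using hom_res_id[OF p] by simp
  qed
qed (use Psi_cofree_cproj[OF V] Psi_cofree_comodule_hom[OF V] in auto)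

lemma lin_Psi_cofree:
  assumes V: "vec_space V"
  shows "lin (Hom C V) (Hom C (tensor C V)) (Psi_cofree C V)"
proof (rule lin_congI)
  show "lin (Hom C V) (Hom C (tensor C V)) (\<lambda>p. res C (sw (tensor C V) (\<lambda>a b. tens C V a (p b))))"
  proof (rule lin_res_Hom)
    show "lin C (tensor C V) (sw (tensor C V) (\<lambda>a b. tens C V a (p b)))" if "p \<in> carr (Hom C V)" for p
      using lin_sw[OF _ bil_tens_hom[OF V] lin_id, of p] that by (simp add: hom_lin)
    show "lin (Hom C V) (tensor C V) (\<lambda>p. sw (tensor C V) (\<lambda>a b. tens C V a (p b)) c)" if c: "c \<in> carr C" for c
      by (rule lin_sw_param)
         (auto simp: V vec_space_Hom c hom_lin bil_tens_hom intro!: lin_tens2 lin_ev)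
  qed (simp_all add: V vec_space_Hom)
qed (simp_all add: Psi_cofree_apply V vec_space_Hom)

text \<open>The carrier of \<open>Psi\<close> is a set of comodule morphisms; for a cofree comodule
  it is the image of the linear map \<open>Psi_cofree\<close>, which makes it a subspace.\<close>

lemma vec_space_Psi_cofree:
  assumes V: "vec_space V"
  shows "vec_space (Psi C (cofree C V))"
proof -
  note l = lin_Psi_cofree[OF V]
  have im: "carr (Psi C (cofree C V)) = Psi_cofree C V ` hom C V"
    using Psi_cofree_bij[OF V] by (simp add: carr_Psi bij_betw_def)
  have vM: "vector_space (ptmul (smul (tensor C V)))"
    using vector_space_ptmul vec_space_tensor by (metis vec_space_def)
  interpret vector_space "ptmul (smul (tensor C V))" by (rule vM)
  have "subspace (Psi_cofree C V ` hom C V)"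
    unfolding subspace_def
  proof (intro conjI ballI allI)
    have vH: "vec_space (Hom C V)" by (rule vec_space_Hom[OF V])
    show "0 \<in> Psi_cofree C V ` hom C V"
      using lin_zero[OF vH l] vs_zero[OF vH] by (metis carr_Hom imageI)
    fix x assume "x \<in> Psi_cofree C V ` hom C V"
    then obtain p where p: "p \<in> hom C V" "x = Psi_cofree C V p" by blast
    show "(\<lambda>xa. smul (tensor C V) c (x xa)) \<in> Psi_cofree C V ` hom C V" for c
      by (rule image_eqI[where x = "smul (Hom C V) c p"])
         (use lin_scale[OF l, of p c] vs_scale[OF vH, of p c] p in \<open>simp_all add: smul_Hom\<close>)
    fix y assume "y \<in> Psi_cofree C V ` hom C V"
    then obtain q where q: "q \<in> hom C V" "y = Psi_cofree C V q" by blast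
    show "x + y \<in> Psi_cofree C V ` hom C V"
      using lin_add[OF l, of p q] vs_add[OF vH, of p q] p q by (metis carr_Hom imageI)
  qed
  then show ?thesis by (simp add: vec_space_def im smul_Psi vM)
qed

lemma contract_Psi_cofree:
  assumes "F \<in> hom C (Psi C (cofree C V))"
  shows "contract (Psi C (cofree C V)) F = res C (sw (tensor C V) (\<lambda>d e. F e d))"
proof -
  have "F \<in> hom C \<lparr>carr = comodule_hom C (left_regular C) (cofree C V), smul = ptmul (smul (cofree C V))\<rparr>"
    using assms sp_cong(8)[of "Psi C (cofree C V)" "\<lparr>carr = comodule_hom C (left_regular C) (cofree C V), smul = ptmul (smul (cofree C V))\<rparr>" C]
    by (simp add: carr_Psi smul_Psi)
  then show ?thesis
    by (simp add: Psi_def Let_def res_apply sw_def[abs_def] tensor_lift_sp_cong[OF carr_cofree smul_cofree])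
qed

lemma contract_Psi_cofree_outside:
  assumes "F \<notin> hom C (Psi C (cofree C V))"
  shows "contract (Psi C (cofree C V)) F = 0"
proof -
  have "F \<notin> hom C \<lparr>carr = comodule_hom C (left_regular C) (cofree C V), smul = ptmul (smul (cofree C V))\<rparr>"
    using assms sp_cong(8)[of "Psi C (cofree C V)" "\<lparr>carr = comodule_hom C (left_regular C) (cofree C V), smul = ptmul (smul (cofree C V))\<rparr>" C]
    by (simp add: carr_Psi smul_Psi)
  then show ?thesis by (simp add: Psi_def Let_def res_def)
qed

lemma lin_Psi_cofree':
  assumes V: "vec_space V"
  shows "lin (free C V) (Psi C (cofree C V)) (Psi_cofree C V)"
  using lin_Psi_cofree[OF V] Psi_cofree_comodule_hom[OF V] by (simp add: lin_def carr_Psi smul_Psi smul_Hom)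

text \<open>Both sides are the map \<open>c \<mapsto> c_1 \<otimes> F(c_3)(c_2)\<close>, by
  coassociativity.\<close>

lemma Psi_cofree_contract:
  assumes V: "vec_space V" and F: "F \<in> hom C (Hom C V)"
  shows "Psi_cofree C V (contract (free C V) F)
    = contract (Psi C (cofree C V)) (res C (\<lambda>c. Psi_cofree C V (F c)))"
proof -
  let ?M = "tensor C V"
  have cF: "contract (free C V) F \<in> hom C V"
    using contract_mem[OF contramodule_free[OF V]] F by simp
  have FV: "F c \<in> hom C V" if "c \<in> carr C" for c using lin_mem[OF hom_lin[OF F] that] by simp
  have Fm: "F c d \<in> carr V" if "c \<in> carr C" "d \<in> carr C" for c d using lin_mem[OF hom_lin[OF FV[OF that(1)]] that(2)] .
  have "lin C (Psi C (cofree C V)) (\<lambda>c. Psi_cofree C V (F c))"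
    using lin_comp[OF hom_lin[OF F], of "Psi C (cofree C V)" "Psi_cofree C V"] lin_Psi_cofree'[OF V] by simp
  then have h: "res C (\<lambda>c. Psi_cofree C V (F c)) \<in> hom C (Psi C (cofree C V))" by (rule res_hom[OF C_vs])
  show ?thesis
    unfolding contract_Psi_cofree[OF h] Psi_cofree_apply[OF cF]
  proof (rule res_cong)
    fix c assume c: "c \<in> carr C"
    have "sw ?M (\<lambda>a b. tens C V a (contract (free C V) F b)) c
        = sw ?M (\<lambda>a b. sw ?M (\<lambda>d e. tens C V a (F e d)) b) c"
    proof (rule sw_cong)
      fix a b assume a: "a \<in> carr C" and b: "b \<in> carr C"
      have "tens C V a (sw V (\<lambda>d e. F e d) b) = sw ?M (\<lambda>d e. tens C V a (F e d)) b"
        by (rule sw_comp[OF V _ bil_hom_Hom[OF F] lin_tens2[OF C_vs V a lin_id] b]) simp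
      then show "tens C V a (contract (free C V) F b) = sw ?M (\<lambda>d e. tens C V a (F e d)) b"
        by (simp add: contract_free[OF F] res_apply b)
    qed
    also have "\<dots> = sw ?M (\<lambda>a b. sw ?M (\<lambda>a1 a2. tens C V a1 (F b a2)) a) c"
    proof (rule sw_coassoc[where f = "\<lambda>x y z. tens C V x (F z y)", symmetric])
      show "lin C ?M (\<lambda>c. tens C V a (F c b))" if "a \<in> carr C" "b \<in> carr C" for a b
        by (rule lin_tens2[OF C_vs V that(1)]) (rule lin_eval[OF that(2) hom_lin[OF F]])
    qed (auto simp: V c Fm intro!: lin_tens1 lin_tens2 lin_id hom_lin[OF FV])
    also have "\<dots> = sw ?M (\<lambda>d e. res C (\<lambda>c. Psi_cofree C V (F c)) e d) c"
      by (rule sw_cong) (simp add: res_apply Psi_cofree_apply FV)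
    finally show "sw ?M (\<lambda>a b. tens C V a (contract (free C V) F b)) c
      = sw ?M (\<lambda>d e. res C (\<lambda>c. Psi_cofree C V (F c)) e d) c" .
  qed
qed

lemma contramodule_Psi_cofree:
  assumes V: "vec_space V"
  shows "contramodule C (Psi C (cofree C V))"
  by (rule contramodule_transfer[OF contramodule_free[OF V] vec_space_Psi_cofree[OF V] lin_Psi_cofree'[OF V]])
     (use Psi_cofree_bij[OF V] Psi_cofree_contract[OF V] in \<open>simp_all add: carr_Psi contract_Psi_cofree_outside\<close>)

lemma Psi_cofree_contramodule_hom:
  assumes V: "vec_space V"
  shows "Psi_cofree C V \<in> contramodule_hom C (free C V) (Psi C (cofree C V))"
proof -
  have "Psi_cofree C V \<in> hom (free C V) (Psi C (cofree C V))"
    using lin_Psi_cofree'[OF V] unfolding hom_iff_lin by (simp add: Psi_cofree_def res_def)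
  then show ?thesis using Psi_cofree_contract[OF V] by (simp add: contramodule_hom_def)
qed

end

section \<open>The functor Phi on free contramodules\<close>

lemma carr_right_regular [simp]: "carr (right_regular C) = carr C"
  and smul_right_regular [simp]: "smul (right_regular C) = smul C"
  and rcoact_right_regular [simp]: "rcoact (right_regular C) = comult C"
  by (simp_all add: right_regular_def)

lemmas right_regular_sp [simp] = sp_cong[OF carr_right_regular smul_right_regular]
  tensor_lift_sp_cong[OF carr_right_regular smul_right_regular]

lemma kernel_subspace:
  assumes "vec_space V" "vec_space U" "lin V U g"
  shows "module.subspace (smul V) {x \<in> carr V. g x = 0}"
proof -
  interpret vector_space "smul V" using assms(1) by (simp add: vec_space_def)
  show ?thesis
    using assms by (auto simp: subspace_def lin_zero[of V U] lin_add lin_scale vs_add vs_scale vs_scale_zero[of U])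
qed

lemma vec_space_image:
  assumes V: "vec_space V" and t: "vector_space t"
    and g: "lin V \<lparr>carr = g ` carr V, smul = t\<rparr> g"
  shows "vec_space \<lparr>carr = g ` carr V, smul = t\<rparr>"
proof -
  interpret vector_space t by (rule t)
  have "subspace (g ` carr V)"
    unfolding subspace_def
  proof (intro conjI ballI allI)
    show "0 \<in> g ` carr V" using lin_zero[OF V g] vs_zero[OF V] by (rule image_eqI[OF sym])
    fix x assume "x \<in> g ` carr V"
    then obtain a where a: "a \<in> carr V" "x = g a" by blast
    show "t c x \<in> g ` carr V" for c
      by (rule image_eqI[where x = "smul V c a"])
         (use lin_scale[OF g a(1), of c] vs_scale[OF V a(1), of c] a(2) in simp_all)
    fix y assume "y \<in> g ` carr V"
    then obtain b where b: "b \<in> carr V" "y = g b" by blast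
    show "x + y \<in> g ` carr V"
      by (rule image_eqI[where x = "a + b"])
         (use lin_add[OF g a(1) b(1)] vs_add[OF V a(1) b(1)] a(2) b(2) in simp_all)
  qed
  then show ?thesis by (simp add: vec_space_def t)
qed

lemma carr_quotient_space: "carr (quotient_space V R) = coset V R ` carr V"
  and smul_quotient_space: "smul (quotient_space V R) = ptmul (*)"
  by (simp_all add: quotient_space_def)

lemma lin_coset: "lin V (quotient_space V R) (coset V R)"
  by (auto simp: lin_def carr_quotient_space smul_quotient_space coset_def fun_eq_iff Vector_Spaces.linear_iff)

lemma vec_space_quotient_space: "vec_space V \<Longrightarrow> vec_space (quotient_space V R)"
  unfolding quotient_space_def
  by (rule vec_space_image[OF _ vector_space_functions lin_coset[unfolded quotient_space_def]])

context coalg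
begin

section \<open>The contratensor product with a free contramodule\<close>

abbreviation rel :: "('k, 'v::ab_group_add, 't) vspace_scheme \<Rightarrow> ('k, 'c, 'c \<Rightarrow> 'v) tensor set" where
  "rel V \<equiv> contratensor_rel C (right_regular C) (free C V)"

abbreviation cos :: "('k, 'v::ab_group_add, 't) vspace_scheme \<Rightarrow> ('k, 'c, 'c \<Rightarrow> 'v) tensor
    \<Rightarrow> (('k, 'c, 'c \<Rightarrow> 'v) tensor \<Rightarrow> 'k) \<Rightarrow> 'k" where
  "cos V \<equiv> coset (tensor C (Hom C V)) (rel V)"

text \<open>The value at \<open>c \<otimes> p\<close> is \<open>c_1 \<otimes> p(c_2)\<close>, that
  is, \<open>Psi_cofree C V p c\<close>. Modulo the contratensor relations this becomes the inverse
  of \<open>Phi_free\<close>.\<close>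

definition theta :: "('k, 'v::ab_group_add, 't) vspace_scheme \<Rightarrow> ('k, 'c, 'c \<Rightarrow> 'v) tensor \<Rightarrow> ('k, 'c, 'v) tensor" where
  "theta V = tensor_lift C (Hom C V) (tensor C V) (\<lambda>c p. sw (tensor C V) (\<lambda>a b. tens C V a (p b)) c)"

definition emb :: "('k, 'v::ab_group_add, 't) vspace_scheme \<Rightarrow> ('k, 'c, 'v) tensor \<Rightarrow> ('k, 'c, 'c \<Rightarrow> 'v) tensor" where
  "emb V = tensor_map C V C (Hom C V) (\<lambda>c. c) (\<lambda>v. res C (\<lambda>d. smul V (counit C d) v))"

lemma bil_theta:
  assumes V: "vec_space V"
  shows "bil C (Hom C V) (tensor C V) (\<lambda>c p. sw (tensor C V) (\<lambda>a b. tens C V a (p b)) c)"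
proof (rule bilI)
  show "lin C (tensor C V) (sw (tensor C V) (\<lambda>a b. tens C V a (p b)))" if "p \<in> carr (Hom C V)" for p
    using lin_sw[OF _ bil_tens_hom[OF V] lin_id, of p] that by (simp add: hom_lin)
  show "lin (Hom C V) (tensor C V) (\<lambda>p. sw (tensor C V) (\<lambda>a b. tens C V a (p b)) c)" if c: "c \<in> carr C" for c
    by (rule lin_sw_param)
       (auto simp: V vec_space_Hom c hom_lin bil_tens_hom intro!: lin_tens2 lin_ev)
qed

lemma lin_theta: "vec_space V \<Longrightarrow> lin (tensor C (Hom C V)) (tensor C V) (theta V)"
  unfolding theta_def by (rule hom_lin, rule tensor_lift_hom) (simp_all add: vec_space_Hom bil_theta)

lemma theta_tens:
  "vec_space V \<Longrightarrow> c \<in> carr C \<Longrightarrow> p \<in> hom C V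
   \<Longrightarrow> theta V (tens C (Hom C V) c p) = sw (tensor C V) (\<lambda>a b. tens C V a (p b)) c"
  unfolding theta_def by (rule tensor_lift_tens) (simp_all add: vec_space_Hom bil_theta)

lemma lin_emb: "vec_space V \<Longrightarrow> lin (tensor C V) (tensor C (Hom C V)) (emb V)"
  unfolding emb_def by (rule hom_lin, rule tensor_map_hom) (simp_all add: vec_space_Hom lin_counit_smul lin_id)

lemma emb_tens:
  "vec_space V \<Longrightarrow> c \<in> carr C \<Longrightarrow> v \<in> carr V
   \<Longrightarrow> emb V (tens C V c v) = tens C (Hom C V) c (res C (\<lambda>d. smul V (counit C d) v))"
  unfolding emb_def by (rule tensor_map_tens) (simp_all add: vec_space_Hom lin_counit_smul lin_id)

lemma theta_emb:
  assumes V: "vec_space V" and t: "t \<in> carr (tensor C V)"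
  shows "theta V (emb V t) = t"
proof (rule tensor_ext[OF C_vs V lin_comp[OF lin_emb[OF V] lin_theta[OF V]] lin_id _ t])
  fix c v assume c: "c \<in> carr C" and v: "v \<in> carr V"
  have "theta V (emb V (tens C V c v)) = sw (tensor C V) (\<lambda>a b. tens C V a (res C (\<lambda>d. smul V (counit C d) v) b)) c"
    by (simp add: emb_tens theta_tens V c v counit_smul_hom)
  also have "\<dots> = sw (tensor C V) (\<lambda>a b. smul (tensor C V) (counit C b) (tens C V a v)) c"
    by (rule sw_cong) (simp add: res_apply lin_scale[OF lin_tens2[OF C_vs V _ lin_id]] v)
  also have "\<dots> = tens C V c v"
    by (rule sw_counit_right[where g = "\<lambda>b. tens C V b v"]) (simp_all add: lin_tens1 lin_id V v c)
  finally show "theta V (emb V (tens C V c v)) = tens C V c v" .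
qed

lemma rel_eq:
  "rel V = module.span (ptmul (*))
     {tens C (Hom C V) n (contract (free C V) f) - sw (tensor C (Hom C V)) (\<lambda>m c. tens C (Hom C V) m (f c)) n
      |n f. n \<in> carr C \<and> f \<in> hom C (Hom C V)}"
  by (simp add: contratensor_rel_def smul_tensor sw_def)

lemma rel_subspace: "module.subspace (smul (tensor C (Hom C V))) (rel V)"
proof -
  interpret vector_space "ptmul ((*) :: 'k \<Rightarrow> 'k \<Rightarrow> 'k)" using vector_space_functions by simp
  show ?thesis unfolding rel_eq smul_tensor by (rule subspace_span)
qed

text \<open>\<open>Psi_cofree_contract\<close>, evaluated at \<open>n\<close>, says that the two
  terms of a generating relation have the same image; coassociativity enters through that
  lemma.\<close>

lemma theta_rel:
  assumes V: "vec_space V" and r: "r \<in> rel V"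
  shows "r \<in> carr (tensor C (Hom C V))" "theta V r = 0"
proof -
  let ?H = "Hom C V" and ?M = "tensor C V"
  have H: "vec_space ?H" by (rule vec_space_Hom[OF V])
  interpret vector_space "ptmul ((*) :: 'k \<Rightarrow> 'k \<Rightarrow> 'k)" using vector_space_functions by simp
  have "tens C ?H n (contract (free C V) f) - sw (tensor C ?H) (\<lambda>m c. tens C ?H m (f c)) n
      \<in> {x \<in> carr (tensor C ?H). theta V x = 0}" if n: "n \<in> carr C" and f: "f \<in> hom C ?H" for n f
  proof -
    have b: "bil C C (tensor C ?H) (\<lambda>m c. tens C ?H m (f c))" by (rule bil_tens_hom[OF H hom_lin[OF f]])
    have fH: "f c \<in> hom C V" if "c \<in> carr C" for c using lin_mem[OF hom_lin[OF f] that] by simp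
    have cf: "contract (free C V) f \<in> hom C V" using contract_mem[OF contramodule_free[OF V]] f by simp
    have m1: "tens C ?H n (contract (free C V) f) \<in> carr (tensor C ?H)" by (rule tens_mem) (simp_all add: H n cf)
    have m2: "sw (tensor C ?H) (\<lambda>m c. tens C ?H m (f c)) n \<in> carr (tensor C ?H)" by (rule sw_mem[OF _ b n]) simp
    have "theta V (sw (tensor C ?H) (\<lambda>m c. tens C ?H m (f c)) n) = sw ?M (\<lambda>m c. theta V (tens C ?H m (f c))) n"
      by (rule sw_comp[OF _ _ b lin_theta[OF V] n]) simp_all
    also have "\<dots> = sw ?M (\<lambda>m c. sw ?M (\<lambda>a b. tens C V a (f c b)) m) n"
      by (rule sw_cong) (simp add: theta_tens V fH)
    also have "\<dots> = Psi_cofree C V (contract (free C V) f) n"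
    proof -
      have "Psi_cofree C V (contract (free C V) f) n
        = contract (Psi C (cofree C V)) (res C (\<lambda>c. Psi_cofree C V (f c))) n"
        by (simp add: Psi_cofree_contract[OF V f])
      also have "lin C (Psi C (cofree C V)) (\<lambda>c. Psi_cofree C V (f c))"
        using lin_comp[OF hom_lin[OF f], of "Psi C (cofree C V)" "Psi_cofree C V"] lin_Psi_cofree'[OF V] by simp
      then have "contract (Psi C (cofree C V)) (res C (\<lambda>c. Psi_cofree C V (f c))) n
        = sw ?M (\<lambda>m c. res C (\<lambda>c. Psi_cofree C V (f c)) c m) n"
        by (simp add: contract_Psi_cofree res_hom res_apply n)
      also have "\<dots> = sw ?M (\<lambda>m c. sw ?M (\<lambda>a b. tens C V a (f c b)) m) n"
        by (rule sw_cong) (simp add: res_apply Psi_cofree_apply fH)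
      finally show ?thesis by simp
    qed
    also have "\<dots> = theta V (tens C ?H n (contract (free C V) f))"
      by (simp add: theta_tens V n cf Psi_cofree_apply res_apply)
    finally have "theta V (tens C ?H n (contract (free C V) f) - sw (tensor C ?H) (\<lambda>m c. tens C ?H m (f c)) n) = 0"
      using lin_diff[OF vec_space_tensor lin_theta[OF V] m1 m2] by simp
    then show ?thesis using vs_diff[OF vec_space_tensor m1 m2] by simp
  qed
  then have "rel V \<subseteq> {x \<in> carr (tensor C ?H). theta V x = 0}"
    unfolding rel_eq
    by (intro span_minimal kernel_subspace[OF _ _ lin_theta[OF V], unfolded smul_tensor]) auto
  then show "r \<in> carr (tensor C ?H)" "theta V r = 0" using r by auto
qed

text \<open>For a pure tensor \<open>c \<otimes> p\<close> the difference is one of the generating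
  relations, namely the one for \<open>c\<close> and the family \<open>?f\<close>, whose
  contraaction is \<open>p\<close> by \<open>contract_free_counit_smul\<close>.\<close>

lemma emb_theta:
  assumes V: "vec_space V" and t: "t \<in> carr (tensor C (Hom C V))"
  shows "t - emb V (theta V t) \<in> rel V"
proof -
  let ?H = "Hom C V" and ?M = "tensor C V"
  have H: "vec_space ?H" by (rule vec_space_Hom[OF V])
  interpret vector_space "ptmul ((*) :: 'k \<Rightarrow> 'k \<Rightarrow> 'k)" using vector_space_functions by simp
  have gen: "tens C ?H c p - emb V (theta V (tens C ?H c p)) \<in> rel V" if c: "c \<in> carr C" and p: "p \<in> hom C V" for c p
  proof -
    let ?f = "res C (\<lambda>c. res C (\<lambda>d. smul V (counit C d) (p c)))"
    have f: "?f \<in> hom C ?H"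
      by (rule res_hom[OF C_vs lin_comp[OF hom_lin[OF p] lin_counit_smul[OF V]]])
    have "emb V (theta V (tens C ?H c p)) = sw (tensor C ?H) (\<lambda>a b. emb V (tens C V a (p b))) c"
      unfolding theta_tens[OF V c p]
      by (rule sw_comp[OF _ _ bil_tens_hom[OF V hom_lin[OF p]] lin_emb[OF V] c]) simp_all
    also have "\<dots> = sw (tensor C ?H) (\<lambda>a b. tens C ?H a (?f b)) c"
      by (rule sw_cong) (simp add: emb_tens V lin_mem[OF hom_lin[OF p]] res_apply)
    finally have "tens C ?H c p - emb V (theta V (tens C ?H c p))
      = tens C ?H c (contract (free C V) ?f) - sw (tensor C ?H) (\<lambda>a b. tens C ?H a (?f b)) c"
      by (simp add: contract_free_counit_smul[OF V p])
    then show ?thesis unfolding rel_eq using c f by (intro span_base) blast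
  qed
  obtain n :: nat and c p where *: "\<forall>i<n. c i \<in> carr C \<and> p i \<in> carr ?H" "t = (\<Sum>i<n. tens C ?H (c i) (p i))"
    using tensor_rep[OF C_vs H t] by blast
  have m: "tens C ?H (c i) (p i) \<in> carr (tensor C ?H)" if "i \<in> {..<n}" for i
    using * tens_mem[OF C_vs H] that by simp
  have "emb V (theta V t) = (\<Sum>i<n. emb V (theta V (tens C ?H (c i) (p i))))"
    unfolding *(2) by (rule lin_sum[OF vec_space_tensor lin_comp[OF lin_theta[OF V] lin_emb[OF V]] m])
  then have "t - emb V (theta V t) = (\<Sum>i<n. tens C ?H (c i) (p i) - emb V (theta V (tens C ?H (c i) (p i))))"
    unfolding *(2) by (simp add: sum_subtractf)
  also have "\<dots> \<in> rel V"
    using rel_subspace[unfolded smul_tensor] gen * by (intro subspace_sum) simp_all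
  finally show ?thesis .
qed

lemma carr_Phi: "carr (Phi C (free C V)) = cos V ` carr (tensor C (Hom C V))"
  and smul_Phi: "smul (Phi C (free C V)) = ptmul (*)"
  by (simp_all add: Phi_def Let_def contratensor_def quotient_space_def)

lemma ctens_eq: "ctens C (right_regular C) (free C V) c p = cos V (tens C (Hom C V) c p)"
  by (simp add: ctens_def)

lemma lin_cos: "lin (tensor C (Hom C V)) (Phi C (free C V)) (cos V)"
  using lin_coset[of "tensor C (Hom C V)" "rel V"]
  by (simp add: sp_cong(6)[of "Phi C (free C V)" "quotient_space (tensor C (Hom C V)) (rel V)"]
    carr_Phi smul_Phi carr_quotient_space smul_quotient_space)

lemma vec_space_Phi: "vec_space (Phi C (free C V))"
  using vec_space_quotient_space[of "tensor C (Hom C V)" "rel V"]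
  by (simp add: sp_cong(11)[of "Phi C (free C V)" "quotient_space (tensor C (Hom C V)) (rel V)"]
    carr_Phi smul_Phi carr_quotient_space smul_quotient_space)

lemma bil_Phi_free:
  assumes V: "vec_space V"
  shows "bil C V (Phi C (free C V)) (\<lambda>c v. cos V (tens C (Hom C V) c (res C (\<lambda>d. smul V (counit C d) v))))"
  using bil_tens_comp[OF C_vs vec_space_Hom[OF V] lin_id lin_counit_smul[OF V]]
  by (auto simp: bil_def intro!: lin_comp[OF _ lin_cos])

lemma Phi_free_hom: "vec_space V \<Longrightarrow> Phi_free C V \<in> hom (tensor C V) (Phi C (free C V))"
  unfolding Phi_free_def ctens_eq by (rule tensor_lift_hom) (simp_all add: vec_space_Phi bil_Phi_free)

lemma Phi_free_apply:
  assumes V: "vec_space V" and t: "t \<in> carr (tensor C V)"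
  shows "Phi_free C V t = cos V (emb V t)"
proof (rule tensor_ext[OF C_vs V hom_lin[OF Phi_free_hom[OF V]] lin_comp[OF lin_emb[OF V] lin_cos] _ t])
  fix c v assume "c \<in> carr C" "v \<in> carr V"
  then show "Phi_free C V (tens C V c v) = cos V (emb V (tens C V c v))"
    unfolding Phi_free_def ctens_eq by (simp add: tensor_lift_tens V vec_space_Phi bil_Phi_free emb_tens)
qed

lemma cos_eq_iff: "cos V t = cos V t' \<longleftrightarrow> t - t' \<in> rel V"
  by (rule coset_eq_iff[OF vec_space_tensor rel_subspace])

lemma cos_eq_Phi_free:
  assumes V: "vec_space V" and t: "t \<in> carr (tensor C (Hom C V))"
  shows "cos V t = Phi_free C V (theta V t)"
  using emb_theta[OF V t] lin_mem[OF lin_theta[OF V] t] by (simp add: Phi_free_apply V cos_eq_iff)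

text \<open>Injectivity: \<open>theta\<close> kills the relations and is a left inverse of
  \<open>emb\<close>. Surjectivity: modulo relations every tensor lies in the image of
  \<open>emb\<close>.\<close>

lemma Phi_free_bij:
  assumes V: "vec_space V"
  shows "bij_betw (Phi_free C V) (carr (tensor C V)) (carr (Phi C (free C V)))"
  unfolding bij_betw_def
proof
  show "inj_on (Phi_free C V) (carr (tensor C V))"
  proof (rule inj_onI)
    fix t t' assume t: "t \<in> carr (tensor C V)" "t' \<in> carr (tensor C V)" and "Phi_free C V t = Phi_free C V t'"
    then have "emb V t - emb V t' \<in> rel V" by (simp add: Phi_free_apply V cos_eq_iff)
    then have "emb V (t - t') \<in> rel V" using lin_diff[OF vec_space_tensor lin_emb[OF V] t] by simp
    then have "t - t' = 0" using theta_rel(2)[OF V] theta_emb[OF V vs_diff[OF vec_space_tensor t]] by metis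
    then show "t = t'" by simp
  qed
  show "Phi_free C V ` carr (tensor C V) = carr (Phi C (free C V))"
  proof
    show "Phi_free C V ` carr (tensor C V) \<subseteq> carr (Phi C (free C V))"
      using lin_mem[OF hom_lin[OF Phi_free_hom[OF V]]] by blast
    show "carr (Phi C (free C V)) \<subseteq> Phi_free C V ` carr (tensor C V)"
      using cos_eq_Phi_free[OF V] lin_mem[OF lin_theta[OF V]] by (auto simp: carr_Phi)
  qed
qed

abbreviation Phi_inv :: "('k, 'v::ab_group_add, 't) vspace_scheme \<Rightarrow> ((('k, 'c, 'c \<Rightarrow> 'v) tensor \<Rightarrow> 'k) \<Rightarrow> 'k) \<Rightarrow> ('k, 'c, 'v) tensor" where
  "Phi_inv V \<equiv> inv_into (carr (tensor C V)) (Phi_free C V)"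

lemma lin_Phi_inv: "vec_space V \<Longrightarrow> lin (Phi C (free C V)) (tensor C V) (Phi_inv V)"
  by (rule lin_inverse[OF vec_space_tensor hom_lin[OF Phi_free_hom] Phi_free_bij])

lemma Phi_inv_Phi_free: "vec_space V \<Longrightarrow> t \<in> carr (tensor C V) \<Longrightarrow> Phi_inv V (Phi_free C V t) = t"
  using Phi_free_bij[of V] by (simp add: bij_betw_def)

lemma Phi_inv_cos: "vec_space V \<Longrightarrow> t \<in> carr (tensor C (Hom C V)) \<Longrightarrow> Phi_inv V (cos V t) = theta V t"
  by (simp add: cos_eq_Phi_free Phi_inv_Phi_free lin_mem[OF lin_theta])

text \<open>Cosets of pure tensors span \<open>Phi\<close>. This provides the uniqueness in the
  definite descriptions of its coaction and of \<open>Phi_map\<close>.\<close>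

lemma Phi_ext:
  assumes V: "vec_space V" and g: "g \<in> hom (Phi C (free C V)) X" and h: "h \<in> hom (Phi C (free C V)) X"
    and eq: "\<And>c p. c \<in> carr C \<Longrightarrow> p \<in> hom C V \<Longrightarrow> g (cos V (tens C (Hom C V) c p)) = h (cos V (tens C (Hom C V) c p))"
  shows "g = h"
proof (rule hom_eqI[OF g h])
  fix q assume "q \<in> carr (Phi C (free C V))"
  then obtain t where t: "t \<in> carr (tensor C (Hom C V))" "q = cos V t" by (auto simp: carr_Phi)
  show "g q = h q"
    unfolding t(2)
    by (rule tensor_ext[OF C_vs vec_space_Hom[OF V] lin_comp[OF lin_cos hom_lin[OF g]] lin_comp[OF lin_cos hom_lin[OF h]] _ t(1)])
       (simp add: eq)
qed

text \<open>The specification in \<open>Phi\<close> is met by the coaction of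
  \<open>cofree C V\<close> transported along \<open>Phi_free\<close>: through \<open>theta\<close>
  the required formula becomes the statement that \<open>Psi_cofree C V p\<close> is a comodule
  morphism.\<close>

lemma coact_Phi:
  assumes V: "vec_space V"
  shows "coact (Phi C (free C V)) = res (Phi C (free C V))
    (\<lambda>q. tensor_map C (tensor C V) C (Phi C (free C V)) (\<lambda>c. c) (Phi_free C V) (coact (cofree C V) (Phi_inv V q)))"
    (is "_ = ?h")
proof -
  let ?P = "Phi C (free C V)" and ?H = "Hom C V" and ?M = "tensor C V"
  let ?Q = "contratensor C (right_regular C) (free C V)"
  have Q: "carr ?Q = carr ?P" "smul ?Q = smul ?P" by (simp_all add: Phi_def Let_def)
  note Q_sp = sp_cong[OF Q] tensor_lift_sp_cong[OF Q]
  let ?spec = "\<lambda>h. h \<in> hom ?P (tensor C ?P) \<and> (\<forall>c\<in>carr C. \<forall>p\<in>hom C V.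
    h (cos V (tens C ?H c p)) = sw (tensor C ?P) (\<lambda>d e. tens C ?P d (cos V (tens C ?H e p))) c)"
  have "coact ?P = (THE h. h \<in> hom ?Q (tensor C ?Q) \<and> (\<forall>c\<in>carr C. \<forall>p\<in>hom C V.
      h (cos V (tens C ?H c p)) = sw (tensor C ?Q) (\<lambda>d e. tens C ?Q d (cos V (tens C ?H e p))) c))"
    by (simp add: Phi_def Let_def ctens_eq sw_def)
  also have "\<dots> = (THE h. ?spec h)"
    by (simp only: Q_sp)
  also have "(THE h. ?spec h) = ?h"
  proof (rule the_equality)
    have tl: "lin (tensor C ?M) (tensor C ?P) (tensor_map C ?M C ?P (\<lambda>c. c) (Phi_free C V))"
      by (rule hom_lin, rule tensor_map_hom) (simp_all add: vec_space_Phi lin_id hom_lin Phi_free_hom V)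
    have l: "lin ?P (tensor C ?P) (\<lambda>q. tensor_map C ?M C ?P (\<lambda>c. c) (Phi_free C V) (coact (cofree C V) (Phi_inv V q)))"
      by (rule lin_comp[OF lin_coact_cofree[OF V lin_Phi_inv[OF V]] tl])
    show h: "?spec ?h"
    proof (intro conjI ballI)
      show "?h \<in> hom ?P (tensor C ?P)" by (rule res_hom[OF vec_space_Phi l])
      fix c p assume c: "c \<in> carr C" and p: "p \<in> hom C V"
      have T: "tens C ?H c p \<in> carr (tensor C ?H)" if "c \<in> carr C" for c
        by (rule tens_mem) (simp_all add: vec_space_Hom V that p)
      let ?p = "Psi_cofree C V p"
      have pl: "lin C ?M ?p" and pc: "coact (cofree C V) (?p c) = sw (tensor C ?M) (\<lambda>a b. tens C ?M a (?p b)) c"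
        using comodule_homD(2,3)[OF Psi_cofree_comodule_hom[OF V p]] c by (simp_all add: tensor_map_comult)
      have th: "theta V (tens C ?H d p) = ?p d" if "d \<in> carr C" for d
        using that by (simp add: theta_tens V p Psi_cofree_apply res_apply)
      have "?h (cos V (tens C ?H c p)) = tensor_map C ?M C ?P (\<lambda>c. c) (Phi_free C V) (coact (cofree C V) (?p c))"
        using lin_mem[OF lin_cos T[OF c]] by (simp add: res_apply Phi_inv_cos V T c th)
      also have "\<dots> = sw (tensor C ?P) (\<lambda>a b. tensor_map C ?M C ?P (\<lambda>c. c) (Phi_free C V) (tens C ?M a (?p b))) c"
        unfolding pc by (rule sw_comp[OF _ _ bil_tens_hom[OF _ pl] tl c]) simp_all
      also have "\<dots> = sw (tensor C ?P) (\<lambda>d e. tens C ?P d (cos V (tens C ?H e p))) c"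
        by (rule sw_cong)
           (simp add: tensor_map_tens vec_space_Phi lin_id hom_lin[OF Phi_free_hom] V lin_mem[OF pl] cos_eq_Phi_free T th)
      finally show "?h (cos V (tens C ?H c p)) = sw (tensor C ?P) (\<lambda>d e. tens C ?P d (cos V (tens C ?H e p))) c" .
    qed
    show "h = ?h" if "?spec h" for h
      by (rule Phi_ext[OF V]) (use that h in auto)
  qed
  finally show ?thesis .
qed

lemma coact_Phi_free:
  assumes V: "vec_space V" and t: "t \<in> carr (tensor C V)"
  shows "coact (Phi C (free C V)) (Phi_free C V t)
    = tensor_map C (tensor C V) C (Phi C (free C V)) (\<lambda>c. c) (Phi_free C V) (coact (cofree C V) t)"
  using lin_mem[OF hom_lin[OF Phi_free_hom[OF V]] t] by (simp add: coact_Phi V res_apply Phi_inv_Phi_free t)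

lemma coact_Phi_hom:
  assumes V: "vec_space V"
  shows "coact (Phi C (free C V)) \<in> hom (Phi C (free C V)) (tensor C (Phi C (free C V)))"
proof -
  have tl: "lin (tensor C (tensor C V)) (tensor C (Phi C (free C V))) (tensor_map C (tensor C V) C (Phi C (free C V)) (\<lambda>c. c) (Phi_free C V))"
    by (rule hom_lin, rule tensor_map_hom) (simp_all add: vec_space_Phi lin_id hom_lin Phi_free_hom V)
  show ?thesis
    unfolding coact_Phi[OF V] by (rule res_hom[OF vec_space_Phi lin_comp[OF lin_coact_cofree[OF V lin_Phi_inv[OF V]] tl]])
qed

lemma comodule_Phi:
  assumes V: "vec_space V"
  shows "comodule C (Phi C (free C V))"
  by (rule comodule_transfer[OF comodule_cofree[OF V] vec_space_Phi coact_Phi_hom[OF V], where f = "Phi_free C V"])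
     (simp_all add: hom_lin[OF Phi_free_hom[OF V]] Phi_free_bij V coact_Phi_free)

lemma Phi_free_comodule_hom:
  assumes V: "vec_space V"
  shows "Phi_free C V \<in> comodule_hom C (cofree C V) (Phi C (free C V))"
  by (simp add: comodule_hom_def Phi_free_hom V coact_Phi_free)

text \<open>The premise \<open>eq\<close> says that \<open>d\<close> corresponds under
  \<open>theta\<close> to \<open>c \<otimes> p \<mapsto> c \<otimes> f p\<close>, so the conjugate
  of \<open>d\<close> by \<open>Phi_free\<close> fulfils the definite description of
  \<open>Phi_map\<close>.\<close>

lemma Phi_map_eq:
  assumes V: "vec_space V" and U: "vec_space U" and d: "lin (tensor C V) (tensor C U) d"
    and f: "\<And>p. p \<in> hom C V \<Longrightarrow> f p \<in> hom C U"
    and eq: "\<And>c p. c \<in> carr C \<Longrightarrow> p \<in> hom C V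
      \<Longrightarrow> d (sw (tensor C V) (\<lambda>a b. tens C V a (p b)) c) = sw (tensor C U) (\<lambda>a b. tens C U a (f p b)) c"
  shows "Phi_map C (free C V) (free C U) f = res (Phi C (free C V)) (\<lambda>q. Phi_free C U (d (Phi_inv V q)))"
    (is "_ = ?h")
proof -
  let ?spec = "\<lambda>h. h \<in> hom (Phi C (free C V)) (Phi C (free C U)) \<and> (\<forall>c\<in>carr C. \<forall>p\<in>hom C V.
     h (cos V (tens C (Hom C V) c p)) = cos U (tens C (Hom C U) c (f p)))"
  have "Phi_map C (free C V) (free C U) f = (THE h. ?spec h)"
    by (simp add: Phi_map_def ctens_eq)
  also have "\<dots> = ?h"
  proof (rule the_equality)
    show h: "?spec ?h"
    proof (intro conjI ballI)
      show "?h \<in> hom (Phi C (free C V)) (Phi C (free C U))"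
        by (rule res_hom[OF vec_space_Phi lin_comp[OF lin_comp[OF lin_Phi_inv[OF V] d] hom_lin[OF Phi_free_hom[OF U]]]])
      fix c p assume c: "c \<in> carr C" and p: "p \<in> hom C V"
      have T: "tens C (Hom C V) c p \<in> carr (tensor C (Hom C V))" "tens C (Hom C U) c (f p) \<in> carr (tensor C (Hom C U))"
        by (rule tens_mem; simp add: vec_space_Hom V U c p f)+
      have m: "sw (tensor C V) (\<lambda>a b. tens C V a (p b)) c \<in> carr (tensor C V)"
        by (rule sw_mem[OF _ bil_tens_hom[OF V hom_lin[OF p]] c]) simp
      show "?h (cos V (tens C (Hom C V) c p)) = cos U (tens C (Hom C U) c (f p))"
        using lin_mem[OF lin_cos T(1)]
        by (simp add: res_apply cos_eq_Phi_free V U T theta_tens c p f eq Phi_inv_Phi_free m)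
    qed
    show "h = ?h" if "?spec h" for h
      by (rule Phi_ext[OF V]) (use that h in auto)
  qed
  finally show ?thesis .
qed

end

section \<open>Permutations as products of adjacent transpositions\<close>

text \<open>\<open>asw j\<close> exchanges the letters at the positions \<open>j\<close> and \<open>j + 1\<close>; it fixes words that are too short.\<close>

fun asw :: "nat \<Rightarrow> 'a list \<Rightarrow> 'a list" where
  "asw 0 (x # y # zs) = y # x # zs"
| "asw (Suc j) (x # zs) = x # asw j zs"
| "asw _ zs = zs"

lemma length_asw [simp]: "length (asw j zs) = length zs"
  by (induction j zs rule: asw.induct) auto

lemma length_foldr_asw [simp]: "length (foldr asw js zs) = length zs"
  by (induction js) auto

lemma map_asw: "map f (asw j zs) = asw j (map f zs)"
  by (induction j zs rule: asw.induct) auto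

lemma map_foldr_asw: "map f (foldr asw js zs) = foldr asw js (map f zs)"
  by (induction js) (auto simp: map_asw)

lemma foldr_asw_Suc: "foldr asw (map Suc js) (x # zs) = x # foldr asw js zs"
  by (induction js) auto

lemma asw_short: "length zs \<le> Suc j \<Longrightarrow> asw j zs = zs"
  by (induction j zs rule: asw.induct) auto

lemma nth_asw: "Suc j < length zs \<Longrightarrow> i < length zs \<Longrightarrow> asw j zs ! i = zs ! Transposition.transpose j (Suc j) i"
proof (induction j zs arbitrary: i rule: asw.induct)
  case (1 x y zs)
  then show ?case by (cases i; cases "i - 1") (auto simp: Transposition.transpose_def)
next
  case (2 j x zs)
  then show ?case by (cases i) (auto simp: Transposition.transpose_def)
qed auto

lemma asw_move: "\<exists>js. foldr asw js (a @ y # b) = y # a @ b"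
proof (induction a)
  case Nil
  show ?case by (intro exI[of _ "[]"]) simp
next
  case (Cons x a)
  then obtain js where "foldr asw js (a @ y # b) = y # a @ b" by blast
  then have "foldr asw (0 # map Suc js) ((x # a) @ y # b) = y # (x # a) @ b"
    by (simp add: foldr_asw_Suc)
  then show ?case by blast
qed

text \<open>As in insertion sort: the first letter of the target is moved to the front, and the
  tails are matched recursively by swaps shifted by one position.\<close>

lemma mset_eq_asw: "mset xs = mset ys \<Longrightarrow> \<exists>js. foldr asw js xs = ys"
proof (induction ys arbitrary: xs)
  case Nil
  then show ?case by (intro exI[of _ "[]"]) simp
next
  case (Cons y ys)
  then obtain a b where xs: "xs = a @ y # b"
    by (metis list.set_intros(1) set_mset_mset split_list)
  obtain js where js: "foldr asw js xs = y # a @ b" using asw_move[of a y b] unfolding xs by blast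
  have "mset (a @ b) = mset ys" using Cons.prems by (simp add: xs)
  then obtain js' where "foldr asw js' (a @ b) = ys" using Cons.IH by blast
  then have "foldr asw (map Suc js' @ js) xs = y # ys" by (simp add: js foldr_asw_Suc)
  then show ?case by blast
qed

text \<open>A map that only moves positions is determined by what it does to the word
  \<open>[0..<n]\<close> of positions. Swaps commute with \<open>map\<close>, so one sequence of
  swaps found for that word works for all words of length \<open>n\<close>.\<close>

lemma natural_asw:
  fixes f :: "nat list \<Rightarrow> nat list"
  assumes "mset (f [0..<n]) = mset [0..<n]"
    and nat: "\<And>ws :: 'a list. length ws = n \<Longrightarrow> g ws = map ((!) ws) (f [0..<n])"
  shows "\<exists>js. \<forall>ws :: 'a list. length ws = n \<longrightarrow> g ws = foldr asw js ws"
proof -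
  obtain js where js: "foldr asw js [0..<n] = f [0..<n]" using mset_eq_asw assms(1) by metis
  have "g ws = foldr asw js ws" if "length ws = n" for ws :: "'a list"
    using nat[OF that] that map_nth[of ws] by (simp add: js[symmetric] map_foldr_asw)
  then show ?thesis by blast
qed

lemma permute_list_asw:
  assumes "p permutes {..<n}"
  shows "\<exists>js. \<forall>ws :: 'a list. length ws = n \<longrightarrow> permute_list p ws = foldr asw js ws"
proof (rule natural_asw[where f = "permute_list p"])
  show "mset (permute_list p [0..<n]) = mset [0..<n]" using assms by simp
  show "permute_list p ws = map ((!) ws) (permute_list p [0..<n])" if "length ws = n" for ws :: "'a list"
    using permute_list_map[of p "[0..<n]" "(!) ws"] assms that map_nth[of ws] by simp
qed

lemma rotate1_asw: "\<exists>js. \<forall>ws :: 'a list. length ws = n \<longrightarrow> rotate1 ws = foldr asw js ws"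
proof (rule natural_asw[where f = rotate1])
  show "rotate1 ws = map ((!) ws) (rotate1 [0..<n])" if "length ws = n" for ws :: "'a list"
    using that map_nth[of ws] by (metis rotate1_map)
qed (cases "[0..<n]"; simp)

section \<open>The tensor coalgebra\<close>

lemma tens_smul_cong: "smul V = smul V' \<Longrightarrow> smul U = smul U' \<Longrightarrow> tens V U = tens V' U'"
  by (simp add: tens_def[abs_def])

locale words =
  fixes s :: "'k::field \<Rightarrow> 'w::ab_group_add \<Rightarrow> 'w"
  assumes vs: "vector_space s"
begin

abbreviation "W \<equiv> whole s"
abbreviation "T \<equiv> tensor_coalgebra s"

text \<open>Multilinear on words of all lengths at once, as the tensor coalgebra is a single span
  over all words. Linearity in a letter yields values in \<open>carr X\<close> for nonempty words
  only, hence the clause for \<open>[]\<close>.\<close>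

definition mlin :: "('k, 'x::ab_group_add, 't) vspace_scheme \<Rightarrow> ('w list \<Rightarrow> 'x) \<Rightarrow> bool" where
  "mlin X f \<longleftrightarrow> f [] \<in> carr X \<and> (\<forall>xs ys. lin W X (\<lambda>w. f (xs @ w # ys)))"

definition wlift :: "('k, 'x::ab_group_add, 't) vspace_scheme \<Rightarrow> ('w list \<Rightarrow> 'x) \<Rightarrow> ('k, 'w) words \<Rightarrow> 'x" where
  "wlift X f = (THE g. g \<in> hom T X \<and> (\<forall>ws. g (word s ws) = f ws))"

lemma W_vs [simp]: "vec_space W"
  by (rule vec_space_whole[OF vs])

lemma carr_T: "carr T = module.span (ptmul (*)) (range (word s))" and smul_T: "smul T = ptmul (*)"
  by (simp_all add: tensor_coalgebra_def Let_def)

lemma T_vs [simp]: "vec_space T"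
  using vec_space_span_functions[of "range (word s)"]
  by (simp add: sp_cong(11)[of T "\<lparr>carr = module.span (ptmul (*)) (range (word s)), smul = ptmul (*)\<rparr>"] carr_T smul_T)

lemma word_mem [simp]: "word s ws \<in> carr T"
proof -
  interpret vector_space "ptmul ((*) :: 'k \<Rightarrow> 'k \<Rightarrow> 'k)" using vector_space_functions by simp
  show ?thesis unfolding carr_T by (rule span_base) simp
qed

lemma lin_word: "lin W T (\<lambda>w. word s (xs @ w # ys))"
  by (rule linI) (simp add: word_mem,
      auto simp: smul_T word_def fun_eq_iff multilinear_form_def Vector_Spaces.linear_iff)

lemma mlin_mem: "mlin X f \<Longrightarrow> f ws \<in> carr X"
proof (cases ws)
  case (Cons w vs)
  assume "mlin X f"
  then have "lin W X (\<lambda>w. f ([] @ w # vs))" by (simp add: mlin_def del: append_Nil)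
  then show ?thesis using Cons by (simp add: lin_def)
qed (simp add: mlin_def)

lemma mlin_lin: "mlin X f \<Longrightarrow> lin W X (\<lambda>w. f (xs @ w # ys))"
  by (simp add: mlin_def)

lemma mlin_word: "mlin T (word s)"
  by (simp add: mlin_def lin_word)

lemma wlift_spec:
  assumes X: "vec_space X" and f: "mlin X f"
  shows "wlift X f \<in> hom T X \<and> (\<forall>ws. wlift X f (word s ws) = f ws)"
proof -
  let ?T = "\<lparr>carr = module.span (ptmul (*)) (range (word s)), smul = ptmul ((*) :: 'k \<Rightarrow> 'k \<Rightarrow> 'k)\<rparr>"
  have "\<exists>!g. g \<in> hom ?T X \<and> (\<forall>ws\<in>UNIV. g (word s ws) = f ws)"
  proof (rule evaluation_span_universal[OF X mlin_mem[OF f]])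
    fix l assume l: "Vector_Spaces.linear (smul X) (*) l"
    have "multilinear_form s (\<lambda>ws. l (f ws))"
      unfolding multilinear_form_def
    proof (intro allI)
      fix xs ys
      show "Vector_Spaces.linear s (*) (\<lambda>w. l (f (xs @ w # ys)))"
        using mlin_lin[OF f, of xs ys] l vs by (simp add: Vector_Spaces.linear_iff lin_def)
    qed
    then show "\<exists>\<phi>. \<forall>ws\<in>UNIV. word s ws \<phi> = l (f ws)"
      by (intro exI[of _ "\<lambda>ws. l (f ws)"]) (simp add: word_def)
  qed
  moreover have "hom ?T X = hom T X" by (rule sp_cong(7)) (simp_all add: carr_T smul_T)
  ultimately have "\<exists>!g. g \<in> hom T X \<and> (\<forall>ws. g (word s ws) = f ws)" by simp
  from theI'[OF this] show ?thesis by (simp add: wlift_def)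
qed

lemma wlift_hom: "vec_space X \<Longrightarrow> mlin X f \<Longrightarrow> wlift X f \<in> hom T X"
  using wlift_spec by blast

lemma lin_wlift: "vec_space X \<Longrightarrow> mlin X f \<Longrightarrow> lin T X (wlift X f)"
  by (rule hom_lin[OF wlift_hom])

lemma wlift_word: "vec_space X \<Longrightarrow> mlin X f \<Longrightarrow> wlift X f (word s ws) = f ws"
  using wlift_spec by blast

lemma T_induct:
  assumes "t \<in> carr T" "P 0" "\<And>c ws t. t \<in> carr T \<Longrightarrow> P t \<Longrightarrow> P (smul T c (word s ws) + t)"
  shows "P t"
proof -
  interpret vector_space "ptmul ((*) :: 'k \<Rightarrow> 'k \<Rightarrow> 'k)" using vector_space_functions by simp
  have "t \<in> span (range (word s))" using assms(1) by (simp add: carr_T)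
  then have "t \<in> carr T \<and> P t"
  proof (rule span_induct_alt)
    show "0 \<in> carr T \<and> P 0" using assms(2) by simp
    fix c x y assume "x \<in> range (word s)" and y: "y \<in> carr T \<and> P y"
    then obtain ws where "x = word s ws" by blast
    then show "(\<lambda>f. c * x f) + y \<in> carr T \<and> P ((\<lambda>f. c * x f) + y)"
      using y assms(3)[of y c ws] vs_add[OF T_vs vs_scale[OF T_vs word_mem[of ws], of c], of y] by (simp add: smul_T)
  qed
  then show ?thesis ..
qed

lemma T_ext:
  assumes g: "lin T X g" and h: "lin T Y h" and X: "vec_space X" and eq: "\<And>ws. g (word s ws) = h (word s ws)" and t: "t \<in> carr T"
    and sm: "smul X = smul Y"
  shows "g t = h t"
proof (rule T_induct[OF t])
  show "g 0 = h 0" using lin_zero[OF T_vs g] lin_zero[OF T_vs h] by simp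
  fix c ws t assume "t \<in> carr T" "g t = h t"
  then show "g (smul T c (word s ws) + t) = h (smul T c (word s ws) + t)"
    using lin_add[OF g, of "smul T c (word s ws)" t] lin_add[OF h, of "smul T c (word s ws)" t]
      vs_scale[OF T_vs word_mem] lin_scale[OF g word_mem] lin_scale[OF h word_mem] eq sm by simp
qed

lemma lin_wlift_param:
  assumes X: "vec_space X" and Y: "vec_space Y" and t: "t \<in> carr T"
    and f: "\<And>y. y \<in> carr Y \<Longrightarrow> mlin X (f y)" and p: "\<And>ws. lin Y X (\<lambda>y. f y ws)"
  shows "lin Y X (\<lambda>y. wlift X (f y) t)"
proof (rule T_induct[OF t])
  show "lin Y X (\<lambda>y. wlift X (f y) 0)"
    by (rule lin_congI[OF _ Y lin_const_0[OF X]]) (simp add: lin_zero[OF T_vs lin_wlift[OF X f]])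
next
  fix c ws t assume step: "t \<in> carr T" "lin Y X (\<lambda>y. wlift X (f y) t)"
  show "lin Y X (\<lambda>y. wlift X (f y) (smul T c (word s ws) + t))"
  proof (rule lin_congI[OF _ Y])
    show "lin Y X (\<lambda>y. smul X c (f y ws) + wlift X (f y) t)"
      by (intro lin_plus X lin_smul_right p step)
    show "wlift X (f y) (smul T c (word s ws) + t) = smul X c (f y ws) + wlift X (f y) t" if "y \<in> carr Y" for y
      using lin_add[OF lin_wlift[OF X f[OF that]] vs_scale[OF T_vs word_mem] step(1)]
        lin_scale[OF lin_wlift[OF X f[OF that]] word_mem] wlift_word[OF X f[OF that]] by simp
  qed
qed

text \<open>Rearrangements of words are those maps that move each letter to a place independent of the letter.\<close>

definition rearr :: "('w list \<Rightarrow> 'w list) \<Rightarrow> bool" where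
  "rearr \<sigma> \<longleftrightarrow> (\<forall>xs ys. \<exists>xs' ys'. \<forall>w. \<sigma> (xs @ w # ys) = xs' @ w # ys')"

lemma rearr_comp: "rearr \<sigma> \<Longrightarrow> rearr \<tau> \<Longrightarrow> rearr (\<lambda>ws. \<sigma> (\<tau> ws))"
  unfolding rearr_def by metis

lemma rearr_asw: "rearr (asw j)"
  unfolding rearr_def
proof (intro allI)
  fix xs ys :: "'w list"
  show "\<exists>xs' ys'. \<forall>w. asw j (xs @ w # ys) = xs' @ w # ys'"
  proof (induction j arbitrary: xs)
    case 0
    show ?case
    proof (cases xs)
      case Nil
      then show ?thesis
        by (cases ys) (simp_all, rule exI[of _ "[]"], simp, metis append_Cons append_Nil)
    next
      case (Cons x xs')
      then show ?thesis
        by (cases xs') (simp_all, metis append_Nil, metis append_Cons)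
    qed
  next
    case (Suc j)
    show ?case
    proof (cases xs)
      case Nil
      then show ?thesis by (intro exI[of _ "[]"] exI[of _ "asw j ys"]) simp
    next
      case (Cons x xs')
      obtain us vs where "\<forall>w. asw j (xs' @ w # ys) = us @ w # vs" using Suc by blast
      then show ?thesis using Cons by (intro exI[of _ "x # us"] exI[of _ vs]) simp
    qed
  qed
qed

lemma mlin_rearr: "mlin X f \<Longrightarrow> rearr \<sigma> \<Longrightarrow> mlin X (\<lambda>ws. f (\<sigma> ws))"
  unfolding mlin_def[of X "\<lambda>ws. f (\<sigma> ws)"]
proof (intro conjI allI)
  fix xs ys assume f: "mlin X f" and "rearr \<sigma>"
  then obtain xs' ys' where "\<forall>w. \<sigma> (xs @ w # ys) = xs' @ w # ys'" unfolding rearr_def by blast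
  then show "lin W X (\<lambda>w. f (\<sigma> (xs @ w # ys)))" using mlin_lin[OF f] by simp
qed (rule mlin_mem)

text \<open>Acts on all degrees at once, whereas \<open>permute_tensor\<close> is a definite
  description for each degree separately; \<open>permute_tensor_wop\<close> compares the
  two.\<close>

definition wop :: "('w list \<Rightarrow> 'w list) \<Rightarrow> ('k, 'w) words \<Rightarrow> ('k, 'w) words" where
  "wop \<sigma> = wlift T (\<lambda>ws. word s (\<sigma> ws))"

lemma lin_wop: "rearr \<sigma> \<Longrightarrow> lin T T (wop \<sigma>)"
  unfolding wop_def by (intro lin_wlift T_vs mlin_rearr[OF mlin_word])

lemma wop_word: "rearr \<sigma> \<Longrightarrow> wop \<sigma> (word s ws) = word s (\<sigma> ws)"
  unfolding wop_def by (rule wlift_word[OF T_vs mlin_rearr[OF mlin_word]])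

lemma wop_comp: "rearr \<sigma> \<Longrightarrow> rearr \<tau> \<Longrightarrow> t \<in> carr T \<Longrightarrow> wop \<sigma> (wop \<tau> t) = wop (\<lambda>ws. \<sigma> (\<tau> ws)) t"
  by (rule T_ext[OF lin_comp[OF lin_wop lin_wop] lin_wop[OF rearr_comp] T_vs])
     (simp_all add: wop_word rearr_comp)

lemma rearr_foldr_asw: "rearr (foldr asw js)"
proof (induction js)
  case Nil
  show ?case unfolding rearr_def by auto
next
  case (Cons j js)
  then show ?case using rearr_comp[OF rearr_asw[of j] Cons] by (simp add: comp_def)
qed

lemma wop_foldr_asw:
  assumes t: "t \<in> carr T" and fx: "\<And>j. wop (asw j) t = t"
  shows "wop (foldr asw js) t = t"
proof (induction js)
  case Nil
  show ?case
    by (rule T_ext[OF lin_wop[OF rearr_foldr_asw] lin_id T_vs _ t]) (simp_all add: wop_word rearr_foldr_asw[of "[]", simplified])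
next
  case (Cons j js)
  then show ?case
    using wop_comp[OF rearr_asw[of j] rearr_foldr_asw[of js] t] fx by (simp add: comp_def)
qed

lemma mlin_length: "mlin X f \<Longrightarrow> vec_space X \<Longrightarrow> mlin X (\<lambda>ws. if P (length ws) then f ws else 0)"
  unfolding mlin_def[of X "\<lambda>ws. if P (length ws) then f ws else 0"]
proof (intro conjI allI)
  fix xs ys assume f: "mlin X f" and X: "vec_space X"
  show "lin W X (\<lambda>w. if P (length (xs @ w # ys)) then f (xs @ w # ys) else 0)"
    using mlin_lin[OF f, of xs ys] lin_const_0[OF X] by (cases "P (Suc (length xs + length ys))") simp_all
qed (auto simp: mlin_def)

section \<open>Homogeneous components\<close>

definition hcomp :: "nat \<Rightarrow> ('k, 'w) words \<Rightarrow> ('k, 'w) words" where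
  "hcomp n = wlift T (\<lambda>ws. if length ws = n then word s ws else 0)"

lemma lin_hcomp: "lin T T (hcomp n)"
  unfolding hcomp_def by (rule lin_wlift[OF T_vs mlin_length[OF mlin_word T_vs]])

lemma hcomp_word: "hcomp n (word s ws) = (if length ws = n then word s ws else 0)"
  unfolding hcomp_def by (rule wlift_word[OF T_vs mlin_length[OF mlin_word T_vs]])

lemma carr_tensor_power: "carr (tensor_power s n) = module.span (ptmul (*)) (word s ` {ws. length ws = n})"
  and smul_tensor_power: "smul (tensor_power s n) = smul T"
  by (simp_all add: tensor_power_def smul_T)

lemma vec_space_tensor_power [simp]: "vec_space (tensor_power s n)"
  unfolding tensor_power_def by (rule vec_space_span_functions)

lemma tensor_power_T: "carr (tensor_power s n) \<subseteq> carr T"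
proof -
  interpret vector_space "ptmul ((*) :: 'k \<Rightarrow> 'k \<Rightarrow> 'k)" using vector_space_functions by simp
  show ?thesis unfolding carr_tensor_power carr_T by (rule span_mono) auto
qed

lemma word_tensor_power: "length ws = n \<Longrightarrow> word s ws \<in> carr (tensor_power s n)"
proof -
  interpret vector_space "ptmul ((*) :: 'k \<Rightarrow> 'k \<Rightarrow> 'k)" using vector_space_functions by simp
  show "length ws = n \<Longrightarrow> ?thesis" unfolding carr_tensor_power by (rule span_base) simp
qed

lemma hcomp_mem:
  assumes "t \<in> carr T"
  shows "hcomp n t \<in> carr (tensor_power s n)"
proof (rule T_induct[OF assms])
  show "hcomp n 0 \<in> carr (tensor_power s n)" using lin_zero[OF T_vs lin_hcomp] by simp
  fix c ws t assume step: "t \<in> carr T" "hcomp n t \<in> carr (tensor_power s n)"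
  have "hcomp n (smul T c (word s ws) + t) = smul (tensor_power s n) c (hcomp n (word s ws)) + hcomp n t"
    using lin_add[OF lin_hcomp vs_scale[OF T_vs word_mem] step(1)] lin_scale[OF lin_hcomp word_mem]
    by (simp add: smul_tensor_power)
  then show "hcomp n (smul T c (word s ws) + t) \<in> carr (tensor_power s n)"
    using step(2) by (simp add: hcomp_word vs_add vs_scale word_tensor_power)
qed

text \<open>The identity is claimed for all larger \<open>M\<close>, so that the bounds for two
  tensors can be merged by taking their maximum, as in \<open>wop_rotate1_C\<close>.\<close>

lemma sum_hcomp:
  assumes "t \<in> carr T"
  shows "\<exists>N. \<forall>M\<ge>N. t = (\<Sum>n<M. hcomp n t)"
proof (rule T_induct[OF assms])
  show "\<exists>N. \<forall>M\<ge>N. 0 = (\<Sum>n<M. hcomp n 0)" using lin_zero[OF T_vs lin_hcomp] by simp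
  fix c ws t assume step: "t \<in> carr T" "\<exists>N. \<forall>M\<ge>N. t = (\<Sum>n<M. hcomp n t)"
  then obtain N where N: "\<forall>M\<ge>N. t = (\<Sum>n<M. hcomp n t)" by blast
  have "smul T c (word s ws) + t = (\<Sum>n<M. hcomp n (smul T c (word s ws) + t))" if M: "M \<ge> max N (Suc (length ws))" for M
  proof -
    have "(\<Sum>n<M. hcomp n (smul T c (word s ws) + t)) = (\<Sum>n<M. smul T c (hcomp n (word s ws))) + (\<Sum>n<M. hcomp n t)"
      using lin_add[OF lin_hcomp vs_scale[OF T_vs word_mem] step(1)] lin_scale[OF lin_hcomp word_mem]
      by (simp add: sum.distrib)
    also have "(\<Sum>n<M. smul T c (hcomp n (word s ws))) = (\<Sum>n<M. if n = length ws then smul T c (word s ws) else 0)"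
      by (rule sum.cong) (auto simp: hcomp_word vs_scale_zero[OF T_vs])
    also have "\<dots> = smul T c (word s ws)" using M by simp
    also have "(\<Sum>n<M. hcomp n t) = t" using N M by simp
    finally show ?thesis by (rule sym)
  qed
  then show "\<exists>N. \<forall>M\<ge>N. smul T c (word s ws) + t = (\<Sum>n<M. hcomp n (smul T c (word s ws) + t))" by blast
qed

section \<open>The symmetric coalgebra\<close>

abbreviation "C \<equiv> Sym s"

lemma carr_C: "carr C = module.span (ptmul (*)) (\<Union>n. symmetric_tensors s n)"
  and smul_C: "smul C = smul T"
  and comult_C: "comult C = res C (comult T)"
  and counit_C: "counit C = res C (counit T)"
  by (simp_all add: Sym_def Let_def smul_T res_def fun_eq_iff)

lemma tensor_power_ext:
  assumes g: "lin (tensor_power s n) T g" and h: "lin (tensor_power s n) T h"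
    and eq: "\<And>ws. length ws = n \<Longrightarrow> g (word s ws) = h (word s ws)" and t: "t \<in> carr (tensor_power s n)"
  shows "g t = h t"
proof -
  interpret vector_space "ptmul ((*) :: 'k \<Rightarrow> 'k \<Rightarrow> 'k)" using vector_space_functions by simp
  let ?E = "{t \<in> carr (tensor_power s n). g t - h t = 0}"
  have "subspace ?E"
    using kernel_subspace[OF vec_space_tensor_power T_vs lin_minus[OF T_vs g h]] by (simp add: smul_tensor_power smul_T)
  then have "span (word s ` {ws. length ws = n}) \<subseteq> ?E"
    by (intro span_minimal) (auto simp: eq word_tensor_power)
  then show ?thesis using t by (auto simp: carr_tensor_power)
qed

text \<open>\<open>\<sigma>\<close> is defined on all words but compared with the permutation on
  length \<open>n\<close> only. Since it preserves lengths, \<open>wop \<sigma>\<close> maps the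
  component of degree \<open>n\<close> to itself and satisfies the definite description.\<close>

lemma permute_tensor_wop:
  assumes \<sigma>: "rearr \<sigma>" and len: "\<And>ws. length (\<sigma> ws) = length ws"
    and eq: "\<And>ws. length ws = n \<Longrightarrow> permute_list p ws = \<sigma> ws" and t: "t \<in> carr (tensor_power s n)"
  shows "permute_tensor s n p t = wop \<sigma> t"
proof -
  let ?P = "tensor_power s n"
  have lT: "lin ?P T f" if "lin ?P ?P f" for f
    using that tensor_power_T by (auto simp: lin_def smul_tensor_power)
  have lP: "lin ?P T (wop \<sigma>)"
    using lin_wop[OF \<sigma>] tensor_power_T[of n] unfolding lin_def smul_tensor_power by blast
  interpret vector_space "ptmul ((*) :: 'k \<Rightarrow> 'k \<Rightarrow> 'k)" using vector_space_functions by simp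
  have mem: "wop \<sigma> t \<in> carr ?P" if "t \<in> carr ?P" for t
  proof -
    have t: "t \<in> carr T" using that tensor_power_T by blast
    have "hcomp n (wop \<sigma> t) = wop \<sigma> t"
      by (rule tensor_power_ext[OF lin_comp[OF lP lin_hcomp] lP _ that]) (simp add: wop_word \<sigma> hcomp_word len)
    then show ?thesis using hcomp_mem[OF lin_mem[OF lin_wop[OF \<sigma>] t], of n] by simp
  qed
  have "permute_tensor s n p = res ?P (wop \<sigma>)"
    unfolding permute_tensor_def
  proof (rule the_equality)
    have "lin ?P ?P (wop \<sigma>)" using lP mem by (simp add: lin_def smul_tensor_power)
    then show spec: "res ?P (wop \<sigma>) \<in> hom ?P ?P \<and> (\<forall>ws. length ws = n \<longrightarrow> res ?P (wop \<sigma>) (word s ws) = word s (permute_list p ws))"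
      by (auto simp: res_hom res_apply word_tensor_power wop_word \<sigma> eq)
    fix f assume f: "f \<in> hom ?P ?P \<and> (\<forall>ws. length ws = n \<longrightarrow> f (word s ws) = word s (permute_list p ws))"
    show "f = res ?P (wop \<sigma>)"
    proof (rule hom_eqI)
      show "f t = res ?P (wop \<sigma>) t" if "t \<in> carr ?P" for t
        by (rule tensor_power_ext[OF lT lT _ that]) (use f spec in \<open>auto simp: hom_lin\<close>)
    qed (use f spec in auto)
  qed
  then show ?thesis by (simp add: res_apply t)
qed

text \<open>Replaces the span of the degreewise symmetric tensors by fixed-point equations that do
  not mention degrees: a swap fixes the words that are too short for it, so one condition serves all
  degrees. Membership in Sym then becomes a linear identity that can be checked on words.\<close>

lemma Sym_iff: "t \<in> carr C \<longleftrightarrow> t \<in> carr T \<and> (\<forall>j. wop (asw j) t = t)"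
proof
  interpret vector_space "ptmul ((*) :: 'k \<Rightarrow> 'k \<Rightarrow> 'k)" using vector_space_functions by simp
  let ?E = "\<lambda>j. {t \<in> carr T. wop (asw j) t - t = 0}"
  have E: "subspace (?E j)" for j
    using kernel_subspace[OF T_vs T_vs lin_minus[OF T_vs lin_wop[OF rearr_asw] lin_id]] by (simp add: smul_T)
  have "symmetric_tensors s n \<subseteq> ?E j" for n j
  proof
    fix t assume "t \<in> symmetric_tensors s n"
    then have t: "t \<in> carr (tensor_power s n)" and p: "\<And>p. p permutes {..<n} \<Longrightarrow> permute_tensor s n p t = t"
      by (auto simp: symmetric_tensors_def)
    \<comment> \<open>For \<open>n \<le> Suc j\<close> the swap acts on degree \<open>n\<close> as
      the identity, so the identity permutation represents it.\<close>
    let ?p = "if Suc j < n then Transposition.transpose j (Suc j) else id"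
    have "permute_tensor s n ?p t = wop (asw j) t"
    proof (rule permute_tensor_wop[OF rearr_asw _ _ t])
      fix ws :: "'w list" assume ws: "length ws = n"
      show "permute_list ?p ws = asw j ws"
        by (rule nth_equalityI) (auto simp: permute_list_def nth_asw asw_short ws)
    qed simp
    moreover have "?p permutes {..<n}" by (auto intro!: permutes_swap_id permutes_id)
    ultimately show "t \<in> ?E j" using p t tensor_power_T by auto
  qed
  then have "span (\<Union>n. symmetric_tensors s n) \<subseteq> ?E j" for j
    by (intro span_minimal E) blast
  then show "t \<in> carr T \<and> (\<forall>j. wop (asw j) t = t)" if "t \<in> carr C"
    using that unfolding carr_C by (auto simp: subset_iff)
  assume "t \<in> carr T \<and> (\<forall>j. wop (asw j) t = t)"
  then have t: "t \<in> carr T" and fx: "\<And>j. wop (asw j) t = t" by auto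
  \<comment> \<open>Conversely each homogeneous component is symmetric: in a given degree every
    permutation is a product of swaps, and these preserve lengths, hence commute with
    \<open>hcomp\<close>.\<close>
  have "hcomp n t \<in> symmetric_tensors s n" for n
    unfolding symmetric_tensors_def
  proof (intro CollectI conjI allI impI hcomp_mem[OF t])
    fix p assume "p permutes {..<n}"
    then obtain js where js: "\<And>ws :: 'w list. length ws = n \<Longrightarrow> permute_list p ws = foldr asw js ws"
      using permute_list_asw by blast
    have "permute_tensor s n p (hcomp n t) = wop (foldr asw js) (hcomp n t)"
      by (rule permute_tensor_wop[OF rearr_foldr_asw _ js hcomp_mem[OF t]]) simp_all
    also have "\<dots> = hcomp n (wop (foldr asw js) t)"
      by (rule T_ext[OF lin_comp[OF lin_hcomp lin_wop] lin_comp[OF lin_wop lin_hcomp] T_vs _ t])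
         (auto simp: rearr_foldr_asw wop_word hcomp_word lin_zero[OF T_vs lin_wop])
    also have "\<dots> = hcomp n t" by (simp add: wop_foldr_asw[OF t fx])
    finally show "permute_tensor s n p (hcomp n t) = hcomp n t" .
  qed
  then have "(\<Sum>n<M. hcomp n t) \<in> span (\<Union>n. symmetric_tensors s n)" for M
    by (intro span_sum span_base) blast
  then show "t \<in> carr C" using sum_hcomp[OF t] unfolding carr_C by (metis order_refl)
qed

lemma C_T: "c \<in> carr C \<Longrightarrow> c \<in> carr T"
  by (simp add: Sym_iff)

lemma wop_foldr_C: "c \<in> carr C \<Longrightarrow> wop (foldr asw js) c = c"
  by (rule wop_foldr_asw) (simp_all add: Sym_iff)

lemma vec_space_C [simp]: "vec_space C"
proof -
  have "vec_space \<lparr>carr = carr C, smul = ptmul ((*) :: 'k \<Rightarrow> 'k \<Rightarrow> 'k)\<rparr>"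
    unfolding carr_C by (rule vec_space_span_functions)
  then show ?thesis by (simp add: vec_space_def smul_C smul_T)
qed

lemma rearr_rotate1: "rearr rotate1"
  unfolding rearr_def
proof (intro allI)
  fix xs ys :: "'w list"
  show "\<exists>xs' ys'. \<forall>w. rotate1 (xs @ w # ys) = xs' @ w # ys'"
  proof (cases xs)
    case Nil
    then show ?thesis by (intro exI[of _ ys] exI[of _ "[]"]) simp
  next
    case (Cons x us)
    then show ?thesis by (intro exI[of _ us] exI[of _ "ys @ [x]"]) simp
  qed
qed

text \<open>The product of swaps that represents a rotation depends on the length of the word, so
  invariance is shown in each degree and then summed.\<close>

lemma wop_rotate1_C:
  assumes c: "c \<in> carr C"
  shows "wop rotate1 c = c"
proof -
  note t = C_T[OF c]
  have "hcomp n (wop rotate1 c) = hcomp n c" for n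
  proof -
    obtain js where js: "\<And>ws :: 'w list. length ws = n \<Longrightarrow> rotate1 ws = foldr asw js ws"
      using rotate1_asw by blast
    have "hcomp n (wop rotate1 c) = hcomp n (wop (foldr asw js) c)"
      by (rule T_ext[OF lin_comp[OF lin_wop lin_hcomp] lin_comp[OF lin_wop lin_hcomp] T_vs _ t])
         (auto simp: rearr_foldr_asw rearr_rotate1 wop_word hcomp_word js)
    then show ?thesis by (simp add: wop_foldr_C[OF c])
  qed
  then have eq: "(\<Sum>n<M. hcomp n (wop rotate1 c)) = (\<Sum>n<M. hcomp n c)" for M by simp
  obtain N N' where N: "\<forall>M\<ge>N. c = (\<Sum>n<M. hcomp n c)"
      "\<forall>M\<ge>N'. wop rotate1 c = (\<Sum>n<M. hcomp n (wop rotate1 c))"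
    using sum_hcomp[OF t] sum_hcomp[OF lin_mem[OF lin_wop[OF rearr_rotate1] t]] by blast
  have "wop rotate1 c = (\<Sum>n<max N N'. hcomp n (wop rotate1 c))" using N(2) max.cobounded2 by blast
  also have "\<dots> = c" unfolding eq using N(1) max.cobounded1 by metis
  finally show ?thesis .
qed

end

section \<open>Subspaces of tensor products\<close>

definition subsp :: "('k::field, 'v::ab_group_add, 'y) vspace_scheme \<Rightarrow> ('k, 'v, 'z) vspace_scheme \<Rightarrow> bool" where
  "subsp A V \<longleftrightarrow> vec_space A \<and> vec_space V \<and> carr A \<subseteq> carr V \<and> smul A = smul V"

lemma subsp_refl: "vec_space V \<Longrightarrow> subsp V V"
  by (simp add: subsp_def)

text \<open>Pure tensors are evaluations of bilinear forms on the ambient types, which depend on the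
  scalar multiplications but not on the carriers; this makes a tensor product of subspaces a literal
  subset.\<close>

lemma subsp_tens: "subsp A V \<Longrightarrow> subsp B U \<Longrightarrow> tens A B = tens V U"
  by (rule tens_smul_cong) (simp_all add: subsp_def)

lemma subsp_tensor: 
  assumes "subsp A V" "subsp B U"
  shows "subsp (tensor A B) (tensor V U)"
proof -
  interpret vector_space "ptmul ((*) :: 'a \<Rightarrow> 'a \<Rightarrow> 'a)" using vector_space_functions by simp
  have "carr (tensor A B) \<subseteq> carr (tensor V U)"
    unfolding tensor_def subsp_tens[OF assms] using assms by (auto simp: subsp_def intro!: span_mono)
  then show ?thesis by (simp add: subsp_def smul_tensor)
qed

lemma lin_subsp_dom: "subsp A V \<Longrightarrow> lin V X f \<Longrightarrow> lin A X f"
  by (simp add: lin_def subsp_def subset_iff)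

lemma lin_subsp_cod: "subsp X Y \<Longrightarrow> lin V X f \<Longrightarrow> lin V Y f"
  by (auto simp: lin_def subsp_def)

lemma tensor_lift_subsp:
  assumes A: "subsp A V" and B: "subsp B U" and X: "subsp X Y"
    and f: "bil A B X f" and g: "bil V U Y g"
    and eq: "\<And>a b. a \<in> carr A \<Longrightarrow> b \<in> carr B \<Longrightarrow> f a b = g a b" and t: "t \<in> carr (tensor A B)"
  shows "tensor_lift A B X f t = tensor_lift V U Y g t"
proof -
  have vs: "vec_space A" "vec_space B" "vec_space X" "vec_space V" "vec_space U" "vec_space Y"
    using A B X by (auto simp: subsp_def)
  have l: "lin (tensor A B) Y (tensor_lift A B X f)"
    by (rule lin_subsp_cod[OF X hom_lin[OF tensor_lift_hom]]) (simp_all add: vs f)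
  have r: "lin (tensor A B) Y (tensor_lift V U Y g)"
    by (rule lin_subsp_dom[OF subsp_tensor[OF A B] hom_lin[OF tensor_lift_hom]]) (simp_all add: vs g)
  show ?thesis
  proof (rule tensor_ext[OF vs(1,2) l r _ t])
    fix a b assume ab: "a \<in> carr A" "b \<in> carr B"
    then have "a \<in> carr V" "b \<in> carr U" using A B by (auto simp: subsp_def)
    then have "tensor_lift V U Y g (tens A B a b) = g a b"
      unfolding subsp_tens[OF A B] using g vs by (simp add: tensor_lift_tens)
    then show "tensor_lift A B X f (tens A B a b) = tensor_lift V U Y g (tens A B a b)"
      using ab f vs eq by (simp add: tensor_lift_tens)
  qed
qed

lemma tensor_map_subsp:
  assumes "subsp A V" "subsp B U" "subsp A' V'" "subsp B' U'"
    "lin A A' f" "lin B B' g" "lin V V' f'" "lin U U' g'"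
    "\<And>a. a \<in> carr A \<Longrightarrow> f a = f' a" "\<And>b. b \<in> carr B \<Longrightarrow> g b = g' b" "t \<in> carr (tensor A B)"
  shows "tensor_map A B A' B' f g t = tensor_map V U V' U' f' g' t"
  unfolding tensor_map_def
  by (rule tensor_lift_subsp[OF assms(1,2) subsp_tensor[OF assms(3,4)]])
     (use assms(3-11) in \<open>simp_all add: bil_tens_comp subsp_tens[OF assms(3,4)] subsp_def
        bil_tens_comp[of A' B' A f B g, unfolded subsp_tens[OF assms(3,4)]]\<close>)

lemma assoc_subsp:
  assumes A: "subsp A V" and B: "subsp B U" and X: "subsp X Y" and t: "t \<in> carr (tensor (tensor A B) X)"
  shows "assoc A B X t = assoc V U Y t"
proof -
  have vs: "vec_space A" "vec_space B" "vec_space X" "vec_space V" "vec_space U" "vec_space Y"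
    using A B X by (auto simp: subsp_def)
  show ?thesis
    unfolding assoc_def
  proof (rule tensor_lift_subsp[OF subsp_tensor[OF A B] X subsp_tensor[OF A subsp_tensor[OF B X]] _ _ _ t])
    fix r x assume r: "r \<in> carr (tensor A B)" and x: "x \<in> carr X"
    have xY: "x \<in> carr Y" using X x by (auto simp: subsp_def)
    show "tensor_lift A B (tensor A (tensor B X)) (\<lambda>v u. tens A (tensor B X) v (tens B X u x)) r
      = tensor_lift V U (tensor V (tensor U Y)) (\<lambda>v u. tens V (tensor U Y) v (tens U Y u x)) r"
    proof (rule tensor_lift_subsp[OF A B subsp_tensor[OF A subsp_tensor[OF B X]] _ _ _ r])
      show "bil A B (tensor A (tensor B X)) (\<lambda>v u. tens A (tensor B X) v (tens B X u x))"
        by (intro bilI lin_tens1 lin_tens2 tens_mem lin_id; simp add: vs x)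
      show "bil V U (tensor V (tensor U Y)) (\<lambda>v u. tens V (tensor U Y) v (tens U Y u x))"
        by (intro bilI lin_tens1 lin_tens2 tens_mem lin_id; simp add: vs xY)
    qed (simp add: subsp_tens[OF A subsp_tensor[OF B X]] subsp_tens[OF B X])
  qed (rule bil_assoc; simp add: vs)+
qed

text \<open>All structure maps are restrictions and \<open>tensor C C\<close> is literally a
  subspace of \<open>tensor D D\<close>, so each axiom for \<open>C\<close> is the axiom for
  \<open>D\<close> at an element of \<open>C\<close>. The content is in \<open>cl\<close>, which
  \<open>comult_C_mem\<close> supplies for symmetric tensors.\<close>

lemma subcoalgebra:
  assumes D: "coalgebra D" and CD: "subsp C D"
    and co: "comult C = res C (comult D)" "counit C = res C (counit D)"
    and cl: "\<And>c. c \<in> carr C \<Longrightarrow> comult D c \<in> carr (tensor C C)"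
  shows "coalgebra C"
proof -
  have vs [simp]: "vec_space C" "vec_space D" using CD by (auto simp: subsp_def)
  have in_D: "c \<in> carr D" if "c \<in> carr C" for c using CD that by (auto simp: subsp_def)
  have lD: "lin D (tensor D D) (comult D)" "lin D ground (counit D)" using D by (auto simp: coalgebra_def hom_lin)
  note sT = subsp_tensor[OF CD CD]
  have "lin C (tensor C C) (comult D)"
    using lin_subsp_dom[OF CD lD(1)] cl by (simp add: lin_def smul_tensor)
  then have hC: "comult C \<in> hom C (tensor C C)" unfolding co by (rule res_hom[OF vs(1)])
  have hE: "counit C \<in> hom C ground" unfolding co by (rule res_hom[OF vs(1) lin_subsp_dom[OF CD lD(2)]])
  note lC = hom_lin[OF hC] hom_lin[OF hE]
  have eqC: "comult C c = comult D c" "counit C c = counit D c" if "c \<in> carr C" for c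
    using that by (simp_all add: co res_apply)
  have "assoc C C C (tensor_map C C (tensor C C) C (comult C) (\<lambda>x. x) (comult C c))
      = tensor_map C C C (tensor C C) (\<lambda>x. x) (comult C) (comult C c)" if c: "c \<in> carr C" for c
  proof -
    have m: "tensor_map C C (tensor C C) C (comult C) (\<lambda>x. x) (comult C c) \<in> carr (tensor (tensor C C) C)"
      by (rule lin_mem[OF lin_tensor_map[OF _ _ _ _ lC(1) lin_id lC(1)] c]) simp_all
    have "assoc C C C (tensor_map C C (tensor C C) C (comult C) (\<lambda>x. x) (comult C c))
      = assoc D D D (tensor_map C C (tensor C C) C (comult C) (\<lambda>x. x) (comult C c))"
      by (rule assoc_subsp[OF CD CD CD m])
    also have "\<dots> = assoc D D D (tensor_map D D (tensor D D) D (comult D) (\<lambda>x. x) (comult D c))"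
      using tensor_map_subsp[OF CD CD sT CD lC(1) lin_id lD(1) lin_id eqC(1) refl cl[OF c]] c by (simp add: eqC)
    also have "\<dots> = tensor_map D D D (tensor D D) (\<lambda>x. x) (comult D) (comult D c)"
      using D in_D[OF c] unfolding coalgebra_def by blast
    also have "\<dots> = tensor_map C C C (tensor C C) (\<lambda>x. x) (comult C) (comult C c)"
      using tensor_map_subsp[OF CD CD CD sT lin_id lC(1) lin_id lD(1) refl eqC(1) cl[OF c]] c by (simp add: eqC)
    finally show ?thesis .
  qed
  moreover have bil1: "bil V V V (\<lambda>d e. smul V (counit V d) e)" "bil V V V (\<lambda>d e. smul V (counit V e) d)"
    if "vec_space V" "lin V ground (counit V)" for V :: "('a, 'b) coalg"
    by (intro bilI lin_smul_left lin_smul_right lin_id; simp add: that)+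
  have "tensor_lift C C C (\<lambda>d e. smul C (counit C d) e) (comult C c) = c" if c: "c \<in> carr C" for c
  proof -
    have "tensor_lift C C C (\<lambda>d e. smul C (counit C d) e) (comult C c)
      = tensor_lift D D D (\<lambda>d e. smul D (counit D d) e) (comult D c)"
      unfolding eqC(1)[OF c] by (rule tensor_lift_subsp[OF CD CD CD bil1(1) bil1(1) _ cl[OF c]])
        (use CD in \<open>simp_all add: lC lD eqC subsp_def\<close>)
    then show ?thesis using D in_D[OF c] by (simp add: coalgebra_def)
  qed
  moreover have "tensor_lift C C C (\<lambda>d e. smul C (counit C e) d) (comult C c) = c" if c: "c \<in> carr C" for c
  proof -
    have "tensor_lift C C C (\<lambda>d e. smul C (counit C e) d) (comult C c)
      = tensor_lift D D D (\<lambda>d e. smul D (counit D e) d) (comult D c)"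
      unfolding eqC(1)[OF c] by (rule tensor_lift_subsp[OF CD CD CD bil1(2) bil1(2) _ cl[OF c]])
        (use CD in \<open>simp_all add: lC lD eqC subsp_def\<close>)
    then show ?thesis using D in_D[OF c] by (simp add: coalgebra_def)
  qed
  ultimately show ?thesis unfolding coalgebra_def using hC hE vs by blast
qed

section \<open>Minimal representations of tensors and invariants of tensor products\<close>

text \<open>The coefficients are indexed by \<open>J\<close> rather than by vectors, so a family
  that repeats vectors causes no trouble in the minimality argument.\<close>

lemma span_image_sum:
  assumes "vector_space s" "finite J" "x \<in> module.span s (u ` J)"
  shows "\<exists>c. x = (\<Sum>k\<in>J. s (c k) (u k))"
proof -
  interpret vector_space s by fact
  show ?thesis
  proof (rule span_induct_alt[OF assms(3)])
    show "\<exists>c. 0 = (\<Sum>k\<in>J. s (c k) (u k))" by (intro exI[of _ "\<lambda>_. 0"]) simp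
    fix a x y assume "x \<in> u ` J" "\<exists>c. y = (\<Sum>k\<in>J. s (c k) (u k))"
    then obtain k c where k: "k \<in> J" "x = u k" and y: "y = (\<Sum>k\<in>J. s (c k) (u k))" by blast
    have "s a x + y = (\<Sum>i\<in>J. s ((c(k := a + c k)) i) (u i))"
      unfolding y k(2) using assms(2) k(1)
      by (simp add: sum.remove[of J k] scale_left_distrib add.assoc)
    then show "\<exists>c. s a x + y = (\<Sum>k\<in>J. s (c k) (u k))" by blast
  qed
qed

text \<open>In a representation of a tensor of minimal length both families of vectors are independent.\<close>

lemma tensor_minimal_rep:
  assumes V: "vec_space V" and U: "vec_space U" and t: "t \<in> carr (tensor V U)"
  obtains I :: "nat set" and v u where "finite I" "\<And>i. i \<in> I \<Longrightarrow> v i \<in> carr V \<and> u i \<in> carr U"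
    "t = (\<Sum>i\<in>I. tens V U (v i) (u i))"
    "\<And>i. i \<in> I \<Longrightarrow> v i \<notin> module.span (smul V) (v ` (I - {i}))"
    "\<And>i. i \<in> I \<Longrightarrow> u i \<notin> module.span (smul U) (u ` (I - {i}))"
proof -
  define Q where "Q I v u \<longleftrightarrow> finite I \<and> (\<forall>i\<in>I. v i \<in> carr V \<and> u i \<in> carr U) \<and> t = (\<Sum>i\<in>I. tens V U (v i) (u i))"
    for I :: "nat set" and v u
  have ex: "\<exists>n I v u. Q I v u \<and> card I = n"
    using tensor_rep[OF V U t] unfolding Q_def by (metis finite_lessThan lessThan_iff)
  define n where "n = (LEAST n. \<exists>I v u. Q I v u \<and> card I = n)"
  obtain I v u where Q: "Q I v u" and n: "card I = n" using LeastI_ex[OF ex] unfolding n_def by blast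
  have least: "n \<le> card I'" if "Q I' v' u'" for I' v' u'
    unfolding n_def by (rule Least_le) (use that in blast)
  have fin: "finite I" and mem: "\<And>i. i \<in> I \<Longrightarrow> v i \<in> carr V \<and> u i \<in> carr U"
    and t_eq: "t = (\<Sum>i\<in>I. tens V U (v i) (u i))" using Q by (auto simp: Q_def)
  note b = bil_tens[OF V U]
  have vsV: "vector_space (smul V)" and vsU: "vector_space (smul U)" using V U by (auto simp: vec_space_def)
  have less: "card (I - {i}) < n" if "i \<in> I" for i using card_Diff1_less[OF fin that] n by simp
  have iv: "v i \<notin> module.span (smul V) (v ` (I - {i}))" if i: "i \<in> I" for i
  proof
    assume "v i \<in> module.span (smul V) (v ` (I - {i}))"
    then obtain c where c: "v i = (\<Sum>k\<in>I - {i}. smul V (c k) (v k))"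
      using span_image_sum[OF vsV, of "I - {i}"] fin by blast
    \<comment> \<open>If \<open>v i\<close> depends on the other vectors, the term of index
      \<open>i\<close> is distributed over the other terms through their right factors, and a
      shorter representation results.\<close>
    have "tens V U (v i) (u i) = (\<Sum>k\<in>I - {i}. tens V U (smul V (c k) (v k)) (u i))"
      unfolding c using lin_sum[OF V bil_left[OF b], of "u i" "I - {i}" "\<lambda>k. smul V (c k) (v k)"] mem i
      by (simp add: vs_scale[OF V])
    also have "\<dots> = (\<Sum>k\<in>I - {i}. tens V U (v k) (smul U (c k) (u i)))"
      using lin_scale[OF bil_left[OF b]] lin_scale[OF bil_right[OF b]] mem i by (intro sum.cong) auto
    finally have "t = (\<Sum>k\<in>I - {i}. tens V U (v k) (u k + smul U (c k) (u i)))"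
      unfolding t_eq using sum.remove[OF fin i, of "\<lambda>i. tens V U (v i) (u i)"]
        lin_add[OF bil_right[OF b]] mem i by (simp add: sum.distrib vs_scale[OF U])
    then have "Q (I - {i}) v (\<lambda>k. u k + smul U (c k) (u i))"
      unfolding Q_def using fin mem i by (simp add: vs_add[OF U] vs_scale[OF U])
    then show False using least less[OF i] by fastforce
  qed
  have iu: "u i \<notin> module.span (smul U) (u ` (I - {i}))" if i: "i \<in> I" for i
  proof
    assume "u i \<in> module.span (smul U) (u ` (I - {i}))"
    then obtain c where c: "u i = (\<Sum>k\<in>I - {i}. smul U (c k) (u k))"
      using span_image_sum[OF vsU, of "I - {i}"] fin by blast
    have "tens V U (v i) (u i) = (\<Sum>k\<in>I - {i}. tens V U (v i) (smul U (c k) (u k)))"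
      unfolding c using lin_sum[OF U bil_right[OF b], of "v i" "I - {i}" "\<lambda>k. smul U (c k) (u k)"] mem i
      by (simp add: vs_scale[OF U])
    also have "\<dots> = (\<Sum>k\<in>I - {i}. tens V U (smul V (c k) (v i)) (u k))"
      using lin_scale[OF bil_left[OF b]] lin_scale[OF bil_right[OF b]] mem i by (intro sum.cong) auto
    finally have "t = (\<Sum>k\<in>I - {i}. tens V U (v k + smul V (c k) (v i)) (u k))"
      unfolding t_eq using sum.remove[OF fin i, of "\<lambda>i. tens V U (v i) (u i)"]
        lin_add[OF bil_left[OF b]] mem i by (simp add: sum.distrib vs_scale[OF V])
    then have "Q (I - {i}) (\<lambda>k. v k + smul V (c k) (v i)) u"
      unfolding Q_def using fin mem i by (simp add: vs_add[OF V] vs_scale[OF V])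
    then show False using least less[OF i] by fastforce
  qed
  show thesis by (rule that[OF fin mem t_eq iv iu])
qed

text \<open>In a minimal representation the right factors are independent, so a functional that is 1
  on \<open>u i\<close> and 0 on the others extracts \<open>v i\<close> from \<open>t\<close>; hence
  invariance of \<open>t\<close> under the \<open>F j\<close> makes \<open>v i\<close> invariant.
  The right factors are treated in the same way with the \<open>G j\<close>.\<close>

lemma tensor_fixed:
  assumes V: "vec_space V" and U: "vec_space U" and t: "t \<in> carr (tensor V U)"
    and F: "\<And>j. lin V V (F j)" "\<And>j. tensor_map V U V U (F j) (\<lambda>x. x) t = t"
    and G: "\<And>j. lin U U (G j)" "\<And>j. tensor_map V U V U (\<lambda>x. x) (G j) t = t"
    and A: "subsp A V" "\<And>x. x \<in> carr V \<Longrightarrow> (\<And>j. F j x = x) \<Longrightarrow> x \<in> carr A"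
    and B: "subsp B U" "\<And>x. x \<in> carr U \<Longrightarrow> (\<And>j. G j x = x) \<Longrightarrow> x \<in> carr B"
  shows "t \<in> carr (tensor A B)"
proof -
  obtain I :: "nat set" and v u where fin: "finite I" and mem: "\<And>i. i \<in> I \<Longrightarrow> v i \<in> carr V \<and> u i \<in> carr U"
    and t_eq: "t = (\<Sum>i\<in>I. tens V U (v i) (u i))"
    and iv: "\<And>i. i \<in> I \<Longrightarrow> v i \<notin> module.span (smul V) (v ` (I - {i}))"
    and iu: "\<And>i. i \<in> I \<Longrightarrow> u i \<notin> module.span (smul U) (u ` (I - {i}))"
    by (rule tensor_minimal_rep[OF V U t]) blast
  have tm: "tens V U (v i) (u i) \<in> carr (tensor V U)" if "i \<in> I" for i
    using tens_mem[OF V U] mem[OF that] by blast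
  have vsV: "vector_space (smul V)" and vsU: "vector_space (smul U)" using V U by (auto simp: vec_space_def)
  have Fv: "F j (v i) = v i" if i: "i \<in> I" for i j
  proof -
    interpret U: vector_space "smul U" by (rule vsU)
    obtain l where l: "Vector_Spaces.linear (smul U) (*) l" "\<forall>r\<in>U.span (u ` (I - {i})). l r = 0" "l (u i) = 1"
      using functional_separates[OF vsU U.subspace_span iu[OF i]] by blast
    have l0: "l (u k) = 0" if "k \<in> I" "k \<noteq> i" for k
      using l(2) that U.span_base[of "u k" "u ` (I - {i})"] by auto
    have lU: "lin U ground l" using l(1) by (simp add: lin_def Vector_Spaces.linear_iff)
    let ?L = "tensor_lift V U V (\<lambda>x y. smul V (l y) x)"
    have bl: "bil V U V (\<lambda>x y. smul V (l y) x)"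
      by (intro bilI lin_smul_left lin_smul_right lin_id lU; simp add: V)
    have L: "lin (tensor V U) V ?L" by (rule hom_lin[OF tensor_lift_hom[OF V U V bl]])
    have sum1: "(\<Sum>k\<in>I. smul V (l (u k)) (h k)) = h i" for h
    proof -
      have "(\<Sum>k\<in>I. smul V (l (u k)) (h k)) = (\<Sum>k\<in>I. if k = i then h k else 0)"
        by (rule sum.cong) (auto simp: vs_one[OF V] vs_scale_0[OF V] l(3) l0)
      then show ?thesis using fin i by simp
    qed
    have "F j (v i) = (\<Sum>k\<in>I. smul V (l (u k)) (F j (v k)))" by (rule sum1[symmetric])
    also have "\<dots> = (\<Sum>k\<in>I. ?L (tensor_map V U V U (F j) (\<lambda>x. x) (tens V U (v k) (u k))))"
      by (rule sum.cong) (simp_all add: tensor_map_tens V U F(1) lin_id mem tensor_lift_tens bl lin_mem[OF F(1)])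
    also have "\<dots> = ?L (tensor_map V U V U (F j) (\<lambda>x. x) t)"
      unfolding t_eq by (rule lin_sum[OF vec_space_tensor lin_comp[OF lin_tensor_map[OF V U V U F(1) lin_id lin_id] L] tm, symmetric])
    also have "\<dots> = (\<Sum>k\<in>I. ?L (tens V U (v k) (u k)))"
      unfolding F(2) unfolding t_eq by (rule lin_sum[OF vec_space_tensor L tm])
    also have "\<dots> = (\<Sum>k\<in>I. smul V (l (u k)) (v k))"
      by (rule sum.cong) (simp_all add: V U mem tensor_lift_tens bl)
    also have "\<dots> = v i" by (rule sum1)
    finally show ?thesis .
  qed
  have Gu: "G j (u i) = u i" if i: "i \<in> I" for i j
  proof -
    interpret V: vector_space "smul V" by (rule vsV)
    obtain l where l: "Vector_Spaces.linear (smul V) (*) l" "\<forall>r\<in>V.span (v ` (I - {i})). l r = 0" "l (v i) = 1"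
      using functional_separates[OF vsV V.subspace_span iv[OF i]] by blast
    have l0: "l (v k) = 0" if "k \<in> I" "k \<noteq> i" for k
      using l(2) that V.span_base[of "v k" "v ` (I - {i})"] by auto
    have lV: "lin V ground l" using l(1) by (simp add: lin_def Vector_Spaces.linear_iff)
    let ?L = "tensor_lift V U U (\<lambda>x y. smul U (l x) y)"
    have bl: "bil V U U (\<lambda>x y. smul U (l x) y)"
      by (intro bilI lin_smul_left lin_smul_right lin_id lV; simp add: U)
    have L: "lin (tensor V U) U ?L" by (rule hom_lin[OF tensor_lift_hom[OF V U U bl]])
    have sum1: "(\<Sum>k\<in>I. smul U (l (v k)) (h k)) = h i" for h
    proof -
      have "(\<Sum>k\<in>I. smul U (l (v k)) (h k)) = (\<Sum>k\<in>I. if k = i then h k else 0)"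
        by (rule sum.cong) (auto simp: vs_one[OF U] vs_scale_0[OF U] l(3) l0)
      then show ?thesis using fin i by simp
    qed
    have "G j (u i) = (\<Sum>k\<in>I. smul U (l (v k)) (G j (u k)))" by (rule sum1[symmetric])
    also have "\<dots> = (\<Sum>k\<in>I. ?L (tensor_map V U V U (\<lambda>x. x) (G j) (tens V U (v k) (u k))))"
      by (rule sum.cong) (simp_all add: tensor_map_tens V U G(1) lin_id mem tensor_lift_tens bl lin_mem[OF G(1)])
    also have "\<dots> = ?L (tensor_map V U V U (\<lambda>x. x) (G j) t)"
      unfolding t_eq by (rule lin_sum[OF vec_space_tensor lin_comp[OF lin_tensor_map[OF V U V U lin_id G(1) lin_id] L] tm, symmetric])
    also have "\<dots> = (\<Sum>k\<in>I. ?L (tens V U (v k) (u k)))"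
      unfolding G(2) unfolding t_eq by (rule lin_sum[OF vec_space_tensor L tm])
    also have "\<dots> = (\<Sum>k\<in>I. smul U (l (v k)) (u k))"
      by (rule sum.cong) (simp_all add: V U mem tensor_lift_tens bl)
    also have "\<dots> = u i" by (rule sum1)
    finally show ?thesis .
  qed
  have "tens V U (v i) (u i) \<in> carr (tensor A B)" if i: "i \<in> I" for i
    unfolding subsp_tens[OF A(1) B(1), symmetric]
  proof (rule tens_mem)
    show "v i \<in> carr A" by (rule A(2)) (simp_all add: mem Fv i)
    show "u i \<in> carr B" by (rule B(2)) (simp_all add: mem Gu i)
  qed (use A(1) B(1) in \<open>simp_all add: subsp_def\<close>)
  then show ?thesis unfolding t_eq by (rule vs_sum[OF vec_space_tensor])
qed

section \<open>Swaps of a word that is cut in two\<close>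

lemma asw_take: "Suc j < i \<Longrightarrow> asw j (take i zs) = take i (asw j zs)"
proof (induction j zs arbitrary: i rule: asw.induct)
  case (1 x y zs)
  then obtain k where "i = Suc (Suc k)" by (auto dest: less_imp_Suc_add)
  then show ?case by simp
next
  case (2 j x zs)
  then show ?case by (cases i) auto
qed auto

lemma drop_asw_low: "Suc j < i \<Longrightarrow> drop i (asw j zs) = drop i zs"
proof (induction j zs arbitrary: i rule: asw.induct)
  case (1 x y zs)
  then obtain k where "i = Suc (Suc k)" by (auto dest: less_imp_Suc_add)
  then show ?case by simp
next
  case (2 j x zs)
  then show ?case by (cases i) auto
qed auto

lemma drop_asw: "asw j (drop i zs) = drop i (asw (i + j) zs)"
proof (induction i arbitrary: zs)
  case (Suc i)
  then show ?case by (cases zs) simp_all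
qed simp

lemma take_asw: "take i (asw (i + j) zs) = take i zs"
proof (induction i arbitrary: zs)
  case (Suc i)
  then show ?case by (cases zs) simp_all
qed simp

context words
begin

section \<open>Coalgebra structure\<close>

definition split_word :: "'w list \<Rightarrow> ('k, ('k, 'w) words, ('k, 'w) words) tensor" where
  "split_word ws = (\<Sum>i\<le>length ws. tens T T (word s (take i ws)) (word s (drop i ws)))"

text \<open>On words shorter than \<open>i\<close> the value 0 is chosen, which keeps the cut after
  \<open>i\<close> letters multilinear on words of all lengths. The varying letter lies in the right
  piece, in the left piece, or in a word that is too short.\<close>

lemma mlin_tens_split:
  "mlin (tensor T T) (\<lambda>ws. if i \<le> length ws then tens T T (word s (take i ws)) (word s (drop i ws)) else 0)"
  unfolding mlin_def
proof (intro conjI allI)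
  show "(if i \<le> length [] then tens T T (word s (take i [])) (word s (drop i [])) else 0) \<in> carr (tensor T T)"
    by (simp add: tens_mem)
  fix xs ys :: "'w list"
  consider "i \<le> length xs" | "length xs < i" "i \<le> Suc (length xs + length ys)" | "Suc (length xs + length ys) < i" by linarith
  then show "lin W (tensor T T) (\<lambda>w. if i \<le> length (xs @ w # ys)
      then tens T T (word s (take i (xs @ w # ys))) (word s (drop i (xs @ w # ys))) else 0)"
  proof cases
    case 1
    then show ?thesis by (simp add: lin_tens2 lin_word)
  next
    case 2
    then obtain m where m: "i - length xs = Suc m" by (metis Suc_diff_Suc)
    then show ?thesis using 2 by (simp add: lin_tens1 lin_word)
  next
    case 3
    then show ?thesis by (simp add: lin_const_0)
  qed
qed

lemma mlin_split_word: "mlin (tensor T T) split_word"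
  unfolding mlin_def
proof (intro conjI allI)
  show "split_word [] \<in> carr (tensor T T)" by (simp add: split_word_def tens_mem)
  fix xs ys :: "'w list"
  \<comment> \<open>All words \<open>xs @ w # ys\<close> have the same length, so the range of
    summation does not depend on \<open>w\<close>.\<close>
  have "lin W (tensor T T) (\<lambda>w. \<Sum>i\<le>Suc (length xs + length ys). if i \<le> length (xs @ w # ys)
      then tens T T (word s (take i (xs @ w # ys))) (word s (drop i (xs @ w # ys))) else 0)"
    by (intro lin_setsum mlin_lin[OF mlin_tens_split]) simp
  moreover have "(\<lambda>w. split_word (xs @ w # ys)) = (\<lambda>w. \<Sum>i\<le>Suc (length xs + length ys). if i \<le> length (xs @ w # ys)
      then tens T T (word s (take i (xs @ w # ys))) (word s (drop i (xs @ w # ys))) else 0)"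
    unfolding split_word_def by (intro ext sum.cong) auto
  ultimately show "lin W (tensor T T) (\<lambda>w. split_word (xs @ w # ys))" by simp
qed

lemma comult_T: "comult T = wlift (tensor T T) split_word"
proof -
  let ?T = "\<lparr>carr = module.span (ptmul (*)) (range (word s)), smul = ptmul ((*) :: 'k \<Rightarrow> 'k \<Rightarrow> 'k)\<rparr>"
  have sp: "carr ?T = carr T" "smul ?T = smul T" by (simp_all add: carr_T smul_T)
  have "comult T = (THE f. f \<in> hom ?T (tensor ?T ?T) \<and>
        (\<forall>ws. f (word s ws) = (\<Sum>i\<le>length ws. tens ?T ?T (word s (take i ws)) (word s (drop i ws)))))"
    unfolding tensor_coalgebra_def Let_def by simp
  then show ?thesis unfolding sp_cong[OF sp] wlift_def split_word_def .
qed

lemma counit_T: "counit T = wlift ground (\<lambda>ws. if ws = [] then 1 else 0)"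
proof -
  let ?T = "\<lparr>carr = module.span (ptmul (*)) (range (word s)), smul = ptmul ((*) :: 'k \<Rightarrow> 'k \<Rightarrow> 'k)\<rparr>"
  have sp: "carr ?T = carr T" "smul ?T = smul T" by (simp_all add: carr_T smul_T)
  have "counit T = (THE f. f \<in> hom ?T ground \<and> (\<forall>ws. f (word s ws) = (if ws = [] then 1 else 0)))"
    unfolding tensor_coalgebra_def Let_def by simp
  then show ?thesis unfolding sp_cong[OF sp] wlift_def .
qed

lemma comult_word: "comult T (word s ws) = (\<Sum>i\<le>length ws. tens T T (word s (take i ws)) (word s (drop i ws)))"
  unfolding comult_T by (simp add: wlift_word mlin_split_word split_word_def)

lemma lin_comult_T: "lin T (tensor T T) (comult T)"
  unfolding comult_T by (simp add: lin_wlift mlin_split_word)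

lemma mlin_counit: "mlin ground (\<lambda>ws. if ws = [] then 1 else 0)"
  by (simp add: mlin_def lin_const_0)

lemma counit_word: "counit T (word s ws) = (if ws = [] then 1 else 0)"
  unfolding counit_T by (rule wlift_word[OF vec_space_ground mlin_counit])

lemma lin_counit_T: "lin T ground (counit T)"
  unfolding counit_T by (rule lin_wlift[OF vec_space_ground mlin_counit])

lemma comult_T_sum:
  assumes "vec_space X" "lin (tensor T T) X g"
  shows "g (comult T (word s ws)) = (\<Sum>i\<le>length ws. g (tens T T (word s (take i ws)) (word s (drop i ws))))"
  unfolding comult_word by (rule lin_sum[OF vec_space_tensor assms(2)]) (simp add: tens_mem)

text \<open>Both sides run over all ways of cutting \<open>ws\<close> into three pieces. Cutting the
  left piece again gives the pairs \<open>(j, i - j)\<close> with \<open>j \<le> i\<close>, cutting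
  the right piece again gives the pairs \<open>(i, j)\<close> with
  \<open>i + j \<le> length ws\<close>; the sums agree by reindexing the triangle.\<close>

lemma coassoc_word:
  "assoc T T T (tensor_map T T (tensor T T) T (comult T) (\<lambda>x. x) (comult T (word s ws)))
    = tensor_map T T T (tensor T T) (\<lambda>x. x) (comult T) (comult T (word s ws))"
proof -
  let ?X = "tensor T (tensor T T)" and ?n = "length ws"
  let ?F = "\<lambda>a b. tens T (tensor T T) (word s (take a ws)) (tens T T (word s (take b (drop a ws))) (word s (drop (a + b) ws)))"
  have l1: "lin (tensor T T) ?X (\<lambda>t. assoc T T T (tensor_map T T (tensor T T) T (comult T) (\<lambda>x. x) t))"
    by (intro lin_assoc lin_tensor_map lin_comult_T lin_id) simp_all
  have l2: "lin (tensor T T) ?X (\<lambda>t. tensor_map T T T (tensor T T) (\<lambda>x. x) (comult T) t)"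
    by (intro lin_tensor_map lin_comult_T lin_id) simp_all
  have "assoc T T T (tensor_map T T (tensor T T) T (comult T) (\<lambda>x. x) (comult T (word s ws)))
      = (\<Sum>i\<le>?n. assoc T T T (tensor_map T T (tensor T T) T (comult T) (\<lambda>x. x) (tens T T (word s (take i ws)) (word s (drop i ws)))))"
    by (rule comult_T_sum[OF _ l1]) simp
  also have "\<dots> = (\<Sum>i\<le>?n. \<Sum>j\<le>i. ?F j (i - j))"
  proof (rule sum.cong[OF refl])
    fix i assume i: "i \<in> {..?n}"
    have l: "lin (tensor T T) ?X (\<lambda>t. assoc T T T (tens (tensor T T) T t (word s (drop i ws))))"
      by (intro lin_assoc lin_tens1 lin_id) simp_all
    have "assoc T T T (tensor_map T T (tensor T T) T (comult T) (\<lambda>x. x) (tens T T (word s (take i ws)) (word s (drop i ws))))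
      = assoc T T T (tens (tensor T T) T (comult T (word s (take i ws))) (word s (drop i ws)))"
      by (simp add: tensor_map_tens lin_comult_T lin_id)
    also have "\<dots> = (\<Sum>j\<le>length (take i ws). assoc T T T (tens (tensor T T) T
        (tens T T (word s (take j (take i ws))) (word s (drop j (take i ws)))) (word s (drop i ws))))"
      by (rule comult_T_sum[OF _ l]) simp
    also have "\<dots> = (\<Sum>j\<le>i. ?F j (i - j))"
      using i by (intro sum.cong) (auto simp: assoc_tens min_def drop_take)
    finally show "assoc T T T (tensor_map T T (tensor T T) T (comult T) (\<lambda>x. x) (tens T T (word s (take i ws)) (word s (drop i ws))))
      = (\<Sum>j\<le>i. ?F j (i - j))" .
  qed
  also have "\<dots> = (\<Sum>(i, j)\<in>{(i, j). i + j \<le> ?n}. ?F i j)" by (rule sum.triangle_reindex_eq[symmetric])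
  also have "\<dots> = (\<Sum>(i, j)\<in>Sigma {..?n} (\<lambda>i. {..?n - i}). ?F i j)"
    by (rule sum.cong) auto
  also have "\<dots> = (\<Sum>i\<le>?n. \<Sum>j\<le>?n - i. ?F i j)" by (rule sum.Sigma[symmetric]) auto
  also have "\<dots> = (\<Sum>i\<le>?n. tensor_map T T T (tensor T T) (\<lambda>x. x) (comult T) (tens T T (word s (take i ws)) (word s (drop i ws))))"
  proof (rule sum.cong[OF refl])
    fix i assume i: "i \<in> {..?n}"
    have l: "lin (tensor T T) ?X (\<lambda>t. tens T (tensor T T) (word s (take i ws)) t)"
      by (intro lin_tens2 lin_id) simp_all
    have "tensor_map T T T (tensor T T) (\<lambda>x. x) (comult T) (tens T T (word s (take i ws)) (word s (drop i ws)))
      = tens T (tensor T T) (word s (take i ws)) (comult T (word s (drop i ws)))"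
      by (simp add: tensor_map_tens lin_comult_T lin_id)
    also have "\<dots> = (\<Sum>j\<le>length (drop i ws). tens T (tensor T T) (word s (take i ws))
        (tens T T (word s (take j (drop i ws))) (word s (drop j (drop i ws)))))"
      by (rule comult_T_sum[OF _ l]) simp
    also have "\<dots> = (\<Sum>j\<le>?n - i. ?F i j)" by (simp add: add.commute)
    finally show "(\<Sum>j\<le>?n - i. ?F i j)
      = tensor_map T T T (tensor T T) (\<lambda>x. x) (comult T) (tens T T (word s (take i ws)) (word s (drop i ws)))" by simp
  qed
  also have "\<dots> = tensor_map T T T (tensor T T) (\<lambda>x. x) (comult T) (comult T (word s ws))"
    by (rule comult_T_sum[OF _ l2, symmetric]) simp
  finally show ?thesis .
qed

lemma coalgebra_T: "coalgebra T"
proof -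
  have h: "comult T \<in> hom T (tensor T T)" "counit T \<in> hom T ground"
    unfolding comult_T counit_T by (simp_all add: wlift_hom mlin_split_word mlin_counit)
  have l1: "lin T (tensor T (tensor T T)) (\<lambda>t. assoc T T T (tensor_map T T (tensor T T) T (comult T) (\<lambda>x. x) (comult T t)))"
    by (intro lin_assoc lin_tensor_map lin_comult_T lin_id) simp_all
  have l2: "lin T (tensor T (tensor T T)) (\<lambda>t. tensor_map T T T (tensor T T) (\<lambda>x. x) (comult T) (comult T t))"
    by (intro lin_tensor_map lin_comult_T lin_id) simp_all
  have b: "bil T T T (\<lambda>d e. smul T (counit T d) e)" "bil T T T (\<lambda>d e. smul T (counit T e) d)"
    by (intro bilI lin_smul_left lin_smul_right lin_id; simp add: lin_counit_T)+
  have l3: "lin T T (\<lambda>t. tensor_lift T T T (\<lambda>d e. smul T (counit T d) e) (comult T t))"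
    "lin T T (\<lambda>t. tensor_lift T T T (\<lambda>d e. smul T (counit T e) d) (comult T t))"
    by (intro lin_tensor_lift b lin_comult_T; simp)+
  have w1: "tensor_lift T T T (\<lambda>d e. smul T (counit T d) e) (comult T (word s ws)) = word s ws" for ws
  proof -
    have "tensor_lift T T T (\<lambda>d e. smul T (counit T d) e) (comult T (word s ws))
      = (\<Sum>i\<le>length ws. tensor_lift T T T (\<lambda>d e. smul T (counit T d) e) (tens T T (word s (take i ws)) (word s (drop i ws))))"
      by (rule comult_T_sum[OF T_vs hom_lin[OF tensor_lift_hom]]) (simp_all add: b)
    also have "\<dots> = (\<Sum>i\<le>length ws. if i = 0 then word s ws else 0)"
      by (rule sum.cong) (auto simp: tensor_lift_tens b counit_word vs_one[OF T_vs] vs_scale_0[OF T_vs])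
    finally show ?thesis by simp
  qed
  have w2: "tensor_lift T T T (\<lambda>d e. smul T (counit T e) d) (comult T (word s ws)) = word s ws" for ws
  proof -
    have "tensor_lift T T T (\<lambda>d e. smul T (counit T e) d) (comult T (word s ws))
      = (\<Sum>i\<le>length ws. tensor_lift T T T (\<lambda>d e. smul T (counit T e) d) (tens T T (word s (take i ws)) (word s (drop i ws))))"
      by (rule comult_T_sum[OF T_vs hom_lin[OF tensor_lift_hom]]) (simp_all add: b)
    also have "\<dots> = (\<Sum>i\<le>length ws. if i = length ws then word s ws else 0)"
      by (rule sum.cong) (auto simp: tensor_lift_tens b counit_word vs_one[OF T_vs] vs_scale_0[OF T_vs])
    finally show ?thesis by simp
  qed
  show ?thesis
    unfolding coalgebra_def
    using T_ext[OF l1 l2, OF vec_space_tensor coassoc_word] T_ext[OF l3(1) lin_id, OF T_vs w1] T_ext[OF l3(2) lin_id, OF T_vs w2] h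
    by simp
qed

section \<open>The symmetric tensors form a subcoalgebra\<close>

lemma subsp_C_T: "subsp C T"
  by (auto simp: subsp_def smul_C C_T)

text \<open>Each cut position \<open>i\<close> is treated separately: a swap inside the left piece
  at \<open>j\<close> is the swap of the whole word at \<open>j\<close>, a swap of the right piece
  at \<open>j\<close> is the swap of the whole word at \<open>i + j\<close>. So the cut of a
  symmetric tensor is invariant on both sides, and \<open>tensor_fixed\<close> applies.\<close>

lemma comult_C_mem:
  assumes c: "c \<in> carr C"
  shows "comult T c \<in> carr (tensor C C)"
proof -
  let ?D = "\<lambda>i. wlift (tensor T T) (\<lambda>ws. if i \<le> length ws then tens T T (word s (take i ws)) (word s (drop i ws)) else 0)"
  note t = C_T[OF c]
  have D: "lin T (tensor T T) (?D i)" for i by (rule lin_wlift[OF vec_space_tensor mlin_tens_split])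
  have Dw: "?D i (word s ws) = (if i \<le> length ws then tens T T (word s (take i ws)) (word s (drop i ws)) else 0)" for i ws
    by (rule wlift_word[OF vec_space_tensor mlin_tens_split])
  have fx: "wop (asw j) c = c" for j using c by (simp add: Sym_iff)
  note S = lin_wop[OF rearr_asw]
  have Dc: "?D i c \<in> carr (tensor C C)" for i
  proof (rule tensor_fixed[where F = "\<lambda>j. wop (asw j)" and G = "\<lambda>j. wop (asw j)", OF T_vs T_vs lin_mem[OF D t] S _ S _ subsp_C_T _ subsp_C_T])
    show "tensor_map T T T T (wop (asw j)) (\<lambda>x. x) (?D i c) = ?D i c" for j
    proof -
      \<comment> \<open>The left piece has \<open>i\<close> letters, so for
        \<open>i \<le> Suc j\<close> the swap fixes it, whereas on the whole word it could move
        letters across or behind the cut; the identity takes its place.\<close>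
      let ?\<sigma> = "\<lambda>ws :: 'w list. if Suc j < i then asw j ws else ws"
      have r: "rearr ?\<sigma>" using rearr_asw[of j] by (cases "Suc j < i") (simp_all add: rearr_def, blast)
      have "tensor_map T T T T (wop (asw j)) (\<lambda>x. x) (?D i c) = ?D i (wop ?\<sigma> c)"
      proof (rule T_ext[OF lin_tensor_map[OF T_vs T_vs T_vs T_vs S lin_id D] lin_comp[OF lin_wop[OF r] D] vec_space_tensor _ t])
        fix ws
        have "tensor_map T T T T (wop (asw j)) (\<lambda>x. x) 0 = 0"
          by (rule lin_zero[OF vec_space_tensor lin_tensor_map[OF T_vs T_vs T_vs T_vs S lin_id lin_id]])
        then show "tensor_map T T T T (wop (asw j)) (\<lambda>x. x) (?D i (word s ws)) = ?D i (wop ?\<sigma> (word s ws))"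
          unfolding Dw wop_word[OF r] by (simp add: tensor_map_tens S lin_id wop_word rearr_asw asw_take drop_asw_low asw_short)
      qed simp
      moreover have "wop ?\<sigma> c = c"
        using fx wop_foldr_C[OF c, of "[]"] by (cases "Suc j < i") (simp_all add: id_def)
      ultimately show ?thesis by (simp only:)
    qed
    show "tensor_map T T T T (\<lambda>x. x) (wop (asw j)) (?D i c) = ?D i c" for j
    proof -
      have "tensor_map T T T T (\<lambda>x. x) (wop (asw j)) (?D i c) = ?D i (wop (asw (i + j)) c)"
      proof (rule T_ext[OF lin_tensor_map[OF T_vs T_vs T_vs T_vs lin_id S D] lin_comp[OF S D] vec_space_tensor _ t])
        fix ws
        have "tensor_map T T T T (\<lambda>x. x) (wop (asw j)) 0 = 0"
          by (rule lin_zero[OF vec_space_tensor lin_tensor_map[OF T_vs T_vs T_vs T_vs lin_id S lin_id]])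
        then show "tensor_map T T T T (\<lambda>x. x) (wop (asw j)) (?D i (word s ws)) = ?D i (wop (asw (i + j)) (word s ws))"
          unfolding Dw wop_word[OF rearr_asw] by (simp add: tensor_map_tens S lin_id wop_word rearr_asw drop_asw take_asw)
      qed simp
      then show ?thesis by (simp add: fx)
    qed
  qed (simp_all add: Sym_iff)
  \<comment> \<open>The comultiplication is the sum of these cuts, finite on each element with a
    bound that depends on it.\<close>
  have "\<exists>N. \<forall>M\<ge>N. comult T t = (\<Sum>i\<le>M. ?D i t)" if "t \<in> carr T" for t
  proof (rule T_induct[OF that])
    show "\<exists>N. \<forall>M\<ge>N. comult T 0 = (\<Sum>i\<le>M. ?D i 0)" using lin_zero[OF T_vs D] lin_zero[OF T_vs lin_comult_T] by simp
    fix a ws t assume step: "t \<in> carr T" "\<exists>N. \<forall>M\<ge>N. comult T t = (\<Sum>i\<le>M. ?D i t)"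
    then obtain N where N: "\<forall>M\<ge>N. comult T t = (\<Sum>i\<le>M. ?D i t)" by blast
    have *: "h (smul T a (word s ws) + t) = smul (tensor T T) a (h (word s ws)) + h t" if "lin T (tensor T T) h" for h
      using lin_add[OF that vs_scale[OF T_vs word_mem] step(1)] lin_scale[OF that word_mem] by simp
    have "comult T (smul T a (word s ws) + t) = (\<Sum>i\<le>M. ?D i (smul T a (word s ws) + t))" if M: "M \<ge> max N (length ws)" for M
    proof -
      have e1: "(\<Sum>i\<le>M. ?D i (smul T a (word s ws) + t)) = (\<Sum>i\<le>M. smul (tensor T T) a (?D i (word s ws))) + (\<Sum>i\<le>M. ?D i t)"
        unfolding *[OF D] by (rule sum.distrib)
      have e2: "(\<Sum>i\<le>M. smul (tensor T T) a (?D i (word s ws))) = smul (tensor T T) a (\<Sum>i\<le>M. ?D i (word s ws))"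
        by (rule lin_sum[OF vec_space_tensor lin_smul_right[OF vec_space_tensor lin_id] lin_mem[OF D word_mem], symmetric])
      have e3: "(\<Sum>i\<le>M. ?D i (word s ws)) = (\<Sum>i\<le>length ws. ?D i (word s ws))"
        by (rule sum.mono_neutral_right) (use M in \<open>auto simp: Dw\<close>)
      have e4: "(\<Sum>i\<le>length ws. ?D i (word s ws)) = comult T (word s ws)"
        unfolding comult_word by (rule sum.cong) (simp_all add: Dw)
      have e5: "comult T t = (\<Sum>i\<le>M. ?D i t)" by (rule N[rule_format]) (use M in simp)
      show ?thesis unfolding *[OF lin_comult_T] e1 e2 e3 e4 e5 ..
    qed
    then show "\<exists>N. \<forall>M\<ge>N. comult T (smul T a (word s ws) + t) = (\<Sum>i\<le>M. ?D i (smul T a (word s ws) + t))" by blast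
  qed
  from this[OF t] obtain N where "comult T c = (\<Sum>i\<le>N. ?D i c)" by blast
  also have "\<dots> \<in> carr (tensor C C)" by (rule vs_sum[OF vec_space_tensor Dc])
  finally show ?thesis .
qed

lemma coalgebra_C: "coalgebra C"
  by (rule subcoalgebra[OF coalgebra_T subsp_C_T comult_C counit_C comult_C_mem])

end

lemma bil_comp: "bil V U X f \<Longrightarrow> lin V' V g \<Longrightarrow> lin U' U h \<Longrightarrow> bil V' U' X (\<lambda>v u. f (g v) (h u))"
  by (intro bilI; rule lin_comp, assumption, erule bil_left bil_right, erule lin_mem, assumption)

lemma bil_flip: "bil V U X f \<Longrightarrow> bil U V X (\<lambda>u v. f v u)"
  by (simp add: bil_def)

context words
begin

sublocale T: coalg T by unfold_locales (rule coalgebra_T)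
sublocale C: coalg C by unfold_locales (rule coalgebra_C)

section \<open>Splitting off one letter\<close>

definition p1T :: "('k, 'w) words \<Rightarrow> 'w" where
  "p1T = wlift W (\<lambda>ws. case ws of [w] \<Rightarrow> w | _ \<Rightarrow> 0)"

lemma mlin_p1: "mlin W (\<lambda>ws. case ws of [w] \<Rightarrow> w | _ \<Rightarrow> 0)"
  unfolding mlin_def
proof (intro conjI allI)
  fix xs ys :: "'w list"
  show "lin W W (\<lambda>w. case xs @ w # ys of [w] \<Rightarrow> w | _ \<Rightarrow> 0)"
  proof (cases xs)
    case Nil
    then show ?thesis by (cases ys) (simp_all add: lin_id lin_const_0)
  next
    case (Cons x us)
    then show ?thesis by (cases us) (simp_all add: lin_const_0)
  qed
qed simp

lemma lin_p1T: "lin T W p1T"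
  unfolding p1T_def by (rule lin_wlift[OF W_vs mlin_p1])

lemma p1T_word: "p1T (word s ws) = (case ws of [w] \<Rightarrow> w | _ \<Rightarrow> 0)"
  unfolding p1T_def by (rule wlift_word[OF W_vs mlin_p1])

lemma p1T_word_length: "length ws \<noteq> 1 \<Longrightarrow> p1T (word s ws) = 0"
  by (auto simp: p1T_word split: list.splits)

abbreviation "p1 \<equiv> Sym_proj1 s"

lemma p1_eq: "p1 = res C p1T"
  by (simp add: Sym_proj1_def p1T_def wlift_def)

lemma p1_apply: "c \<in> carr C \<Longrightarrow> p1 c = p1T c"
  by (simp add: p1_eq res_apply)

lemma lin_p1: "lin C W p1"
  unfolding p1_eq by (rule hom_lin, rule res_hom[OF vec_space_C lin_subsp_dom[OF subsp_C_T lin_p1T]])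

definition RT :: "('k, 'x::ab_group_add, 't) vspace_scheme \<Rightarrow> ('w \<Rightarrow> ('k, 'w) words \<Rightarrow> 'x) \<Rightarrow> ('k, 'w) words \<Rightarrow> 'x" where
  "RT X f = wlift X (\<lambda>ws. case ws of [] \<Rightarrow> 0 | w # us \<Rightarrow> f w (word s us))"

text \<open>\<open>RT X f\<close> sends \<open>w # ws\<close> to \<open>f w ws\<close>, and \<open>Rl X f c\<close> is \<open>f(p\<^sub>1(c\<^sub>1), c\<^sub>2)\<close>; the two agree on symmetric tensors.\<close>

definition Rl :: "('k, 'x::ab_group_add, 't) vspace_scheme \<Rightarrow> ('w \<Rightarrow> ('k, 'w) words \<Rightarrow> 'x) \<Rightarrow> ('k, 'w) words \<Rightarrow> 'x" where
  "Rl X f c = C.sw X (\<lambda>a b. f (p1 a) b) c"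

lemma mlin_RT:
  assumes X: "vec_space X" and f: "bil W T X f"
  shows "mlin X (\<lambda>ws. case ws of [] \<Rightarrow> 0 | w # us \<Rightarrow> f w (word s us))"
  unfolding mlin_def
proof (intro conjI allI)
  fix xs ys :: "'w list"
  show "lin W X (\<lambda>w. case xs @ w # ys of [] \<Rightarrow> 0 | w # us \<Rightarrow> f w (word s us))"
    using bil_left[OF f word_mem, of ys] lin_comp[OF lin_word bil_right[OF f]] by (cases xs) auto
qed (simp add: vs_zero[OF X])

lemma lin_RT: "vec_space X \<Longrightarrow> bil W T X f \<Longrightarrow> lin T X (RT X f)"
  unfolding RT_def by (intro lin_wlift mlin_RT)

lemma RT_word:
  "vec_space X \<Longrightarrow> bil W T X f \<Longrightarrow> RT X f (word s ws) = (case ws of [] \<Rightarrow> 0 | w # us \<Rightarrow> f w (word s us))"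
  unfolding RT_def by (intro wlift_word mlin_RT)

lemma bil_p1: "bil W C X f \<Longrightarrow> bil C C X (\<lambda>a b. f (p1 a) b)"
  by (rule bil_comp[OF _ lin_p1 lin_id])

lemma bil_p1': "bil W C X f \<Longrightarrow> bil C C X (\<lambda>a b. f (p1 b) a)"
  by (rule bil_flip[OF bil_p1])

lemma bil_p1T: "bil W T X f \<Longrightarrow> bil T T X (\<lambda>a b. f (p1T a) b)"
  by (rule bil_comp[OF _ lin_p1T lin_id])

lemma bil_p1T': "bil W T X f \<Longrightarrow> bil T T X (\<lambda>a b. f (p1T b) a)"
  by (rule bil_flip[OF bil_p1T])

lemma bil_T_C: "bil W T X f \<Longrightarrow> bil W C X f"
  unfolding bil_def using lin_subsp_dom[OF subsp_C_T] C_T by blast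

lemma C_sw_T_sw:
  assumes "vec_space X" "bil C C X f" "bil T T X g" "\<And>a b. a \<in> carr C \<Longrightarrow> b \<in> carr C \<Longrightarrow> f a b = g a b" "c \<in> carr C"
  shows "C.sw X f c = T.sw X g c"
  unfolding C.sw_def T.sw_def comult_C res_apply[OF assms(5)]
  by (rule tensor_lift_subsp[OF subsp_C_T subsp_C_T subsp_refl[OF assms(1)] assms(2,3,4) comult_C_mem[OF assms(5)]])

lemma T_sw_word:
  assumes "vec_space X" "bil T T X f"
  shows "T.sw X f (word s ws) = (\<Sum>i\<le>length ws. f (word s (take i ws)) (word s (drop i ws)))"
  unfolding T.sw_def
  by (subst comult_T_sum[OF assms(1) hom_lin[OF tensor_lift_hom[OF T_vs T_vs assms]]])
     (simp add: tensor_lift_tens assms)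

text \<open>\<open>p1T\<close> kills all words except single letters, so among all cuts only the one
  after the first letter contributes.\<close>

lemma Rl_RT:
  assumes X: "vec_space X" and f: "bil W T X f" and c: "c \<in> carr C"
  shows "Rl X f c = RT X f c"
proof -
  note b = bil_p1T[OF f]
  have f0: "f 0 t = 0" if "t \<in> carr T" for t by (rule lin_zero[OF W_vs bil_left[OF f that]])
  have "Rl X f c = T.sw X (\<lambda>a b. f (p1T a) b) c"
    unfolding Rl_def
    by (rule C_sw_T_sw[OF X bil_p1[OF bil_T_C[OF f]] b _ c]) (simp add: p1_apply)
  also have "\<dots> = RT X f c"
  proof (rule T_ext[OF T.lin_sw[OF X b lin_id] lin_RT[OF X f] X _ C_T[OF c] refl])
    fix ws
    show "T.sw X (\<lambda>a b. f (p1T a) b) (word s ws) = RT X f (word s ws)"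
    proof (cases ws)
      case Nil
      then show ?thesis by (simp add: T_sw_word[OF X b] RT_word[OF X f] p1T_word f0)
    next
      case (Cons w us)
      have "T.sw X (\<lambda>a b. f (p1T a) b) (word s ws)
        = f (p1T (word s [])) (word s ws) + (\<Sum>i\<le>length us. f (p1T (word s (w # take i us))) (word s (drop i us)))"
        unfolding T_sw_word[OF X b] Cons by (simp add: sum.atMost_Suc_shift del: sum.atMost_Suc)
      also have "(\<Sum>i\<le>length us. f (p1T (word s (w # take i us))) (word s (drop i us)))
        = (\<Sum>i\<le>length us. if i = 0 then f w (word s us) else 0)"
        by (rule sum.cong) (auto simp: p1T_word_length p1T_word[of "[w]", simplified] f0)
      finally show ?thesis by (simp add: p1T_word f0 RT_word[OF X f] Cons)
    qed
  qed
  finally show ?thesis .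
qed

text \<open>Here the last letter is split off. A rotation moves the first letter to the end and
  fixes symmetric tensors, so the result is that for the first letter. This is the form in which
  cocommutativity is used.\<close>

lemma Rl_right_RT:
  assumes X: "vec_space X" and f: "bil W T X f" and c: "c \<in> carr C"
  shows "C.sw X (\<lambda>a b. f (p1 b) a) c = RT X f c"
proof -
  note b = bil_p1T'[OF f]
  have f0: "f 0 t = 0" if "t \<in> carr T" for t by (rule lin_zero[OF W_vs bil_left[OF f that]])
  have "C.sw X (\<lambda>a b. f (p1 b) a) c = T.sw X (\<lambda>a b. f (p1T b) a) c"
    by (rule C_sw_T_sw[OF X bil_p1'[OF bil_T_C[OF f]] b _ c]) (simp add: p1_apply)
  also have "\<dots> = T.sw X (\<lambda>a b. f (p1T b) a) (wop rotate1 c)" by (simp add: wop_rotate1_C[OF c])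
  also have "\<dots> = RT X f c"
  proof (rule T_ext[OF T.lin_sw[OF X b lin_wop[OF rearr_rotate1]] lin_RT[OF X f] X _ C_T[OF c] refl])
    fix ws
    show "T.sw X (\<lambda>a b. f (p1T b) a) (wop rotate1 (word s ws)) = RT X f (word s ws)"
    proof (cases ws)
      case Nil
      then show ?thesis by (simp add: T_sw_word[OF X b] RT_word[OF X f] p1T_word f0 wop_word rearr_rotate1)
    next
      case (Cons w us)
      have "T.sw X (\<lambda>a b. f (p1T b) a) (wop rotate1 (word s ws))
        = (\<Sum>i\<le>Suc (length us). f (p1T (word s (drop i (us @ [w])))) (word s (take i (us @ [w]))))"
        by (simp add: wop_word rearr_rotate1 T_sw_word[OF X b] Cons)
      also have "\<dots> = (\<Sum>i\<le>Suc (length us). if i = length us then f w (word s us) else 0)"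
        by (rule sum.cong) (auto simp: p1T_word_length p1T_word[of "[w]", simplified] f0 le_Suc_eq)
      finally show ?thesis by (simp add: RT_word[OF X f] Cons)
    qed
  qed
  finally show ?thesis .
qed

text \<open>\<open>RT\<close> is defined on all tensors and can be checked on words, but the maps of
  interest are given on Sym; composing with a linear projection onto Sym extends them.\<close>

lemma bil_extend:
  assumes X: "vec_space X" and f: "bil W C X f"
  shows "\<exists>f'. bil W T X f' \<and> (\<forall>w. \<forall>c\<in>carr C. f' w c = f w c)"
proof -
  obtain q where q: "Vector_Spaces.linear (smul C) (smul C) q" "\<And>x. q x \<in> carr C" "\<And>x. x \<in> carr C \<Longrightarrow> q x = x"
    using subspace_projection[OF vec_space_C] by blast
  have lq: "lin T C q" using q by (simp add: lin_def Vector_Spaces.linear_iff smul_C)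
  have "bil W T X (\<lambda>w t. f w (q t))"
    by (rule bil_comp[OF f lin_id lq])
  then show ?thesis using q(3) by (intro exI[of _ "\<lambda>w t. f w (q t)"]) simp
qed

lemma Rl_cong: "(\<And>w d. d \<in> carr C \<Longrightarrow> f w d = g w d) \<Longrightarrow> Rl X f c = Rl X g c"
  unfolding Rl_def by (rule C.sw_cong) simp

lemma lin_Rl: "vec_space X \<Longrightarrow> bil W C X f \<Longrightarrow> lin Y C g \<Longrightarrow> lin Y X (\<lambda>y. Rl X f (g y))"
  unfolding Rl_def by (intro C.lin_sw bil_p1)

lemma Rl_mem: "vec_space X \<Longrightarrow> bil W C X f \<Longrightarrow> c \<in> carr C \<Longrightarrow> Rl X f c \<in> carr X"
  by (rule lin_mem[OF lin_Rl[OF _ _ lin_id]])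

lemma lin_Rl_param:
  assumes "vec_space X" "vec_space Y" "c \<in> carr C" "\<And>y. y \<in> carr Y \<Longrightarrow> bil W C X (f y)"
    "\<And>w d. d \<in> carr C \<Longrightarrow> lin Y X (\<lambda>y. f y w d)"
  shows "lin Y X (\<lambda>y. Rl X (f y) c)"
  unfolding Rl_def by (rule C.lin_sw_param) (simp_all add: assms bil_p1)

lemma Rl_comp:
  assumes "vec_space X" "vec_space Y" "bil W C X f" "lin X Y g" "c \<in> carr C"
  shows "g (Rl X f c) = Rl Y (\<lambda>w d. g (f w d)) c"
  unfolding Rl_def by (rule C.sw_comp[OF assms(1,2) bil_p1[OF assms(3)] assms(4,5)])

lemma Rl_right:
  assumes X: "vec_space X" and f: "bil W C X f" and c: "c \<in> carr C"
  shows "C.sw X (\<lambda>a b. f (p1 b) a) c = Rl X f c"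
proof -
  obtain f' where f': "bil W T X f'" "\<And>w d. d \<in> carr C \<Longrightarrow> f' w d = f w d" using bil_extend[OF X f] by blast
  have "C.sw X (\<lambda>a b. f (p1 b) a) c = C.sw X (\<lambda>a b. f' (p1 b) a) c" by (rule C.sw_cong) (simp add: f'(2))
  also have "\<dots> = Rl X f' c" by (simp add: Rl_right_RT[OF X f'(1) c] Rl_RT[OF X f'(1) c])
  also have "\<dots> = Rl X f c" by (rule Rl_cong) (rule f'(2))
  finally show ?thesis .
qed

lemma Rl_add:
  assumes "vec_space X" "bil W C X f" "bil W C X g" "c \<in> carr C"
  shows "Rl X (\<lambda>w d. f w d + g w d) c = Rl X f c + Rl X g c"
proof -
  note b = bil_p1[OF assms(2)] bil_p1[OF assms(3)]
  have b3: "bil C C X (\<lambda>a b. f (p1 a) b + g (p1 a) b)"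
    using b assms(1) by (auto simp: bil_def intro: lin_plus)
  have l: "lin (tensor C C) X (\<lambda>t. tensor_lift C C X (\<lambda>a b. f (p1 a) b) t + tensor_lift C C X (\<lambda>a b. g (p1 a) b) t)"
    by (intro lin_plus assms(1) lin_tensor_lift[OF vec_space_C vec_space_C assms(1)] b lin_id)
  show ?thesis
    unfolding Rl_def C.sw_def
    by (rule tensor_ext[OF vec_space_C vec_space_C hom_lin[OF tensor_lift_hom[OF vec_space_C vec_space_C assms(1) b3]] l _ C.comult_mem[OF assms(4)]])
       (simp add: tensor_lift_tens assms(1) b b3)
qed

section \<open>Multiplication by a letter on symmetric tensors\<close>

text \<open>Concatenation on the left. It does not preserve symmetric tensors; \<open>eta\<close> is
  a sum of insertions of \<open>b\<close> that does.\<close>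

definition lp :: "'w \<Rightarrow> ('k, 'w) words \<Rightarrow> ('k, 'w) words" where
  "lp w = wlift T (\<lambda>ws. word s (w # ws))"

lemma mlin_lp: "mlin T (\<lambda>ws. word s (w # ws))"
  using lin_word[of "w # xs" for xs] by (simp add: mlin_def)

lemma lp_word: "lp w (word s ws) = word s (w # ws)"
  unfolding lp_def by (rule wlift_word[OF T_vs mlin_lp])

lemma bil_lp: "bil W T T lp"
proof (rule bilI)
  show "lin T T (lp w)" for w unfolding lp_def by (rule lin_wlift[OF T_vs mlin_lp])
  show "lin W T (\<lambda>w. lp w t)" if "t \<in> carr T" for t
    unfolding lp_def
    by (rule lin_wlift_param[OF T_vs W_vs that mlin_lp]) (use lin_word[of "[]"] in simp)
qed

lemma lin_lp1: "t \<in> carr T \<Longrightarrow> lin Y W g \<Longrightarrow> lin Y T (\<lambda>y. lp (g y) t)"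
  by (erule lin_comp[OF _ bil_left[OF bil_lp]])

lemma lin_lp2: "lin Y T g \<Longrightarrow> lin Y T (\<lambda>y. lp w (g y))"
  by (erule lin_comp[OF _ bil_right[OF bil_lp]]) simp

lemma lp_mem: "t \<in> carr T \<Longrightarrow> lp w t \<in> carr T"
  by (rule bil_mem[OF bil_lp]) simp_all

lemma RT_lp:
  assumes "vec_space X" "bil W T X f" "t \<in> carr T"
  shows "RT X f (lp w t) = f w t"
  by (rule T_ext[OF lin_comp[OF lin_lp2[OF lin_id] lin_RT[OF assms(1,2)]] bil_right[OF assms(2)] assms(1) _ assms(3) refl])
     (simp_all add: lp_word RT_word assms)

lemma wop_lp: "t \<in> carr T \<Longrightarrow> wop (asw (Suc j)) (lp w t) = lp w (wop (asw j) t)"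
  by (rule T_ext[OF lin_comp[OF lin_lp2[OF lin_id] lin_wop[OF rearr_asw]] lin_lp2[OF lin_wop[OF rearr_asw]] T_vs _ _ refl])
     (simp_all add: lp_word wop_word rearr_asw)

lemma wop_lp_lp: "t \<in> carr T \<Longrightarrow> wop (asw 0) (lp v (lp w t)) = lp w (lp v t)"
  by (rule T_ext[OF lin_comp[OF lin_lp2[OF lin_lp2[OF lin_id]] lin_wop[OF rearr_asw]] lin_lp2[OF lin_lp2[OF lin_id]] T_vs _ _ refl])
     (simp_all add: lp_word wop_word rearr_asw)

end

text \<open>
  On the orbit sum of the words with a given content in a basis containing \<open>b\<close>, with \<open>g\<close> the
  coordinate of \<open>b\<close>, the map \<open>eta\<close> adds one letter \<open>b\<close> to the content: each word of the new
  content arises exactly once, by inserting \<open>b\<close> before its first occurrence.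
\<close>

locale letter = words s for s :: "'k::field \<Rightarrow> 'w::ab_group_add \<Rightarrow> 'w" +
  fixes b :: 'w and g :: "'w \<Rightarrow> 'k"
  assumes lin_g: "lin W ground g"
begin

definition pr :: "'w \<Rightarrow> 'w" where
  "pr w = w - s (g w) b"

lemma lin_pr: "lin W W pr"
  unfolding pr_def[abs_def] using lin_smul_left[OF W_vs _ lin_g, of b] by (intro lin_minus lin_id W_vs) simp

text \<open>Unfolded, this is the sum over all positions of the word with \<open>b\<close> inserted
  there and every letter before the insertion replaced by its image under \<open>pr\<close>. When
  \<open>g b = 1\<close>, \<open>pr\<close> kills \<open>b\<close>, so nothing is inserted behind an
  occurrence of \<open>b\<close> and multiplicities are avoided.\<close>

fun eta_word :: "'w list \<Rightarrow> ('k, 'w) words" where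
  "eta_word [] = word s [b]"
| "eta_word (w # ws) = word s (b # w # ws) + lp (pr w) (eta_word ws)"

definition eta :: "('k, 'w) words \<Rightarrow> ('k, 'w) words" where
  "eta = wlift T eta_word"

lemma eta_word_mem: "eta_word ws \<in> carr T"
  by (induction ws) (simp_all add: vs_add lp_mem del: plus_fun_apply)

lemma mlin_eta_word: "mlin T eta_word"
  unfolding mlin_def
proof (intro conjI allI eta_word_mem)
  fix xs ys :: "'w list"
  show "lin W T (\<lambda>w. eta_word (xs @ w # ys))"
  proof (induction xs)
    case Nil
    show ?case using lin_word[of "[b]" ys] by (simp add: lin_plus lin_lp1 lin_pr eta_word_mem del: plus_fun_apply)
  next
    case (Cons x xs)
    then show ?case using lin_word[of "b # x # xs" ys] by (simp add: lin_plus lin_lp2 del: plus_fun_apply)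
  qed
qed

lemma lin_eta: "lin T T eta"
  unfolding eta_def by (rule lin_wlift[OF T_vs mlin_eta_word])

lemma eta_word: "eta (word s ws) = eta_word ws"
  unfolding eta_def by (rule wlift_word[OF T_vs mlin_eta_word])

lemma eta_mem_T: "t \<in> carr T \<Longrightarrow> eta t \<in> carr T"
  by (rule lin_mem[OF lin_eta])

lemma bil_eta: "bil W T X f \<Longrightarrow> bil W T X (\<lambda>w d. f (pr w) (eta d))"
  by (rule bil_comp[OF _ lin_pr lin_eta])

text \<open>The recursion of \<open>eta_word\<close> read by the first letter: it is
  \<open>b\<close> followed by the whole word, or the projected first letter followed by
  \<open>eta\<close> of the rest.\<close>

lemma RT_eta:
  assumes X: "vec_space X" and f: "bil W T X f" and t: "t \<in> carr T"
  shows "RT X f (eta t) = f b t + RT X (\<lambda>w d. f (pr w) (eta d)) t"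
proof (rule T_ext[OF lin_comp[OF lin_eta lin_RT[OF X f]] lin_plus[OF X bil_right[OF f] lin_RT[OF X bil_eta[OF f]]] X _ t refl])
  fix ws
  show "RT X f (eta (word s ws)) = f b (word s ws) + RT X (\<lambda>w d. f (pr w) (eta d)) (word s ws)"
  proof (cases ws)
    case Nil
    then show ?thesis by (simp add: eta_word RT_word X f bil_eta)
  next
    case (Cons w us)
    then show ?thesis
      using lin_add[OF lin_RT[OF X f] word_mem lp_mem[OF eta_word_mem]]
      by (simp add: eta_word RT_word X f bil_eta RT_lp eta_word_mem)
  qed
qed simp

text \<open>In \<open>eta(w v us)\<close> the terms with \<open>b\<close> inserted before
  \<open>w\<close> or before \<open>v\<close> sum to
  \<open>b w v us + w b v us - g(w) b b v us\<close>, which is invariant under the first swap. In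
  the other terms \<open>b\<close> stands behind both letters, and the swap just exchanges the roles
  of \<open>w\<close> and \<open>v\<close>.\<close>

lemma wop_eta_0:
  assumes t: "t \<in> carr T" and fx: "wop (asw 0) t = t"
  shows "wop (asw 0) (eta t) = eta t"
proof -
  \<comment> \<open>The terms with \<open>b\<close> behind the first two letters. The swap turns
    \<open>h\<close> of a word into \<open>h\<close> of the swapped word, so the two contributions
    cancel when \<open>t\<close> is invariant.\<close>
  define h where "h ws = (case ws of w # v # us \<Rightarrow> lp (pr w) (lp (pr v) (eta_word us)) | _ \<Rightarrow> 0)" for ws
  have h: "mlin T h"
    unfolding mlin_def
  proof (intro conjI allI)
    show "h [] \<in> carr T" by (simp add: h_def)
    fix xs ys :: "'w list"
    show "lin W T (\<lambda>w. h (xs @ w # ys))"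
    proof (cases xs)
      case Nil
      then show ?thesis by (cases ys) (simp_all add: h_def lin_const_0 lin_lp1 lin_pr eta_word_mem lp_mem)
    next
      case (Cons x us)
      show ?thesis
      proof (cases us)
        case Nil
        then show ?thesis using Cons by (simp add: h_def lin_lp1 lin_lp2 lin_pr eta_word_mem)
      next
        case (Cons y vs)
        then show ?thesis using \<open>xs = x # us\<close> mlin_lin[OF mlin_eta_word, of vs ys] by (simp add: h_def lin_lp2)
      qed
    qed
  qed
  note S = lin_wop[OF rearr_asw]
  have "wop (asw 0) (eta t) - eta t = wlift T h (wop (asw 0) t) - wlift T h t"
  proof (rule T_ext[OF lin_minus[OF T_vs lin_comp[OF lin_eta S] lin_eta] lin_minus[OF T_vs lin_comp[OF S lin_wlift[OF T_vs h]] lin_wlift[OF T_vs h]] T_vs _ t refl])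
    fix ws :: "'w list"
    consider "ws = []" | w where "ws = [w]" | w v us where "ws = w # v # us" by (metis neq_Nil_conv)
    then show "wop (asw 0) (eta (word s ws)) - eta (word s ws) = wlift T h (wop (asw 0) (word s ws)) - wlift T h (word s ws)"
    proof cases
      case 1
      then show ?thesis by (simp add: eta_word wop_word rearr_asw wlift_word h h_def)
    next
      case (2 w)
      have "lp (pr w) (word s [b]) = word s [w, b] - smul T (g w) (word s [b, b])"
        unfolding pr_def using lin_diff[OF W_vs bil_left[OF bil_lp word_mem], of w "s (g w) b" "[b]"]
          lin_scale[OF bil_left[OF bil_lp word_mem], of b "g w" "[b]"] by (simp add: lp_word)
      moreover have "wop (asw 0) (word s [w, b] - smul T (g w) (word s [b, b])) = word s [b, w] - smul T (g w) (word s [b, b])"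
        using lin_diff[OF T_vs S, of "word s [w, b]" "smul T (g w) (word s [b, b])" 0] lin_scale[OF S word_mem, of 0 "g w" "[b, b]"]
        by (simp add: vs_scale wop_word rearr_asw)
      ultimately show ?thesis
        using 2 lin_add[OF S word_mem vs_diff[OF T_vs word_mem vs_scale[OF T_vs word_mem]], of 0 "[b, w]" "[w, b]" "g w" "[b, b]"]
        by (simp add: eta_word wop_word rearr_asw wlift_word h h_def)
    next
      case (3 w v us)
      let ?A = "word s (b # w # v # us)" and ?B = "lp (pr w) (word s (b # v # us))"
      let ?D = "lp (pr w) (lp (pr v) (eta_word us))"
      have lpr: "lp (pr w) t = lp w t - smul T (g w) (lp b t)" if "t \<in> carr T" for w t
        unfolding pr_def using lin_diff[OF W_vs bil_left[OF bil_lp that], of w "s (g w) b"]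
          lin_scale[OF bil_left[OF bil_lp that], of b "g w"] by simp
      have eta3: "eta (word s ws) = ?A + ?B + ?D"
        using lin_add[OF lin_lp2[OF lin_id] word_mem lp_mem[OF eta_word_mem], of "pr w" "b # v # us" "pr v" us]
        by (simp add: eta_word 3 add.assoc)
      have B: "?B = word s (w # b # v # us) - smul T (g w) (word s (b # b # v # us))"
        by (rule trans[OF lpr[OF word_mem]]) (simp add: lp_word)
      have SB: "wop (asw 0) ?B = word s (b # w # v # us) - smul T (g w) (word s (b # b # v # us))"
        unfolding B using lin_diff[OF T_vs S, of "word s (w # b # v # us)" "smul T (g w) (word s (b # b # v # us))" 0]
          lin_scale[OF S word_mem, of 0 "g w" "b # b # v # us"]
        by (simp add: vs_scale wop_word rearr_asw)
      have SA: "wop (asw 0) ?A = word s (w # b # v # us)" by (simp add: wop_word rearr_asw)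
      have SD: "wop (asw 0) ?D = lp (pr v) (lp (pr w) (eta_word us))" by (rule wop_lp_lp[OF eta_word_mem])
      have m: "?A \<in> carr T" "?B \<in> carr T" "?D \<in> carr T" by (simp_all add: lp_mem eta_word_mem)
      have S3: "wop (asw 0) (eta (word s ws)) = word s (w # b # v # us)
          + (word s (b # w # v # us) - smul T (g w) (word s (b # b # v # us))) + lp (pr v) (lp (pr w) (eta_word us))"
        unfolding eta3 using lin_add[OF S vs_add[OF T_vs m(1,2)] m(3), of 0] lin_add[OF S m(1,2), of 0]
        unfolding SA SB SD by (simp only:)
      have "wop (asw 0) (eta (word s ws)) - eta (word s ws) = lp (pr v) (lp (pr w) (eta_word us)) - ?D"
        unfolding S3 unfolding eta3 B by (simp add: algebra_simps)
      moreover have "wlift T h (wop (asw 0) (word s ws)) - wlift T h (word s ws) = lp (pr v) (lp (pr w) (eta_word us)) - ?D"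
        by (simp add: wop_word rearr_asw wlift_word h 3) (simp add: h_def)
      ultimately show ?thesis by simp
    qed
  qed
  then show ?thesis using fx by simp
qed

text \<open>A tensor is rebuilt from its scalar part and from the sum of first letter times rest.
  Applied to \<open>eta c\<close>, this leaves the rest to an induction.\<close>

lemma counit_RT_lp:
  assumes t: "t \<in> carr T"
  shows "t = smul T (counit T t) (word s []) + RT T lp t"
proof (rule T_ext[OF lin_id lin_plus[OF T_vs lin_smul_left[OF T_vs word_mem lin_counit_T] lin_RT[OF T_vs bil_lp]] T_vs _ t refl])
  show "word s ws = smul T (counit T (word s ws)) (word s []) + RT T lp (word s ws)" for ws
    by (cases ws) (simp_all add: counit_word RT_word bil_lp lp_word vs_one[OF T_vs] vs_scale_0[OF T_vs])
qed

lemma counit_eta: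
  assumes t: "t \<in> carr T"
  shows "counit T (eta t) = 0"
proof (rule T_ext[OF lin_comp[OF lin_eta lin_counit_T] lin_const_0[OF vec_space_ground] vec_space_ground _ t refl])
  have lp0: "counit T (lp w t) = 0" if "t \<in> carr T" for w t
    by (rule T_ext[OF lin_comp[OF lin_lp2[OF lin_id] lin_counit_T] lin_const_0[OF vec_space_ground] vec_space_ground _ that refl])
       (simp add: lp_word counit_word)
  show "counit T (eta (word s ws)) = 0" for ws
    by (cases ws) (simp_all add: eta_word counit_word lin_add[OF lin_counit_T word_mem lp_mem[OF eta_word_mem]] lp0 eta_word_mem)
qed

text \<open>Induction on the position of the swap. By \<open>RT_eta\<close>, \<open>eta c\<close> is
  \<open>b c\<close> plus the sum of \<open>pr(w) eta(d)\<close> over the splittings of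
  \<open>c\<close>. A swap at \<open>Suc j\<close> leaves the first letter alone, fixes
  \<open>b c\<close> since \<open>c\<close> is symmetric, and acts on \<open>eta(d)\<close> as the
  swap at \<open>j\<close>.\<close>

lemma wop_eta:
  assumes "c \<in> carr C"
  shows "wop (asw j) (eta c) = eta c"
  using assms
proof (induction j arbitrary: c)
  case 0
  then show ?case by (intro wop_eta_0) (simp_all add: Sym_iff)
next
  case (Suc j)
  note t = C_T[OF Suc.prems]
  note S = lin_wop[OF rearr_asw]
  have b2: "bil W T T (\<lambda>w d. lp (pr w) (eta d))" by (rule bil_eta[OF bil_lp])
  have b3: "bil W T T (\<lambda>w d. lp (pr w) (wop (asw j) (eta d)))"
    by (intro bilI lin_lp1 lin_lp2 lin_pr lin_comp[OF lin_eta S] lin_mem[OF S] eta_mem_T)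
  have e: "eta c = lp b c + RT T (\<lambda>w d. lp (pr w) (eta d)) c"
    using counit_RT_lp[OF eta_mem_T[OF t]] RT_eta[OF T_vs bil_lp t] by (simp add: counit_eta t vs_scale_0)
  have m: "RT T (\<lambda>w d. lp (pr w) (eta d)) c \<in> carr T" by (rule lin_mem[OF lin_RT[OF T_vs b2] t])
  have "wop (asw (Suc j)) (RT T (\<lambda>w d. lp (pr w) (eta d)) c) = RT T (\<lambda>w d. lp (pr w) (wop (asw j) (eta d))) c"
  proof (rule T_ext[OF lin_comp[OF lin_RT[OF T_vs b2] S] lin_RT[OF T_vs b3] T_vs _ t refl])
    show "wop (asw (Suc j)) (RT T (\<lambda>w d. lp (pr w) (eta d)) (word s ws)) = RT T (\<lambda>w d. lp (pr w) (wop (asw j) (eta d))) (word s ws)" for ws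
      by (cases ws) (simp_all add: RT_word b2 b3 lin_zero[OF T_vs S] wop_lp eta_mem_T)
  qed
  \<comment> \<open>Passing from \<open>RT\<close> to \<open>Rl\<close> replaces rests of words by
    elements of Sym, to which the induction hypothesis applies.\<close>
  also have "\<dots> = Rl T (\<lambda>w d. lp (pr w) (wop (asw j) (eta d))) c"
    by (rule Rl_RT[OF T_vs b3 Suc.prems, symmetric])
  also have "\<dots> = Rl T (\<lambda>w d. lp (pr w) (eta d)) c"
    by (rule Rl_cong) (simp add: Suc.IH)
  also have "\<dots> = RT T (\<lambda>w d. lp (pr w) (eta d)) c" by (rule Rl_RT[OF T_vs b2 Suc.prems])
  finally have "wop (asw (Suc j)) (RT T (\<lambda>w d. lp (pr w) (eta d)) c) = RT T (\<lambda>w d. lp (pr w) (eta d)) c" .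
  moreover have "wop (asw (Suc j)) (lp b c) = lp b c"
    using Suc.prems by (simp add: wop_lp t Sym_iff)
  ultimately show ?case
    unfolding e using lin_add[OF S lp_mem[OF t] m] by (simp del: plus_fun_apply)
qed

lemma eta_mem: "c \<in> carr C \<Longrightarrow> eta c \<in> carr C"
  using wop_eta eta_mem_T by (simp add: Sym_iff)

lemma lin_eta_C: "lin C C eta"
  using lin_subsp_dom[OF subsp_C_T lin_eta] eta_mem by (simp add: lin_def smul_C)

lemma bil_eta_C: "bil W C X f \<Longrightarrow> bil W C X (\<lambda>w d. f (pr w) (eta d))"
  by (rule bil_comp[OF _ lin_pr lin_eta_C])

lemma Rl_eta:
  assumes X: "vec_space X" and f: "bil W C X f" and c: "c \<in> carr C"
  shows "Rl X f (eta c) = f b c + Rl X (\<lambda>w d. f (pr w) (eta d)) c"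
proof -
  obtain f' where f': "bil W T X f'" "\<And>w d. d \<in> carr C \<Longrightarrow> f' w d = f w d" using bil_extend[OF X f] by blast
  have "Rl X f (eta c) = Rl X f' (eta c)" by (rule Rl_cong) (simp add: f'(2))
  also have "\<dots> = RT X f' (eta c)" by (rule Rl_RT[OF X f'(1) eta_mem[OF c]])
  also have "\<dots> = f' b c + RT X (\<lambda>w d. f' (pr w) (eta d)) c" by (rule RT_eta[OF X f'(1) C_T[OF c]])
  also have "\<dots> = f' b c + Rl X (\<lambda>w d. f' (pr w) (eta d)) c"
    by (simp add: Rl_RT[OF X bil_eta[OF f'(1)] c])
  also have "\<dots> = f b c + Rl X (\<lambda>w d. f (pr w) (eta d)) c"
    using Rl_cong[of "\<lambda>w d. f' (pr w) (eta d)" "\<lambda>w d. f (pr w) (eta d)" X c] by (simp add: f'(2) c eta_mem)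
  finally show ?thesis .
qed

end

context words
begin

section \<open>Alternating maps vanish on symmetric tensors\<close>

definition tri :: "('k, 'x::ab_group_add, 't) vspace_scheme \<Rightarrow> ('w \<Rightarrow> 'w \<Rightarrow> ('k, 'w) words \<Rightarrow> 'x) \<Rightarrow> bool" where
  "tri X h \<longleftrightarrow> (\<forall>v. \<forall>t\<in>carr T. lin W X (\<lambda>w. h w v t)) \<and> (\<forall>w. \<forall>t\<in>carr T. lin W X (\<lambda>v. h w v t))
    \<and> (\<forall>w v. lin T X (h w v))"

lemma tri_bil: "tri X h \<Longrightarrow> bil W T X (h w)"
  by (rule bilI) (simp_all add: tri_def)

lemma tri_bil_RT:
  assumes X: "vec_space X" and h: "tri X h"
  shows "bil W T X (\<lambda>w t. RT X (h w) t)"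
proof (rule bilI)
  show "lin T X (\<lambda>t. RT X (h w) t)" for w by (rule lin_RT[OF X tri_bil[OF h]])
  show "lin W X (\<lambda>w. RT X (h w) t)" if t: "t \<in> carr T" for t
    unfolding RT_def
  proof (rule lin_wlift_param[OF X W_vs t mlin_RT[OF X tri_bil[OF h]]])
    fix ws
    show "lin W X (\<lambda>y. case ws of [] \<Rightarrow> 0 | w # us \<Rightarrow> h y w (word s us))"
      using h by (cases ws) (simp_all add: lin_const_0 X tri_def)
  qed
qed

text \<open>An alternating map is the antisymmetrization of its strictly upper triangular part with
  respect to an ordered basis. This works in characteristic 2 as well, where halving the map would
  be impossible.\<close>

lemma alternating_decomposition:
  assumes X: "vec_space X" and h: "tri X h" and alt: "\<And>w t. t \<in> carr T \<Longrightarrow> h w w t = 0"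
  shows "\<exists>g. tri X g \<and> (\<forall>w v. \<forall>t\<in>carr T. h w v t = g w v t - g v w t)"
proof -
  have vX: "vector_space (smul X)" "module.subspace (smul X) (carr X)" using X by (auto simp: vec_space_def)
  interpret p: vector_space_pair s "smul X" using vs vX by (simp add: vector_space_pair_def)
  obtain r :: "'w rel" where r: "well_order_on UNIV r" using well_order_on by blast
  then have tot: "(a, b) \<in> r \<or> (b, a) \<in> r" and anti: "(a, b) \<in> r \<Longrightarrow> (b, a) \<in> r \<Longrightarrow> a = b" for a b
    by (auto simp: order_on_defs total_on_def antisym_def refl_on_def) metis+
  obtain B where B: "p.vs1.independent B" "UNIV \<subseteq> p.vs1.span B"
    using p.vs1.maximal_independent_subset[of UNIV] by blast
  \<comment> \<open>\<open>k\<close> keeps \<open>h\<close> on the pairs that are increasing for the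
    well-order, and \<open>g\<close> extends it bilinearly from the basis \<open>B\<close>;
    \<open>t\<close> is a parameter.\<close>
  define k where "k a b t = (if (a, b) \<in> r \<and> a \<noteq> b then h a b t else 0)" for a b t
  define g where "g x y t = p.construct B (\<lambda>a. p.construct B (\<lambda>b. k a b t) y) x" for x y t
  have kX: "k a b t \<in> carr X" if "t \<in> carr T" for a b t
    using h that by (auto simp: k_def tri_def lin_def vs_zero[OF X])
  have cX: "p.construct B f v \<in> carr X" if "\<And>b. f b \<in> carr X" for f v
  proof -
    have "p.vs2.span (f ` B) \<subseteq> carr X" by (rule p.vs2.span_minimal[OF _ vX(2)]) (use that in auto)
    then show ?thesis using p.construct_in_span[OF B(1)] by blast
  qed
  have lc: "p.construct B f (x + y) = p.construct B f x + p.construct B f y"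
    "p.construct B f (s c x) = smul X c (p.construct B f x)" for f x y c
    using p.linear_construct[OF B(1), of f] by (auto simp: Vector_Spaces.linear_iff)
  have gX: "g x y t \<in> carr X" if "t \<in> carr T" for x y t
    unfolding g_def by (intro cX kX that)
  have tri_g: "tri X g"
    unfolding tri_def
  proof (intro conjI allI ballI)
    show "lin W X (\<lambda>w. g w v t)" if "t \<in> carr T" for v t
      by (rule linI) (simp_all add: gX that, simp_all add: g_def lc)
    show "lin W X (\<lambda>v. g w v t)" if "t \<in> carr T" for w t
      by (rule linI) (simp_all add: gX that, simp_all add: g_def lc p.construct_add[OF B(1)] p.construct_scale[OF B(1)])
    show "lin T X (g w v)" for w v
    proof (rule linI)
      fix t t' assume t: "t \<in> carr T" "t' \<in> carr T"
      have "k a b (t + t') = k a b t + k a b t'" for a b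
        using h t by (simp add: k_def tri_def lin_def del: plus_fun_apply)
      then show "g w v (t + t') = g w v t + g w v t'" by (simp add: g_def p.construct_add[OF B(1)] del: plus_fun_apply)
    next
      fix c t assume t: "t \<in> carr T"
      have "k a b (smul T c t) = smul X c (k a b t)" for a b
        using h t by (simp add: k_def tri_def lin_def vs_scale_zero[OF X])
      then show "g w v (smul T c t) = smul X c (g w v t)" by (simp add: g_def p.construct_scale[OF B(1)])
    qed (rule gX)
  qed
  have "h x y t = g x y t - g y x t" if t: "t \<in> carr T" for x y t
  proof -
    have hl: "lin W X (\<lambda>w. h w v t)" "lin W X (\<lambda>v. h w v t)" for w v using h t by (simp_all add: tri_def)
    have gl: "lin W X (\<lambda>w. g w v t)" "lin W X (\<lambda>v. g w v t)" for w v using tri_g t by (simp_all add: tri_def)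
    have vl: "Vector_Spaces.linear s (smul X) f" if "lin W X f" for f
      using that vs vX by (simp add: lin_def Vector_Spaces.linear_iff)
    have hd: "Vector_Spaces.linear s (smul X) (\<lambda>w. g w v t - g v w t)" "Vector_Spaces.linear s (smul X) (\<lambda>w. g v w t - g w v t)" for v
      by (intro vl lin_minus X gl)+
    have swap: "h a b t = - h b a t" for a b
    proof -
      have "h (a + b) (a + b) t = h a a t + h b a t + (h a b t + h b b t)"
        using lin_add[OF hl(1)] lin_add[OF hl(2)] by (simp add: add.assoc)
      then show ?thesis by (simp add: alt t add.commute eq_neg_iff_add_eq_0)
    qed
    have "h a b t = g a b t - g b a t" if "a \<in> B" "b \<in> B" for a b
    proof -
      have "g a b t = k a b t" "g b a t = k b a t"
        using that by (simp_all add: g_def p.construct_basis[OF B(1)])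
      then show ?thesis
        using tot[of a b] anti[of a b] swap[of a b] alt[OF t] by (auto simp: k_def)
    qed
    then have "h a y t = g a y t - g y a t" if "a \<in> B" for a
      using p.linear_eq_on[OF vl[OF hl(2)[of a]] hd(2)[of a], of y B] B(2) that by blast
    then show ?thesis
      using p.linear_eq_on[OF vl[OF hl(1)[of y]] hd(1)[of y], of x B] B(2) by blast
  qed
  then show ?thesis using tri_g by blast
qed

text \<open>With the alternating map written as \<open>g w v - g v w\<close>, the result is the
  difference of a linear map at \<open>c\<close> and at \<open>c\<close> with the first two letters
  swapped, and \<open>c\<close> is invariant. This is why the differentials square to zero.\<close>

lemma Rl_Rl_alternating:
  assumes X: "vec_space X" and c: "c \<in> carr C"
    and f1: "\<And>v d. d \<in> carr C \<Longrightarrow> lin W X (\<lambda>w. f w v d)" and f2: "\<And>w d. d \<in> carr C \<Longrightarrow> lin W X (\<lambda>v. f w v d)"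
    and f3: "\<And>w v. lin C X (f w v)" and alt: "\<And>w d. d \<in> carr C \<Longrightarrow> f w w d = 0"
  shows "Rl X (\<lambda>w d. Rl X (\<lambda>v e. f w v e) d) c = 0"
proof -
  obtain q where q: "Vector_Spaces.linear (smul C) (smul C) q" "\<And>x. q x \<in> carr C" "\<And>x. x \<in> carr C \<Longrightarrow> q x = x"
    using subspace_projection[OF vec_space_C] by blast
  have lq: "lin T C q" using q by (simp add: lin_def Vector_Spaces.linear_iff smul_C)
  define F where "F w v t = f w v (q t)" for w v t
  have F: "tri X F"
    unfolding tri_def F_def using f1 f2 lin_comp[OF lq f3] q(2) by simp
  obtain g where g: "tri X g" "\<And>w v t. t \<in> carr T \<Longrightarrow> F w v t = g w v t - g v w t"
    using alternating_decomposition[OF X F] alt q(2) unfolding F_def by blast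
  note t = C_T[OF c]
  have b2: "bil W T X (\<lambda>w t. RT X (h w) t)" if "tri X h" for h by (rule tri_bil_RT[OF X that])
  have word2: "RT X (\<lambda>w t. RT X (h w) t) (word s ws) = (case ws of w # v # us \<Rightarrow> h w v (word s us) | _ \<Rightarrow> 0)" if "tri X h" for h ws
    by (cases ws; cases "tl ws") (simp_all add: RT_word X b2 that tri_bil)
  have "Rl X (\<lambda>w d. Rl X (\<lambda>v e. f w v e) d) c = Rl X (\<lambda>w d. RT X (F w) d) c"
  proof (rule Rl_cong)
    fix w d assume d: "d \<in> carr C"
    have "Rl X (\<lambda>v e. f w v e) d = Rl X (F w) d" by (rule Rl_cong) (simp add: F_def q(3))
    then show "Rl X (\<lambda>v e. f w v e) d = RT X (F w) d" by (simp add: Rl_RT[OF X tri_bil[OF F] d])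
  qed
  also have "\<dots> = RT X (\<lambda>w t. RT X (F w) t) c" by (rule Rl_RT[OF X b2[OF F] c])
  also have "\<dots> = RT X (\<lambda>w t. RT X (g w) t) c - RT X (\<lambda>w t. RT X (g w) t) (wop (asw 0) c)"
  proof (rule T_ext[OF lin_RT[OF X b2[OF F]] lin_minus[OF X lin_RT[OF X b2[OF g(1)]] lin_comp[OF lin_wop[OF rearr_asw] lin_RT[OF X b2[OF g(1)]]]] X _ t refl])
    fix ws :: "'w list"
    show "RT X (\<lambda>w t. RT X (F w) t) (word s ws)
      = RT X (\<lambda>w t. RT X (g w) t) (word s ws) - RT X (\<lambda>w t. RT X (g w) t) (wop (asw 0) (word s ws))"
      by (cases ws; cases "tl ws") (simp_all add: word2 F g(1) wop_word rearr_asw g(2))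
  qed
  also have "\<dots> = 0" using c by (simp add: Sym_iff)
  finally show ?thesis .
qed

lemma Rl_counit:
  assumes X: "vec_space X" and h: "lin W X h" and c: "c \<in> carr C"
  shows "Rl X (\<lambda>w d. smul X (counit C d) (h w)) c = h (p1 c)"
  unfolding Rl_def by (rule C.sw_counit_right[OF X lin_comp[OF lin_p1 h] c])

text \<open>\<open>f\<close> has no argument for the rest of the word. Multiplying by the counit of
  the rest supplies one, and \<open>Rl_counit\<close> removes it again.\<close>

lemma sw_p1_p1_alternating:
  assumes X: "vec_space X" and c: "c \<in> carr C"
    and f: "bil W W X f" and alt: "\<And>w. f w w = 0"
  shows "C.sw X (\<lambda>a b. f (p1 a) (p1 b)) c = 0"
proof -
  have m: "f w v \<in> carr X" for w v using bil_mem[OF f, of w v] by simp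
  have "Rl X (\<lambda>w d. Rl X (\<lambda>v e. smul X (counit C e) (f w v)) d) c = 0"
    by (rule Rl_Rl_alternating[OF X c])
       (use bil_left[OF f] bil_right[OF f] in \<open>simp_all add: alt vs_scale_zero X lin_smul_right lin_smul_left m C.lin_counit\<close>)
  moreover have "Rl X (\<lambda>w d. Rl X (\<lambda>v e. smul X (counit C e) (f w v)) d) c = Rl X (\<lambda>w d. f w (p1 d)) c"
    by (rule Rl_cong) (use bil_right[OF f] in \<open>simp add: Rl_counit X\<close>)
  ultimately show ?thesis by (simp add: Rl_def)
qed

section \<open>The grouplike element\<close>

abbreviation "one \<equiv> word s []"

lemma one_mem: "one \<in> carr C"
  by (simp add: Sym_iff wop_word rearr_asw)

lemma counit_one: "counit C one = 1"
  by (simp add: counit_C res_apply one_mem counit_word)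

lemma comult_one: "comult C one = tens C C one one"
  using subsp_tens[OF subsp_C_T subsp_C_T] by (simp add: comult_C res_apply one_mem comult_word)

lemma p1_one: "p1 one = 0"
  by (simp add: p1_apply one_mem p1T_word)

lemma sw_one: "vec_space X \<Longrightarrow> bil C C X f \<Longrightarrow> C.sw X f one = f one one"
  by (simp add: C.sw_def comult_one tensor_lift_tens one_mem)

section \<open>Exterior powers\<close>

abbreviation "L i \<equiv> Ext_power s i"

lemma carr_L: "carr (L i) = module.span (ptmul (*)) (wedge_word s ` {ws. int (length ws) = i})"
  and smul_L: "smul (L i) = ptmul (*)"
  by (simp_all add: Ext_power_def)

lemma L_vs [simp]: "vec_space (L i)"
  unfolding Ext_power_def by (rule vec_space_span_functions)

lemma L_negative: "i < 0 \<Longrightarrow> carr (L i) = {0}"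
proof -
  interpret vector_space "ptmul ((*) :: 'k \<Rightarrow> 'k \<Rightarrow> 'k)" using vector_space_functions by simp
  assume "i < 0"
  then have "{ws :: 'w list. int (length ws) = i} = {}" by auto
  then show ?thesis unfolding carr_L by (simp only: image_empty span_empty)
qed

lemma wedge_word_mem: "int (length ws) = i \<Longrightarrow> wedge_word s ws \<in> carr (L i)"
proof -
  interpret vector_space "ptmul ((*) :: 'k \<Rightarrow> 'k \<Rightarrow> 'k)" using vector_space_functions by simp
  show "int (length ws) = i \<Longrightarrow> ?thesis" unfolding carr_L by (rule span_base) simp
qed

lemma lin_wedge_word: "lin W (L (int (length xs + length ys + 1))) (\<lambda>w. wedge_word s (xs @ w # ys))"
  by (rule linI) (simp add: wedge_word_mem,
      auto simp: smul_L wedge_word_def fun_eq_iff alternating_form_def multilinear_form_def Vector_Spaces.linear_iff)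

lemma wedge_word_alt: "wedge_word s (xs @ w # w # ys) = 0"
  by (auto simp: wedge_word_def alternating_form_def fun_eq_iff)

text \<open>Extends \<open>Ext_power_universal\<close> to integer degrees; in negative degree there
  are no words, and zero is the only map out of the zero space.\<close>

lemma L_univ:
  assumes X: "vec_space X"
    and fX: "\<And>ws. int (length ws) = i \<Longrightarrow> f ws \<in> carr X"
    and lin: "\<And>xs ys. int (length xs + length ys + 1) = i \<Longrightarrow> lin W X (\<lambda>w. f (xs @ w # ys))"
    and alt: "\<And>xs w ys. int (length xs + length ys + 2) = i \<Longrightarrow> f (xs @ w # w # ys) = 0"
  shows "\<exists>!g. g \<in> hom (L i) X \<and> (\<forall>ws. int (length ws) = i \<longrightarrow> g (wedge_word s ws) = f ws)"
proof (cases "i < 0")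
  case True
  have "hom (L i) X = {\<lambda>_. 0}"
  proof
    show "hom (L i) X \<subseteq> {\<lambda>_. 0}"
    proof
      fix g assume g: "g \<in> hom (L i) X"
      have "g x = 0" for x
        using lin_zero[OF L_vs hom_lin[OF g]] hom_outside[OF g, of x] L_negative[OF True] by (cases "x = 0") auto
      then show "g \<in> {\<lambda>_. 0}" by auto
    qed
    show "{\<lambda>_. 0} \<subseteq> hom (L i) X" using lin_const_0[OF X] by (auto simp: hom_iff_lin)
  qed
  then show ?thesis using True by auto
next
  case False
  then obtain n where n: "i = int n" by (metis int_nat_eq not_le zero_le_imp_eq_int not_less)
  have vX: "vector_space (smul X)" using X by (simp add: vec_space_def)
  have "\<exists>!g. g \<in> hom (L (int n)) X \<and> (\<forall>ws. length ws = n \<longrightarrow> g (wedge_word s ws) = f ws)"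
  proof (rule Ext_power_universal[OF vs X])
    show "Vector_Spaces.linear s (smul X) (\<lambda>w. f (xs @ w # ys))" if "length xs + length ys + 1 = n" for xs ys
      using lin[of xs ys] that n vs vX by (simp add: lin_def Vector_Spaces.linear_iff)
    show "f (xs @ w # w # ys) = 0" if "length xs + length ys + 2 = n" for xs w ys
      using alt[of xs ys w] that n by simp
  qed (simp add: fX n)
  then show ?thesis by (simp add: n)
qed

lemma L_ext:
  assumes g: "lin (L i) X g" and h: "lin (L i) X h" and X: "vec_space X"
    and eq: "\<And>ws. int (length ws) = i \<Longrightarrow> g (wedge_word s ws) = h (wedge_word s ws)" and x: "x \<in> carr (L i)"
  shows "g x = h x"
proof -
  interpret vector_space "ptmul ((*) :: 'k \<Rightarrow> 'k \<Rightarrow> 'k)" using vector_space_functions by simp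
  let ?E = "{x \<in> carr (L i). g x - h x = 0}"
  have "subspace ?E"
    using kernel_subspace[OF L_vs X lin_minus[OF X g h]] by (simp add: smul_L)
  then have "span (wedge_word s ` {ws. int (length ws) = i}) \<subseteq> ?E"
    by (intro span_minimal) (auto simp: eq wedge_word_mem)
  then show ?thesis using x by (auto simp: carr_L)
qed

lemma wedge_spec: "wedge s i w \<in> hom (L i) (L (i + 1))
    \<and> (\<forall>ws. int (length ws) = i \<longrightarrow> wedge s i w (wedge_word s ws) = wedge_word s (w # ws))"
proof -
  have "\<exists>!g. g \<in> hom (L i) (L (i + 1)) \<and> (\<forall>ws. int (length ws) = i \<longrightarrow> g (wedge_word s ws) = wedge_word s (w # ws))"
  proof (rule L_univ[OF L_vs])
    show "lin W (L (i + 1)) (\<lambda>v. wedge_word s (w # xs @ v # ys))" if "int (length xs + length ys + 1) = i" for xs ys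
    proof -
      have e: "i + 1 = int (length (w # xs) + length ys + 1)" using that by simp
      show ?thesis unfolding e using lin_wedge_word[of "w # xs" ys] by simp
    qed
    show "wedge_word s (w # xs @ v # v # ys) = 0" for xs v ys
      using wedge_word_alt[of "w # xs" v ys] by simp
  qed (simp add: wedge_word_mem)
  from theI'[OF this] show ?thesis by (simp add: wedge_def)
qed

lemma lin_wedge: "lin (L i) (L (i + 1)) (wedge s i w)"
  using wedge_spec by (blast intro: hom_lin)

lemma wedge_wedge_word: "int (length ws) = i \<Longrightarrow> wedge s i w (wedge_word s ws) = wedge_word s (w # ws)"
  using wedge_spec by blast

lemma L_span_induct:
  assumes x: "x \<in> carr (L i)" and "P 0"
    and "\<And>c ws x. int (length ws) = i \<Longrightarrow> x \<in> carr (L i) \<Longrightarrow> P x \<Longrightarrow> P (smul (L i) c (wedge_word s ws) + x)"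
  shows "P x"
proof -
  interpret vector_space "ptmul ((*) :: 'k \<Rightarrow> 'k \<Rightarrow> 'k)" using vector_space_functions by simp
  have "x \<in> span (wedge_word s ` {ws. int (length ws) = i})" using x by (simp add: carr_L)
  then have "x \<in> carr (L i) \<and> P x"
  proof (rule span_induct_alt)
    show "0 \<in> carr (L i) \<and> P 0" using assms(2) by simp
    fix c x y assume "x \<in> wedge_word s ` {ws. int (length ws) = i}" and y: "y \<in> carr (L i) \<and> P y"
    then obtain ws where ws: "x = wedge_word s ws" "int (length ws) = i" by blast
    then show "(\<lambda>f. c * x f) + y \<in> carr (L i) \<and> P ((\<lambda>f. c * x f) + y)"
      using y assms(3)[of ws y c] vs_add[OF L_vs vs_scale[OF L_vs wedge_word_mem[OF ws(2)], of c], of y] by (simp add: smul_L)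
  qed
  then show ?thesis ..
qed

lemma bil_wedge: "bil W (L i) (L (i + 1)) (wedge s i)"
proof (rule bilI)
  show "lin (L i) (L (i + 1)) (wedge s i w)" for w by (rule lin_wedge)
  show "lin W (L (i + 1)) (\<lambda>w. wedge s i w x)" if x: "x \<in> carr (L i)" for x
  proof (rule L_span_induct[OF x])
    show "lin W (L (i + 1)) (\<lambda>w. wedge s i w 0)"
      using lin_zero[OF L_vs lin_wedge] lin_const_0[OF L_vs] by simp
    fix c x and ws :: "'w list" assume ws: "int (length ws) = i" and x: "x \<in> carr (L i)" and l: "lin W (L (i + 1)) (\<lambda>w. wedge s i w x)"
    have "lin W (L (i + 1)) (\<lambda>w. smul (L (i + 1)) c (wedge_word s (w # ws)) + wedge s i w x)"
      using lin_wedge_word[of "[]" ws] ws by (intro lin_plus lin_smul_right l L_vs) (simp add: add.commute)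
    moreover have "wedge s i w (smul (L i) c (wedge_word s ws) + x) = smul (L (i + 1)) c (wedge_word s (w # ws)) + wedge s i w x" for w
      using lin_add[OF lin_wedge vs_scale[OF L_vs wedge_word_mem[OF ws]] x] lin_scale[OF lin_wedge wedge_word_mem[OF ws]]
      by (simp add: wedge_wedge_word ws del: plus_fun_apply)
    ultimately show "lin W (L (i + 1)) (\<lambda>w. wedge s i w (smul (L i) c (wedge_word s ws) + x))" by (simp del: plus_fun_apply)
  qed
qed

lemma wedge_mem: "x \<in> carr (L i) \<Longrightarrow> wedge s i w x \<in> carr (L (i + 1))"
  by (rule lin_mem[OF lin_wedge])

lemma lin_wedge2: "lin Y (L i) h \<Longrightarrow> lin Y (L (i + 1)) (\<lambda>y. wedge s i w (h y))"
  by (rule lin_comp[OF _ lin_wedge])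

lemma lin_wedge1: "x \<in> carr (L i) \<Longrightarrow> lin Y W h \<Longrightarrow> lin Y (L (i + 1)) (\<lambda>y. wedge s i (h y) x)"
  by (rule lin_comp[OF _ bil_left[OF bil_wedge]])

lemma wedge_wedge_self:
  assumes x: "x \<in> carr (L i)"
  shows "wedge s (i + 1) w (wedge s i w x) = 0"
proof -
  have l: "lin (L i) (L (i + 1 + 1)) (\<lambda>x. wedge s (i + 1) w (wedge s i w x))"
    by (intro lin_wedge2 lin_id)
  show ?thesis
    by (rule L_ext[OF l lin_const_0[OF L_vs] L_vs _ x])
       (use wedge_word_alt[of "[]"] in \<open>simp add: wedge_wedge_word\<close>)
qed

end

section \<open>Contraction of exterior products with a functional\<close>

context letter
begin

text \<open>Contraction with \<open>g\<close>, by the signed Leibniz rule. The contraction of the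
  empty word lives in degree -1, where the space is zero.\<close>

primrec iota_word :: "'w list \<Rightarrow> ('k, 'w) words" where
  "iota_word [] = 0"
| "iota_word (w # ws) = smul (L (int (length ws))) (g w) (wedge_word s ws) - wedge s (int (length ws) - 1) w (iota_word ws)"

lemma iota_word_mem: "iota_word ws \<in> carr (L (int (length ws) - 1))"
proof (induction ws)
  case (Cons w ws)
  then have "wedge s (int (length ws) - 1) w (iota_word ws) \<in> carr (L (int (length ws)))"
    using wedge_mem[of "iota_word ws" "int (length ws) - 1" w] by simp
  then show ?case using vs_diff[OF L_vs vs_scale[OF L_vs wedge_word_mem[OF refl]]] by (simp del: minus_apply)
qed (simp del: zero_fun_apply)

lemma lin_iota_word: "lin W (L (int (length xs + length ys))) (\<lambda>w. iota_word (xs @ w # ys))"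
proof (induction xs)
  case Nil
  have "lin W (L (int (length ys))) (\<lambda>w. wedge s (int (length ys) - 1) w (iota_word ys))"
    using lin_wedge1[OF iota_word_mem lin_id, of ys] by simp
  then have "lin W (L (int (length ys))) (\<lambda>w. smul (L (int (length ys))) (g w) (wedge_word s ys) - wedge s (int (length ys) - 1) w (iota_word ys))"
    by (intro lin_minus L_vs lin_smul_left wedge_word_mem lin_g) simp_all
  then show ?case by (simp del: minus_apply)
next
  case (Cons x xs)
  let ?n = "int (length xs + length ys)"
  have "lin W (L (?n + 1)) (\<lambda>w. wedge s ?n x (iota_word (xs @ w # ys)))"
    by (rule lin_wedge2[OF Cons])
  moreover have "lin W (L (?n + 1)) (\<lambda>w. wedge_word s (xs @ w # ys))"
    using lin_wedge_word[of xs ys] by (simp add: add.commute)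
  ultimately have "lin W (L (?n + 1)) (\<lambda>w. smul (L (?n + 1)) (g x) (wedge_word s (xs @ w # ys)) - wedge s ?n x (iota_word (xs @ w # ys)))"
    by (intro lin_minus L_vs lin_smul_right)
  then show ?case by (simp add: algebra_simps del: minus_apply)
qed

text \<open>For a repeated first letter the two terms with factor \<open>g(w)\<close> cancel, and
  the remaining one contains \<open>w\<close> twice. Letters in front are handled by
  induction.\<close>

lemma iota_word_alt: "iota_word (xs @ w # w # ys) = 0"
proof (induction xs)
  case Nil
  let ?n = "int (length ys)"
  have m: "wedge s (?n - 1) w (iota_word ys) \<in> carr (L ?n)"
    using wedge_mem[OF iota_word_mem, of ys w] by simp
  have "wedge s ?n w (smul (L ?n) (g w) (wedge_word s ys) - wedge s (?n - 1) w (iota_word ys))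
    = smul (L (?n + 1)) (g w) (wedge_word s (w # ys)) - wedge s ?n w (wedge s (?n - 1) w (iota_word ys))"
    using lin_diff[OF L_vs lin_wedge vs_scale[OF L_vs wedge_word_mem[OF refl]] m] lin_scale[OF lin_wedge wedge_word_mem[OF refl]]
    by (simp add: wedge_wedge_word)
  also have "wedge s ?n w (wedge s (?n - 1) w (iota_word ys)) = 0"
    using wedge_wedge_self[OF iota_word_mem, of ys w] by simp
  finally show ?case by (simp add: add.commute del: minus_apply)
next
  case (Cons x xs)
  then show ?case
    by (simp add: wedge_word_alt lin_zero[OF L_vs lin_wedge] vs_scale_zero[OF L_vs] del: minus_apply zero_fun_apply uminus_apply)
qed

definition iota :: "int \<Rightarrow> ('k, 'w) words \<Rightarrow> ('k, 'w) words" where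
  "iota i = (THE h. h \<in> hom (L i) (L (i - 1)) \<and> (\<forall>ws. int (length ws) = i \<longrightarrow> h (wedge_word s ws) = iota_word ws))"

lemma iota_spec: "iota i \<in> hom (L i) (L (i - 1)) \<and> (\<forall>ws. int (length ws) = i \<longrightarrow> iota i (wedge_word s ws) = iota_word ws)"
proof -
  have "\<exists>!h. h \<in> hom (L i) (L (i - 1)) \<and> (\<forall>ws. int (length ws) = i \<longrightarrow> h (wedge_word s ws) = iota_word ws)"
  proof (rule L_univ[OF L_vs])
    show "iota_word ws \<in> carr (L (i - 1))" if "int (length ws) = i" for ws
      using iota_word_mem[of ws] that by simp
    show "lin W (L (i - 1)) (\<lambda>w. iota_word (xs @ w # ys))" if "int (length xs + length ys + 1) = i" for xs ys
    proof -
      have "i - 1 = int (length xs + length ys)" using that by simp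
      then show ?thesis using lin_iota_word[of xs ys] by simp
    qed
  qed (rule iota_word_alt)
  from theI'[OF this] show ?thesis by (simp add: iota_def)
qed

lemma lin_iota: "lin (L i) (L (i - 1)) (iota i)"
  using iota_spec by (blast intro: hom_lin)

lemma iota_wedge_word: "int (length ws) = i \<Longrightarrow> iota i (wedge_word s ws) = iota_word ws"
  using iota_spec by blast

lemma iota_mem: "x \<in> carr (L i) \<Longrightarrow> iota i x \<in> carr (L (i - 1))"
  by (rule lin_mem[OF lin_iota])

lemma iota_wedge:
  assumes x: "x \<in> carr (L i)"
  shows "iota (i + 1) (wedge s i w x) = smul (L i) (g w) x - wedge s (i - 1) w (iota i x)"
proof (rule L_ext[OF _ _ L_vs _ x])
  show "lin (L i) (L i) (\<lambda>x. iota (i + 1) (wedge s i w x))"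
    using lin_comp[OF lin_wedge lin_iota, of i w] by simp
  show "lin (L i) (L i) (\<lambda>x. smul (L i) (g w) x - wedge s (i - 1) w (iota i x))"
    using lin_wedge2[OF lin_iota, of i w] by (intro lin_minus L_vs lin_smul_right lin_id) simp
  show "iota (i + 1) (wedge s i w (wedge_word s ws)) = smul (L i) (g w) (wedge_word s ws) - wedge s (i - 1) w (iota i (wedge_word s ws))"
    if "int (length ws) = i" for ws
    using that iota_wedge_word[of "w # ws" "i + 1"] by (simp add: wedge_wedge_word iota_wedge_word add.commute del: minus_apply)
qed

end

section \<open>Koszul-type differentials\<close>

context coalg
begin

text \<open>The comodule morphism \<open>c \<otimes> v \<mapsto> c\<^sub>1 \<otimes> u(c\<^sub>2, v)\<close> with corestriction \<open>u\<close>.\<close>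

definition cod :: "('k, 'v::ab_group_add, 'y) vspace_scheme \<Rightarrow> ('k, 'u::ab_group_add, 'z) vspace_scheme
    \<Rightarrow> ('c \<Rightarrow> 'v \<Rightarrow> 'u) \<Rightarrow> ('k, 'c, 'v) tensor \<Rightarrow> ('k, 'c, 'u) tensor" where
  "cod V U u = tensor_lift C V (tensor C U) (\<lambda>c v. sw (tensor C U) (\<lambda>a b. tens C U a (u b v)) c)"

context
  fixes V :: "('k, 'v::ab_group_add, 'y) vspace_scheme" and U :: "('k, 'u::ab_group_add, 'z) vspace_scheme" and u
  assumes V [simp]: "vec_space V" and U [simp]: "vec_space U" and u: "bil C V U u"
begin

lemma bil_cod_inner: "v \<in> carr V \<Longrightarrow> bil C C (tensor C U) (\<lambda>a b. tens C U a (u b v))"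
  by (rule bil_tens_hom[OF U bil_left[OF u]])

lemma bil_cod: "bil C V (tensor C U) (\<lambda>c v. sw (tensor C U) (\<lambda>a b. tens C U a (u b v)) c)"
proof (rule bilI)
  show "lin C (tensor C U) (sw (tensor C U) (\<lambda>a b. tens C U a (u b v)))" if "v \<in> carr V" for v
    using lin_sw[OF vec_space_tensor bil_cod_inner[OF that] lin_id] .
  show "lin V (tensor C U) (\<lambda>v. sw (tensor C U) (\<lambda>a b. tens C U a (u b v)) c)" if "c \<in> carr C" for c
    by (rule lin_sw_param[OF vec_space_tensor V that bil_cod_inner]) (auto intro!: lin_tens2 bil_right[OF u])
qed

lemma cod_hom: "cod V U u \<in> hom (tensor C V) (tensor C U)"
  unfolding cod_def by (rule tensor_lift_hom) (simp_all add: bil_cod)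

lemma lin_cod: "lin (tensor C V) (tensor C U) (cod V U u)"
  by (rule hom_lin[OF cod_hom])

lemma cod_tens: "c \<in> carr C \<Longrightarrow> v \<in> carr V \<Longrightarrow> cod V U u (tens C V c v) = sw (tensor C U) (\<lambda>a b. tens C U a (u b v)) c"
  unfolding cod_def by (rule tensor_lift_tens) (simp_all add: bil_cod)

lemma bil_cod_conv: "lin C V p \<Longrightarrow> bil C C U (\<lambda>a b. u a (p b))"
  by (rule bil_comp[OF u lin_id])

text \<open>The elements \<open>c_1 \<otimes> p(c_2)\<close> are the values of
  \<open>Psi_cofree\<close> and of \<open>theta\<close>; on them \<open>cod\<close> acts by
  replacing \<open>p\<close> with its convolution with \<open>u\<close>. The differentials on both
  sides are computed by this rule.\<close>

lemma cod_sw: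
  assumes p: "lin C V p" and c: "c \<in> carr C"
  shows "cod V U u (sw (tensor C V) (\<lambda>a b. tens C V a (p b)) c)
    = sw (tensor C U) (\<lambda>a b. tens C U a (sw U (\<lambda>b1 b2. u b1 (p b2)) b)) c"
proof -
  have pV: "p b \<in> carr V" if "b \<in> carr C" for b by (rule lin_mem[OF p that])
  have "cod V U u (sw (tensor C V) (\<lambda>a b. tens C V a (p b)) c) = sw (tensor C U) (\<lambda>a b. cod V U u (tens C V a (p b))) c"
    by (rule sw_comp[OF _ _ bil_tens_hom[OF V p] lin_cod c]) simp_all
  also have "\<dots> = sw (tensor C U) (\<lambda>a b. sw (tensor C U) (\<lambda>a1 a2. tens C U a1 (u a2 (p b))) a) c"
    by (rule sw_cong) (simp add: cod_tens pV)
  also have "\<dots> = sw (tensor C U) (\<lambda>a b. sw (tensor C U) (\<lambda>b1 b2. tens C U a (u b1 (p b2))) b) c"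
  proof (rule sw_coassoc[where f = "\<lambda>a b c. tens C U a (u b (p c))"])
    show "lin C (tensor C U) (\<lambda>a. tens C U a (u b (p c)))" if "b \<in> carr C" "c \<in> carr C" for b c
      by (intro lin_tens1 lin_id) (simp_all add: bil_mem[OF u] that pV)
    show "lin C (tensor C U) (\<lambda>b. tens C U a (u b (p c)))" if "a \<in> carr C" "c \<in> carr C" for a c
      by (intro lin_tens2 bil_left[OF u]) (simp_all add: that pV)
    show "lin C (tensor C U) (\<lambda>c. tens C U a (u b (p c)))" if "a \<in> carr C" "b \<in> carr C" for a b
      by (intro lin_tens2 lin_comp[OF p bil_right[OF u]]) (simp_all add: that)
  qed (simp_all add: c)
  also have "\<dots> = sw (tensor C U) (\<lambda>a b. tens C U a (sw U (\<lambda>b1 b2. u b1 (p b2)) b)) c"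
  proof (rule sw_cong)
    fix a b assume a: "a \<in> carr C" and b: "b \<in> carr C"
    show "sw (tensor C U) (\<lambda>b1 b2. tens C U a (u b1 (p b2))) b = tens C U a (sw U (\<lambda>b1 b2. u b1 (p b2)) b)"
      by (rule sw_comp[OF U _ bil_cod_conv[OF p] lin_tens2[OF C_vs U a lin_id] b, symmetric]) simp
  qed
  finally show ?thesis .
qed

text \<open>For fixed \<open>v\<close> the map \<open>c \<mapsto> cod(c \<otimes> v)\<close> is
  \<open>Psi_cofree\<close> of \<open>b \<mapsto> u(b, v)\<close>, already known to be a comodule
  morphism.\<close>

lemma cod_comodule_hom: "cod V U u \<in> comodule_hom C (cofree C V) (cofree C U)"
proof -
  let ?M = "tensor C V" and ?N = "tensor C U"
  have l1: "lin ?M (tensor C ?N) (\<lambda>t. coact (cofree C U) (cod V U u t))"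
    by (rule lin_coact_cofree[OF U lin_cod])
  have l2: "lin (tensor C ?M) (tensor C ?N) (tensor_map C ?M C ?N (\<lambda>x. x) (cod V U u))"
    by (rule hom_lin, rule tensor_map_hom) (simp_all add: lin_id lin_cod)
  have "coact (cofree C U) (cod V U u t) = tensor_map C ?M C ?N (\<lambda>x. x) (cod V U u) (coact (cofree C V) t)" if t: "t \<in> carr ?M" for t
  proof (rule tensor_ext[OF C_vs V l1 lin_comp[OF lin_coact_cofree[OF V lin_id] l2] _ t])
    fix c v assume c: "c \<in> carr C" and v: "v \<in> carr V"
    let ?p = "res C (\<lambda>b. u b v)"
    have p: "?p \<in> hom C U" by (rule res_hom[OF C_vs bil_left[OF u v]])
    have pp: "Psi_cofree C U ?p c = cod V U u (tens C V c v)" if "c \<in> carr C" for c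
      unfolding Psi_cofree_apply[OF p] using that v by (simp add: res_apply cod_tens) (rule sw_cong, simp add: res_apply)
    have "coact (cofree C U) (cod V U u (tens C V c v)) = sw (tensor C ?N) (\<lambda>a b. tens C ?N a (Psi_cofree C U ?p b)) c"
      using comodule_homD(3)[OF Psi_cofree_comodule_hom[OF U p], of c] c pp[OF c] by (simp add: tensor_map_comult)
    also have "\<dots> = sw (tensor C ?N) (\<lambda>a b. tensor_map C ?M C ?N (\<lambda>x. x) (cod V U u) (tens C ?M a (tens C V b v))) c"
      by (rule sw_cong) (simp add: pp tensor_map_tens lin_id lin_cod tens_mem v)
    also have "\<dots> = tensor_map C ?M C ?N (\<lambda>x. x) (cod V U u) (sw (tensor C ?M) (\<lambda>a b. tens C ?M a (tens C V b v)) c)"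
      by (rule sw_comp[OF _ _ bil_tens_hom[OF vec_space_tensor lin_tens1[OF C_vs V v lin_id]] l2 c, symmetric]) simp_all
    finally show "coact (cofree C U) (cod V U u (tens C V c v))
      = tensor_map C ?M C ?N (\<lambda>x. x) (cod V U u) (coact (cofree C V) (tens C V c v))"
      by (simp add: coact_cofree_tens v c)
  qed
  then show ?thesis using cod_hom by (simp add: comodule_hom_def)
qed

end

text \<open>By \<open>cod_sw\<close> the composition has corestriction
  \<open>u'(b_1, u(b_2, v))\<close>, so it suffices that this convolution vanishes.\<close>

lemma cod_cod:
  assumes V: "vec_space V" and U: "vec_space U" and X: "vec_space X" and u: "bil C V U u" and u': "bil C U X u'"
    and z: "\<And>c v. c \<in> carr C \<Longrightarrow> v \<in> carr V \<Longrightarrow> sw X (\<lambda>b1 b2. u' b1 (u b2 v)) c = 0" and t: "t \<in> carr (tensor C V)"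
  shows "cod U X u' (cod V U u t) = 0"
proof (rule tensor_ext[OF C_vs V lin_comp[OF lin_cod[OF V U u] lin_cod[OF U X u']] lin_const_0[OF vec_space_tensor] _ t])
  fix c v assume c: "c \<in> carr C" and v: "v \<in> carr V"
  have t0: "tens C X a 0 = 0" if "a \<in> carr C" for a
    by (rule lin_zero[OF X lin_tens2[OF C_vs X that lin_id]])
  have b0: "bil C C (tensor C X) (\<lambda>a b. 0)" by (simp add: bil_def lin_const_0)
  have "cod U X u' (cod V U u (tens C V c v)) = sw (tensor C X) (\<lambda>a b. tens C X a (sw X (\<lambda>b1 b2. u' b1 (u b2 v)) b)) c"
    unfolding cod_tens[OF V U u c v] by (rule cod_sw[OF U X u' bil_left[OF u v] c])
  also have "\<dots> = sw (tensor C X) (\<lambda>a b. 0) c" by (rule sw_cong) (simp add: z v t0)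
  also have "\<dots> = 0"
    using sw_comp[OF vec_space_tensor vec_space_tensor b0 lin_const_0[OF vec_space_tensor] c, of C X] by simp
  finally show "cod U X u' (cod V U u (tens C V c v)) = 0" .
qed

end

context words
begin

lemma bil_wedge_p1: "bil C (L i) (L (i + 1)) (\<lambda>b x. wedge s i (p1 b) x)"
  by (rule bil_comp[OF bil_wedge lin_p1 lin_id])

text \<open>In Sweedler notation the three maps in the definition compose to
  \<open>c \<otimes> x \<mapsto> c_1 \<otimes> (p1(c_2) \<and> x)\<close>, which makes
  \<open>cod_sw\<close> and \<open>cod_comodule_hom\<close> available.\<close>

lemma koszul_comod_d_eq:
  assumes t: "t \<in> carr (tensor C (L i))"
  shows "koszul_comod_d s i t = C.cod (L i) (L (i + 1)) (\<lambda>b x. wedge s i (p1 b) x) t"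
proof -
  let ?L = "L i" and ?L' = "L (i + 1)"
  have lR: "lin C (tensor C W) (\<lambda>c. tensor_map C C C W (\<lambda>x. x) p1 (comult C c))"
    by (intro lin_tensor_map C.lin_comult lin_p1 lin_id) simp_all
  have lw: "lin (tensor W ?L) ?L' (tensor_lift W ?L ?L' (wedge s i))"
    by (rule hom_lin, rule tensor_lift_hom) (simp_all add: bil_wedge)
  have l2: "lin (tensor C (tensor W ?L)) (tensor C ?L') (tensor_map C (tensor W ?L) C ?L' (\<lambda>x. x) (tensor_lift W ?L ?L' (wedge s i)))"
    by (rule hom_lin, rule tensor_map_hom) (simp_all add: lin_id lw)
  have l1: "lin (tensor C ?L) (tensor C ?L') (koszul_comod_d s i)"
    unfolding koszul_comod_d_def Let_def
    by (intro lin_comp[OF _ l2] lin_assoc lin_tensor_map lR lin_id) simp_all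
  show ?thesis
  proof (rule tensor_ext[OF vec_space_C L_vs l1 C.lin_cod[OF L_vs L_vs bil_wedge_p1] _ t])
    fix c x assume c: "c \<in> carr C" and x: "x \<in> carr ?L"
    let ?F = "\<lambda>t. assoc C W ?L (tens (tensor C W) ?L t x)"
    have lF: "lin (tensor C W) (tensor C (tensor W ?L)) ?F"
      by (intro lin_assoc lin_tens1 lin_id) (simp_all add: x)
    have bp: "bil C C (tensor C W) (\<lambda>a b. tens C W a (p1 b))" by (rule C.bil_tens_hom[OF W_vs lin_p1])
    have e1: "koszul_comod_d s i (tens C ?L c x) = tensor_map C (tensor W ?L) C ?L' (\<lambda>x. x) (tensor_lift W ?L ?L' (wedge s i))
        (?F (C.sw (tensor C W) (\<lambda>a b. tens C W a (p1 b)) c))"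
      unfolding koszul_comod_d_def Let_def
      using c x lR by (simp add: tensor_map_tens lin_id C.tensor_map_comult)
    have "?F (C.sw (tensor C W) (\<lambda>a b. tens C W a (p1 b)) c) = C.sw (tensor C (tensor W ?L)) (\<lambda>a b. ?F (tens C W a (p1 b))) c"
      by (rule C.sw_comp[OF _ _ bp lF c]) simp_all
    also have "\<dots> = C.sw (tensor C (tensor W ?L)) (\<lambda>a b. tens C (tensor W ?L) a (tens W ?L (p1 b) x)) c"
      by (rule C.sw_cong) (simp add: assoc_tens x)
    finally have e2: "koszul_comod_d s i (tens C ?L c x) = tensor_map C (tensor W ?L) C ?L' (\<lambda>x. x) (tensor_lift W ?L ?L' (wedge s i))
        (C.sw (tensor C (tensor W ?L)) (\<lambda>a b. tens C (tensor W ?L) a (tens W ?L (p1 b) x)) c)"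
      unfolding e1 by simp
    have "koszul_comod_d s i (tens C ?L c x)
      = C.sw (tensor C ?L') (\<lambda>a b. tensor_map C (tensor W ?L) C ?L' (\<lambda>x. x) (tensor_lift W ?L ?L' (wedge s i)) (tens C (tensor W ?L) a (tens W ?L (p1 b) x))) c"
      unfolding e2
      by (rule C.sw_comp[OF _ _ C.bil_tens_hom[OF vec_space_tensor lin_tens1[OF W_vs L_vs x lin_p1]] l2 c]) simp_all
    also have "\<dots> = C.sw (tensor C ?L') (\<lambda>a b. tens C ?L' a (wedge s i (p1 b) x)) c"
      by (rule C.sw_cong) (simp add: tensor_map_tens lin_id lw tens_mem x tensor_lift_tens bil_wedge)
    finally show "koszul_comod_d s i (tens C ?L c x) = C.cod ?L ?L' (\<lambda>b x. wedge s i (p1 b) x) (tens C ?L c x)"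
      by (simp add: C.cod_tens bil_wedge_p1 c x)
  qed
qed

lemma koszul_comod_d_comodule_hom: "koszul_comod_d s i \<in> comodule_hom C (cofree C (L i)) (cofree C (L (i + 1)))"
proof -
  let ?c = "C.cod (L i) (L (i + 1)) (\<lambda>b x. wedge s i (p1 b) x)"
  have c: "?c \<in> comodule_hom C (cofree C (L i)) (cofree C (L (i + 1)))"
    by (rule C.cod_comodule_hom[OF L_vs L_vs bil_wedge_p1])
  have "koszul_comod_d s i t = ?c t" for t
  proof (cases "t \<in> carr (tensor C (L i))")
    \<comment> \<open>\<open>koszul_comod_d\<close> is not wrapped in \<open>res\<close>; off the
      carrier it vanishes because its innermost \<open>tensor_map\<close> does and the other two
      maps send 0 to 0.\<close>
    case False
    have h: "tensor_map C (L i) (tensor C W) (L i) (\<lambda>c. tensor_map C C C W (\<lambda>x. x) p1 (comult C c)) (\<lambda>x. x)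
        \<in> hom (tensor C (L i)) (tensor (tensor C W) (L i))"
      by (intro tensor_map_hom lin_tensor_map C.lin_comult lin_p1 lin_id) simp_all
    have "assoc C W (L i) 0 = 0"
      by (rule lin_zero[OF vec_space_tensor lin_assoc[OF _ _ _ lin_id]]) simp_all
    moreover have "tensor_map C (tensor W (L i)) C (L (i + 1)) (\<lambda>x. x) (tensor_lift W (L i) (L (i + 1)) (wedge s i)) 0 = 0"
      by (rule lin_zero[OF vec_space_tensor lin_tensor_map[OF _ _ _ _ lin_id _ lin_id]])
         (simp_all add: hom_lin[OF tensor_lift_hom] bil_wedge)
    ultimately show ?thesis
      using hom_outside[OF h False] hom_outside[OF C.cod_hom[OF L_vs L_vs bil_wedge_p1] False]
      by (simp add: koszul_comod_d_def Let_def)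
  qed (rule koszul_comod_d_eq)
  then have "koszul_comod_d s i = ?c" by (rule ext)
  then show ?thesis using c by simp
qed

section \<open>The differentials after applying Psi and Phi\<close>

text \<open>\<open>D\<close>, \<open>dl\<close> and \<open>cd\<close> are the differentials of \<open>Hom(C, \<Lambda>(W))\<close>, of \<open>C \<otimes> \<Lambda>(W)\<^sup>*\<close> and of \<open>Hom(C, \<Lambda>(W)\<^sup>*)\<close>.\<close>

definition D :: "int \<Rightarrow> (('k, 'w) words \<Rightarrow> ('k, 'w) words) \<Rightarrow> ('k, 'w) words \<Rightarrow> ('k, 'w) words" where
  "D i p = res C (Rl (L (i + 1)) (\<lambda>w d. wedge s i w (p d)))"

lemma bil_wedge_conv: "lin C (L i) p \<Longrightarrow> bil W C (L (i + 1)) (\<lambda>w d. wedge s i w (p d))"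
  by (rule bil_comp[OF bil_wedge lin_id])

lemma D_hom: "p \<in> hom C (L i) \<Longrightarrow> D i p \<in> hom C (L (i + 1))"
  unfolding D_def by (intro res_hom vec_space_C lin_Rl[OF L_vs bil_wedge_conv lin_id] hom_lin)

lemma koszul_comod_d_Psi_cofree:
  assumes p: "p \<in> hom C (L i)"
  shows "res C (\<lambda>c. koszul_comod_d s i (Psi_cofree C (L i) p c)) = Psi_cofree C (L (i + 1)) (D i p)"
  unfolding C.Psi_cofree_apply[OF D_hom[OF p]]
proof (rule res_cong)
  fix c assume c: "c \<in> carr C"
  note lp = hom_lin[OF p]
  have m: "C.sw (tensor C (L i)) (\<lambda>a b. tens C (L i) a (p b)) c \<in> carr (tensor C (L i))"
    by (rule C.sw_mem[OF vec_space_tensor C.bil_tens_hom[OF L_vs lp] c])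
  have "koszul_comod_d s i (Psi_cofree C (L i) p c)
    = C.sw (tensor C (L (i + 1))) (\<lambda>a b. tens C (L (i + 1)) a (C.sw (L (i + 1)) (\<lambda>b1 b2. wedge s i (p1 b1) (p b2)) b)) c"
    by (simp add: C.Psi_cofree_apply[OF p] res_apply c koszul_comod_d_eq m C.cod_sw[OF L_vs L_vs bil_wedge_p1 lp c])
  also have "\<dots> = C.sw (tensor C (L (i + 1))) (\<lambda>a b. tens C (L (i + 1)) a (D i p b)) c"
    by (rule C.sw_cong) (simp add: D_def res_apply Rl_def)
  finally show "koszul_comod_d s i (Psi_cofree C (L i) p c) = C.sw (tensor C (L (i + 1))) (\<lambda>a b. tens C (L (i + 1)) a (D i p b)) c" .
qed

text \<open>After two steps the summand is \<open>w \<and> v \<and> p(e)\<close>, which is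
  alternating in \<open>w\<close> and \<open>v\<close>.\<close>

lemma D_D:
  assumes p: "p \<in> hom C (L i)"
  shows "D (i + 1) (D i p) = 0"
proof -
  let ?f = "\<lambda>w v e. wedge s (i + 1) w (wedge s i v (p e))"
  have lp: "lin C (L i) p" by (rule hom_lin[OF p])
  have pm: "p e \<in> carr (L i)" if "e \<in> carr C" for e by (rule lin_mem[OF lp that])
  have "D (i + 1) (D i p) = res C (\<lambda>c. 0)"
    unfolding D_def[of "i + 1"]
  proof (rule res_cong)
    fix c assume c: "c \<in> carr C"
    have "Rl (L (i + 1 + 1)) (\<lambda>w d. wedge s (i + 1) w (D i p d)) c = Rl (L (i + 1 + 1)) (\<lambda>w d. Rl (L (i + 1 + 1)) (\<lambda>v e. ?f w v e) d) c"
    proof (rule Rl_cong)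
      fix w d assume d: "d \<in> carr C"
      show "wedge s (i + 1) w (D i p d) = Rl (L (i + 1 + 1)) (\<lambda>v e. ?f w v e) d"
        unfolding D_def res_apply[OF d] by (rule Rl_comp[OF L_vs L_vs bil_wedge_conv[OF lp] lin_wedge d])
    qed
    also have "\<dots> = 0"
    proof (rule Rl_Rl_alternating[OF L_vs c])
      show "lin W (L (i + 1 + 1)) (\<lambda>w. ?f w v d)" if "d \<in> carr C" for v d
        by (intro lin_wedge1 wedge_mem lin_id pm that)
      show "lin W (L (i + 1 + 1)) (\<lambda>v. ?f w v d)" if "d \<in> carr C" for w d
        by (intro lin_wedge2 lin_wedge1 lin_id pm that)
      show "lin C (L (i + 1 + 1)) (?f w v)" for w v
        by (intro lin_wedge2 lp)
      show "?f w w d = 0" if "d \<in> carr C" for w d by (rule wedge_wedge_self[OF pm[OF that]])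
    qed
    finally show "Rl (L (i + 1 + 1)) (\<lambda>w d. wedge s (i + 1) w (D i p d)) c = 0" .
  qed
  then show ?thesis by (auto simp: res_def fun_eq_iff)
qed

section \<open>Transposed exterior multiplication\<close>

definition wd :: "int \<Rightarrow> 'w \<Rightarrow> (('k, 'w) words \<Rightarrow> 'k) \<Rightarrow> ('k, 'w) words \<Rightarrow> 'k" where
  "wd j w \<xi> = res (L j) (\<lambda>x. \<xi> (wedge s j w x))"

lemma dual_vs [simp]: "vec_space (dual (L j))"
  by (rule vec_space_Hom[OF vec_space_ground])

lemma dual_lin: "\<xi> \<in> hom (L j) ground \<Longrightarrow> lin (L j) ground \<xi>"
  by (rule hom_lin)

lemma bil_wd: "bil W (dual (L (j + 1))) (dual (L j)) (wd j)"
proof (rule bilI)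
  show "lin W (dual (L j)) (\<lambda>w. wd j w \<xi>)" if "\<xi> \<in> carr (dual (L (j + 1)))" for \<xi>
    unfolding wd_def using that
    by (intro lin_res_Hom lin_comp[OF lin_wedge1 hom_lin] lin_comp[OF lin_wedge hom_lin] lin_id) simp_all
  show "lin (dual (L (j + 1))) (dual (L j)) (wd j w)" for w
    unfolding wd_def[abs_def]
    by (intro lin_res_Hom lin_comp[OF lin_wedge hom_lin] lin_ev wedge_mem) simp_all
qed

lemma wd_mem: "\<xi> \<in> hom (L (j + 1)) ground \<Longrightarrow> wd j w \<xi> \<in> hom (L j) ground"
  using bil_mem[OF bil_wd, of w \<xi> j] by simp

lemma wd_apply: "x \<in> carr (L j) \<Longrightarrow> wd j w \<xi> x = \<xi> (wedge s j w x)"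
  by (simp add: wd_def res_apply)

lemma bil_wd_p1: "bil C (dual (L (j + 1))) (dual (L j)) (\<lambda>b \<xi>. wd j (p1 b) \<xi>)"
  by (rule bil_comp[OF bil_wd lin_p1 lin_id])

abbreviation "dl j \<equiv> C.cod (dual (L (j + 1))) (dual (L j)) (\<lambda>b \<xi>. wd j (p1 b) \<xi>)"

lemma lin_dl: "lin (tensor C (dual (L (j + 1)))) (tensor C (dual (L j))) (dl j)"
  by (rule C.lin_cod[OF dual_vs dual_vs bil_wd_p1])

text \<open>\<open>cod\<close> splits the letter off on the right, but \<open>eta\<close> is
  controlled through the first letter; \<open>Rl_right\<close> exchanges the two.\<close>

lemma dl_tens:
  assumes c: "c \<in> carr C" and \<xi>: "\<xi> \<in> hom (L (j + 1)) ground"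
  shows "dl j (tens C (dual (L (j + 1))) c \<xi>) = Rl (tensor C (dual (L j))) (\<lambda>w d. tens C (dual (L j)) d (wd j w \<xi>)) c"
proof -
  have "bil W C (tensor C (dual (L j))) (\<lambda>w d. tens C (dual (L j)) d (wd j w \<xi>))"
    by (rule bil_flip, rule bil_tens_comp) (use bil_left[OF bil_wd, of \<xi> j] \<xi> in \<open>simp_all add: lin_id\<close>)
  from Rl_right[OF vec_space_tensor this c] show ?thesis
    using C.cod_tens[OF dual_vs dual_vs bil_wd_p1 c, of \<xi> j] \<xi> by simp
qed

lemma dl_dl:
  assumes t: "t \<in> carr (tensor C (dual (L (j + 1 + 1))))"
  shows "dl j (dl (j + 1) t) = 0"
proof (rule C.cod_cod[OF dual_vs dual_vs dual_vs bil_wd_p1 bil_wd_p1 _ t])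
  fix c \<xi> assume c: "c \<in> carr C" and "\<xi> \<in> carr (dual (L (j + 1 + 1)))"
  then have \<xi>: "\<xi> \<in> hom (L (j + 1 + 1)) ground" by simp
  show "C.sw (dual (L j)) (\<lambda>b1 b2. wd j (p1 b1) (wd (j + 1) (p1 b2) \<xi>)) c = 0"
  proof (rule sw_p1_p1_alternating[where f = "\<lambda>v w. wd j v (wd (j + 1) w \<xi>)", OF dual_vs c])
    show "bil W W (dual (L j)) (\<lambda>v w. wd j v (wd (j + 1) w \<xi>))"
      by (rule bil_comp[OF bil_wd lin_id bil_left[OF bil_wd]]) (use \<xi> in simp)
    have x0: "\<xi> 0 = 0" by (rule lin_zero[OF L_vs dual_lin[OF \<xi>]])
    have "wd j w (wd (j + 1) w \<xi>) = res (L j) (\<lambda>x. 0)" for w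
      unfolding wd_def[of j] by (rule res_cong) (simp add: wd_apply wedge_mem wedge_wedge_self x0)
    then show "wd j w (wd (j + 1) w \<xi>) = 0" for w by (simp add: res_def zero_fun_def)
  qed
qed

definition cd :: "int \<Rightarrow> (('k, 'w) words \<Rightarrow> ('k, 'w) words \<Rightarrow> 'k) \<Rightarrow> ('k, 'w) words \<Rightarrow> ('k, 'w) words \<Rightarrow> 'k" where
  "cd j p = res C (Rl (dual (L j)) (\<lambda>w d. wd j w (p d)))"

lemma bil_wd_conv: "lin C (dual (L (j + 1))) p \<Longrightarrow> bil W C (dual (L j)) (\<lambda>w d. wd j w (p d))"
  by (rule bil_comp[OF bil_wd lin_id])

lemma cd_hom: "p \<in> hom C (dual (L (j + 1))) \<Longrightarrow> cd j p \<in> hom C (dual (L j))"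
  unfolding cd_def by (intro res_hom vec_space_C lin_Rl[OF dual_vs bil_wd_conv lin_id] hom_lin)

text \<open>Pairing \<open>p\<close> with the Koszul differential of \<open>c \<otimes> x\<close>
  gives \<open>p(c_1)(p1(c_2) \<and> x)\<close>, which \<open>Rl_right\<close> turns into a
  convolution. The exterior degree that belongs to the cohomological degree \<open>i\<close> is
  \<open>- i = j + 1\<close>.\<close>

lemma koszul_contra_d_eq:
  assumes ij: "j = - i - 1" and p: "p \<in> hom C (dual (L (j + 1)))"
  shows "koszul_contra_d s i p = cd j p"
proof -
  have i: "- i = j + 1" "- i - 1 = j" using ij by simp_all
  have lp: "lin C (dual (L (j + 1))) p" by (rule hom_lin[OF p])
  have pm: "p d \<in> hom (L (j + 1)) ground" if "d \<in> carr C" for d using lin_mem[OF lp that] by simp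
  have pk: "p \<in> carr (koszul_contra s i)" using p by (simp add: koszul_contra_def i(1))
  have bp: "bil C (L (j + 1)) ground p"
    by (intro bilI lin_eval[OF _ lp] dual_lin pm)
  have "koszul_contra_d s i p = res C (\<lambda>c. res (L j) (\<lambda>x.
       tensor_lift C (L (j + 1)) ground p (koszul_comod_d s j (tens C (L j) c x))))"
    unfolding koszul_contra_d_def Let_def i(2) unfolding i(1) res_apply[OF pk] ..
  also have "\<dots> = res C (Rl (dual (L j)) (\<lambda>w d. wd j w (p d)))"
  proof (rule res_cong)
    fix c assume c: "c \<in> carr C"
    let ?R = "Rl (dual (L j)) (\<lambda>w d. wd j w (p d)) c"
    have R: "?R \<in> hom (L j) ground"
      using Rl_mem[OF dual_vs bil_wd_conv[OF lp] c] by simp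
    have "res (L j) (\<lambda>x. tensor_lift C (L (j + 1)) ground p (koszul_comod_d s j (tens C (L j) c x))) = res (L j) ?R"
    proof (rule res_cong)
      fix x assume x: "x \<in> carr (L j)"
      let ?g = "tensor_lift C (L (j + 1)) ground p"
      have g: "lin (tensor C (L (j + 1))) ground ?g"
        by (rule hom_lin, rule tensor_lift_hom) (simp_all add: bp)
      have bw: "bil C C (tensor C (L (j + 1))) (\<lambda>a b. tens C (L (j + 1)) a (wedge s j (p1 b) x))"
        by (rule C.bil_tens_hom[OF L_vs lin_wedge1[OF x lin_p1]])
      have "?g (koszul_comod_d s j (tens C (L j) c x)) = ?g (C.sw (tensor C (L (j + 1))) (\<lambda>a b. tens C (L (j + 1)) a (wedge s j (p1 b) x)) c)"
        by (simp add: koszul_comod_d_eq tens_mem c x C.cod_tens bil_wedge_p1)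
      also have "\<dots> = C.sw ground (\<lambda>a b. ?g (tens C (L (j + 1)) a (wedge s j (p1 b) x))) c"
        by (rule C.sw_comp[OF _ _ bw g c]) simp_all
      also have "\<dots> = C.sw ground (\<lambda>a b. p a (wedge s j (p1 b) x)) c"
        by (rule C.sw_cong) (simp add: tensor_lift_tens bp wedge_mem x)
      also have "\<dots> = Rl ground (\<lambda>w d. p d (wedge s j w x)) c"
        by (rule Rl_right[OF vec_space_ground bil_flip[OF bil_comp[OF bp lin_id lin_wedge1[OF x lin_id]]] c])
      also have "\<dots> = Rl ground (\<lambda>w d. wd j w (p d) x) c"
        by (rule Rl_cong) (simp add: wd_apply x)
      also have "\<dots> = ?R x"
        by (rule Rl_comp[OF dual_vs vec_space_ground bil_wd_conv[OF lp] lin_ev[OF x] c, symmetric])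
      finally show "?g (koszul_comod_d s j (tens C (L j) c x)) = ?R x" .
    qed
    then show "res (L j) (\<lambda>x. tensor_lift C (L (j + 1)) ground p (koszul_comod_d s j (tens C (L j) c x))) = ?R"
      using hom_res_id[OF R] by simp
  qed
  finally show ?thesis by (simp add: cd_def)
qed

text \<open>The premise \<open>eq\<close> of \<open>Phi_map_eq\<close> for \<open>d = dl j\<close>
  and \<open>f = cd j\<close>.\<close>

lemma dl_sw:
  assumes p: "p \<in> hom C (dual (L (j + 1)))" and c: "c \<in> carr C"
  shows "dl j (C.sw (tensor C (dual (L (j + 1)))) (\<lambda>a b. tens C (dual (L (j + 1))) a (p b)) c)
    = C.sw (tensor C (dual (L j))) (\<lambda>a b. tens C (dual (L j)) a (cd j p b)) c"
  unfolding C.cod_sw[OF dual_vs dual_vs bil_wd_p1 hom_lin[OF p] c]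
  by (rule C.sw_cong) (simp add: cd_def res_apply Rl_def)

end

section \<open>Homotopies\<close>

context words
begin

lemma Rl_diff:
  assumes "vec_space X" "bil W C X f" "bil W C X h" "c \<in> carr C"
  shows "Rl X (\<lambda>w d. f w d - h w d) c = Rl X f c - Rl X h c"
proof -
  have b: "bil W C X (\<lambda>w d. f w d - h w d)"
    using assms by (simp add: bil_def lin_minus)
  have "Rl X f c = Rl X (\<lambda>w d. (f w d - h w d) + h w d) c" by simp
  also have "\<dots> = Rl X (\<lambda>w d. f w d - h w d) c + Rl X h c" by (rule Rl_add[OF assms(1) b assms(3,4)])
  finally show ?thesis by simp
qed

end

locale unit_letter = letter s b g
  for s :: "'k::field \<Rightarrow> 'w::ab_group_add \<Rightarrow> 'w" and b and g +
  assumes g_b: "g b = 1"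
begin

lemma g_pr: "g (pr w) = 0"
proof -
  have "g (w - s (g w) b) = g w - g (s (g w) b)" using lin_diff[OF W_vs lin_g, of w "s (g w) b"] by simp
  also have "g (s (g w) b) = g w" using lin_scale[OF lin_g, of b "g w"] g_b by simp
  finally show ?thesis by (simp add: pr_def)
qed

lemma bil_pr: "bil W V X f \<Longrightarrow> v \<in> carr V \<Longrightarrow> f (pr w) v = f w v - smul X (g w) (f b v)"
  unfolding pr_def using lin_diff[OF W_vs bil_left, of V X f v w "s (g w) b"] lin_scale[OF bil_left, of W V X f v b "g w"] by simp

lemma bil_g: "bil W C C (\<lambda>w d. smul C (g w) d)"
  by (intro bilI lin_smul_left lin_smul_right lin_id lin_g vec_space_C)

text \<open>Contraction with \<open>g\<close> on C. By \<open>Rl_eta\<close>, with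
  \<open>g b = 1\<close> and \<open>g (pr w) = 0\<close>, it is a left inverse of
  \<open>eta\<close>, so \<open>kappa\<close> below is a projection whose kernel is the image of
  \<open>eta\<close>.\<close>

definition theta :: "('k, 'w) words \<Rightarrow> ('k, 'w) words" where
  "theta = Rl C (\<lambda>w d. smul C (g w) d)"

lemma lin_theta: "lin C C theta"
  unfolding theta_def by (rule lin_Rl[OF vec_space_C bil_g lin_id])

definition kappa :: "('k, 'w) words \<Rightarrow> ('k, 'w) words" where
  "kappa c = c - eta (theta c)"

lemma lin_kappa: "lin C C kappa"
  unfolding kappa_def[abs_def] by (intro lin_minus vec_space_C lin_id lin_comp[OF lin_theta lin_eta_C])

lemma Rl_g:
  assumes "vec_space X" "lin C X q" "c \<in> carr C"
  shows "Rl X (\<lambda>w d. smul X (g w) (q d)) c = q (theta c)"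
proof -
  have "q (theta c) = Rl X (\<lambda>w d. q (smul C (g w) d)) c"
    unfolding theta_def by (rule Rl_comp[OF vec_space_C assms(1) bil_g assms(2,3)])
  also have "\<dots> = Rl X (\<lambda>w d. smul X (g w) (q d)) c"
    by (rule Rl_cong) (simp add: lin_scale[OF assms(2)])
  finally show ?thesis by simp
qed

definition P :: "int \<Rightarrow> ('k, 'w) words \<Rightarrow> ('k, 'w) words" where
  "P i x = wedge s (i - 1) b (iota i x)"

lemma lin_wedge_iota: "lin (L i) (L i) (\<lambda>x. wedge s (i - 1) w (iota i x))"
  using lin_wedge2[OF lin_iota, of i w] by simp

lemma lin_P: "lin (L i) (L i) (P i)"
  unfolding P_def[abs_def] by (rule lin_wedge_iota)

section \<open>The homotopy for maps into exterior powers\<close>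

definition hb :: "int \<Rightarrow> (('k, 'w) words \<Rightarrow> ('k, 'w) words) \<Rightarrow> ('k, 'w) words \<Rightarrow> ('k, 'w) words" where
  "hb i p = res C (\<lambda>c. iota i (p (eta c)))"

lemma lin_iota_eta: "lin C (L i) p \<Longrightarrow> lin C (L (i - 1)) (\<lambda>c. iota i (p (eta c)))"
  by (rule lin_comp[OF lin_comp[OF lin_eta_C] lin_iota])

lemma hb_hom: "p \<in> hom C (L i) \<Longrightarrow> hb i p \<in> hom C (L (i - 1))"
  unfolding hb_def by (intro res_hom vec_space_C lin_iota_eta hom_lin)

text \<open>Obtained by applying \<open>iota\<close> to the equation \<open>D i p = 0\<close> at
  \<open>eta c\<close>. As it is stated for cycles, only one of the two terms of a homotopy
  appears.\<close>

lemma homotopy_Hom: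
  assumes p: "p \<in> hom C (L i)" and D0: "D i p = 0" and c: "c \<in> carr C"
  shows "p c = D (i - 1) (hb i p) c + P i (p (kappa c))"
proof -
  note lp = hom_lin[OF p]
  note pc = lin_mem[OF lp c]
  define q where "q d = iota i (p (eta d))" for d
  have lq: "lin C (L (i - 1)) q" unfolding q_def by (rule lin_iota_eta[OF lp])
  have bq: "bil W C (L i) (\<lambda>w d. wedge s (i - 1) w (q d))" using bil_wedge_conv[OF lq] by simp
  have bw: "bil W (L (i - 1)) (L i) (wedge s (i - 1))" using bil_wedge[of "i - 1"] by simp
  have lbq: "lin C (L i) (\<lambda>d. wedge s (i - 1) b (q d))" using bil_right[OF bq, of b] by simp
  have bgq: "bil W C (L i) (\<lambda>w d. smul (L i) (g w) (wedge s (i - 1) b (q d)))"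
    by (intro bilI lin_smul_left lin_smul_right lbq lin_g L_vs lin_mem[OF lbq])
  note bp = bil_wedge_conv[OF lp]
  note bp' = bil_eta_C[OF bp]
  have pe: "p (eta d) \<in> carr (L i)" if "d \<in> carr C" for d by (rule lin_mem[OF lp eta_mem[OF that]])
  have li: "lin (L (i + 1)) (L i) (iota (i + 1))" using lin_iota[of "i + 1"] by simp
  have "Rl (L (i + 1)) (\<lambda>w d. wedge s i w (p d)) (eta c) = 0"
    using fun_cong[OF D0, of "eta c"] by (simp add: D_def res_apply eta_mem c)
  \<comment> \<open>\<open>Rl_eta\<close> expands the value at \<open>eta c\<close>. Contracting
    \<open>b \<and> p(c)\<close> reproduces \<open>p(c)\<close> because \<open>g b = 1\<close>,
    while \<open>g (pr w) = 0\<close> leaves a single term for each of the other summands.\<close>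
  then have "0 = iota (i + 1) (wedge s i b (p c) + Rl (L (i + 1)) (\<lambda>w d. wedge s i (pr w) (p (eta d))) c)"
    using Rl_eta[OF L_vs bp c] lin_zero[OF L_vs lin_iota[of "i + 1"]] by simp
  also have "\<dots> = iota (i + 1) (wedge s i b (p c)) + iota (i + 1) (Rl (L (i + 1)) (\<lambda>w d. wedge s i (pr w) (p (eta d))) c)"
    by (rule lin_add[OF lin_iota wedge_mem[OF pc] Rl_mem[OF L_vs bp' c]])
  also have "iota (i + 1) (wedge s i b (p c)) = p c - P i (p c)"
    by (simp add: iota_wedge pc g_b vs_one[OF L_vs] P_def)
  also have "iota (i + 1) (Rl (L (i + 1)) (\<lambda>w d. wedge s i (pr w) (p (eta d))) c)
    = Rl (L i) (\<lambda>w d. iota (i + 1) (wedge s i (pr w) (p (eta d)))) c"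
    by (rule Rl_comp[OF L_vs L_vs bp' li c])
  also have "\<dots> = Rl (L i) (\<lambda>w d. smul (L i) (g w) (wedge s (i - 1) b (q d)) - wedge s (i - 1) w (q d)) c"
  proof (rule Rl_cong)
    fix w d assume d: "d \<in> carr C"
    have "iota (i + 1) (wedge s i (pr w) (p (eta d))) = - wedge s (i - 1) (pr w) (q d)"
      using iota_wedge[OF pe[OF d], of "pr w"] by (simp add: g_pr vs_scale_0[OF L_vs] q_def)
    also have "wedge s (i - 1) (pr w) (q d) = wedge s (i - 1) w (q d) - smul (L i) (g w) (wedge s (i - 1) b (q d))"
      by (rule bil_pr[OF bw lin_mem[OF lq d]])
    finally show "iota (i + 1) (wedge s i (pr w) (p (eta d)))
      = smul (L i) (g w) (wedge s (i - 1) b (q d)) - wedge s (i - 1) w (q d)"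
      by (simp del: minus_apply uminus_apply)
  qed
  also have "\<dots> = Rl (L i) (\<lambda>w d. smul (L i) (g w) (wedge s (i - 1) b (q d))) c - Rl (L i) (\<lambda>w d. wedge s (i - 1) w (q d)) c"
    by (rule Rl_diff[OF L_vs bgq bq c])
  also have "Rl (L i) (\<lambda>w d. smul (L i) (g w) (wedge s (i - 1) b (q d))) c = P i (p (eta (theta c)))"
    using Rl_g[OF L_vs lbq c] by (simp add: q_def P_def)
  also have "Rl (L i) (\<lambda>w d. wedge s (i - 1) w (q d)) c = D (i - 1) (hb i p) c"
    using Rl_cong[of "\<lambda>w d. wedge s (i - 1) w (q d)" "\<lambda>w d. wedge s (i - 1) w (hb i p d)" "L i" c]
    by (simp add: D_def res_apply c hb_def q_def)
  finally have e: "p c - P i (p c) + (P i (p (eta (theta c))) - D (i - 1) (hb i p) c) = 0" by (rule sym)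
  have m: "eta (theta c) \<in> carr C" by (intro eta_mem lin_mem[OF lin_theta] c)
  \<comment> \<open>The error terms at \<open>c\<close> and at \<open>eta (theta c)\<close> combine
    into one at \<open>kappa c\<close>.\<close>
  have eP: "P i (p (kappa c)) = P i (p c) - P i (p (eta (theta c)))"
    unfolding kappa_def using lin_diff[OF vec_space_C lin_comp[OF lp lin_P] c m] .
  have "p c - (D (i - 1) (hb i p) c + P i (p (kappa c)))
      = p c - P i (p c) + (P i (p (eta (theta c))) - D (i - 1) (hb i p) c)"
    unfolding eP by (simp add: algebra_simps)
  then have "p c - (D (i - 1) (hb i p) c + P i (p (kappa c))) = 0" unfolding e .
  then show ?thesis by (simp only: right_minus_eq)
qed

section \<open>The homotopy for tensors with functionals\<close>

definition io :: "int \<Rightarrow> (('k, 'w) words \<Rightarrow> 'k) \<Rightarrow> ('k, 'w) words \<Rightarrow> 'k" where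
  "io j \<xi> = res (L (j + 1)) (\<lambda>x. \<xi> (iota (j + 1) x))"

lemma iota_mem': "x \<in> carr (L (j + 1)) \<Longrightarrow> iota (j + 1) x \<in> carr (L j)"
  using iota_mem[of x "j + 1"] by simp

lemma lin_io: "lin (dual (L j)) (dual (L (j + 1))) (io j)"
proof -
  have l: "lin (L (j + 1)) (L j) (iota (j + 1))" using lin_iota[of "j + 1"] by simp
  show ?thesis
    unfolding io_def[abs_def] by (intro lin_res_Hom lin_comp[OF l hom_lin] lin_ev iota_mem') simp_all
qed

lemma io_apply: "x \<in> carr (L (j + 1)) \<Longrightarrow> io j \<xi> x = \<xi> (iota (j + 1) x)"
  by (simp add: io_def res_apply)

text \<open>For \<open>w = b\<close> this is the transpose of \<open>P\<close>. General
  \<open>w\<close> occur because \<open>io\<close> after \<open>wd\<close> is of this form, see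
  \<open>io_wd\<close>.\<close>

definition zd :: "int \<Rightarrow> 'w \<Rightarrow> (('k, 'w) words \<Rightarrow> 'k) \<Rightarrow> ('k, 'w) words \<Rightarrow> 'k" where
  "zd j w \<xi> = res (L j) (\<lambda>x. \<xi> (wedge s (j - 1) w (iota j x)))"

lemma bil_zd: "bil W (dual (L j)) (dual (L j)) (zd j)"
proof (rule bilI)
  show "lin W (dual (L j)) (\<lambda>w. zd j w \<xi>)" if "\<xi> \<in> carr (dual (L j))" for \<xi>
    unfolding zd_def
  proof (rule lin_res_Hom)
    have \<xi>: "lin (L j) ground \<xi>" using that by (simp add: hom_lin)
    show "lin (L j) ground (\<lambda>x. \<xi> (wedge s (j - 1) w (iota j x)))" for w by (rule lin_comp[OF lin_wedge_iota \<xi>])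
    show "lin W ground (\<lambda>w. \<xi> (wedge s (j - 1) w (iota j x)))" if x: "x \<in> carr (L j)" for x
      using lin_wedge1[OF iota_mem[OF x] lin_id] \<xi> by (intro lin_comp[OF _ \<xi>]) simp
  qed simp_all
  show "lin (dual (L j)) (dual (L j)) (zd j w)" for w
    unfolding zd_def[abs_def]
    by (intro lin_res_Hom lin_comp[OF lin_wedge_iota hom_lin] lin_ev lin_mem[OF lin_wedge_iota]) simp_all
qed

lemma zd_mem: "\<xi> \<in> hom (L j) ground \<Longrightarrow> zd j w \<xi> \<in> hom (L j) ground"
  using bil_mem[OF bil_zd, of w \<xi> j] by simp

lemma wd_io:
  assumes \<xi>: "\<xi> \<in> hom (L n) ground"
  shows "wd n v (io n \<xi>) = smul (dual (L n)) (g v) \<xi> - zd n v \<xi>"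
proof
  fix x
  show "wd n v (io n \<xi>) x = (smul (dual (L n)) (g v) \<xi> - zd n v \<xi>) x"
  proof (cases "x \<in> carr (L n)")
    case True
    have "wd n v (io n \<xi>) x = \<xi> (smul (L n) (g v) x - wedge s (n - 1) v (iota n x))"
      by (simp add: wd_apply True io_apply wedge_mem iota_wedge)
    also have "\<dots> = g v * \<xi> x - \<xi> (wedge s (n - 1) v (iota n x))"
      using lin_diff[OF L_vs hom_lin[OF \<xi>] vs_scale[OF L_vs True] lin_mem[OF lin_wedge_iota True]]
        lin_scale[OF hom_lin[OF \<xi>] True] by simp
    finally show ?thesis by (simp add: smul_Hom zd_def res_apply True)
  next
    case False
    then show ?thesis using hom_outside[OF \<xi> False] by (simp add: wd_def zd_def res_def smul_Hom)
  qed
qed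

lemma io_wd: "io j (wd j w \<xi>) = zd (j + 1) w \<xi>"
  unfolding io_def zd_def by (rule res_cong) (simp add: wd_apply iota_mem')

definition ha :: "int \<Rightarrow> ('k, ('k, 'w) words, ('k, 'w) words \<Rightarrow> 'k) tensor \<Rightarrow> ('k, ('k, 'w) words, ('k, 'w) words \<Rightarrow> 'k) tensor" where
  "ha j = tensor_map C (dual (L j)) C (dual (L (j + 1))) eta (io j)"

definition Q :: "int \<Rightarrow> ('k, ('k, 'w) words, ('k, 'w) words \<Rightarrow> 'k) tensor \<Rightarrow> ('k, ('k, 'w) words, ('k, 'w) words \<Rightarrow> 'k) tensor" where
  "Q j = tensor_map C (dual (L j)) C (dual (L j)) kappa (zd j b)"

lemma lin_zd: "lin (dual (L j)) (dual (L j)) (zd j w)"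
  by (rule bil_right[OF bil_zd]) simp

lemma lin_ha: "lin (tensor C (dual (L j))) (tensor C (dual (L (j + 1)))) (ha j)"
  unfolding ha_def by (rule hom_lin, rule tensor_map_hom) (simp_all add: lin_eta_C lin_io)

lemma lin_Q: "lin (tensor C (dual (L j))) (tensor C (dual (L j))) (Q j)"
  unfolding Q_def by (rule hom_lin, rule tensor_map_hom) (simp_all add: lin_kappa lin_zd)

text \<open>On \<open>c \<otimes> \<xi>\<close> the first composition yields
  \<open>c \<otimes> \<xi> - kappa(c) \<otimes> zd b \<xi>\<close> minus the sum of
  \<open>eta(d) \<otimes> zd w \<xi>\<close> over the splittings of \<open>c\<close>, and the second
  composition is that sum.\<close>

lemma homotopy_tensor:
  assumes t: "t \<in> carr (tensor C (dual (L (j + 1))))"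
  shows "dl (j + 1) (ha (j + 1) t) + ha j (dl j t) = t - Q (j + 1) t"
proof -
  define n where "n = j + 1"
  let ?V = "dual (L n)" and ?X = "tensor C (dual (L n))"
  have l1: "lin ?X ?X (\<lambda>t. dl n (ha n t) + ha j (dl j t))"
    unfolding n_def by (intro lin_plus vec_space_tensor lin_comp[OF lin_ha lin_dl] lin_comp[OF lin_dl lin_ha])
  have l2: "lin ?X ?X (\<lambda>t. t - Q n t)" by (intro lin_minus vec_space_tensor lin_id lin_Q)
  have "dl n (ha n t) + ha j (dl j t) = t - Q n t"
  proof (rule tensor_ext[OF vec_space_C dual_vs l1 l2 _ t[folded n_def]])
    fix c \<xi> assume c: "c \<in> carr C" and "\<xi> \<in> carr ?V"
    then have \<xi>: "\<xi> \<in> hom (L n) ground" by simp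
    have io: "io n \<xi> \<in> hom (L (n + 1)) ground" using lin_mem[OF lin_io, of \<xi> n] \<xi> by simp
    have zm: "zd n w \<xi> \<in> hom (L n) ground" for w by (rule zd_mem[OF \<xi>])
    have z_pr: "zd n (pr w) \<xi> = zd n w \<xi> - smul ?V (g w) (zd n b \<xi>)" for w
      using bil_pr[OF bil_zd, of \<xi> n w] \<xi> by simp
    have ta: "lin C ?X (\<lambda>d. tens C ?V d \<zeta>)" if "\<zeta> \<in> hom (L n) ground" for \<zeta>
      by (rule lin_tens1[OF vec_space_C dual_vs _ lin_id]) (simp add: that)
    have tv: "lin ?V ?X (\<lambda>\<zeta>. tens C ?V d \<zeta>)" if "d \<in> carr C" for d
      by (rule lin_tens2[OF vec_space_C dual_vs that lin_id])
    have b1: "bil W C ?X (\<lambda>w d. tens C ?V d (wd n w (io n \<xi>)))"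
      by (rule bil_flip, rule bil_tens_comp) (use bil_left[OF bil_wd, of "io n \<xi>" n] io in \<open>simp_all add: lin_id\<close>)
    have bz: "bil W C ?X (\<lambda>w d. tens C ?V (eta d) (zd n w \<xi>))"
      by (rule bil_flip, rule bil_tens_comp) (use bil_left[OF bil_zd, of \<xi> n] \<xi> in \<open>simp_all add: lin_eta_C\<close>)
    have lbz: "lin C ?X (\<lambda>d. tens C ?V (eta d) (zd n b \<xi>))" by (rule lin_comp[OF lin_eta_C ta[OF zm]])
    have bg: "bil W C ?X (\<lambda>w d. smul ?X (g w) (tens C ?V (eta d) (zd n b \<xi>)))"
      by (intro bilI lin_smul_left lin_smul_right lbz lin_g vec_space_tensor lin_mem[OF lbz])
    have "dl n (ha n (tens C ?V c \<xi>)) = dl n (tens C (dual (L (n + 1))) (eta c) (io n \<xi>))"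
      using c \<xi> by (simp add: ha_def tensor_map_tens lin_eta_C lin_io)
    also have "\<dots> = Rl ?X (\<lambda>w d. tens C ?V d (wd n w (io n \<xi>))) (eta c)"
      by (rule dl_tens[OF eta_mem[OF c] io])
    also have "\<dots> = tens C ?V c (wd n b (io n \<xi>)) + Rl ?X (\<lambda>w d. tens C ?V (eta d) (wd n (pr w) (io n \<xi>))) c"
      by (rule Rl_eta[OF vec_space_tensor b1 c])
    finally have e1: "dl n (ha n (tens C ?V c \<xi>)) = tens C ?V c (wd n b (io n \<xi>)) + Rl ?X (\<lambda>w d. tens C ?V (eta d) (wd n (pr w) (io n \<xi>))) c" .
    have e2: "tens C ?V c (wd n b (io n \<xi>)) = tens C ?V c \<xi> - tens C ?V c (zd n b \<xi>)"
      using lin_diff[OF dual_vs tv[OF c], of \<xi> "zd n b \<xi>"] \<xi> zm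
      by (simp add: wd_io[OF \<xi>] g_b vs_one[OF dual_vs] del: minus_apply)
    have "Rl ?X (\<lambda>w d. tens C ?V (eta d) (wd n (pr w) (io n \<xi>))) c
      = Rl ?X (\<lambda>w d. smul ?X (g w) (tens C ?V (eta d) (zd n b \<xi>)) - tens C ?V (eta d) (zd n w \<xi>)) c"
    proof (rule Rl_cong)
      fix w d assume d: "d \<in> carr C"
      have "wd n (pr w) (io n \<xi>) = smul ?V (g w) (zd n b \<xi>) - zd n w \<xi>"
        by (simp add: wd_io[OF \<xi>] g_pr vs_scale_0[OF dual_vs] z_pr del: minus_apply zero_fun_apply)
      then show "tens C ?V (eta d) (wd n (pr w) (io n \<xi>))
        = smul ?X (g w) (tens C ?V (eta d) (zd n b \<xi>)) - tens C ?V (eta d) (zd n w \<xi>)"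
        using lin_diff[OF dual_vs tv[OF eta_mem[OF d]], of "smul ?V (g w) (zd n b \<xi>)" "zd n w \<xi>"]
          lin_scale[OF tv[OF eta_mem[OF d]], of "zd n b \<xi>" "g w"] vs_scale[OF dual_vs, of "zd n b \<xi>" n "g w"] zm
        by (simp del: minus_apply)
    qed
    also have "\<dots> = Rl ?X (\<lambda>w d. smul ?X (g w) (tens C ?V (eta d) (zd n b \<xi>))) c - Rl ?X (\<lambda>w d. tens C ?V (eta d) (zd n w \<xi>)) c"
      by (rule Rl_diff[OF vec_space_tensor bg bz c])
    finally have e3: "Rl ?X (\<lambda>w d. tens C ?V (eta d) (wd n (pr w) (io n \<xi>))) c
      = Rl ?X (\<lambda>w d. smul ?X (g w) (tens C ?V (eta d) (zd n b \<xi>))) c - Rl ?X (\<lambda>w d. tens C ?V (eta d) (zd n w \<xi>)) c" .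
    have e4: "Rl ?X (\<lambda>w d. smul ?X (g w) (tens C ?V (eta d) (zd n b \<xi>))) c = tens C ?V (eta (theta c)) (zd n b \<xi>)"
      by (rule Rl_g[OF vec_space_tensor lbz c])
    have A: "dl n (ha n (tens C ?V c \<xi>)) = tens C ?V c \<xi> - tens C ?V c (zd n b \<xi>)
      + (tens C ?V (eta (theta c)) (zd n b \<xi>) - Rl ?X (\<lambda>w d. tens C ?V (eta d) (zd n w \<xi>)) c)"
      unfolding e1 e2 e3 e4 ..
    have \<xi>': "\<xi> \<in> hom (L (j + 1)) ground" using \<xi> by (simp add: n_def)
    have b2: "bil W C (tensor C (dual (L j))) (\<lambda>w d. tens C (dual (L j)) d (wd j w \<xi>))"
      by (rule bil_flip, rule bil_tens_comp) (use bil_left[OF bil_wd, of \<xi> j] \<xi>' in \<open>simp_all add: lin_id\<close>)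
    have "ha j (dl j (tens C ?V c \<xi>)) = ha j (Rl (tensor C (dual (L j))) (\<lambda>w d. tens C (dual (L j)) d (wd j w \<xi>)) c)"
      unfolding n_def dl_tens[OF c \<xi>'] ..
    also have "\<dots> = Rl ?X (\<lambda>w d. ha j (tens C (dual (L j)) d (wd j w \<xi>))) c"
      unfolding n_def by (rule Rl_comp[OF vec_space_tensor vec_space_tensor b2 lin_ha c])
    also have "\<dots> = Rl ?X (\<lambda>w d. tens C ?V (eta d) (zd n w \<xi>)) c"
      by (rule Rl_cong) (simp add: ha_def tensor_map_tens lin_eta_C lin_io wd_mem[OF \<xi>'] io_wd n_def)
    finally have B: "ha j (dl j (tens C ?V c \<xi>)) = Rl ?X (\<lambda>w d. tens C ?V (eta d) (zd n w \<xi>)) c" .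
    have m: "eta (theta c) \<in> carr C" by (intro eta_mem lin_mem[OF lin_theta] c)
    have "Q n (tens C ?V c \<xi>) = tens C ?V c (zd n b \<xi>) - tens C ?V (eta (theta c)) (zd n b \<xi>)"
      using lin_diff[OF vec_space_C ta[OF zm] c m] c \<xi> by (simp add: Q_def tensor_map_tens lin_kappa lin_zd kappa_def)
    then show "dl n (ha n (tens C ?V c \<xi>)) + ha j (dl j (tens C ?V c \<xi>)) = tens C ?V c \<xi> - Q n (tens C ?V c \<xi>)"
      unfolding A B by (simp add: algebra_simps)
  qed
  then show ?thesis by (simp add: n_def)
qed

end

section \<open>Exactness\<close>

locale dual_letters = words s for s :: "'k::field \<Rightarrow> 'w::ab_group_add \<Rightarrow> 'w" +
  fixes bb :: "nat \<Rightarrow> 'w" and gg :: "nat \<Rightarrow> 'w \<Rightarrow> 'k"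
  assumes lin_gg: "lin W ground (gg j)" and gg_bb: "gg j (bb k) = (if j = k then 1 else 0)"
begin

sublocale ul: unit_letter s "bb j" "gg j" for j
  by unfold_locales (simp_all add: lin_gg gg_bb)

text \<open>\<open>A j i\<close> consists of the products \<open>b\<^sub>j\<^sub>-\<^sub>1 \<and> \<dots> \<and> b\<^sub>0 \<and> x\<close> in \<open>\<Lambda>\<^sup>i(W)\<close>, hence is zero for \<open>j > i\<close>.\<close>

primrec A :: "nat \<Rightarrow> int \<Rightarrow> ('k, 'w) words set" where
  "A 0 i = carr (L i)"
| "A (Suc j) i = wedge s (i - 1) (bb j) ` A j (i - 1)"

lemma A_L: "x \<in> A j i \<Longrightarrow> x \<in> carr (L i)"
proof (induction j arbitrary: i x)
  case (Suc j)
  then show ?case using wedge_mem[of _ "i - 1" "bb j"] by auto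
qed simp

lemma A_neg: "x \<in> A j i \<Longrightarrow> - x \<in> A j i"
proof (induction j arbitrary: i x)
  case 0
  then show ?case by (simp add: vs_neg del: uminus_apply)
next
  case (Suc j)
  then obtain y where y: "y \<in> A j (i - 1)" "x = wedge s (i - 1) (bb j) y" by auto
  then have "- x = wedge s (i - 1) (bb j) (- y)" using lin_neg[OF L_vs lin_wedge A_L[OF y(1)]] by simp
  then show ?case using Suc.IH[OF y(1)] by (simp del: uminus_apply)
qed

text \<open>\<open>iota m\<close> anticommutes with multiplication by \<open>bb k\<close> for
  \<open>k \<noteq> m\<close>, as \<open>gg m\<close> vanishes on \<open>bb k\<close>; so it passes
  through the first \<open>j \<le> m\<close> letters.\<close>

lemma iota_A: "j \<le> m \<Longrightarrow> x \<in> A j i \<Longrightarrow> ul.iota m i x \<in> A j (i - 1)"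
proof (induction j arbitrary: i x)
  case 0
  then show ?case by (simp add: ul.iota_mem)
next
  case (Suc j)
  then obtain y where y: "y \<in> A j (i - 1)" "x = wedge s (i - 1) (bb j) y" by auto
  have "ul.iota m (i - 1 + 1) (wedge s (i - 1) (bb j) y) = - wedge s (i - 1 - 1) (bb j) (ul.iota m (i - 1) y)"
    using ul.iota_wedge[OF A_L[OF y(1)], of m "bb j"] Suc.prems(1) by (simp add: gg_bb vs_scale_0[OF L_vs])
  also have "\<dots> = wedge s (i - 1 - 1) (bb j) (- ul.iota m (i - 1) y)"
    using lin_neg[OF L_vs lin_wedge ul.iota_mem[OF A_L[OF y(1)]]] by simp
  finally have "ul.iota m i x = wedge s (i - 1 - 1) (bb j) (- ul.iota m (i - 1) y)" by (simp add: y(2) del: uminus_apply)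
  moreover have "- ul.iota m (i - 1) y \<in> A j (i - 1 - 1)"
    by (rule A_neg[OF Suc.IH[OF _ y(1)]]) (use Suc.prems(1) in simp)
  ultimately show ?case by (auto simp del: uminus_apply)
qed

lemma P_A: "x \<in> A j i \<Longrightarrow> ul.P j i x \<in> A (Suc j) i"
  using iota_A[OF order_refl] by (simp add: ul.P_def)

lemma A_zero: "i < int j \<Longrightarrow> x \<in> A j i \<Longrightarrow> x = 0"
proof (induction j arbitrary: i x)
  case 0
  then show ?case using L_negative[of i] by simp
next
  case (Suc j)
  then obtain y where y: "y \<in> A j (i - 1)" "x = wedge s (i - 1) (bb j) y" by auto
  have "y = 0" by (rule Suc.IH[OF _ y(1)]) (use Suc.prems(1) in simp)
  then show ?case using y(2) lin_zero[OF L_vs lin_wedge] by metis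
qed

text \<open>Each homotopy changes the cycle by a boundary and applies one more \<open>P\<close>, so
  after \<open>j\<close> steps the values of the remainder lie in \<open>A j i\<close>, which is
  zero for \<open>j > i\<close>. The remainder is again a cycle, being the difference of a cycle and
  a boundary.\<close>

lemma exact_Hom:
  assumes p: "p \<in> hom C (L i)" and D0: "D i p = 0"
  shows "\<exists>q\<in>hom C (L (i - 1)). D (i - 1) q = p"
proof -
  have v: "vec_space (Hom C (L j))" for j by (rule vec_space_Hom[OF L_vs])
  have lD: "lin (Hom C (L j)) (Hom C (L (j + 1))) (D j)" for j
    unfolding D_def
    by (intro lin_res_Hom lin_Rl[OF L_vs bil_wedge_conv lin_id] lin_Rl_param bil_wedge_conv hom_lin lin_wedge2 lin_ev)
       (simp_all add: v)
  have lD': "lin (Hom C (L (i - 1))) (Hom C (L i)) (D (i - 1))" using lD[of "i - 1"] by simp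
  have "\<exists>q\<in>hom C (L (i - 1)). \<exists>p'\<in>hom C (L i). D i p' = 0 \<and> p = D (i - 1) q + p' \<and> (\<forall>c\<in>carr C. p' c \<in> A j i)" for j
  proof (induction j)
    case 0
    show ?case
    proof (intro bexI conjI)
      show "0 \<in> hom C (L (i - 1))" using vs_zero[OF v] by simp
      show "p = D (i - 1) 0 + p" using lin_zero[OF v lD] by simp
    qed (use p D0 lin_mem[OF hom_lin[OF p]] in simp_all)
  next
    case (Suc j)
    then obtain q p' where q: "q \<in> hom C (L (i - 1))" and p': "p' \<in> hom C (L i)" "D i p' = 0"
      and eq: "p = D (i - 1) q + p'" and A: "\<And>c. c \<in> carr C \<Longrightarrow> p' c \<in> A j i" by blast
    let ?h = "ul.hb j i p'"
    let ?p = "res C (\<lambda>c. ul.P j i (p' (ul.kappa j c)))"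
    have h: "?h \<in> hom C (L (i - 1))" by (rule ul.hb_hom[OF p'(1)])
    have pp: "?p \<in> hom C (L i)"
      by (rule res_hom[OF vec_space_C lin_comp[OF lin_comp[OF ul.lin_kappa hom_lin[OF p'(1)]] ul.lin_P]])
    have Dh: "D (i - 1) ?h \<in> hom C (L i)" using D_hom[OF h] by simp
    have sum: "p' = D (i - 1) ?h + ?p"
    proof
      fix c show "p' c = (D (i - 1) ?h + ?p) c"
        using ul.homotopy_Hom[OF p'] hom_outside[OF p'(1)] hom_outside[OF Dh] hom_outside[OF pp]
        by (cases "c \<in> carr C") (simp_all add: res_apply)
    qed
    have DD: "D i (D (i - 1) ?h) = 0" using D_D[OF h] by simp
    have "D i p' = D i (D (i - 1) ?h) + D i ?p"
      using arg_cong[OF sum, of "D i"] lin_add[OF lD[of i], of "D (i - 1) ?h" ?p] Dh pp by simp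
    then have D0': "D i ?p = 0" using p'(2) DD by simp
    have "p = D (i - 1) (q + ?h) + ?p"
      using eq sum lin_add[OF lD', of q ?h] q h by (simp add: add.assoc del: plus_fun_apply)
    moreover have "q + ?h \<in> hom C (L (i - 1))" using vs_add[OF v, of q "i - 1" ?h] q h by simp
    moreover have "?p c \<in> A (Suc j) i" if "c \<in> carr C" for c
      unfolding res_apply[OF that] by (rule P_A[OF A[OF lin_mem[OF ul.lin_kappa that]]])
    ultimately show ?case using pp D0' by blast
  qed
  \<comment> \<open>\<open>nat (i + 1)\<close> steps suffice; when \<open>i + 1\<close> is negative,
    the truncated value 0 still exceeds \<open>i\<close>.\<close>
  then obtain q p' where q: "q \<in> hom C (L (i - 1))" and p': "p' \<in> hom C (L i)"
    and eq: "p = D (i - 1) q + p'" and A: "\<forall>c\<in>carr C. p' c \<in> A (nat (i + 1)) i" by blast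
  have "p' c = 0" for c
    using A A_zero[of i "nat (i + 1)" "p' c"] hom_outside[OF p', of c] by (cases "c \<in> carr C") auto
  then have "p = D (i - 1) q" using eq by (simp add: fun_eq_iff)
  then show ?thesis using q by blast
qed

section \<open>Exactness for tensors with functionals\<close>

text \<open>The annihilator of \<open>A j n\<close>: zero for \<open>j = 0\<close>, and the whole
  dual once \<open>n < j\<close>.\<close>

definition K :: "nat \<Rightarrow> int \<Rightarrow> ('k, ('k, 'w) words \<Rightarrow> 'k) vspace" where
  "K j n = \<lparr>carr = {\<xi> \<in> hom (L n) ground. \<forall>x\<in>A j n. \<xi> x = 0}, smul = smul (dual (L n))\<rparr>"

lemma subsp_K: "subsp (K j n) (dual (L n))"
proof -
  have v: "vector_space (smul (dual (L n)))" using dual_vs[of n] by (simp add: vec_space_def del: dual_vs)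
  interpret vector_space "smul (dual (L n))" by (rule v)
  have "subspace {\<xi> \<in> hom (L n) ground. \<forall>x\<in>A j n. \<xi> x = 0}"
    unfolding subspace_def
    using vs_zero[OF dual_vs, of n] vs_add[OF dual_vs, of _ n] vs_scale[OF dual_vs, of _ n]
    by (auto simp: smul_Hom)
  then show ?thesis using vs_sub[OF dual_vs[of n]] by (auto simp: subsp_def K_def vec_space_def v)
qed

text \<open>Transposition reverses the filtration: \<open>P\<close> maps \<open>A m\<close> to
  \<open>A (Suc m)\<close>, so \<open>zd\<close> maps \<open>K (Suc m)\<close> to
  \<open>K m\<close>, and the letters are used in descending order. The remainder starts in
  \<open>K N\<close>, which is the whole dual since \<open>N\<close> exceeds the exterior degree,
  and has reached \<open>K (N - k)\<close> after \<open>k\<close> steps.\<close>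

lemma exact_tensor_step:
  assumes t: "t \<in> carr (tensor C (dual (L (n + 1))))" and d0: "dl n t = 0" and "k \<le> N" "n + 1 < int N"
  shows "\<exists>r\<in>carr (tensor C (dual (L (n + 1 + 1)))). \<exists>t'\<in>carr (tensor C (K (N - k) (n + 1))).
      dl n t' = 0 \<and> t = dl (n + 1) r + t'"
proof -
  define R where "R k \<longleftrightarrow> (\<exists>r\<in>carr (tensor C (dual (L (n + 1 + 1)))). \<exists>t'\<in>carr (tensor C (K (N - k) (n + 1))).
      dl n t' = 0 \<and> t = dl (n + 1) r + t')" for k
  have "k \<le> N \<Longrightarrow> R k"
  proof (induction k)
    case 0
    have "K N (n + 1) = \<lparr>carr = carr (dual (L (n + 1))), smul = smul (dual (L (n + 1)))\<rparr>"
      using A_zero[of "n + 1" N] assms(4) lin_zero[OF L_vs hom_lin] by (auto simp: K_def)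
    then have "tensor C (K N (n + 1)) = tensor C (dual (L (n + 1)))" by (intro sp_cong(1)) simp_all
    then show ?case
      unfolding R_def using t d0 lin_zero[OF vec_space_tensor lin_dl[of "n + 1"]] by (intro bexI[of _ 0] bexI[of _ t]) simp_all
  next
    case (Suc k)
    define m where "m = N - Suc k"
    have m: "N - k = Suc m" using Suc.prems by (simp add: m_def)
    obtain r t' where r: "r \<in> carr (tensor C (dual (L (n + 1 + 1))))" and t': "t' \<in> carr (tensor C (K (Suc m) (n + 1)))"
      and d: "dl n t' = 0" and eq: "t = dl (n + 1) r + t'"
      using Suc.IH Suc.prems m unfolding R_def by auto
    note sK = subsp_tensor[OF subsp_refl[OF vec_space_C] subsp_K]
    have t'V: "t' \<in> carr (tensor C (dual (L (n + 1))))" using sK t' by (auto simp: subsp_def)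
    let ?h = "ul.ha m (n + 1) t'" and ?q = "ul.Q m (n + 1) t'"
    have h: "?h \<in> carr (tensor C (dual (L (n + 1 + 1))))" by (rule lin_mem[OF ul.lin_ha t'V])
    have hom: "dl (n + 1) ?h = t' - ?q"
      using ul.homotopy_tensor[OF t'V, of m] d lin_zero[OF vec_space_tensor ul.lin_ha] by simp
    have q: "?q \<in> carr (tensor C (dual (L (n + 1))))" by (rule lin_mem[OF ul.lin_Q t'V])
    have "dl n (t' - ?q) = 0" unfolding hom[symmetric] by (rule dl_dl[OF h])
    then have dq: "dl n ?q = 0" using lin_diff[OF vec_space_tensor lin_dl t'V q] d by simp
    have qK: "?q \<in> carr (tensor C (K m (n + 1)))"
    proof -
      \<comment> \<open>On \<open>A m\<close> the functional \<open>zd m \<xi>\<close> is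
        \<open>\<xi>\<close> after \<open>P m\<close>, whose values lie in \<open>A (Suc m)\<close>,
        where \<open>\<xi>\<close> vanishes.\<close>
      have lz: "lin (K (Suc m) (n + 1)) (K m (n + 1)) (ul.zd m (n + 1) (bb m))"
      proof -
        have "ul.zd m (n + 1) (bb m) \<xi> x = 0" if \<xi>: "\<xi> \<in> carr (K (Suc m) (n + 1))" and x: "x \<in> A m (n + 1)" for \<xi> x
        proof -
          have "\<xi> (ul.P m (n + 1) x) = 0" using \<xi> P_A[OF x] by (simp add: K_def del: A.simps)
          then show ?thesis using A_L[OF x] by (simp add: ul.zd_def res_apply ul.P_def)
        qed
        moreover have "lin (dual (L (n + 1))) (dual (L (n + 1))) (ul.zd m (n + 1) (bb m))" by (rule ul.lin_zd)
        ultimately show ?thesis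
          using lin_subsp_dom[OF subsp_K[of "Suc m" "n + 1"]] unfolding lin_def by (auto simp: K_def)
      qed
      have "tensor_map C (K (Suc m) (n + 1)) C (K m (n + 1)) (ul.kappa m) (ul.zd m (n + 1) (bb m)) t' = ?q"
        unfolding ul.Q_def
        by (rule tensor_map_subsp[OF subsp_refl[OF vec_space_C] subsp_K subsp_refl[OF vec_space_C] subsp_K
              ul.lin_kappa lz ul.lin_kappa ul.lin_zd refl refl t'])
      moreover have "vec_space (K m' (n + 1))" for m' using subsp_K[of m' "n + 1"] by (simp add: subsp_def)
      ultimately show ?thesis
        using lin_mem[OF hom_lin[OF tensor_map_hom[OF vec_space_C _ vec_space_C _ ul.lin_kappa[of m] lz]] t'] by simp
    qed
    have "t = dl (n + 1) (r + ?h) + ?q"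
      using lin_add[OF lin_dl r h] eq hom by (simp del: plus_fun_apply minus_apply)
    moreover have "r + ?h \<in> carr (tensor C (dual (L (n + 1 + 1))))" by (rule vs_add[OF vec_space_tensor r h])
    ultimately show ?case using qK dq unfolding R_def m_def[symmetric] by blast
  qed
  then show ?thesis using assms(3) unfolding R_def by blast
qed

lemma exact_tensor:
  assumes t: "t \<in> carr (tensor C (dual (L (n + 1))))" and d0: "dl n t = 0"
  shows "\<exists>r\<in>carr (tensor C (dual (L (n + 1 + 1)))). dl (n + 1) r = t"
proof -
  \<comment> \<open>The number of letters exceeds the exterior degree \<open>n + 1\<close>, also
    when the truncation gives 0. All of them are used, so the remainder lies in the tensor product
    with \<open>K 0 = 0\<close>.\<close>
  have "n + 1 < int (nat (n + 2))" by linarith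
  from exact_tensor_step[OF t d0 order_refl this] obtain r t' where r: "r \<in> carr (tensor C (dual (L (n + 1 + 1))))"
    and t': "t' \<in> carr (tensor C (K 0 (n + 1)))" and eq: "t = dl (n + 1) r + t'"
    by auto
  have K0: "\<xi> = 0" if "\<xi> \<in> carr (K 0 (n + 1))" for \<xi>
    using that hom_outside[of \<xi> "L (n + 1)" ground] by (auto simp: K_def fun_eq_iff)
  have vK: "vec_space (K 0 (n + 1))" using subsp_K[of 0 "n + 1"] by (simp add: subsp_def)
  have "t' = 0"
  proof (rule tensor_ext[OF vec_space_C vK lin_id lin_const_0[OF vec_space_tensor] _ t'])
    fix c \<xi> assume "c \<in> carr C" "\<xi> \<in> carr (K 0 (n + 1))"
    then show "tens C (K 0 (n + 1)) c \<xi> = 0"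
      using K0 lin_zero[OF vK lin_tens2[OF vec_space_C vK _ lin_id]] by blast
  qed
  then show ?thesis using r eq by auto
qed

end

text \<open>The \<open>bb j\<close> are distinct members of a basis of W and the \<open>gg j\<close>
  their coordinate functions. Infinite dimension enters the proof at this point only.\<close>

lemma (in words) dual_letters_exist:
  assumes "\<not> (\<exists>B. finite B \<and> module.span s B = UNIV)"
  shows "\<exists>bb gg. dual_letters s bb gg"
proof -
  interpret p: vector_space_pair s "(*) :: 'k \<Rightarrow> 'k \<Rightarrow> 'k" using vs vector_space_mult by (simp add: vector_space_pair_def)
  obtain B where B: "p.vs1.independent B" "UNIV \<subseteq> p.vs1.span B"
    using p.vs1.maximal_independent_subset[of UNIV] by blast
  then have "infinite B" using assms by blast
  then obtain bb :: "nat \<Rightarrow> 'w" where bb: "inj bb" "range bb \<subseteq> B" by (meson infinite_countable_subset)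
  have "\<exists>g. Vector_Spaces.linear s (*) g \<and> (\<forall>b\<in>B. g b = (if b = bb j then 1 else 0))" for j
    using p.linear_independent_extend[OF B(1), of "\<lambda>b. if b = bb j then 1 else 0"] by blast
  then obtain gg where gg: "\<And>j. Vector_Spaces.linear s (*) (gg j)" "\<And>j b. b \<in> B \<Longrightarrow> gg j b = (if b = bb j then 1 else 0)"
    by metis
  have "dual_letters s bb gg"
  proof
    show "lin W ground (gg j)" for j using gg(1)[of j] by (simp add: lin_def Vector_Spaces.linear_iff)
    show "gg j (bb k) = (if j = k then 1 else 0)" for j k
    proof -
      have "bb k \<in> B" using bb(2) by blast
      then show ?thesis using gg(2)[of "bb k" j] bb(1) by (auto simp: inj_eq)
    qed
  qed
  then show ?thesis by blast
qed

section \<open>The complex of contramodules\<close>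

context words begin

lemma Rl_one:
  assumes X: "vec_space X" and f: "bil W C X f"
  shows "Rl X f one = 0"
proof -
  have "Rl X f one = f (p1 one) one"
    unfolding Rl_def by (rule sw_one[OF X bil_comp[OF f lin_p1 lin_id]])
  then show ?thesis using lin_zero[OF W_vs bil_left[OF f one_mem]] by (simp add: p1_one)
qed

abbreviation "Y i \<equiv> Psi C (cofree C (L i))"
abbreviation "dY i \<equiv> Psi_map C (cofree C (L i)) (koszul_comod_d s i)"

lemma dY_apply:
  "g \<in> comodule_hom C (left_regular C) (cofree C (L i)) \<Longrightarrow> dY i g = res C (\<lambda>c. koszul_comod_d s i (g c))"
  by (simp add: Psi_map_def res_apply C.carr_Psi)

lemma dY_Psi_cofree:
  "p \<in> hom C (L i) \<Longrightarrow> dY i (Psi_cofree C (L i) p) = Psi_cofree C (L (i + 1)) (D i p)"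
  using dY_apply[OF C.Psi_cofree_comodule_hom[OF L_vs]] koszul_comod_d_Psi_cofree by simp

lemma Y_cases:
  assumes "g \<in> carr (Y i)"
  obtains p where "p \<in> hom C (L i)" "g = Psi_cofree C (L i) p"
  using assms C.Psi_cofree_bij[OF L_vs[of i]] by (auto simp: C.carr_Psi bij_betw_def)

lemma Psi_cofree_mem: "p \<in> hom C (L i) \<Longrightarrow> Psi_cofree C (L i) p \<in> carr (Y i)"
  by (simp add: C.carr_Psi C.Psi_cofree_comodule_hom)

text \<open>Forgets that the values are comodule morphisms, so that the bilinearity needed for
  \<open>sw\<close> follows from \<open>bil_hom_Hom\<close>.\<close>

lemma Y_hom:
  assumes "F \<in> hom C (Y i)"
  shows "F \<in> hom C (Hom C (tensor C (L i)))"
proof -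
  have "F c \<in> hom C (tensor C (L i))" if "c \<in> carr C" for c
    using comodule_homD(1)[of "F c" C "left_regular C" "cofree C (L i)"] lin_mem[OF hom_lin[OF assms] that] by (simp add: C.carr_Psi)
  then show ?thesis using assms by (simp add: hom_def[of _ "Y i"] hom_def[of _ "Hom C (tensor C (L i))"] C.smul_Psi smul_Hom)
qed

lemma lin_koszul_comod_d: "lin (tensor C (L i)) (tensor C (L (i + 1))) (koszul_comod_d s i)"
  using comodule_homD(2)[OF koszul_comod_d_comodule_hom[of i]] by simp

lemma lin_dY: "lin (Y i) (Y (i + 1)) (dY i)"
proof (rule linI)
  show "dY i g \<in> carr (Y (i + 1))" if "g \<in> carr (Y i)" for g
    using that by (rule Y_cases) (simp add: dY_Psi_cofree Psi_cofree_mem D_hom)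
  have mem: "g c \<in> carr (tensor C (L i))" if "g \<in> carr (Y i)" "c \<in> carr C" for g c
    using that comodule_homD(2)[of g C "left_regular C" "cofree C (L i)"]
    by (auto simp: C.carr_Psi dest: lin_mem)
  note vs = C.vec_space_Psi_cofree[OF L_vs[of i]]
  show "dY i (g + h) = dY i g + dY i h" if g: "g \<in> carr (Y i)" and h: "h \<in> carr (Y i)" for g h
  proof -
    have "g + h \<in> carr (Y i)" by (rule vs_add[OF vs g h])
    then show ?thesis
      using g h lin_add[OF lin_koszul_comod_d mem[OF g] mem[OF h]]
      by (auto simp: dY_apply C.carr_Psi res_def fun_eq_iff)
  qed
  show "dY i (smul (Y i) k g) = smul (Y (i + 1)) k (dY i g)" if g: "g \<in> carr (Y i)" for k g
  proof -
    have "smul (Y i) k g \<in> carr (Y i)" by (rule vs_scale[OF vs g])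
    then show ?thesis
      using g lin_scale[OF lin_koszul_comod_d mem[OF g]] vs_scale_zero[OF vec_space_tensor[of C "L (i + 1)"]]
      by (auto simp: dY_apply C.carr_Psi C.smul_Psi res_def fun_eq_iff)
  qed
qed

text \<open>The contraaction of \<open>Psi\<close> acts on the argument in C and \<open>dY\<close>
  composes with a linear map on the values, so the two commute by \<open>sw_comp\<close>.\<close>

lemma dY_contramodule_hom: "dY i \<in> contramodule_hom C (Y i) (Y (i + 1))"
proof -
  let ?f = "koszul_comod_d s i"
  have h: "dY i \<in> hom (Y i) (Y (i + 1))"
    unfolding hom_iff_lin using lin_dY by (simp add: Psi_map_def res_def)
  have "dY i (contract (Y i) F) = contract (Y (i + 1)) (res C (\<lambda>c. dY i (F c)))" if F: "F \<in> hom C (Y i)" for F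
  proof -
    have bF: "bil C C (tensor C (L i)) (\<lambda>d e. F e d)" by (rule C.bil_hom_Hom[OF Y_hom[OF F]])
    have G: "res C (\<lambda>c. dY i (F c)) \<in> hom C (Y (i + 1))"
      by (rule res_hom[OF vec_space_C lin_comp[OF hom_lin[OF F] lin_dY]])
    have Fm: "F e \<in> comodule_hom C (left_regular C) (cofree C (L i))" if "e \<in> carr C" for e
      using lin_mem[OF hom_lin[OF F] that] by (simp add: C.carr_Psi)
    have cm: "contract (Y i) F \<in> comodule_hom C (left_regular C) (cofree C (L i))"
      using contract_mem[OF C.contramodule_Psi_cofree[OF L_vs] F] by (simp add: C.carr_Psi)
    show ?thesis
      unfolding dY_apply[OF cm] C.contract_Psi_cofree[OF G]
    proof (rule res_cong)
      fix c assume c: "c \<in> carr C"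
      have "?f (contract (Y i) F c) = ?f (C.sw (tensor C (L i)) (\<lambda>d e. F e d) c)"
        unfolding C.contract_Psi_cofree[OF F] res_apply[OF c] ..
      also have "\<dots> = C.sw (tensor C (L (i + 1))) (\<lambda>d e. ?f (F e d)) c"
        by (rule C.sw_comp[OF vec_space_tensor vec_space_tensor bF lin_koszul_comod_d c])
      also have "\<dots> = C.sw (tensor C (L (i + 1))) (\<lambda>d e. res C (\<lambda>c. dY i (F c)) e d) c"
        by (rule C.sw_cong) (simp add: res_apply dY_apply[OF Fm])
      finally show "?f (contract (Y i) F c) = \<dots>" .
    qed
  qed
  then show ?thesis using h by (simp add: contramodule_hom_def)
qed

lemma cochain_complex_Y: "cochain_complex (contramodule_hom C) Y dY"
  unfolding cochain_complex_def
proof (intro allI conjI ballI dY_contramodule_hom)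
  fix i g assume "g \<in> carr (Y i)"
  then show "dY (i + 1) (dY i g) = 0"
  proof (rule Y_cases)
    fix p assume p: "p \<in> hom C (L i)" and g: "g = Psi_cofree C (L i) p"
    have "Psi_cofree C (L (i + 1 + 1)) 0 = 0"
      by (rule lin_zero[OF _ C.lin_Psi_cofree'[OF L_vs]]) (simp add: vec_space_Hom)
    then show ?thesis using p by (simp add: g dY_Psi_cofree D_hom D_D)
  qed
qed

lemma Psi_cofree_iso:
  "Psi_cofree C (L i) \<in> contramodule_hom C (free C (L i)) (Y i)"
  "bij_betw (Psi_cofree C (L i)) (carr (free C (L i))) (carr (Y i))"
  using C.Psi_cofree_contramodule_hom[OF L_vs] C.Psi_cofree_bij[OF L_vs] by (simp_all add: C.carr_Psi)

lemma projective_Y: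
  "projective_contramodule TYPE('p::ab_group_add) TYPE('q::ab_group_add) C (Y i)"
  by (rule projective_contramodule_transfer[OF C.free_projective[OF L_vs] C.contramodule_Psi_cofree[OF L_vs] Psi_cofree_iso])

lemma Y_negative:
  assumes "i < 0"
  shows "carr (Y i) = {0}"
proof -
  have "p = 0" if p: "p \<in> hom C (L i)" for p
  proof
    show "p c = 0 c" for c
      using lin_mem[OF hom_lin[OF p], of c] hom_outside[OF p, of c] L_negative[OF assms] by (cases "c \<in> carr C") auto
  qed
  then have "hom C (L i) = {0}" using vs_zero[OF vec_space_Hom[OF L_vs], of C i] by auto
  moreover have "Psi_cofree C (L i) 0 = 0"
    by (rule lin_zero[OF _ C.lin_Psi_cofree'[OF L_vs]]) (simp add: vec_space_Hom)
  ultimately show ?thesis using Psi_cofree_iso(2)[of i] by (auto simp: bij_betw_def)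
qed

lemma bounded_below_Y: "bounded_below Y"
  using Y_negative by (auto simp: bounded_below_def)

lemma wedge_word_Nil_neq_0: "wedge_word s [] \<noteq> 0"
proof -
  have "alternating_form s (\<lambda>ws. if ws = [] then 1 else 0)"
    using vs vector_space_mult by (simp add: alternating_form_def multilinear_form_def Vector_Spaces.linear_iff)
  then have "wedge_word s [] (\<lambda>ws. if ws = [] then 1 else 0) = 1" by (simp add: wedge_word_def)
  then show ?thesis by auto
qed

text \<open>As \<open>Y (-1)\<close> is zero, \<open>h 1\<close> after \<open>dY 0\<close> would be
  the identity of \<open>Y 0\<close>. The element \<open>x\<close> that corresponds to the counit,
  with values in exterior degree 0, refutes this: its value at \<open>one\<close> is nonzero, while
  that of \<open>h 1 (dY 0 x)\<close> is zero.\<close>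

lemma not_contractible_Y: "\<not> contractible (contramodule_hom C) Y dY"
proof
  assume "contractible (contramodule_hom C) Y dY"
  then obtain h where h: "\<And>i. h i \<in> contramodule_hom C (Y i) (Y (i - 1))"
    and hd: "\<And>i x. x \<in> carr (Y i) \<Longrightarrow> dY (i - 1) (h i x) + h (i + 1) (dY i x) = x"
    unfolding contractible_def by blast
  let ?\<omega> = "wedge_word s []"
  define \<phi> where "\<phi> = res C (\<lambda>c. smul (L 0) (counit C c) ?\<omega>)"
  define \<psi> where "\<psi> = D 0 \<phi>"
  define x where "x = Psi_cofree C (L 0) \<phi>"
  \<comment> \<open>The contraaction of this family is \<open>\<psi>\<close>, and a contramodule
    morphism can be moved inside a contraaction. The family vanishes at \<open>one\<close> since
    \<open>\<psi>\<close> does.\<close>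
  define F where "F = res C (\<lambda>c. res C (\<lambda>d. smul (L 1) (counit C d) (\<psi> c)))"
  have \<phi>: "\<phi> \<in> hom C (L 0)" unfolding \<phi>_def by (rule C.counit_smul_hom[OF L_vs wedge_word_mem]) simp
  have \<psi>: "\<psi> \<in> hom C (L 1)" using D_hom[OF \<phi>] by (simp add: \<psi>_def)
  have x: "x \<in> carr (Y 0)" unfolding x_def by (rule Psi_cofree_mem[OF \<phi>])
  have "h 0 x \<in> carr (Y (0 - 1))" using lin_mem[OF contramodule_homD(2)[OF h[of 0]] x] .
  then have "h 0 x = 0" using Y_negative[of "-1"] by simp
  moreover have "dY (0 - 1) 0 = 0" by (rule lin_zero[OF C.vec_space_Psi_cofree[OF L_vs] lin_dY])
  moreover have "dY 0 x = Psi_cofree C (L 1) \<psi>" using dY_Psi_cofree[OF \<phi>] by (simp add: x_def \<psi>_def)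
  ultimately have hx: "h 1 (Psi_cofree C (L 1) \<psi>) = x" using hd[OF x] by simp
  have h1: "h 1 \<in> contramodule_hom C (Y 1) (Y 0)" using h[of 1] by simp
  define k where "k = res (free C (L 1)) (\<lambda>p. h 1 (Psi_cofree C (L 1) p))"
  have k: "k \<in> contramodule_hom C (free C (L 1)) (Y 0)"
    unfolding k_def
    by (rule contramodule_hom_comp[OF C.contramodule_free[OF L_vs] C.contramodule_Psi_cofree[OF L_vs]
          C.contramodule_Psi_cofree[OF L_vs] Psi_cofree_iso(1) h1])
  have F: "F \<in> hom C (Hom C (L 1))"
    unfolding F_def
    by (rule res_hom[OF vec_space_C lin_comp[OF hom_lin[OF \<psi>] C.lin_counit_smul[OF L_vs]]])
  have F': "F \<in> hom C (free C (L 1))"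
    using F by (simp add: hom_def[of _ "free C (L 1)"] hom_def[of _ "Hom C (L 1)"])
  have G: "res C (\<lambda>c. k (F c)) \<in> hom C (Y 0)"
    by (rule res_hom[OF vec_space_C lin_comp[OF hom_lin[OF F'] contramodule_homD(2)[OF k]]])
  have "\<psi> one = 0"
    using Rl_one[OF L_vs bil_wedge_conv[OF hom_lin[OF \<phi>]]] by (simp add: \<psi>_def D_def res_apply one_mem)
  then have "F one = 0"
    using vs_scale_zero[OF L_vs[of 1]]
    by (simp add: F_def res_apply one_mem del: zero_fun_apply) (simp add: res_def fun_eq_iff)
  then have kF: "k (F one) = 0"
    using lin_zero[OF contramodule_vs[OF C.contramodule_free[OF L_vs]] contramodule_homD(2)[OF k]] by simp
  have "x = k \<psi>" using hx \<psi> by (simp add: k_def res_apply)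
  also have "\<psi> = contract (free C (L 1)) F" using C.contract_free_counit_smul[OF L_vs \<psi>] by (simp add: F_def)
  also have "k (contract (free C (L 1)) F) = contract (Y 0) (res C (\<lambda>c. k (F c)))"
    by (rule contramodule_homD(3)[OF k F'])
  also have "\<dots> = res C (C.sw (tensor C (L 0)) (\<lambda>d e. res C (\<lambda>c. k (F c)) e d))"
    by (rule C.contract_Psi_cofree[OF G])
  finally have "x one = C.sw (tensor C (L 0)) (\<lambda>d e. res C (\<lambda>c. k (F c)) e d) one"
    by (simp add: res_apply one_mem)
  \<comment> \<open>\<open>one\<close> is grouplike, so the value of a contraaction at
    \<open>one\<close> involves the family at \<open>one\<close> only.\<close>
  also have "\<dots> = res C (\<lambda>c. k (F c)) one one"
    by (rule sw_one[OF vec_space_tensor C.bil_hom_Hom[OF Y_hom[OF G]]])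
  finally have "x one = 0" by (simp add: res_apply one_mem kF)
  moreover have "C.cproj (L 0) (x one) = \<phi> one" unfolding x_def by (rule C.cproj_Psi_cofree[OF L_vs \<phi> one_mem])
  moreover have "C.cproj (L 0) 0 = 0" by (rule lin_zero[OF vec_space_tensor C.lin_cproj[OF L_vs]])
  moreover have "\<phi> one = ?\<omega>" by (simp add: \<phi>_def res_apply one_mem counit_one smul_L)
  ultimately show False using wedge_word_Nil_neq_0 by simp
qed

end

text \<open>\<open>Psi_cofree\<close> is bijective and intertwines \<open>D\<close> with
  \<open>dY\<close>, so exactness is that of \<open>exact_Hom\<close>.\<close>

lemma (in dual_letters) acyclic_Y: "acyclic_complex Y dY"
  unfolding acyclic_complex_def
proof (intro allI equalityI subsetI)
  fix i g assume "g \<in> {x \<in> carr (Y i). dY i x = 0}"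
  then have gY: "g \<in> carr (Y i)" and d: "dY i g = 0" by simp_all
  obtain p where p: "p \<in> hom C (L i)" and g: "g = Psi_cofree C (L i) p" using gY by (rule Y_cases)
  have "Psi_cofree C (L (i + 1)) (D i p) = Psi_cofree C (L (i + 1)) 0"
    using d lin_zero[OF _ C.lin_Psi_cofree'[OF L_vs], of "i + 1"] by (simp add: g dY_Psi_cofree[OF p] vec_space_Hom)
  then have "D i p = 0"
    using Psi_cofree_iso(2)[of "i + 1"] D_hom[OF p] vs_zero[OF vec_space_Hom[OF L_vs], of C "i + 1"]
    by (auto simp: bij_betw_def dest!: inj_onD)
  then obtain q where q: "q \<in> hom C (L (i - 1))" "D (i - 1) q = p" using exact_Hom[OF p] by blast
  have "g = dY (i - 1) (Psi_cofree C (L (i - 1)) q)" using dY_Psi_cofree[OF q(1)] q(2) by (simp add: g)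
  then show "g \<in> dY (i - 1) ` carr (Y (i - 1))" using Psi_cofree_mem[OF q(1)] by (rule image_eqI)
next
  fix i g assume "g \<in> dY (i - 1) ` carr (Y (i - 1))"
  then obtain x where x: "x \<in> carr (Y (i - 1))" and g: "g = dY (i - 1) x" by blast
  then show "g \<in> {x \<in> carr (Y i). dY i x = 0}"
    using cochain_complex_Y lin_mem[OF lin_dY x] unfolding cochain_complex_def by (auto dest: spec[of _ "i - 1"])
qed

section \<open>The complex of comodules\<close>

context words begin

abbreviation "F n \<equiv> Phi C (free C (dual (L n)))"
abbreviation "pf n \<equiv> Phi_free C (dual (L n))"
abbreviation "X i \<equiv> Phi C (koszul_contra s i)"
abbreviation "dX i \<equiv> Phi_map C (koszul_contra s i) (koszul_contra s (i + 1)) (koszul_contra_d s i)"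

lemma X_eq: "X i = F (- i)"
  by (simp add: koszul_contra_def)

text \<open>Stated in degree \<open>- j - 1\<close>, so that the exterior degrees of source and
  target are literally \<open>j + 1\<close> and \<open>j\<close>.\<close>

lemma dX_eq:
  "dX (- j - 1) = res (F (j + 1)) (\<lambda>q. pf j (dl j (C.Phi_inv (dual (L (j + 1))) q)))"
proof -
  have "koszul_contra s (- j - 1) = free C (dual (L (j + 1)))" "koszul_contra s (- j - 1 + 1) = free C (dual (L j))"
    by (simp_all add: koszul_contra_def add.commute)
  then show ?thesis
    using C.Phi_map_eq[OF dual_vs dual_vs lin_dl[of j], of "koszul_contra_d s (- j - 1)"]
      koszul_contra_d_eq[of j "- j - 1"] cd_hom dl_sw by simp
qed

lemma pf_iso:
  "pf n \<in> comodule_hom C (cofree C (dual (L n))) (F n)"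
  "bij_betw (pf n) (carr (tensor C (dual (L n)))) (carr (F n))"
  "bij_betw (pf n) (carr (cofree C (dual (L n)))) (carr (F n))"
  using C.Phi_free_comodule_hom[OF dual_vs] C.Phi_free_bij[OF dual_vs] by simp_all

lemma lin_pf: "lin (tensor C (dual (L n))) (F n) (pf n)"
  by (rule hom_lin[OF C.Phi_free_hom[OF dual_vs]])

lemma pf_0: "pf n 0 = 0"
  by (rule lin_zero[OF vec_space_tensor lin_pf])

lemma F_cases:
  assumes "x \<in> carr (F n)"
  obtains t where "t \<in> carr (tensor C (dual (L n)))" "x = pf n t"
  using assms pf_iso(2)[of n] by (auto simp: bij_betw_def)

lemma dX_pf:
  assumes "t \<in> carr (tensor C (dual (L (j + 1))))"
  shows "dX (- j - 1) (pf (j + 1) t) = pf j (dl j t)"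
  unfolding dX_eq res_apply[OF lin_mem[OF lin_pf assms]] C.Phi_inv_Phi_free[OF dual_vs assms] ..

lemma comodule_F: "comodule C (F n)" and comodule_cofree_dual: "comodule C (cofree C (dual (L n)))"
  by (rule C.comodule_Phi[OF dual_vs] C.comodule_cofree[OF dual_vs])+

lemma Phi_inv_comodule_hom:
  "res (F n) (C.Phi_inv (dual (L n))) \<in> comodule_hom C (F n) (cofree C (dual (L n)))"
  using comodule_hom_inverse[OF comodule_cofree_dual comodule_F pf_iso(1,3)] by simp

lemma dX_comodule_hom: "dX (- j - 1) \<in> comodule_hom C (F (j + 1)) (F j)"
proof -
  note c = comodule_hom_comp[OF comodule_F comodule_cofree_dual comodule_cofree_dual Phi_inv_comodule_hom
      C.cod_comodule_hom[OF dual_vs dual_vs bil_wd_p1[of j]]]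
  from comodule_hom_comp[OF comodule_F comodule_cofree_dual comodule_F c pf_iso(1)] show ?thesis
    unfolding dX_eq by (rule back_subst[of "\<lambda>f. f \<in> _"]) (rule res_cong, simp add: res_apply)
qed

lemma cochain_complex_X: "cochain_complex (comodule_hom C) X dX"
  unfolding cochain_complex_def
proof (intro allI conjI ballI)
  fix i
  show "dX i \<in> comodule_hom C (X i) (X (i + 1))"
    using dX_comodule_hom[of "- i - 1"] by (simp add: X_eq)
  fix x assume x: "x \<in> carr (X i)"
  define j where "j = - i - 2"
  have i: "i = - (j + 1) - 1" "i + 1 = - j - 1" "- i = j + 1 + 1" by (simp_all add: j_def)
  have "x \<in> carr (F (j + 1 + 1))" using x by (simp only: X_eq i(3))
  then obtain t where t: "t \<in> carr (tensor C (dual (L (j + 1 + 1))))" and xt: "x = pf (j + 1 + 1) t" by (rule F_cases)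
  have "dX i x = pf (j + 1) (dl (j + 1) t)" unfolding i(1) xt by (rule dX_pf[OF t])
  then have "dX (i + 1) (dX i x) = dX (- j - 1) (pf (j + 1) (dl (j + 1) t))" by (simp only: i(2))
  also have "\<dots> = pf j (dl j (dl (j + 1) t))" by (rule dX_pf[OF lin_mem[OF lin_dl t]])
  finally show "dX (i + 1) (dX i x) = 0" by (simp only: dl_dl[OF t] pf_0)
qed

lemma injective_X: "injective_comodule TYPE('x::ab_group_add) TYPE('y::ab_group_add) C (X i)"
  unfolding X_eq
  by (rule injective_comodule_transfer[OF C.cofree_injective[OF dual_vs] comodule_F pf_iso(1,3)])

lemma F_negative:
  assumes "n < 0"
  shows "carr (F n) = {0}"
proof -
  have z: "\<xi> = 0" if \<xi>: "\<xi> \<in> hom (L n) ground" for \<xi>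
  proof
    show "\<xi> x = 0 x" for x
      using lin_zero[OF L_vs hom_lin[OF \<xi>]] hom_outside[OF \<xi>, of x] L_negative[OF assms] by (cases "x = 0") auto
  qed
  have "t = 0" if t: "t \<in> carr (tensor C (dual (L n)))" for t
  proof (rule tensor_ext[OF vec_space_C dual_vs lin_id lin_const_0[OF vec_space_tensor] _ t])
    fix c \<xi> assume c: "c \<in> carr C" and "\<xi> \<in> carr (dual (L n))"
    then have "\<xi> = 0" using z by simp
    then show "tens C (dual (L n)) c \<xi> = 0"
      using lin_zero[OF dual_vs lin_tens2[OF vec_space_C dual_vs c lin_id]] by blast
  qed
  then have "carr (tensor C (dual (L n))) = {0}" using vs_zero[OF vec_space_tensor] by blast
  then show ?thesis using pf_iso(2)[of n] pf_0 by (auto simp: bij_betw_def)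
qed

lemma bounded_above_X: "bounded_above X"
  unfolding bounded_above_def by (rule exI[of _ 0]) (simp add: X_eq F_negative)

text \<open>As \<open>X 1\<close> is zero, \<open>dX (-1)\<close> after \<open>h 0\<close> would be
  the identity of \<open>X 0\<close>. A comodule morphism preserves the condition that the coaction
  of \<open>t\<close> is \<open>one \<otimes> t\<close>, so \<open>one \<otimes> \<xi>\<close> is
  sent to some \<open>one \<otimes> \<zeta>\<close>, and the differential kills such elements
  because \<open>one\<close> contains no letter.\<close>

lemma not_contractible_X: "\<not> contractible (comodule_hom C) X dX"
proof
  assume "contractible (comodule_hom C) X dX"
  then obtain h where h: "\<And>i. h i \<in> comodule_hom C (X i) (X (i - 1))"
    and hd: "\<And>i x. x \<in> carr (X i) \<Longrightarrow> dX (i - 1) (h i x) + h (i + 1) (dX i x) = x"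
    unfolding contractible_def by blast
  \<comment> \<open>The functional on exterior degree 0 that takes the value 1 on the empty
    product.\<close>
  obtain \<xi> where \<xi>: "\<xi> \<in> hom (L 0) ground" "\<xi> (wedge_word s []) = 1"
    using L_univ[OF vec_space_ground, of 0 "\<lambda>_. 1"] by auto
  have \<xi>': "\<xi> \<in> carr (dual (L 0))" using \<xi>(1) by simp
  define t where "t = tens C (dual (L 0)) one \<xi>"
  have t: "t \<in> carr (tensor C (dual (L 0)))" unfolding t_def by (rule tens_mem[OF vec_space_C dual_vs one_mem \<xi>'])
  define x where "x = pf 0 t"
  have xF: "x \<in> carr (F 0)" unfolding x_def by (rule lin_mem[OF lin_pf t])
  then have x: "x \<in> carr (X 0)" by (simp add: X_eq)
  have h0: "h 0 \<in> comodule_hom C (F 0) (F 1)" using h[of 0] by (simp add: X_eq)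
  have "dX 0 x \<in> carr (X 1)"
    using lin_mem[OF comodule_homD(2)[OF dX_comodule_hom[of "-1"]]] xF by (simp add: X_eq)
  then have "dX 0 x = 0" using F_negative[of "-1"] by (simp add: X_eq)
  moreover have "h 1 0 = 0" using lin_zero[OF _ comodule_homD(2)[OF h[of 1]]] comodule_vs[OF comodule_F] by (simp add: X_eq)
  ultimately have dhx: "dX (- 1) (h 0 x) = x" using hd[OF x] by simp
  define k where "k = res (cofree C (dual (L 0))) (\<lambda>t. res (F 1) (C.Phi_inv (dual (L 1)))
     (res (cofree C (dual (L 0))) (\<lambda>t. h 0 (pf 0 t)) t))"
  have k: "k \<in> comodule_hom C (cofree C (dual (L 0))) (cofree C (dual (L 1)))"
    unfolding k_def
    by (rule comodule_hom_comp[OF comodule_cofree_dual comodule_F comodule_cofree_dual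
        comodule_hom_comp[OF comodule_cofree_dual comodule_F comodule_F pf_iso(1) h0] Phi_inv_comodule_hom])
  have hxF: "h 0 x \<in> carr (F 1)" by (rule lin_mem[OF comodule_homD(2)[OF h0] xF])
  have kt: "k t = C.Phi_inv (dual (L 1)) (h 0 x)"
    using t hxF by (simp add: k_def res_apply x_def)
  have pk: "pf 1 (k t) = h 0 x"
    using hxF pf_iso(2)[of 1] unfolding kt by (simp add: bij_betw_def f_inv_into_f)
  have ktm: "k t \<in> carr (tensor C (dual (L 1)))" using lin_mem[OF comodule_homD(2)[OF k], of t] t by simp
  have "coact (cofree C (dual (L 0))) t = tens C (tensor C (dual (L 0))) one t"
    unfolding t_def C.coact_cofree_tens[OF dual_vs one_mem \<xi>']
    by (rule sw_one[OF vec_space_tensor])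
       (intro bilI lin_tens1 lin_tens2 tens_mem lin_id; simp add: \<xi>(1) lin_id vec_space_C)
  then have "coact (cofree C (dual (L 1))) (k t)
      = tensor_map C (tensor C (dual (L 0))) C (tensor C (dual (L 1))) (\<lambda>x. x) k (tens C (tensor C (dual (L 0))) one t)"
    using comodule_homD(3)[OF k, of t] t by simp
  also have "\<dots> = tens C (tensor C (dual (L 1))) one (k t)"
    using comodule_homD(2)[OF k] t
    by (intro tensor_map_tens) (simp_all add: one_mem lin_id)
  finally have co: "coact (cofree C (dual (L 1))) (k t) = tens C (tensor C (dual (L 1))) one (k t)" .
  define \<zeta> where "\<zeta> = C.cproj (dual (L 1)) (k t)"
  have \<zeta>: "\<zeta> \<in> hom (L (0 + 1)) ground" using lin_mem[OF C.lin_cproj[OF dual_vs] ktm] by (simp add: \<zeta>_def)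
  \<comment> \<open>\<open>cproj\<close> recovers a tensor from its coaction; with coaction
    \<open>one \<otimes> k t\<close> the result is a pure tensor with left factor
    \<open>one\<close>.\<close>
  have "k t = tensor_map C (tensor C (dual (L 1))) C (dual (L 1)) (\<lambda>x. x) (C.cproj (dual (L 1)))
      (tens C (tensor C (dual (L 1))) one (k t))"
    using C.coact_cofree_cproj[OF dual_vs ktm] unfolding co ..
  also have "\<dots> = tens C (dual (L 1)) one \<zeta>"
    unfolding \<zeta>_def by (rule tensor_map_tens) (simp_all add: one_mem lin_id C.lin_cproj ktm)
  finally have kt1: "k t = tens C (dual (L (0 + 1))) one \<zeta>" by simp
  have bz: "bil W C (tensor C (dual (L 0))) (\<lambda>w d. tens C (dual (L 0)) d (wd 0 w \<zeta>))"
    by (rule bil_flip, rule bil_tens_comp) (use bil_left[OF bil_wd, of \<zeta> 0] \<zeta> in \<open>simp_all add: lin_id\<close>)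
  have "dl 0 (k t) = 0" unfolding kt1 dl_tens[OF one_mem \<zeta>] by (rule Rl_one[OF vec_space_tensor bz])
  then have "dX (- 0 - 1) (pf (0 + 1) (k t)) = 0" using dX_pf[of "k t" 0] ktm pf_0 by simp
  then have "x = 0" using dhx pk by simp
  then have "t = C.Phi_inv (dual (L 0)) (pf 0 0)" using C.Phi_inv_Phi_free[OF dual_vs t] by (simp add: x_def pf_0)
  also have "\<dots> = 0" by (rule C.Phi_inv_Phi_free[OF dual_vs vs_zero[OF vec_space_tensor]])
  finally have "C.cproj (dual (L 0)) t = 0" using lin_zero[OF vec_space_tensor C.lin_cproj[OF dual_vs]] by simp
  then have "\<xi> = 0"
    unfolding t_def C.cproj_tens[OF dual_vs one_mem \<xi>'] by (simp add: counit_one smul_Hom whole_def)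
  then show False using \<xi>(2) by simp
qed

end

lemma (in dual_letters) acyclic_X: "acyclic_complex X dX"
  unfolding acyclic_complex_def
proof (intro allI equalityI subsetI)
  fix i x assume "x \<in> {x \<in> carr (X i). dX i x = 0}"
  then have xX: "x \<in> carr (X i)" and d: "dX i x = 0" by simp_all
  \<comment> \<open>The exterior degree of the target of \<open>dX i\<close>; with it the degrees
    take the form \<open>n + 1\<close> and \<open>n + 1 + 1\<close> that occurs in
    \<open>exact_tensor\<close>.\<close>
  define n where "n = - i - 1"
  have i: "i = - n - 1" "i - 1 = - (n + 1) - 1" "- i = n + 1" "- (i - 1) = n + 1 + 1" by (simp_all add: n_def)
  have "x \<in> carr (F (n + 1))" using xX by (simp only: X_eq i(3))
  then obtain t where t: "t \<in> carr (tensor C (dual (L (n + 1))))" and x: "x = pf (n + 1) t" by (rule F_cases)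
  have "pf n (dl n t) = 0" using d dX_pf[OF t] by (simp only: x i(1))
  then have "pf n (dl n t) = pf n 0" by (simp only: pf_0)
  then have "dl n t = 0"
    using pf_iso(2)[of n] lin_mem[OF lin_dl t] vs_zero[OF vec_space_tensor[of C "dual (L n)"]]
    by (meson bij_betw_imp_inj_on inj_onD)
  then obtain r where r: "r \<in> carr (tensor C (dual (L (n + 1 + 1))))" "dl (n + 1) r = t" using exact_tensor[OF t] by blast
  have "x = dX (i - 1) (pf (n + 1 + 1) r)" unfolding i(2) dX_pf[OF r(1)] r(2) x ..
  moreover have "pf (n + 1 + 1) r \<in> carr (X (i - 1))"
    unfolding X_eq i(4) by (rule lin_mem[OF lin_pf r(1)])
  ultimately show "x \<in> dX (i - 1) ` carr (X (i - 1))" by (rule image_eqI)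
next
  fix i x assume "x \<in> dX (i - 1) ` carr (X (i - 1))"
  then obtain y where y: "y \<in> carr (X (i - 1))" and x: "x = dX (i - 1) y" by blast
  have "dX (i - 1) \<in> comodule_hom C (X (i - 1)) (X (i - 1 + 1))" and "dX (i - 1 + 1) (dX (i - 1) y) = 0"
    using cochain_complex_X y unfolding cochain_complex_def by blast+
  then have "dX (i - 1) \<in> comodule_hom C (X (i - 1)) (X i)" and "dX i (dX (i - 1) y) = 0"
    by (simp_all only: diff_add_cancel)
  then show "x \<in> {x \<in> carr (X i). dX i x = 0}" using lin_mem[OF comodule_homD(2) y] x by blast
qed

theorem corollary7p1:
  fixes s :: "'k::field \<Rightarrow> 'w::ab_group_add \<Rightarrow> 'w"
  assumes "vector_space s"
    and "\<not> (\<exists>B. finite B \<and> module.span s B = UNIV)"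
  defines "C \<equiv> Sym s"
  defines "X \<equiv> \<lambda>i. Phi C (koszul_contra s i)"
    and "dX \<equiv> \<lambda>i. Phi_map C (koszul_contra s i) (koszul_contra s (i + 1)) (koszul_contra_d s i)"
    and "Y \<equiv> \<lambda>i. Psi C (koszul_comod s i)"
    and "dY \<equiv> \<lambda>i. Psi_map C (koszul_comod s i) (koszul_comod_d s i)"
  shows "(cochain_complex (comodule_hom C) X dX
       \<and> (\<forall>n. Phi_free C (dual (Ext_power s n))
               \<in> comodule_hom C (cofree C (dual (Ext_power s n))) (X (- n))
             \<and> bij_betw (Phi_free C (dual (Ext_power s n)))
                 (carr (cofree C (dual (Ext_power s n)))) (carr (X (- n))))
       \<and> (\<forall>i. injective_comodule TYPE('x::ab_group_add) TYPE('y::ab_group_add) C (X i))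
       \<and> bounded_above X
       \<and> \<not> contractible (comodule_hom C) X dX
       \<and> acyclic_complex X dX)
     \<and>
      (cochain_complex (contramodule_hom C) Y dY
       \<and> (\<forall>n. Psi_cofree C (Ext_power s n)
               \<in> contramodule_hom C (free C (Ext_power s n)) (Y n)
             \<and> bij_betw (Psi_cofree C (Ext_power s n))
                 (carr (free C (Ext_power s n))) (carr (Y n)))
       \<and> (\<forall>i. projective_contramodule TYPE('p::ab_group_add) TYPE('q::ab_group_add) C (Y i))
       \<and> bounded_below Y
       \<and> \<not> contractible (contramodule_hom C) Y dY
       \<and> acyclic_complex Y dY)"
proof -
  interpret words s by (rule words.intro[OF assms(1)])
  obtain bb gg where "dual_letters s bb gg" using dual_letters_exist[OF assms(2)] by blast
  then interpret dual_letters s bb gg .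
  have iso: "pf n \<in> comodule_hom (Sym s) (cofree (Sym s) (dual (Ext_power s n))) (Phi (Sym s) (koszul_contra s (- n)))"
    "bij_betw (pf n) (carr (cofree (Sym s) (dual (Ext_power s n)))) (carr (Phi (Sym s) (koszul_contra s (- n))))" for n
    using pf_iso[of n] by (simp_all add: X_eq)
  show ?thesis
    unfolding C_def X_def dX_def Y_def dY_def koszul_comod_def
    using cochain_complex_X iso injective_X bounded_above_X not_contractible_X acyclic_X
      cochain_complex_Y Psi_cofree_iso projective_Y bounded_below_Y not_contractible_Y acyclic_Y
    by blast
qed

end
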